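(* Let $\beta\in\{1,2,4\}$, let $m\ge n$ be positive integers, $A\in S^\beta(m)$, $B\in S^\beta(n)$, and let $\alpha_1$ in the third identity be a non-negative integer. Then, in the range of convergence described in the context: $${}_pF_q^{(\beta;m,n)}(\boldsymbol{\alpha};\boldsymbol{\beta};A,B)=\int_{H_1\in V^\beta_{n,m}}{}_pF_q^{(\beta;m)}(\boldsymbol{\alpha};\boldsymbol{\beta};AH_1BH_1^\ast)\,(dH_1),$$ $${}_0F_0^{(\beta;m,n)}(A,B)=\int_{H_1\in V^\beta_{n,m}}\mathrm{etr}(AH_1BH_1^\ast)\,(dH_1),$$ $${}_1F_0^{(\beta;m,n)}(\alpha_1;A,B)=\int_{H_1\in V^\beta_{n,m}}|I_m-AH_1BH_1^\ast|^{-\alpha_1}\,(dH_1),$$ $${}_0F_0^{(\beta;m,n)}(I_m+A,B)=\mathrm{etr}(B)\;{}_0F_0^{(\beta;m,n)}(A,B).$$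
   Context: $\mathbb{F}_1=\mathbb{R}$, $\mathbb{F}_2=\mathbb{C}$, $\mathbb{F}_4=\mathbb{H}$ (quaternions). $S^\beta(m)$ is the space of $m\times m$ Hermitian matrices over $\mathbb{F}_\beta$; their eigenvalues are real and $|\cdot|$ is the product of eigenvalues. $V^\beta_{n,m}=\{H_1\in\mathbb{F}_\beta^{m\times n}: H_1^\ast H_1=I_n\}$ is the Stiefel manifold, $(dH_1)$ its invariant probability measure (invariant under the group of $m\times m$ matrices $H$ over $\mathbb{F}_\beta$ with $H^\ast H=I_m$). Functions of products: for $A,M\in S^\beta(m)$, symmetric polynomials in "the eigenvalues of $AM$" are understood, when $A$ is positive definite, as those of the Hermitian matrix $A^{1/2}MA^{1/2}$, and for general Hermitian $A$ by polynomial continuation in the entries of $A$ (for $\beta=1,2$ these are the ordinary eigenvalues of $AM$). Thus $\mathrm{tr}(AM)$ is the sum (for $\beta=4$, the real part of the trace), $\mathrm{etr}=\exp(\mathrm{tr}(\cdot))$, and $|I_m-AM|$ is the product of $1-\mu$ over these eigenvalues $\mu$. Jack polynomials: for a partition $\kappa$ of $k$, $C_\kappa^\beta(X)$ is the homogeneous symmetric polynomial of degree $k$ in the eigenvalues $x_1,\dots,x_m$ of $X$ determined by: (i) its lexicographically leading monomial is $x_1^{\kappa_1}\cdots x_m^{\kappa_m}$ up to a constant; (ii) it is an eigenfunction of $\sum_i x_i^2\partial_i^2+\beta\sum_{i\ne j}\frac{x_i^2}{x_i-x_j}\partial_i$; (iii) $\sum_\kappa C_\kappa^\beta(X)=(x_1+\cdots+x_m)^k$,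 the sum being over partitions of $k$ with at most $m$ parts. $(a)_\kappa^\beta=\prod_i\left(a-\frac{i-1}{2}\beta\right)_{\kappa_i}$ with $(a)_k=a(a+1)\cdots(a+k-1)$, $(a)_0=1$; $P_n^k$ is the set of partitions of $k$ with at most $n$ nonzero parts. With $\boldsymbol{\alpha}=(\alpha_1,\dots,\alpha_p)$ and $\boldsymbol{\beta}=(\beta_1,\dots,\beta_q)$ parameter vectors (distinct from the number $\beta$), $${}_pF_q^{(\beta;m,n)}(\boldsymbol{\alpha};\boldsymbol{\beta};A,B)=\sum_{k=0}^\infty\sum_{\kappa\in P_n^k}\frac{(\alpha_1)_\kappa^\beta\cdots(\alpha_p)_\kappa^\beta}{(\beta_1)_\kappa^\beta\cdots(\beta_q)_\kappa^\beta}\frac{C_\kappa^\beta(A)C_\kappa^\beta(B)}{k!\,C_\kappa^\beta(I_m)},$$ and for an $m\times m$ argument, ${}_pF_q^{(\beta;m)}(\boldsymbol{\alpha};\boldsymbol{\beta};X)=\sum_k\sum_{\kappa\in P_m^k}\frac{(\alpha_1)_\kappa^\beta\cdots(\alpha_p)_\kappa^\beta}{(\beta_1)_\kappa^\beta\cdots(\beta_q)_\kappa^\beta}\frac{C_\kappa^\beta(X)}{k!}$. Range of convergence: no denominator $(\beta_j)_\kappa^\beta$, $\kappa\in P_m^k$, vanishes, and in the first identity either $p\le q$, or $p=q+1$ and $\|A\|\,\|B\|<1$, or the series terminate; in the third identity $\|A\|\,\|B\|<1$. Here $\|\cdot\|$ is the maximum absolute value of the eigenvalues.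
   Formalization: Conditions (i)–(iii) do not determine the Jack polynomials (for k=6, m≥3, the partitions (4,1,1) and (3,3) share an eigenvalue); the formal definition also requires the usual triangularity in the dominance order, which singles out the standard Jack polynomials. *)

theory Defs
  imports "HOL-Probability.Probability"
begin

section \<open>Quaternions\<close>

datatype quat = Quat (qRe: real) (qI: real) (qJ: real) (qK: real)

lemma quat_eq_iff: "x = y \<longleftrightarrow> qRe x = qRe y \<and> qI x = qI y \<and> qJ x = qJ y \<and> qK x = qK y"
  by (cases x; cases y) auto

instantiation quat :: ring_1
begin

definition "0 = Quat 0 0 0 0"
definition "1 = Quat 1 0 0 0"
definition "x + y = Quat (qRe x + qRe y) (qI x + qI y) (qJ x + qJ y) (qK x + qK y)"
definition "- x = Quat (- qRe x) (- qI x) (- qJ x) (- qK x)"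
definition "x - y = Quat (qRe x - qRe y) (qI x - qI y) (qJ x - qJ y) (qK x - qK y)"
definition "x * y = Quat
  (qRe x * qRe y - qI x * qI y - qJ x * qJ y - qK x * qK y)
  (qRe x * qI y + qI x * qRe y + qJ x * qK y - qK x * qJ y)
  (qRe x * qJ y - qI x * qK y + qJ x * qRe y + qK x * qI y)
  (qRe x * qK y + qI x * qJ y - qJ x * qI y + qK x * qRe y)"

instance
  by standard
    (simp_all add: quat_eq_iff zero_quat_def one_quat_def plus_quat_def uminus_quat_def
      minus_quat_def times_quat_def algebra_simps)

end

instantiation quat :: real_algebra_1
begin

definition "scaleR r x = Quat (r * qRe x) (r * qI x) (r * qJ x) (r * qK x)"

instance
  by standard
    (simp_all add: quat_eq_iff plus_quat_def times_quat_def scaleR_quat_def algebra_simps)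

end

instantiation quat :: real_inner
begin

definition "inner x y = qRe x * qRe y + qI x * qI y + qJ x * qJ y + qK x * qK y"
definition "norm (x :: quat) = sqrt (inner x x)"
definition "sgn (x :: quat) = x /\<^sub>R norm x"
definition "dist (x :: quat) y = norm (x - y)"
definition [code del]:
  "(uniformity :: (quat \<times> quat) filter) = (INF e\<in>{0 <..}. principal {(x, y). dist x y < e})"
definition [code del]:
  "open (U :: quat set) \<longleftrightarrow> (\<forall>x\<in>U. eventually (\<lambda>(x', y). x' = x \<longrightarrow> y \<in> U) uniformity)"

instance
proof
  fix x y z :: quat and r s :: real
  show "dist x y = norm (x - y)" by (rule dist_quat_def)
  show "sgn x = x /\<^sub>R norm x" by (rule sgn_quat_def)
  show "(uniformity :: (quat \<times> quat) filter) = (INF e\<in>{0 <..}. principal {(x, y). dist x y < e})"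
    by (rule uniformity_quat_def)
  show "open U \<longleftrightarrow> (\<forall>x\<in>U. eventually (\<lambda>(x', y). x' = x \<longrightarrow> y \<in> U) uniformity)"
    for U :: "quat set"
    by (rule open_quat_def)
  show "norm x = sqrt (inner x x)" by (rule norm_quat_def)
  show "inner x x = 0 \<longleftrightarrow> x = 0"
  proof
    assume "inner x x = 0"
    then have "(qRe x)\<^sup>2 + (qI x)\<^sup>2 + (qJ x)\<^sup>2 + (qK x)\<^sup>2 = 0"
      by (simp add: inner_quat_def power2_eq_square)
    then have "(qRe x)\<^sup>2 = 0 \<and> (qI x)\<^sup>2 = 0 \<and> (qJ x)\<^sup>2 = 0 \<and> (qK x)\<^sup>2 = 0"
      using zero_le_power2[of "qRe x"] zero_le_power2[of "qI x"]
        zero_le_power2[of "qJ x"] zero_le_power2[of "qK x"] by linarith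
    then show "x = 0"
      by (simp add: quat_eq_iff zero_quat_def)
  qed (simp add: inner_quat_def zero_quat_def)
qed (simp_all add: plus_quat_def scaleR_quat_def inner_quat_def algebra_simps)

end

instantiation quat :: real_normed_div_algebra
begin

definition "inverse x =
  Quat (qRe x / inner x x) (- qI x / inner x x) (- qJ x / inner x x) (- qK x / inner x x)"
definition "x div (y :: quat) = x * inverse y"

instance
proof
  fix x y :: quat and r :: real
  show "inverse x * x = 1" "x * inverse x = 1" if "x \<noteq> 0"
  proof -
    from that have "inner x x \<noteq> 0"
      by simp
    then show "inverse x * x = 1" "x * inverse x = 1"
      by (simp_all add: quat_eq_iff inverse_quat_def times_quat_def one_quat_def inner_quat_def
          add_divide_distrib[symmetric] diff_divide_distrib[symmetric] mult.commute)
  qed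
  show "x div y = x * inverse y" by (rule divide_quat_def)
  show "inverse 0 = (0 :: quat)"
    by (simp add: inverse_quat_def zero_quat_def)
  show "norm (x * y) = norm x * norm y"
  proof -
    have "inner (x * y) (x * y) = inner x x * inner y y"
      by (simp add: inner_quat_def times_quat_def algebra_simps)
    then show ?thesis
      by (simp add: norm_quat_def real_sqrt_mult)
  qed
qed

end

instantiation quat :: euclidean_space
begin

definition "Basis = {Quat 1 0 0 0, Quat 0 1 0 0, Quat 0 0 1 0, Quat 0 0 0 1}"

instance
  by standard (auto simp: Basis_quat_def inner_quat_def zero_quat_def intro: quat.expand)

end

definition qcnj :: "quat \<Rightarrow> quat"
  where "qcnj x = Quat (qRe x) (- qI x) (- qJ x) (- qK x)"

text \<open>
  The reals and the complex numbers are taken as subalgebras of the quaternions, so that the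
  three cases share the matrix types of the library.  The value for other arguments is irrelevant.
\<close>

definition \<F> :: "nat \<Rightarrow> quat set"
  where "\<F> \<beta> =
    (if \<beta> = 1 then {x. qI x = 0 \<and> qJ x = 0 \<and> qK x = 0}
     else if \<beta> = 2 then {x. qJ x = 0 \<and> qK x = 0}
     else UNIV)"


section \<open>Hermitian matrices and the Stiefel manifold\<close>

definition adj :: "quat^'n^'m \<Rightarrow> quat^'m^'n"
  where "adj X = (\<chi> i j. qcnj (X $ j $ i))"

definition vecs :: "nat \<Rightarrow> (quat^'m) set"
  where "vecs \<beta> = {v. \<forall>i. v $ i \<in> \<F> \<beta>}"

definition mats :: "nat \<Rightarrow> (quat^'n^'m) set"
  where "mats \<beta> = {X. \<forall>i j. X $ i $ j \<in> \<F> \<beta>}"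

definition herm :: "nat \<Rightarrow> (quat^'m^'m) set"
  where "herm \<beta> = {X \<in> mats \<beta>. adj X = X}"

definition eigspace :: "nat \<Rightarrow> quat^'m^'m \<Rightarrow> real \<Rightarrow> (quat^'m) set"
  where "eigspace \<beta> X l = {v \<in> vecs \<beta>. X *v v = l *\<^sub>R v}"

text \<open>
  The eigenvalues of a Hermitian matrix with multiplicities, in increasing order.  \<^term>\<open>dim\<close> is
  the dimension over the reals, hence the division by \<open>\<beta>\<close>.
\<close>

definition eigvals :: "nat \<Rightarrow> quat^'m^'m \<Rightarrow> real list"
  where "eigvals \<beta> X = sorted_list_of_multiset
    (\<Sum>l\<in>{l. eigspace \<beta> X l \<noteq> {0}}. replicate_mset (dim (eigspace \<beta> X l) div \<beta>) l)"

definition eignorm :: "nat \<Rightarrow> quat^'m^'m \<Rightarrow> real"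
  where "eignorm \<beta> X = Max (abs ` set (eigvals \<beta> X))"

definition etr :: "nat \<Rightarrow> quat^'m^'m \<Rightarrow> real"
  where "etr \<beta> X = exp (sum_list (eigvals \<beta> X))"

text \<open>The real inner product \<open>v \<bullet> (X *v v)\<close> is the real part of \<open>v\<^sup>* X v\<close>.\<close>

definition posdef :: "nat \<Rightarrow> quat^'m^'m \<Rightarrow> bool"
  where "posdef \<beta> X \<longleftrightarrow> X \<in> herm \<beta> \<and> (\<forall>v\<in>vecs \<beta>. v \<noteq> 0 \<longrightarrow> 0 < v \<bullet> (X *v v))"

definition psqrt :: "nat \<Rightarrow> quat^'m^'m \<Rightarrow> quat^'m^'m"
  where "psqrt \<beta> X = (THE R. posdef \<beta> R \<and> R ** R = X)"

definition stiefel :: "nat \<Rightarrow> (quat^'n^'m) set"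
  where "stiefel \<beta> = {H \<in> mats \<beta>. adj H ** H = mat 1}"

definition stiefel_measure :: "nat \<Rightarrow> (quat^'n^'m) measure \<Rightarrow> bool"
  where "stiefel_measure \<beta> \<mu> \<longleftrightarrow>
    prob_space \<mu> \<and>
    sets \<mu> = sets (restrict_space borel (stiefel \<beta>)) \<and>
    (\<forall>U \<in> stiefel \<beta> :: (quat^'m^'m) set. distr \<mu> \<mu> (\<lambda>H. U ** H) = \<mu>)"


section \<open>Symmetric polynomials in the eigenvalues of a product\<close>

text \<open>
  \<open>sym_prod \<beta> f A M\<close> is the symmetric polynomial \<open>f\<close> in the eigenvalues of \<open>AM\<close>: for positive
  definite \<open>A\<close> it is \<open>f\<close> at the eigenvalues of \<open>A\<^sup>1\<^sup>/\<^sup>2MA\<^sup>1\<^sup>/\<^sup>2\<close>, and for Hermitian \<open>A\<close> it is the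
  polynomial continuation in the entries of \<open>A\<close>.  The continuation is unique on the Hermitian
  matrices because the positive definite ones are open there.
\<close>

definition sym_prod :: "nat \<Rightarrow> (real list \<Rightarrow> real) \<Rightarrow> quat^'m^'m \<Rightarrow> quat^'m^'m \<Rightarrow> real"
  where "sym_prod \<beta> f A M = (THE v. \<exists>g. real_polynomial_function g \<and>
    (\<forall>X. posdef \<beta> X \<longrightarrow> g X = f (eigvals \<beta> (psqrt \<beta> X ** M ** psqrt \<beta> X))) \<and> v = g A)"

definition etr_prod :: "nat \<Rightarrow> quat^'m^'m \<Rightarrow> quat^'m^'m \<Rightarrow> real"
  where "etr_prod \<beta> A M = exp (sym_prod \<beta> sum_list A M)"

definition det_I_minus_prod :: "nat \<Rightarrow> quat^'m^'m \<Rightarrow> quat^'m^'m \<Rightarrow> real"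
  where "det_I_minus_prod \<beta> A M = sym_prod \<beta> (\<lambda>xs. \<Prod>x\<leftarrow>xs. 1 - x) A M"


section \<open>Jack polynomials\<close>

text \<open>Partitions and exponent vectors are 0-indexed sequences padded with zeros.\<close>

definition expos :: "nat \<Rightarrow> nat \<Rightarrow> (nat \<Rightarrow> nat) set"
  where "expos n k = {e. (\<forall>i\<ge>n. e i = 0) \<and> (\<Sum>i<n. e i) = k}"

definition parts :: "nat \<Rightarrow> nat \<Rightarrow> (nat \<Rightarrow> nat) set"
  where "parts n k = {\<kappa> \<in> expos n k. antimono \<kappa>}"

text \<open>The homogeneous polynomial of degree \<open>k\<close> in \<open>m\<close> variables with coefficients \<open>c\<close>.\<close>

definition hpoly :: "nat \<Rightarrow> nat \<Rightarrow> ((nat \<Rightarrow> nat) \<Rightarrow> real) \<Rightarrow> (nat \<Rightarrow> real) \<Rightarrow> real"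
  where "hpoly m k c x = (\<Sum>e\<in>expos m k. c e * (\<Prod>i<m. x i ^ e i))"

definition pderiv_at :: "nat \<Rightarrow> ((nat \<Rightarrow> real) \<Rightarrow> real) \<Rightarrow> (nat \<Rightarrow> real) \<Rightarrow> real"
  where "pderiv_at i f x = deriv (\<lambda>t. f (x(i := t))) (x i)"

definition jack_op :: "nat \<Rightarrow> nat \<Rightarrow> ((nat \<Rightarrow> real) \<Rightarrow> real) \<Rightarrow> (nat \<Rightarrow> real) \<Rightarrow> real"
  where "jack_op \<beta> m f x =
    (\<Sum>i<m. (x i)\<^sup>2 * pderiv_at i (pderiv_at i f) x) +
    real \<beta> * (\<Sum>i<m. \<Sum>j\<in>{..<m} - {i}. (x i)\<^sup>2 / (x i - x j) * pderiv_at i f x)"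

text \<open>
  The lexicographic condition alone does not determine the polynomials: \<open>(4,1,1)\<close> and \<open>(3,3)\<close>
  have the same eigenvalue for every \<open>\<beta>\<close>, so a multiple of the polynomial of \<open>(3,3)\<close> could be
  moved into that of \<open>(4,1,1)\<close>.  The clause on partial sums is the usual triangularity with
  respect to the dominance order; it refines the lexicographic one and makes the family unique.
\<close>

definition jack_family :: "nat \<Rightarrow> nat \<Rightarrow> nat \<Rightarrow> ((nat \<Rightarrow> nat) \<Rightarrow> (nat \<Rightarrow> nat) \<Rightarrow> real) \<Rightarrow> bool"
  where "jack_family \<beta> m k c \<longleftrightarrow>
    (\<forall>\<kappa>\<in>parts m k.
      (\<forall>\<pi> e. \<pi> permutes {..<m} \<longrightarrow> e \<in> expos m k \<longrightarrow> c \<kappa> (e \<circ> \<pi>) = c \<kappa> e) \<and>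
      c \<kappa> \<kappa> \<noteq> 0 \<and>
      (\<forall>e\<in>expos m k. c \<kappa> e \<noteq> 0 \<longrightarrow> e \<noteq> \<kappa> \<longrightarrow> (\<exists>i. e i < \<kappa> i \<and> (\<forall>j<i. e j = \<kappa> j))) \<and>
      (\<forall>e\<in>expos m k. c \<kappa> e \<noteq> 0 \<longrightarrow> (\<forall>j\<le>m. (\<Sum>i<j. e i) \<le> (\<Sum>i<j. \<kappa> i))) \<and>
      (\<exists>\<rho>. \<forall>x. inj_on x {..<m} \<longrightarrow>
        jack_op \<beta> m (hpoly m k (c \<kappa>)) x = \<rho> * hpoly m k (c \<kappa>) x)) \<and>
    (\<forall>x. (\<Sum>\<kappa>\<in>parts m k. hpoly m k (c \<kappa>) x) = (\<Sum>i<m. x i) ^ k)"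

text \<open>The number of variables is the length of the list.\<close>

definition jack :: "nat \<Rightarrow> nat \<Rightarrow> (nat \<Rightarrow> nat) \<Rightarrow> real list \<Rightarrow> real"
  where "jack \<beta> k \<kappa> xs =
    hpoly (length xs) k ((SOME c. jack_family \<beta> (length xs) k c) \<kappa>) (\<lambda>i. xs ! i)"

definition jackC :: "nat \<Rightarrow> nat \<Rightarrow> (nat \<Rightarrow> nat) \<Rightarrow> quat^'m^'m \<Rightarrow> real"
  where "jackC \<beta> k \<kappa> X = jack \<beta> k \<kappa> (eigvals \<beta> X)"


section \<open>Hypergeometric functions of matrix arguments\<close>

definition gpoch :: "nat \<Rightarrow> complex \<Rightarrow> (nat \<Rightarrow> nat) \<Rightarrow> complex"
  where "gpoch \<beta> a \<kappa> = (\<Prod>i | \<kappa> i \<noteq> 0. pochhammer (a - of_nat i / 2 * of_nat \<beta>) (\<kappa> i))"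

definition pFq_coeff :: "nat \<Rightarrow> complex list \<Rightarrow> complex list \<Rightarrow> (nat \<Rightarrow> nat) \<Rightarrow> complex"
  where "pFq_coeff \<beta> as bs \<kappa> = (\<Prod>a\<leftarrow>as. gpoch \<beta> a \<kappa>) / (\<Prod>b\<leftarrow>bs. gpoch \<beta> b \<kappa>)"

definition pFq2_term :: "nat \<Rightarrow> complex list \<Rightarrow> complex list \<Rightarrow>
    quat^'m^'m \<Rightarrow> quat^'n^'n \<Rightarrow> nat \<Rightarrow> (nat \<Rightarrow> nat) \<Rightarrow> complex"
  where "pFq2_term \<beta> as bs A B k \<kappa> = pFq_coeff \<beta> as bs \<kappa> *
    of_real (jackC \<beta> k \<kappa> A * jackC \<beta> k \<kappa> B / (fact k * jackC \<beta> k \<kappa> (mat 1 :: quat^'m^'m)))"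

definition pFq2 :: "nat \<Rightarrow> complex list \<Rightarrow> complex list \<Rightarrow> quat^'m^'m \<Rightarrow> quat^'n^'n \<Rightarrow> complex"
  where "pFq2 \<beta> as bs A B = (\<Sum>k. \<Sum>\<kappa>\<in>parts CARD('n) k. pFq2_term \<beta> as bs A B k \<kappa>)"

text \<open>The function of one \<open>m \<times> m\<close> argument, at the product \<open>AM\<close>.\<close>

definition pFq1_term :: "nat \<Rightarrow> complex list \<Rightarrow> complex list \<Rightarrow>
    quat^'m^'m \<Rightarrow> quat^'m^'m \<Rightarrow> nat \<Rightarrow> (nat \<Rightarrow> nat) \<Rightarrow> complex"
  where "pFq1_term \<beta> as bs A M k \<kappa> =
    pFq_coeff \<beta> as bs \<kappa> * of_real (sym_prod \<beta> (jack \<beta> k \<kappa>) A M / fact k)"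

definition pFq1_prod :: "nat \<Rightarrow> complex list \<Rightarrow> complex list \<Rightarrow> quat^'m^'m \<Rightarrow> quat^'m^'m \<Rightarrow> complex"
  where "pFq1_prod \<beta> as bs A M = (\<Sum>k. \<Sum>\<kappa>\<in>parts CARD('m) k. pFq1_term \<beta> as bs A M k \<kappa>)"

text \<open>Both sides of the integral formula have only finitely many nonzero terms.\<close>

definition pFq_terminates :: "nat \<Rightarrow> complex list \<Rightarrow> complex list \<Rightarrow> quat^'m^'m \<Rightarrow> quat^'n^'n \<Rightarrow> bool"
  where "pFq_terminates \<beta> as bs A B \<longleftrightarrow> (\<exists>K. \<forall>k\<ge>K.
    (\<forall>\<kappa>\<in>parts CARD('n) k. pFq2_term \<beta> as bs A B k \<kappa> = 0) \<and>
    (\<forall>H \<in> stiefel \<beta> :: (quat^'n^'m) set. \<forall>\<kappa>\<in>parts CARD('m) k.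
      pFq1_term \<beta> as bs A (H ** B ** adj H) k \<kappa> = 0))"

definition pFq_convergent :: "nat \<Rightarrow> complex list \<Rightarrow> complex list \<Rightarrow> quat^'m^'m \<Rightarrow> quat^'n^'n \<Rightarrow> bool"
  where "pFq_convergent \<beta> as bs A B \<longleftrightarrow>
    (\<forall>b\<in>set bs. \<forall>k. \<forall>\<kappa>\<in>parts CARD('m) k. gpoch \<beta> b \<kappa> \<noteq> 0) \<and>
    (length as \<le> length bs \<or>
     length as = length bs + 1 \<and> eignorm \<beta> A * eignorm \<beta> B < 1 \<or>
     pFq_terminates \<beta> as bs A B)"

end

theory Submission imports Defs begin

text \<open>Let \<open>\<Delta>\<^sub>\<kappa>\<close> be the power function, a product of powers of leading minors, and let
\<open>\<Phi>\<^sub>\<kappa>\<close> be the average of \<open>V \<mapsto> \<Delta>\<^sub>\<kappa>(V* A V)\<close> over the unitary group. Writing \<open>V* g*\<close> as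
a triangular times a unitary matrix gives the functional equation
\<open>\<integral> \<Phi>\<^sub>\<kappa>(g* H B H* g) dH = \<Phi>\<^sub>\<kappa>(g* g) \<Phi>\<^sub>\<kappa>(H\<^sub>0 B H\<^sub>0*)\<close>. Its second-order expansion shows that \<open>\<Phi>\<^sub>\<kappa>\<close> is an
eigenfunction of the invariant Laplacian, whose radial part is the operator defining the Jack
polynomials; since \<open>\<Phi>\<^sub>\<kappa>\<close> is also triangular in the monomials, \<open>C\<^sub>\<kappa> = a\<^sub>\<kappa> \<Phi>\<^sub>\<kappa>\<close>. So the series may be
integrated term by term, first for positive definite and then by interpolation for Hermitian \<open>A\<close>.
The kernel \<open>a\<^sub>\<kappa> \<Phi>\<^sub>\<kappa>(A\<^sup>1\<^sup>/\<^sup>2 M A\<^sup>1\<^sup>/\<^sup>2)\<close> is positive semidefinite, which gives \<open>a\<^sub>\<kappa> > 0\<close> and, by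
Cauchy-Schwarz, the bound of \<open>\<bar>C\<^sub>\<kappa>(AM)\<bar>\<close> by \<open>a\<^sub>\<kappa>\<close> times the \<open>k\<close>-th power of the product of the norms
also for indefinite \<open>A\<close>. The Pieri rule for \<open>\<Phi>\<^sub>\<kappa>\<close> yields the binomial series, hence the third
identity and the majorant in the case \<open>p = q + 1\<close>.\<close>

section \<open>Quaternionic matrices\<close>

lemmas quat_simps = quat_eq_iff zero_quat_def one_quat_def plus_quat_def uminus_quat_def
 minus_quat_def times_quat_def scaleR_quat_def qcnj_def inner_quat_def

lemma qcnj_simps [simp]:
 "qcnj 0 = 0" "qcnj 1 = 1" "qcnj (qcnj x) = x" "qcnj (x + y) = qcnj x + qcnj y"
 "qcnj (x - y) = qcnj x - qcnj y" "qcnj (- x) = - qcnj x" "qcnj (r *\<^sub>R x) = r *\<^sub>R qcnj x"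
 by (simp_all add: quat_simps)

lemma qcnj_mult: "qcnj (x * y) = qcnj y * qcnj x" by (simp add: quat_simps algebra_simps)

lemma linear_qcnj: "linear qcnj" by (rule linearI) auto

lemma qcnj_sum: "qcnj (sum f A) = (\<Sum>a\<in>A. qcnj (f a))" by (rule linear_sum[OF linear_qcnj])

lemma linear_qRe: "linear qRe" by (rule linearI) (auto simp: quat_simps)

lemma qRe_simps [simp]: "qRe 0 = 0" "qRe 1 = 1" "qRe (x + y) = qRe x + qRe y"
 "qRe (x - y) = qRe x - qRe y" "qRe (r *\<^sub>R x) = r * qRe x" "qRe (qcnj x) = qRe x" by (simp_all add: quat_simps)

lemma qRe_sum: "qRe (sum f A) = (\<Sum>a\<in>A. qRe (f a))" by (rule linear_sum[OF linear_qRe])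

lemma qRe_mult_commute: "qRe (x * y) = qRe (y * x)" by (simp add: quat_simps algebra_simps)

lemma inner_quat_qRe: "x \<bullet> y = qRe (qcnj x * y)" by (simp add: quat_simps)

lemma of_real_quat: "of_real r = Quat r 0 0 0" by (simp add: of_real_def quat_simps)

lemma qRe_of_real [simp]: "qRe (of_real r) = r"
 and qcnj_of_real [simp]: "qcnj (of_real r) = of_real r" by (simp_all add: of_real_quat quat_simps)

lemma of_real_mult_quat: "of_real r * (x::quat) = r *\<^sub>R x" "x * of_real r = r *\<^sub>R x"
 by (simp_all add: of_real_quat quat_simps)

lemma qcnj_mult_self: "qcnj x * x = of_real (x \<bullet> x)" "x * qcnj x = of_real (x \<bullet> x)"
 by (simp_all add: of_real_quat quat_simps)

lemma qRe_continuous [continuous_intros]: "continuous_on S f ==> continuous_on S (%x. qRe (f x))"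
 using bounded_linear.continuous_on[of qRe] linear_qRe by (auto simp: linear_conv_bounded_linear)

lemma qcnj_continuous [continuous_intros]: "continuous_on S f ==> continuous_on S (%x. qcnj (f x))"
 using bounded_linear.continuous_on[of qcnj] linear_qcnj by (auto simp: linear_conv_bounded_linear)

lemma adj_nth [simp]: "adj X$i$j = qcnj (X$j$i)" by (simp add: adj_def)

lemma adj_adj [simp]: "adj (adj X) = X" by (simp add: vec_eq_iff)

lemma adj_mult: "adj (A**B) = adj B**adj A" by (simp add: vec_eq_iff matrix_matrix_mult_def qcnj_sum qcnj_mult)

lemma adj_simps [simp]: "adj (A + B) = adj A + adj B" "adj (A - B) = adj A - adj B"
 "adj (r *\<^sub>R A) = r *\<^sub>R adj A" "adj 0 = 0" by (simp_all add: vec_eq_iff)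

lemma adj_mat1 [simp]: "adj (mat 1) = mat 1" by (simp add: vec_eq_iff mat_def)

lemma matrix_add_rdistrib: "(A + B)**C = A**C + B**(C::'a::semiring_1^'n^'m)"
 by (simp add: vec_eq_iff matrix_matrix_mult_def distrib_right sum.distrib)

lemma matrix_scaleR_left: "(r *\<^sub>R A)**B = r *\<^sub>R (A**(B::'a::real_algebra_1^'n^'m))"
 and matrix_scaleR_right: "A**(r *\<^sub>R B) = r *\<^sub>R (A**(B::'a::real_algebra_1^'n^'m))"
 by (simp_all add: vec_eq_iff matrix_matrix_mult_def scaleR_sum_right)

lemma matrix_diff_distrib: "(A - B)**C = A**C - B**(C::'a::ring_1^'n^'m)"
 "C**(D - E) = C**D - C**E"
 by (simp_all add: vec_eq_iff matrix_matrix_mult_def left_diff_distrib right_diff_distrib sum_subtractf)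

lemma matrix_mult_zero [simp]: "0**A = 0" "A**0 = (0::'a::semiring_1^'n^'m)"
 by (simp_all add: vec_eq_iff matrix_matrix_mult_def)

lemmas matrix_linear_simps = matrix_add_ldistrib matrix_add_rdistrib matrix_scaleR_left
 matrix_scaleR_right matrix_diff_distrib

lemma matrix_vector_scaleR: "(r *\<^sub>R A) *v x = r *\<^sub>R (A *v x)"
 "A *v (r *\<^sub>R x) = r *\<^sub>R (A *v (x::'a::real_algebra_1^'n))"
 by (simp_all add: vec_eq_iff matrix_vector_mult_def scaleR_sum_right)

lemma inner_adj: "x \<bullet> (A *v y) = (adj A *v x) \<bullet> y" for A :: "quat^'n^'m"
proof -
 have "x \<bullet> (A *v y) = (\<Sum>i\<in>UNIV. \<Sum>j\<in>UNIV. qRe (qcnj (x$i) * (A$i$j * y$j)))"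
  by (simp add: inner_vec_def inner_quat_qRe matrix_vector_mult_def qRe_sum sum_distrib_left)
 also have "... = (\<Sum>j\<in>UNIV. \<Sum>i\<in>UNIV. qRe (qcnj (x$i) * (A$i$j * y$j)))" by (rule sum.swap)
 also have "... = (adj A *v x) \<bullet> y"
  by (simp add: inner_vec_def inner_quat_qRe matrix_vector_mult_def qRe_sum sum_distrib_right
    qcnj_sum qcnj_mult mult.assoc)
 finally show ?thesis .
qed

text \<open>Over the quaternions only the real part of the trace is cyclic.\<close>

definition rtr :: "quat^'m^'m => real"
 where "rtr X = (\<Sum>i\<in>UNIV. qRe (X$i$i))"

lemma rtr_commute: "rtr (A**B) = rtr (B**A)" for A :: "quat^'n^'m"
proof -
 have "rtr (A**B) = (\<Sum>i\<in>UNIV. \<Sum>j\<in>UNIV. qRe (A$i$j * B$j$i))"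
  by (simp add: rtr_def matrix_matrix_mult_def qRe_sum)
 also have "... = (\<Sum>j\<in>UNIV. \<Sum>i\<in>UNIV. qRe (B$j$i * A$i$j))" by (subst sum.swap) (simp add: qRe_mult_commute)
 also have "... = rtr (B**A)" by (simp add: rtr_def matrix_matrix_mult_def qRe_sum)
 finally show ?thesis .
qed

lemma linear_rtr: "linear rtr" by (rule linearI) (simp_all add: rtr_def sum.distrib sum_distrib_left)

lemma inner_rtr: "A \<bullet> B = rtr (adj A**B)" for A B :: "quat^'n^'m"
proof -
 have "rtr (adj A**B) = (\<Sum>i\<in>UNIV. \<Sum>j\<in>UNIV. qRe (qcnj (A$j$i) * B$j$i))"
  by (simp add: rtr_def matrix_matrix_mult_def qRe_sum)
 also have "... = A \<bullet> B" by (subst sum.swap) (simp add: inner_vec_def inner_quat_qRe)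
 finally show ?thesis by simp
qed

text \<open>\<open>B\<close> is an injective real-linear endomorphism of a finite-dimensional space,
  hence onto; no determinant over a skew field is involved.\<close>

lemma matrix_left_right_inverse_quat:
 fixes A B :: "quat^'m^'m"
 assumes "A**B = mat 1"
 shows "B**A = mat 1"
proof -
 have inj: "inj ((*v) B)" by (rule inj_on_inverseI[where g="(*v) A"]) (simp add: matrix_vector_mul_assoc assms)
 have "surj ((*v) B)" by (rule linear_injective_imp_surjective[OF _ inj]) auto
 then have "(B**A) *v y = y" for y
 proof -
  obtain x where y: "y = B *v x" using \<open>surj ((*v) B)\<close> by (auto elim: surjE)
  have "(B**A) *v (B *v x) = B *v ((A**B) *v x)" by (simp add: matrix_vector_mul_assoc matrix_mul_assoc)
  then show ?thesis by (simp add: y assms)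
 qed
 then show ?thesis by (simp add: matrix_eq)
qed

text \<open>A fixed enumeration of the index type supplies the order behind leading minors,
  triangular matrices and the variables x_0, ..., x_(m-1).\<close>

definition idx :: "'m::finite => nat"
 where "idx = (SOME f. bij_betw f UNIV {..<CARD('m)})"

definition ith :: "nat => 'm::finite"
 where "ith = inv_into UNIV idx"

lemma idx_bij: "bij_betw (idx :: 'm::finite => nat) UNIV {..<CARD('m)}"
proof -
 have "\<exists>f::'m => nat. bij_betw f UNIV {..<CARD('m)}"
  using ex_bij_betw_finite_nat[of "UNIV :: 'm set"] by (simp add: lessThan_atLeast0)
 then show ?thesis unfolding idx_def by (rule someI_ex)
qed

lemma idx_less [simp]: "idx (a::'m::finite) < CARD('m)" using idx_bij[where 'm='m] by (auto simp: bij_betw_def)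

lemma ith_idx [simp]: "ith (idx a) = (a::'m::finite)"
 using idx_bij[where 'm='m] by (simp add: ith_def bij_betw_inv_into_left)

lemma idx_ith [simp]: "i < CARD('m) ==> idx (ith i :: 'm::finite) = i"
 using idx_bij[where 'm='m] by (simp add: ith_def bij_betw_inv_into_right)

lemma idx_eq_iff [simp]: "idx a = idx b \<longleftrightarrow> a = b" by (metis ith_idx)

lemma sum_idx: "(\<Sum>a\<in>(UNIV::'m::finite set). f (idx a)) = (\<Sum>i<CARD('m). f i)"
 using idx_bij[where 'm='m] by (rule sum.reindex_bij_betw)

lemma prod_idx: "(\<Prod>a\<in>(UNIV::'m::finite set). f (idx a)) = (\<Prod>i<CARD('m). f i)"
 using idx_bij[where 'm='m] by (rule prod.reindex_bij_betw)

definition dg :: "('m => real) => quat^'m^'m"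
 where "dg x = (\<chi> i j. if i = j then of_real (x i) else 0)"

lemma dg_nth [simp]: "dg x$i$j = (if i = j then of_real (x i) else 0)" by (simp add: dg_def)

lemma adj_dg [simp]: "adj (dg x) = dg x" by (simp add: vec_eq_iff)

lemma sum_delta_mult:
 "(\<Sum>k\<in>UNIV. (if i = k then c else 0) * f k) = c * (f (i::'m::finite) :: quat)"
 "(\<Sum>k\<in>UNIV. f k * (if k = i then c else 0)) = f i * c"
proof -
 have "(\<Sum>k\<in>UNIV. (if i = k then c else 0) * f k) = (\<Sum>k\<in>UNIV. if i = k then c * f k else 0)"
  by (intro sum.cong) auto
 then show "(\<Sum>k\<in>UNIV. (if i = k then c else 0) * f k) = c * f i" by simp
 have "(\<Sum>k\<in>UNIV. f k * (if k = i then c else 0)) = (\<Sum>k\<in>UNIV. if k = i then f k * c else 0)"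
  by (intro sum.cong) auto
 then show "(\<Sum>k\<in>UNIV. f k * (if k = i then c else 0)) = f i * c" by simp
qed

lemma dg_mult_nth: "(dg x**A)$i$j = x i *\<^sub>R A$i$j" "(A**dg y)$i$j = y j *\<^sub>R A$i$j"
proof -
 show "(dg x**A)$i$j = x i *\<^sub>R A$i$j" by (simp add: matrix_matrix_mult_def sum_delta_mult of_real_mult_quat)
 have "(A**dg y)$i$j = (\<Sum>k\<in>UNIV. A$i$k * (if k = j then of_real (y j) else 0))"
  by (auto simp: matrix_matrix_mult_def intro!: sum.cong)
 then show "(A**dg y)$i$j = y j *\<^sub>R A$i$j" by (simp add: sum_delta_mult of_real_mult_quat)
qed

lemma dg_mult: "dg x**dg y = dg (%i. x i * y i)" by (simp add: vec_eq_iff dg_mult_nth of_real_def)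

lemma dg_vec: "(dg x *v v)$i = x i *\<^sub>R v$i"
 by (simp add: matrix_vector_mult_def sum_delta_mult of_real_mult_quat)

lemma dg_one: "dg (%_. 1) = mat 1" by (simp add: vec_eq_iff mat_def)

lemma dg_add: "dg x + dg y = dg (%i. x i + y i)"
 and dg_scaleR: "r *\<^sub>R dg x = dg (%i. r * x i)" by (simp_all add: vec_eq_iff of_real_def scaleR_add_left)

lemma rtr_dg [simp]: "rtr (dg x) = (\<Sum>i\<in>UNIV. x i)" by (simp add: rtr_def)

locale fld =
 fixes \<beta> :: nat
 assumes beta: "\<beta> \<in> {1, 2, 4}"
begin

abbreviation "Stf \<equiv> stiefel \<beta>"
abbreviation "Hrm \<equiv> herm \<beta>"
abbreviation "Mts \<equiv> mats \<beta>"
abbreviation "Vcs \<equiv> vecs \<beta>"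
abbreviation "spec \<equiv> eigvals \<beta>"
abbreviation "sqr \<equiv> psqrt \<beta>"
abbreviation "pdef \<equiv> posdef \<beta>"
abbreviation "sprod \<equiv> sym_prod \<beta>"

lemma beta_pos: "\<beta> > 0" using beta by auto

lemma F_simps [simp]:
 "0 \<in> \<F> \<beta>" "1 \<in> \<F> \<beta>" "of_real r \<in> \<F> \<beta>"
 "x \<in> \<F> \<beta> ==> y \<in> \<F> \<beta> ==> x + y \<in> \<F> \<beta>" "x \<in> \<F> \<beta> ==> y \<in> \<F> \<beta> ==> x - y \<in> \<F> \<beta>"
 "x \<in> \<F> \<beta> ==> y \<in> \<F> \<beta> ==> x * y \<in> \<F> \<beta>" "x \<in> \<F> \<beta> ==> - x \<in> \<F> \<beta>"
 "x \<in> \<F> \<beta> ==> qcnj x \<in> \<F> \<beta>" "x \<in> \<F> \<beta> ==> r *\<^sub>R x \<in> \<F> \<beta>" using beta by (auto simp: \<F>_def quat_simps of_real_quat)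

lemma F_sum: "(!!a. a \<in> A ==> f a \<in> \<F> \<beta>) ==> sum f A \<in> \<F> \<beta>" by (induction A rule: infinite_finite_induct) auto

text \<open>A real orthonormal basis of the scalars; its cardinality is how \<beta> enters as a
  dimension.\<close>

definition fbasis :: "quat set"
 where "fbasis = Basis \<inter> \<F> \<beta>"

lemma card_fbasis: "card fbasis = \<beta>" and finite_fbasis: "finite fbasis"
proof -
 consider "\<beta> = 1" | "\<beta> = 2" | "\<beta> = 4" using beta by blast
 then have "card fbasis = \<beta> \<and> finite fbasis"
 proof cases
  case 1
  have "fbasis = {Quat 1 0 0 0}" unfolding fbasis_def unfolding 1 by (auto simp: \<F>_def Basis_quat_def)
  then show ?thesis unfolding 1 by simp
 next
  case 2
  have "fbasis = {Quat 1 0 0 0, Quat 0 1 0 0}"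
   unfolding fbasis_def unfolding 2 by (auto simp: \<F>_def Basis_quat_def)
  then show ?thesis unfolding 2 by simp
 next
  case 3
  have "fbasis = Basis" unfolding fbasis_def unfolding 3 by (auto simp: \<F>_def)
  then show ?thesis unfolding 3 by (simp add: Basis_quat_def)
 qed
 then show "card fbasis = \<beta>" "finite fbasis" by auto
qed

lemma F_inner_Basis: "x \<in> \<F> \<beta> ==> q \<in> Basis - \<F> \<beta> ==> x \<bullet> q = 0"
 using beta by (auto simp: \<F>_def Basis_quat_def quat_simps)

lemma subspace_vecs: "subspace Vcs" by (auto simp: subspace_def vecs_def)

lemma subspace_mats: "subspace Mts" by (auto simp: subspace_def mats_def)

lemma mats_simps [simp]:
 "A \<in> Mts ==> B \<in> Mts ==> A**B \<in> Mts" "A \<in> Mts ==> adj A \<in> Mts"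
 "A \<in> Mts ==> A' \<in> Mts ==> A + A' \<in> Mts" "A \<in> Mts ==> A' \<in> Mts ==> A - A' \<in> Mts"
 "A \<in> Mts ==> r *\<^sub>R A \<in> Mts" "dg x \<in> Mts" "mat 1 \<in> Mts" "0 \<in> Mts"
 by (auto simp: mats_def matrix_matrix_mult_def mat_def intro!: F_sum)

lemma mats_vecs: "A \<in> Mts ==> v \<in> Vcs ==> A *v v \<in> Vcs"
 by (auto simp: mats_def vecs_def matrix_vector_mult_def intro!: F_sum)

lemma herm_simps [simp]:
 "A \<in> Hrm ==> B \<in> Hrm ==> A + B \<in> Hrm" "A \<in> Hrm ==> B \<in> Hrm ==> A - B \<in> Hrm"
 "A \<in> Hrm ==> r *\<^sub>R A \<in> Hrm" "dg x \<in> Hrm" "mat 1 \<in> Hrm" "0 \<in> Hrm" by (auto simp: herm_def)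

lemma herm_conj [simp]: "A \<in> Hrm ==> g \<in> Mts ==> g**A**adj g \<in> Hrm"
 "A \<in> Hrm ==> g' \<in> Mts ==> adj g'**A**g' \<in> Hrm"
 "g \<in> Mts ==> g**adj g \<in> Hrm" "g' \<in> Mts ==> adj g'**g' \<in> Hrm" by (auto simp: herm_def adj_mult matrix_mul_assoc)

lemma herm_conjD: "g \<in> Hrm ==> A \<in> Hrm ==> g**A**g \<in> Hrm" using herm_conj(1)[of A g] by (auto simp: herm_def)

lemma herm_mats: "A \<in> Hrm ==> A \<in> Mts" and herm_adj: "A \<in> Hrm ==> adj A = A" by (auto simp: herm_def)

lemma stiefel_mats: "U \<in> Stf ==> U \<in> Mts" and stiefelD: "U \<in> Stf ==> adj U**U = mat 1" by (auto simp: stiefel_def)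

lemma unitaryD: "U \<in> Stf ==> U**adj U = mat 1" for U :: "quat^'m^'m"
 using matrix_left_right_inverse_quat stiefelD by blast

lemma unitary_mult: "U \<in> Stf ==> H \<in> Stf ==> U**H \<in> Stf" for U :: "quat^'m^'m"
 by (simp add: stiefel_def adj_mult) (metis matrix_mul_assoc matrix_mul_rid)

lemma unitary_adj: "U \<in> Stf ==> adj U \<in> Stf" for U :: "quat^'m^'m" using unitaryD[of U] by (simp add: stiefel_def)

text \<open>Eigenspaces of a diagonal matrix are coordinate subspaces, so this count yields the
  multiplicities in \<open>eigvals\<close>.\<close>

lemma dim_vecs_supp: "dim {w \<in> Vcs. \<forall>i. i \<notin> I --> w$i = 0} = card I * \<beta>" for I :: "'m::finite set"
proof (rule dim_unique)
 let ?B = "(%(i, q). axis i q) ` (I \<times> fbasis) :: (quat^'m) set"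
 have Bsub: "?B \<subseteq> Basis" by (auto simp: fbasis_def Basis_vec_def)
 show "?B \<subseteq> {w \<in> Vcs. \<forall>i. i \<notin> I --> w$i = 0}" by (auto simp: fbasis_def vecs_def axis_def)
 show "independent ?B" using Bsub independent_Basis independent_mono by blast
 have "inj_on (%(i, q). axis i q) (I \<times> fbasis)" by (auto simp: inj_on_def axis_eq_axis fbasis_def)
 then show "card ?B = card I * \<beta>" by (simp add: card_image card_cartesian_product card_fbasis)
 show "{w \<in> Vcs. \<forall>i. i \<notin> I --> w$i = 0} \<subseteq> span ?B"
 proof
  fix w assume w: "w \<in> {w \<in> Vcs. \<forall>i. i \<notin> I --> w$i = 0}"
  have "(\<Sum>b\<in>Basis. (w \<bullet> b) *\<^sub>R b) \<in> span ?B"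
  proof (intro span_sum)
   fix b :: "quat^'m" assume "b \<in> Basis"
   then obtain i q where b: "b = axis i q" "q \<in> Basis" by (auto simp: Basis_vec_def)
   show "(w \<bullet> b) *\<^sub>R b \<in> span ?B"
   proof (cases "i \<in> I \<and> q \<in> \<F> \<beta>")
    case True
    then show ?thesis using b by (intro span_scale span_base) (auto simp: fbasis_def)
   next
    case False
    then have "w \<bullet> b = 0"
     using w b F_inner_Basis[of "w$i" q] by (cases "i \<in> I") (simp_all add: inner_axis vecs_def)
    then show ?thesis by (simp add: span_zero)
   qed
  qed
  then show "w \<in> span ?B" by (simp only: euclidean_representation)
 qed
qed

lemma dim_vecs: "dim (Vcs :: (quat^'m) set) = CARD('m) * \<beta>" using dim_vecs_supp[of "UNIV :: 'm set"] by simp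

section \<open>The spectral theorem\<close>

definition vdot :: "quat^'m => quat^'m => quat"
 where "vdot u v = (\<Sum>i\<in>UNIV. qcnj (u$i) * v$i)"

text \<open>Matrices act from the left, so scalars must act from the right; \<open>vdot u\<close> is
  linear for this right structure.\<close>

definition rs :: "quat^'m => quat => quat^'m"
 where "rs v q = (\<chi> i. v$i * q)"

lemma vdot_simps: "vdot u (v + w) = vdot u v + vdot u w" "vdot u (v - w) = vdot u v - vdot u w"
 "vdot u (r *\<^sub>R v) = r *\<^sub>R vdot u v" "vdot (r *\<^sub>R u) v = r *\<^sub>R vdot u v" "vdot u 0 = 0"
 "vdot u (rs v q) = vdot u v * q"
 by (simp_all add: vdot_def distrib_left right_diff_distrib sum.distrib sum_subtractf rs_def
   scaleR_sum_right mult.assoc[symmetric] sum_distrib_right)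

lemma linear_vdot: "linear (vdot u)" by (rule linearI) (simp_all add: vdot_simps)

lemma vdot_adj: "vdot u (X *v v) = vdot (adj X *v u) v"
proof -
 have "vdot u (X *v v) = (\<Sum>i\<in>UNIV. \<Sum>j\<in>UNIV. qcnj (u$i) * (X$i$j * v$j))"
  by (simp add: vdot_def matrix_vector_mult_def sum_distrib_left)
 also have "... = (\<Sum>j\<in>UNIV. \<Sum>i\<in>UNIV. qcnj (u$i) * (X$i$j * v$j))" by (rule sum.swap)
 also have "... = vdot (adj X *v u) v"
  by (simp add: vdot_def matrix_vector_mult_def qcnj_sum qcnj_mult sum_distrib_right mult.assoc)
 finally show ?thesis .
qed

lemma vdot_cnj: "qcnj (vdot u v) = vdot v u" by (simp add: vdot_def qcnj_sum qcnj_mult)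

lemma vdot_self: "vdot v v = of_real (v \<bullet> v)" by (simp add: vdot_def inner_vec_def qcnj_mult_self)

lemma vdot_F: "u \<in> Vcs ==> v \<in> Vcs ==> vdot u v \<in> \<F> \<beta>" by (auto simp: vdot_def vecs_def intro!: F_sum)

lemma rs_vecs: "u \<in> Vcs ==> q \<in> \<F> \<beta> ==> rs u q \<in> Vcs" by (auto simp: rs_def vecs_def)

lemma inner_rs: "rs v q \<bullet> u = q \<bullet> vdot v u"
 by (simp add: rs_def inner_vec_def inner_quat_qRe vdot_def sum_distrib_left qRe_sum qcnj_mult mult.assoc)

text \<open>The real components of \<open>vdot v u\<close> are the real inner products of
  \<open>u\<close> with the right multiples of \<open>v\<close> by units, so real orthogonality
  controls the scalar-valued form.\<close>

lemma vdot_eq_0: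
 assumes "u \<in> Vcs" "v \<in> Vcs" "!!q. q \<in> fbasis ==> rs v q \<bullet> u = 0"
 shows "vdot v u = 0"
proof (rule euclidean_eqI)
 fix q :: quat assume q: "q \<in> Basis"
 show "vdot v u \<bullet> q = 0 \<bullet> q" using assms(3)[of q] F_inner_Basis[OF vdot_F[OF assms(2,1)], of q] q
  by (cases "q \<in> \<F> \<beta>") (auto simp: fbasis_def inner_rs inner_commute[of q])
qed

text \<open>A real dimension count: the right multiples of r vectors by the \<beta> units span at
  most r\<beta> dimensions, fewer than m\<beta>.\<close>

lemma orthogonal_vector_exists:
 fixes v :: "nat => quat^'m"
 assumes "r < CARD('m)" "!!i. i < r ==> v i \<in> Vcs"
 obtains u where "u \<in> Vcs" "u ~= 0" "!!i. i < r ==> vdot (v i) u = 0"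
proof -
 let ?C = "(%(i, q). rs (v i) q) ` ({..<r} \<times> fbasis)"
 have fin: "finite ?C" by (simp add: finite_fbasis)
 have sub: "?C \<subseteq> Vcs" using assms(2) by (auto simp: fbasis_def intro!: rs_vecs)
 have "dim ?C <= card ?C" using dim_le_card'[OF fin] .
 also have "... <= r * \<beta>"
  using card_image_le[of "{..<r} \<times> fbasis"] by (simp add: card_cartesian_product card_fbasis finite_fbasis)
 also have "... < dim (Vcs :: (quat^'m) set)" using assms(1) beta_pos by (simp add: dim_vecs)
 finally have "span ?C ~= span Vcs" by (metis dim_span less_irrefl)
 then have "span ?C \<subset> span Vcs" using span_mono[OF sub] by blast
 then obtain u where u: "u ~= 0" "u \<in> span Vcs" "!!y. y \<in> span ?C ==> orthogonal u y"
  using orthogonal_to_subspace_exists_gen by metis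
 have uv: "u \<in> Vcs" using u(2) subspace_vecs span_eq_iff by blast
 have "vdot (v i) u = 0" if "i < r" for i
 proof (rule vdot_eq_0[OF uv assms(2)[OF that]])
  fix q assume "q \<in> fbasis"
  then have "rs (v i) q \<in> span ?C" using that by (intro span_base) auto
  then show "rs (v i) q \<bullet> u = 0" using u(3)[of "rs (v i) q"] by (simp add: orthogonal_def inner_commute)
 qed
 then show ?thesis using that uv u(1) by blast
qed

text \<open>A maximizer of the Rayleigh quotient on the unit sphere of \<open>S\<close> is an
  eigenvector: the form \<open>Q\<close> is nonnegative on \<open>S\<close> and vanishes there, so
  its first variation vanishes too.\<close>

lemma eigenvector_exists:
 fixes X :: "quat^'m^'m"
 assumes X: "X \<in> Hrm" and S: "subspace S" "S ~= {0}" and inv: "!!v. v \<in> S ==> X *v v \<in> S"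
 obtains v l where "v \<in> S" "norm v = 1" "X *v v = l *\<^sub>R v"
proof -
 have symm: "u \<bullet> (X *v w) = w \<bullet> (X *v u)" for u w
  using inner_adj[of u X w] herm_adj[OF X] by (simp add: inner_commute)
 let ?K = "sphere 0 1 \<inter> S"
 obtain w where w: "w \<in> S" "w ~= 0" using S subspace_0 by blast
 have cK: "compact ?K" using closed_subspace[OF S(1)] by (intro compact_Int_closed) auto
 have "w /\<^sub>R norm w \<in> ?K" using w S(1) by (auto simp: subspace_scale)
 then have neK: "?K ~= {}" by blast
 have cont: "continuous_on ?K (%v. v \<bullet> (X *v v))"
  by (intro continuous_intros linear_continuous_on linear_conv_bounded_linear[THEN iffD1]) auto
 obtain v where v: "v \<in> ?K" and max: "!!u. u \<in> ?K ==> u \<bullet> (X *v u) <= v \<bullet> (X *v v)"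
  using continuous_attains_sup[OF cK neK cont] by blast
 define l where "l = v \<bullet> (X *v v)"
 define Q where "Q u = l * (u \<bullet> u) - u \<bullet> (X *v u)" for u
 have Q: "0 <= Q u" if u: "u \<in> S" for u
 proof (cases "u = 0")
  case False
  then have "u /\<^sub>R norm u \<in> ?K" using u S(1) by (auto simp: subspace_scale)
  from max[OF this] have "(u \<bullet> (X *v u)) / (norm u)\<^sup>2 <= l"
   by (simp add: l_def matrix_vector_scaleR power2_eq_square field_simps)
  then show ?thesis using False by (simp add: Q_def field_simps power2_norm_eq_inner)
 qed (simp add: Q_def)
 have v1: "v \<bullet> v = 1" "v \<in> S" "norm v = 1" using v by (auto simp: power2_norm_eq_inner[symmetric])
 have crit: "w \<bullet> (l *\<^sub>R v - X *v v) = 0" if wS: "w \<in> S" for w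
 proof -
  define a where "a = w \<bullet> (l *\<^sub>R v - X *v v)"
  have "Q (v + t *\<^sub>R w) = 2 * t * a + t\<^sup>2 * Q w" for t using symm[of w v] v1
   by (simp add: Q_def a_def matrix_vector_right_distrib matrix_vector_scaleR inner_add_left
     inner_add_right inner_diff_right l_def inner_commute algebra_simps power2_eq_square)
  then have *: "0 <= 2 * t * a + t\<^sup>2 * Q w" for t
   using Q[of "v + t *\<^sub>R w"] wS v1(2) S(1) by (simp add: subspace_add subspace_scale)
  show ?thesis
  proof (rule ccontr)
   assume "w \<bullet> (l *\<^sub>R v - X *v v) ~= 0"
   then have a: "a ~= 0" by (simp add: a_def)
   have Qw: "0 <= Q w" using Q wS by blast
   \<comment> \<open>Close to the minimizer of the quadratic in t; adding 1 to \<open>Q w\<close>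
     avoids a zero denominator and still makes the value negative.\<close>
   define t where "t = - a / (Q w + 1)"
   have "2 * t * a + t\<^sup>2 * Q w = - (a\<^sup>2 / (Q w + 1)) * (2 - Q w / (Q w + 1))"
    by (simp add: t_def power2_eq_square algebra_simps)
   moreover have "Q w / (Q w + 1) < 2" using Qw by (simp add: field_simps)
   moreover have "a\<^sup>2 / (Q w + 1) > 0" using a Qw by (intro divide_pos_pos) auto
   ultimately have "2 * t * a + t\<^sup>2 * Q w < 0"
    by (metis diff_gt_0_iff_gt mult_minus_left mult_pos_pos neg_less_0_iff_less)
   then show False using *[of t] by simp
  qed
 qed
 have "l *\<^sub>R v - X *v v \<in> S" using v1(2) inv S(1) by (simp add: subspace_diff subspace_scale)
 then have "l *\<^sub>R v - X *v v = 0" using crit inner_eq_zero_iff by blast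
 then have "X *v v = l *\<^sub>R v" by simp
 then show ?thesis by (rule that[OF v1(2,3)])
qed

text \<open>The vectors orthogonal to the eigenvectors found so far form an invariant real subspace,
  so the orthonormal system can be extended one vector at a time.\<close>

theorem spectral:
 fixes X :: "quat^'m^'m"
 assumes X: "X \<in> Hrm"
 obtains U :: "quat^'m^'m" and x where "U \<in> Stf" "X = U**dg x**adj U"
proof -
 have "\<exists>v l. \<forall>i<r. v i \<in> Vcs \<and> X *v v i = l i *\<^sub>R v i \<and>
   (\<forall>j<r. vdot (v i) (v j) = (if i = j then 1 else 0))" if "r <= CARD('m)" for r using that
 proof (induction r)
  case 0
  then show ?case by simp
 next
  case (Suc r)
  then obtain v l where vl: "!!i. i < r ==> v i \<in> Vcs \<and> X *v v i = l i *\<^sub>R v i"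
   "!!i j. i < r ==> j < r ==> vdot (v i) (v j) = (if i = j then 1 else 0)" by auto
  let ?S = "{u \<in> Vcs. \<forall>i<r. vdot (v i) u = 0}"
  have S: "subspace ?S" using subspace_vecs by (auto simp: subspace_def vdot_simps)
  obtain u0 where "u0 \<in> Vcs" "u0 ~= 0" "!!i. i < r ==> vdot (v i) u0 = 0"
   using orthogonal_vector_exists[of r v] Suc.prems vl(1) by (metis Suc_le_eq)
  then have ne: "?S ~= {0}" by auto
  have inv: "X *v u \<in> ?S" if "u \<in> ?S" for u
  proof -
   have "vdot (v i) (X *v u) = 0" if "i < r" for i
    unfolding vdot_adj herm_adj[OF X] using vl(1)[OF that] \<open>u \<in> ?S\<close> that by (simp add: vdot_simps)
   then show ?thesis using that X by (simp add: mats_vecs herm_mats)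
  qed
  obtain u m where u: "u \<in> ?S" "norm u = 1" "X *v u = m *\<^sub>R u" by (rule eigenvector_exists[OF X S ne inv])
  have "vdot u u = 1" using u(2) by (simp add: vdot_self norm_eq_1)
  moreover have "vdot u (v i) = 0" if "i < r" for i using u(1) that vdot_cnj[of "v i" u] by auto
  ultimately show ?case using vl u
   by (intro exI[of _ "v(r := u)"] exI[of _ "l(r := m)"]) (auto simp: less_Suc_eq)
 qed
 from this[OF order_refl] obtain v l where
  vl: "!!i. i < CARD('m) ==> v i \<in> Vcs \<and> X *v v i = l i *\<^sub>R v i"
   "!!i j. i < CARD('m) ==> j < CARD('m) ==> vdot (v i) (v j) = (if i = j then 1 else 0)" by auto
 define U :: "quat^'m^'m" where "U = (\<chi> i j. v (idx j)$i)"
 define x where "x a = l (idx a)" for a :: 'm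
 have "adj U**U = mat 1"
  using vl(2) by (simp add: vec_eq_iff matrix_matrix_mult_def U_def mat_def vdot_def[symmetric])
 moreover have "U \<in> Mts" using vl(1) by (auto simp: U_def mats_def vecs_def)
 ultimately have U: "U \<in> Stf" by (simp add: stiefel_def)
 have "(X**U)$i$j = (X *v v (idx j))$i" for i j
  by (simp add: matrix_matrix_mult_def matrix_vector_mult_def U_def)
 then have XU: "X**U = U**dg x" using vl(1) by (simp add: vec_eq_iff dg_mult_nth) (simp add: U_def x_def)
 have "X**U**adj U = X" by (simp only: matrix_mul_assoc[symmetric] unitaryD[OF U] matrix_mul_rid)
 then have "X = U**dg x**adj U" by (simp only: XU)
 then show ?thesis by (rule that[OF U])
qed

section \<open>Eigenvalues with multiplicities\<close>

lemma mset_eigvals_dims: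
 fixes X :: "quat^'m^'m"
 assumes "finite {l. eigspace \<beta> X l ~= {0}}"
 shows "count (mset (spec X)) l = dim (eigspace \<beta> X l) div \<beta>"
proof -
 let ?L = "{l. eigspace \<beta> X l ~= {0}}"
 have "count (mset (spec X)) l = (\<Sum>k\<in>?L. if l = k then dim (eigspace \<beta> X k) div \<beta> else 0)"
  unfolding eigvals_def mset_sorted_list_of_multiset count_sum count_replicate_mset
  by (rule sum.cong) simp_all
 \<comment> \<open>Over an infinite index set the sum in \<open>eigvals\<close> would default to the
   empty multiset, so finiteness enters here.\<close>
 also have "... = (if l \<in> ?L then dim (eigspace \<beta> X l) div \<beta> else 0)" using assms by (rule sum.delta')
 also have "... = dim (eigspace \<beta> X l) div \<beta>"
 proof (cases "eigspace \<beta> X l = {0}")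
  case True
  then show ?thesis unfolding True by simp
 qed simp
 finally show ?thesis .
qed

lemma unitary_inj: "U \<in> Stf ==> inj ((*v) U)"
 by (rule inj_on_inverseI[where g="(*v) (adj U)"]) (simp add: matrix_vector_mul_assoc stiefelD)

lemma dim_unitary_image:
 fixes U :: "quat^'n^'m"
 assumes "U \<in> Stf"
 shows "dim ((*v) U ` S) = dim S" by (rule dim_image_eq) (auto intro: inj_on_subset unitary_inj[OF assms])

lemma eigspace_unitary:
 fixes U :: "quat^'m^'m"
 assumes U: "U \<in> Stf"
 shows "eigspace \<beta> (U**dg x**adj U) l = (*v) U ` {w \<in> Vcs. \<forall>i. i \<notin> {i. x i = l} --> w$i = 0}"
  (is "?E = ?R")
proof
 show "?E \<subseteq> ?R"
 proof
  fix v assume "v \<in> ?E"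
  then have v: "v \<in> Vcs" "(U**dg x**adj U) *v v = l *\<^sub>R v" by (auto simp: eigspace_def)
  define w where "w = adj U *v v"
  have "adj U *v ((U**dg x**adj U) *v v) = l *\<^sub>R w" by (simp add: v(2) matrix_vector_scaleR w_def)
  then have "dg x *v w = l *\<^sub>R w"
   using stiefelD[OF U] by (simp add: w_def matrix_vector_mul_assoc matrix_mul_assoc)
  then have eq: "x i *\<^sub>R w$i = l *\<^sub>R w$i" for i by (metis dg_vec vector_scaleR_component)
  have "w$i = 0" if "x i ~= l" for i using eq[of i] that by simp
  moreover have "w \<in> Vcs" using v(1) U by (simp add: w_def mats_vecs stiefel_mats)
  moreover have "v = U *v w" using unitaryD[OF U] by (simp add: w_def matrix_vector_mul_assoc)
  ultimately show "v \<in> ?R" by auto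
 qed
 show "?R \<subseteq> ?E"
 proof
  fix v assume "v \<in> ?R"
  then obtain w where w: "v = U *v w" "w \<in> Vcs" "!!i. x i ~= l ==> w$i = 0" by auto
  have "dg x *v w = l *\<^sub>R w"
   unfolding vec_eq_iff dg_vec vector_scaleR_component using w(3) by (metis scaleR_zero_right)
  moreover have "(U**dg x**adj U) *v v = U *v (dg x *v ((adj U**U) *v w))"
   by (simp add: w(1) matrix_vector_mul_assoc matrix_mul_assoc)
  ultimately show "v \<in> ?E"
   using w U by (simp add: eigspace_def mats_vecs stiefel_mats stiefelD matrix_vector_scaleR)
 qed
qed

lemma dim_eigspace_unitary:
 fixes U :: "quat^'m^'m"
 assumes "U \<in> Stf"
 shows "dim (eigspace \<beta> (U**dg x**adj U) l) = card {i. x i = l} * \<beta>"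
 unfolding eigspace_unitary[OF assms] dim_unitary_image[OF assms] by (rule dim_vecs_supp)

lemma eigspace_0: "eigspace \<beta> X l = {0} \<longleftrightarrow> dim (eigspace \<beta> X l) = 0"
proof -
 have "0 \<in> eigspace \<beta> X l" by (simp add: eigspace_def vecs_def)
 then show ?thesis unfolding dim_eq_0 by blast
qed

lemma finite_eigs_unitary:
 fixes U :: "quat^'m^'m"
 assumes "U \<in> Stf"
 shows "finite {l. eigspace \<beta> (U**dg x**adj U) l ~= {0}}"
proof (rule finite_subset)
 show "{l. eigspace \<beta> (U**dg x**adj U) l ~= {0}} \<subseteq> range x"
 proof
  fix l assume "l \<in> {l. eigspace \<beta> (U**dg x**adj U) l ~= {0}}"
  then have "card {i. x i = l} ~= 0" unfolding eigspace_0 dim_eigspace_unitary[OF assms] mem_Collect_eq by simp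
  then have "{i. x i = l} ~= {}" using card.empty by metis
  then show "l \<in> range x" by auto
 qed
qed simp

lemma mset_eigvals:
 fixes U :: "quat^'m^'m"
 assumes "U \<in> Stf"
 shows "mset (spec (U**dg x**adj U)) = image_mset x (mset_set UNIV)"
proof (rule multiset_eqI)
 fix l
 have "count (image_mset x (mset_set UNIV)) l = card {i. x i = l}" by (simp add: count_image_mset vimage_def)
 then show "count (mset (spec (U**dg x**adj U))) l = count (image_mset x (mset_set UNIV)) l"
  using beta_pos by (simp add: mset_eigvals_dims[OF finite_eigs_unitary[OF assms]] dim_eigspace_unitary[OF assms])
qed

lemma finite_eigs:
 fixes X :: "quat^'m^'m"
 assumes "X \<in> Hrm"
 shows "finite {l. eigspace \<beta> X l ~= {0}}"
proof -
 obtain U :: "quat^'m^'m" and x where U: "U \<in> Stf" and X: "X = U**dg x**adj U" by (rule spectral[OF assms])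
 show ?thesis unfolding X by (rule finite_eigs_unitary[OF U])
qed

lemma length_eigvals:
 fixes X :: "quat^'m^'m"
 assumes "X \<in> Hrm"
 shows "length (spec X) = CARD('m)"
proof -
 obtain U :: "quat^'m^'m" and x where U: "U \<in> Stf" and X: "X = U**dg x**adj U" by (rule spectral[OF assms])
 show ?thesis using arg_cong[OF mset_eigvals[OF U, of x], of size] unfolding X by simp
qed

lemma eigvals_cong: "mset (spec X) = mset (spec Y) ==> spec X = spec Y" unfolding eigvals_def by simp

lemma eigvals_conj:
 fixes X U :: "quat^'m^'m"
 assumes "X \<in> Hrm" and U: "U \<in> Stf"
 shows "spec (U**X**adj U) = spec X"
proof -
 obtain V :: "quat^'m^'m" and x where V: "V \<in> Stf" and X: "X = V**dg x**adj V" by (rule spectral[OF assms(1)])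
 have eq: "U**X**adj U = (U**V)**dg x**adj (U**V)" by (simp add: X adj_mult matrix_mul_assoc)
 show ?thesis
  unfolding eq by (rule eigvals_cong) (simp only: X mset_eigvals[OF unitary_mult[OF U V]] mset_eigvals[OF V])
qed

text \<open>\<open>H\<close> is an isometry that carries the eigenspaces of \<open>B\<close> for
  nonzero eigenvalues onto those of the conjugate; the number of zeros follows by counting.\<close>

lemma eigvals_stiefel_conj:
 fixes B :: "quat^'n^'n" and H :: "quat^'n^'m"
 assumes B: "B \<in> Hrm" and H: "H \<in> Stf"
 shows "mset (spec (H**B**adj H)) =
  mset (spec B) + replicate_mset (CARD('m) - CARD('n)) 0"
proof -
 let ?M = "H**B**adj H"
 have M: "?M \<in> Hrm" using B H by (simp add: stiefel_mats)
 have HH: "adj H**H = mat 1" using H by (simp add: stiefelD)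
 have E: "eigspace \<beta> ?M l = (*v) H ` eigspace \<beta> B l" if "l ~= 0" for l
 proof (intro equalityI subsetI)
  fix v assume "v \<in> eigspace \<beta> ?M l"
  then have v: "v \<in> Vcs" "?M *v v = l *\<^sub>R v" by (auto simp: eigspace_def)
  define w where "w = adj H *v v"
  have "adj H *v (?M *v v) = l *\<^sub>R w" by (simp add: v(2) matrix_vector_scaleR w_def)
  then have "B *v w = l *\<^sub>R w" using HH by (simp add: w_def matrix_vector_mul_assoc matrix_mul_assoc)
  moreover have "w \<in> Vcs" using v(1) H by (simp add: w_def mats_vecs stiefel_mats)
  ultimately have "w \<in> eigspace \<beta> B l" by (simp add: eigspace_def)
  moreover have "v = H *v w"
  proof -
   have "l *\<^sub>R v = H *v (B *v w)" using v(2) by (simp add: w_def matrix_vector_mul_assoc matrix_mul_assoc)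
   also have "... = l *\<^sub>R (H *v w)" using \<open>B *v w = _\<close> by (simp add: matrix_vector_scaleR)
   finally show ?thesis using that by simp
  qed
  ultimately show "v \<in> (*v) H ` eigspace \<beta> B l" by blast
 next
  fix v assume "v \<in> (*v) H ` eigspace \<beta> B l"
  then obtain w where w: "v = H *v w" "w \<in> Vcs" "B *v w = l *\<^sub>R w" by (auto simp: eigspace_def)
  have "?M *v v = H *v (B *v ((adj H**H) *v w))" by (simp add: w(1) matrix_vector_mul_assoc matrix_mul_assoc)
  then show "v \<in> eigspace \<beta> ?M l"
   using w H by (simp add: eigspace_def mats_vecs stiefel_mats HH matrix_vector_scaleR)
 qed
 have c: "count (mset (spec ?M)) l = count (mset (spec B)) l" if "l ~= 0" for l
  by (simp add: mset_eigvals_dims finite_eigs M B E[OF that] dim_unitary_image[OF H])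
 have filt: "filter_mset (%l. l ~= 0) (mset (spec ?M)) = filter_mset (%l. l ~= 0) (mset (spec B))"
  by (rule multiset_eqI) (simp add: c)
 have zero: "size N = size (filter_mset (%l. l ~= 0) N) + count N 0" for N :: "real multiset"
  using multiset_partition[of N "%l. l ~= 0"]
  by (metis (mono_tags, lifting) filter_eq_replicate_mset filter_mset_cong not_not size_replicate_mset size_union)
 have "CARD('m) = size (filter_mset (%l. l ~= 0) (mset (spec B))) + count (mset (spec ?M)) 0"
  using zero[of "mset (spec ?M)"] length_eigvals[OF M] filt by simp
 moreover have "CARD('n) = size (filter_mset (%l. l ~= 0) (mset (spec B))) + count (mset (spec B)) 0"
  using zero[of "mset (spec B)"] length_eigvals[OF B] by simp
 \<comment> \<open>This inequality also forces n \<le> m, without which the truncated difference in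
   the conclusion would be wrong.\<close>
 moreover have "count (mset (spec B)) 0 <= count (mset (spec ?M)) 0"
 proof -
  have "(*v) H ` eigspace \<beta> B 0 \<subseteq> eigspace \<beta> ?M 0"
  proof
   fix v assume "v \<in> (*v) H ` eigspace \<beta> B 0"
   then obtain w where w: "v = H *v w" "w \<in> Vcs" "B *v w = 0" by (auto simp: eigspace_def)
   have "?M *v v = H *v (B *v ((adj H**H) *v w))"
    by (simp add: w(1) matrix_vector_mul_assoc matrix_mul_assoc)
   then show "v \<in> eigspace \<beta> ?M 0" using w H by (simp add: eigspace_def mats_vecs stiefel_mats HH)
  qed
  then have "dim (eigspace \<beta> B 0) <= dim (eigspace \<beta> ?M 0)" using dim_subset dim_unitary_image[OF H] by metis
  then show ?thesis by (simp add: mset_eigvals_dims finite_eigs M B div_le_mono)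
 qed
 ultimately show ?thesis by (intro multiset_eqI) (auto simp: c)
qed

end

section \<open>Homogeneous polynomial functions\<close>

text \<open>A class of functions rather than a type of polynomials: closure properties are
  introduction rules, and scaling, restriction to lines, second-order expansion and expansion in
  words are each one induction.\<close>

inductive hp :: "nat => ('a::euclidean_space => real) => bool" where
 hp_const: "hp 0 (%_. c)"
| hp_inner: "hp 1 (%X. X \<bullet> b)"
| hp_add: "hp k F ==> hp k G ==> hp k (%X. F X + G X)"
| hp_mult: "hp i F ==> hp j G ==> hp (i + j) (%X. F X * G X)"

lemma hp_cmult: "hp k F ==> hp k (%X. c * F X)" using hp_mult[OF hp_const] by fastforce

lemma hp_power1: "hp k (%X. (X \<bullet> b) ^ k)" by (induction k) (use hp_const[of 1] hp_mult[OF hp_inner] in \<open>auto\<close>)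

lemma hp_zero: "hp k (%_. 0)" using hp_cmult[OF hp_power1[of k 0], of 0] by simp

lemma hp_sum: "(!!a. a \<in> A ==> hp k (F a)) ==> hp k (%X. \<Sum>a\<in>A. F a X)"
 by (induction A rule: infinite_finite_induct) (auto intro: hp_zero hp_add)

lemma hp_prod: "finite A ==> (!!a. a \<in> A ==> hp (k a) (F a)) ==> hp (sum k A) (%X. \<Prod>a\<in>A. F a X)"
 by (induction A rule: finite_induct) (auto intro: hp_const hp_mult)

lemma hp_power: "hp k F ==> hp (k * n) (%X. F X ^ n)" by (induction n) (auto intro: hp_const hp_mult)

lemma hp_linear:
 assumes "linear f"
 shows "hp 1 f"
proof -
 have "f X = (\<Sum>b\<in>Basis. f b * (X \<bullet> b))" for X using linear_sum[OF assms, of "%b. (X \<bullet> b) *\<^sub>R b" Basis]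
  by (simp add: linear_cmul[OF assms] euclidean_representation mult.commute)
 then have eq: "f = (%X. \<Sum>b\<in>Basis. f b * (X \<bullet> b))" by blast
 have "hp 1 (%X. \<Sum>b\<in>Basis. f b * (X \<bullet> b))" by (intro hp_sum hp_cmult hp_inner)
 then show ?thesis by (simp only: eq[symmetric])
qed

lemma hp_comp_linear: "hp k F ==> linear l ==> hp k (%X. F (l X))"
proof (induction rule: hp.induct)
 case (hp_inner b)
 have "linear (%X. l X \<bullet> b)"
  using linear_compose[OF hp_inner bounded_linear.linear[OF bounded_linear_inner_left]] by (simp add: o_def)
 then show ?case by (rule hp_linear)
qed (auto intro: hp.intros)

lemma hp_rpf: "hp k F ==> real_polynomial_function F" by (induction rule: hp.induct)
  (simp_all add: real_polynomial_function.intros(2-4) real_polynomial_function.intros(1)[OF bounded_linear_inner_left])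

lemma hp_continuous: "hp k F ==> continuous_on S F"
 by (induction rule: hp.induct) (auto intro!: continuous_intros)

lemma hp_scale: "hp k F ==> F (c *\<^sub>R X) = c ^ k * F X"
 by (induction rule: hp.induct) (auto simp: algebra_simps power_add)

lemma hp_line: "hp k F ==> \<exists>p. degree p <= k \<and> (\<forall>t. F (X + t *\<^sub>R Y) = poly p t)"
proof (induction rule: hp.induct)
 case (hp_const c)
 then show ?case by (intro exI[of _ "[:c:]"]) auto
next
 case (hp_inner b)
 then show ?case by (intro exI[of _ "[:X \<bullet> b, Y \<bullet> b:]"]) (auto simp: inner_add_left)
next
 case (hp_add k F G)
 then obtain p q where "degree p <= k \<and> (\<forall>t. F (X + t *\<^sub>R Y) = poly p t)"
  "degree q <= k \<and> (\<forall>t. G (X + t *\<^sub>R Y) = poly q t)" by blast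
 then show ?case by (intro exI[of _ "p + q"]) (auto intro: degree_add_le)
next
 case (hp_mult i F j G)
 then obtain p q where "degree p <= i \<and> (\<forall>t. F (X + t *\<^sub>R Y) = poly p t)"
  "degree q <= j \<and> (\<forall>t. G (X + t *\<^sub>R Y) = poly q t)" by blast
 then show ?case using degree_mult_le[of p q] by (intro exI[of _ "p * q"]) auto
qed

lemma poly_eq_eventually:
 fixes p q :: "real poly"
 assumes "!!t. t > C ==> poly p t = poly q t"
 shows "p = q"
proof (rule ccontr)
 assume "p ~= q"
 then have "finite {t. poly (p - q) t = 0}" by (intro poly_roots_finite) simp
 moreover have "{C<..} \<subseteq> {t. poly (p - q) t = 0}" using assms by auto
 ultimately show False using infinite_Ioi finite_subset by blast
qed

text \<open>With \<open>D = mat 1\<close> a large shift makes a Hermitian matrix positive definite.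
  An identity known there extends because both sides are polynomials in the shift.\<close>

lemma hp_eq_shift:
 assumes "hp k F" "hp l G" "!!c. c > C ==> F (Y + c *\<^sub>R D) = G (Y + c *\<^sub>R D)"
 shows "F Y = G Y"
proof -
 obtain p q where p: "!!t. F (Y + t *\<^sub>R D) = poly p t" and q: "!!t. G (Y + t *\<^sub>R D) = poly q t"
  using hp_line[OF assms(1)] hp_line[OF assms(2)] by blast
 have "p = q" by (rule poly_eq_eventually[of C]) (metis assms(3) p q)
 then show ?thesis using p[of 0] q[of 0] by simp
qed

section \<open>Elementary symmetric functions of the eigenvalues\<close>

fun esym :: "nat => real list => real" where
 "esym j [] = (if j = 0 then 1 else 0)"
| "esym 0 (x # xs) = 1"
| "esym (Suc j) (x # xs) = esym (Suc j) xs + x * esym j xs"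

definition psum :: "nat => real list => real"
 where "psum i xs = (\<Sum>x\<leftarrow>xs. x ^ i)"

lemma esym_0 [simp]: "esym 0 xs = 1" by (cases xs) auto

lemma esym_gt: "j > length xs ==> esym j xs = 0" by (induction j xs rule: esym.induct) auto

lemma esym_length: "esym (length xs) xs = prod_list xs" by (induction xs) (auto simp: esym_gt)

lemma prod_list_esym: "(\<Prod>x\<leftarrow>xs. 1 + t * x) = (\<Sum>j\<le>length xs. t ^ j * esym j xs)"
proof (induction xs)
 case (Cons x xs)
 let ?n = "length xs"
 have "(\<Sum>j\<le>Suc ?n. t ^ j * esym j (x # xs)) = 1 + (\<Sum>j\<le>?n. t ^ Suc j * esym (Suc j) (x # xs))"
  by (subst sum.atMost_Suc_shift) simp
 also have "... = (1 + (\<Sum>j\<le>?n. t ^ Suc j * esym (Suc j) xs)) + t * x * (\<Sum>j\<le>?n. t ^ j * esym j xs)"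
  by (simp add: algebra_simps sum.distrib sum_distrib_left)
 also have "1 + (\<Sum>j\<le>?n. t ^ Suc j * esym (Suc j) xs) = (\<Sum>j\<le>Suc ?n. t ^ j * esym j xs)"
  by (subst sum.atMost_Suc_shift) simp
 also have "... = (\<Sum>j\<le>?n. t ^ j * esym j xs)" by (simp add: esym_gt)
 finally show ?case using Cons by (simp add: algebra_simps)
qed simp

text \<open>Compare coefficients in E' = E S, where E is the product of the factors 1 + xX and S,
  the sum of x / (1 + xX), is its logarithmic derivative.\<close>

lemma newton: "real (Suc j) * esym (Suc j) xs = (\<Sum>i\<le>j. (-1) ^ i * psum (Suc i) xs * esym (j - i) xs)"
proof -
 define E where "E xs = Abs_fps (%j. esym j xs)" for xs
 define S where "S xs = Abs_fps (%i. (-1) ^ i * psum (Suc i) xs)" for xs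
 define s where "s x = Abs_fps (%i. (-1) ^ i * x ^ Suc i)" for x :: real
 have EC: "E (x # xs) = (1 + fps_const x * fps_X) * E xs" for x xs
 proof (rule fps_ext)
  fix n show "fps_nth (E (x # xs)) n = fps_nth ((1 + fps_const x * fps_X) * E xs) n"
   by (cases n) (simp_all add: E_def distrib_right mult.assoc)
 qed
 have s: "(1 + fps_const x * fps_X) * s x = fps_const x" for x
 proof (rule fps_ext)
  fix n show "fps_nth ((1 + fps_const x * fps_X) * s x) n = fps_nth (fps_const x) n"
   by (cases n) (simp_all add: s_def distrib_right mult.assoc)
 qed
 have S: "S (x # xs) = S xs + s x" for x xs by (rule fps_ext) (simp add: S_def s_def psum_def algebra_simps)
 have D: "fps_deriv (E xs) = E xs * S xs" for xs
 proof (induction xs)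
  case Nil
  have "E [] = 1" by (rule fps_ext) (simp add: E_def)
  moreover have "S [] = 0" by (rule fps_ext) (simp add: S_def psum_def)
  ultimately show ?case by simp
 next
  case (Cons x xs)
  have "fps_deriv (E (x # xs)) = fps_const x * E xs + (1 + fps_const x * fps_X) * (E xs * S xs)"
   by (simp add: EC Cons algebra_simps)
  also have "... = ((1 + fps_const x * fps_X) * s x) * E xs + (1 + fps_const x * fps_X) * (E xs * S xs)"
   by (simp only: s)
  also have "... = E (x # xs) * S (x # xs)" by (simp add: EC S algebra_simps)
  finally show ?case .
 qed
 have "fps_nth (fps_deriv (E xs)) j = fps_nth (S xs * E xs) j" by (simp add: D mult.commute)
 then show ?thesis by (simp add: E_def S_def fps_mult_nth atMost_atLeast0)
qed

section \<open>Elementary symmetric functions from traces of powers\<close>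

fun mpow :: "quat^'m^'m => nat => quat^'m^'m" where
 "mpow X 0 = mat 1"
| "mpow X (Suc i) = X**mpow X i"

lemma mpow_commute: "mpow X i**X = X**mpow X i" by (induction i) (simp_all add: matrix_mul_assoc[symmetric])

lemma mpow_swap: "mpow (A**B) (Suc i) = A**mpow (B**A) i**B" for A B :: "quat^'m^'m"
proof (induction i)
 case (Suc i)
 have "mpow (A**B) (Suc (Suc i)) = (A**B)**(A**mpow (B**A) i**B)" using Suc by simp
 then show ?case by (simp add: matrix_mul_assoc)
qed simp

lemma rtr_mpow_swap: "rtr (mpow (A**B) (Suc i)) = rtr (mpow (B**A) (Suc i))"  for A B :: "quat^'m^'m"
proof -
 have "rtr (mpow (A**B) (Suc i)) = rtr (A**(mpow (B**A) i**B))" by (simp only: mpow_swap matrix_mul_assoc)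
 also have "... = rtr (mpow (B**A) i**(B**A))" by (subst rtr_commute) (simp add: matrix_mul_assoc)
 finally show ?thesis by (simp add: mpow_commute)
qed

text \<open>Newton's identities taken as the definition: traces of powers are polynomial in the
  entries over all three kinds of scalars.\<close>

fun Esym :: "nat => quat^'m^'m => real" where
 "Esym 0 X = 1"
| "Esym (Suc j) X = (\<Sum>i\<le>j. (-1) ^ i * rtr (mpow X (Suc i)) * Esym (j - i) X) / real (Suc j)"

lemma Esym_swap: "Esym j (A**B) = Esym j (B**A)" for A B :: "quat^'m^'m"
proof (induction j rule: less_induct)
 case (less j)
 show ?case
 proof (cases j)
  case (Suc i)
  then show ?thesis unfolding Suc Esym.simps rtr_mpow_swap[of A B] using less Suc
   by (intro arg_cong2[of _ _ _ _ "(/)"] sum.cong refl) auto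
 qed simp
qed

text \<open>Four real components, so that degrees can be counted through quaternion products before
  a trace is taken.\<close>

definition qhp :: "nat => ('a::euclidean_space => quat) => bool"
 where "qhp k f \<longleftrightarrow> hp k (%X. qRe (f X)) \<and> hp k (%X. qI (f X)) \<and> hp k (%X. qJ (f X)) \<and> hp k (%X. qK (f X))"

lemma qhp_add: "qhp k f ==> qhp k g ==> qhp k (%X. f X + g X)" by (auto simp: qhp_def plus_quat_def intro: hp_add)

lemma qhp_zero: "qhp k (%X. 0)" by (simp add: qhp_def zero_quat_def hp_zero)

lemma qhp_sum: "(!!a. a \<in> A ==> qhp k (f a)) ==> qhp k (%X. \<Sum>a\<in>A. f a X)"
 by (induction A rule: infinite_finite_induct) (simp_all add: qhp_add qhp_zero)

lemma hp_diff: "hp k F ==> hp k G ==> hp k (%X. F X - G X)" using hp_add[OF _ hp_cmult[of k G "-1"]] by fastforce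

lemma qhp_mult: "qhp i f ==> qhp j g ==> qhp (i + j) (%X. f X * g X)"
 unfolding qhp_def times_quat_def quat.sel by (intro conjI hp_add hp_diff hp_mult) auto

lemma qhp_const: "qhp 0 (%X. c)" by (simp add: qhp_def hp_const)

lemma qhp_linear:
 assumes "linear f"
 shows "qhp 1 f"
proof -
 have "linear (%x. qRe (f x))" "linear (%x. qI (f x))" "linear (%x. qJ (f x))" "linear (%x. qK (f x))"
  by (rule linearI; simp add: linear_add[OF assms] linear_cmul[OF assms] quat_simps)+
 then show ?thesis unfolding qhp_def by (intro conjI hp_linear)
qed

lemma linear_entry: "linear (%X::quat^'n^'m. X$a$b)" by (rule linearI) auto

lemma qhp_mpow: "qhp i (%X. mpow X i$a$b)"
proof (induction i arbitrary: a b)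
 case 0
 then show ?case by (simp add: qhp_const)
next
 case (Suc i)
 have "qhp (1 + i) (%X. \<Sum>k\<in>UNIV. X$a$k * mpow X i$k$b)" by (intro qhp_sum qhp_mult Suc qhp_linear linear_entry)
 then show ?case by (simp add: matrix_matrix_mult_def)
qed

lemma hp_rtr_mpow: "hp i (%X. rtr (mpow X i))"
 unfolding rtr_def using qhp_mpow by (intro hp_sum) (auto simp: qhp_def)

lemma hp_Esym: "hp j (Esym j :: quat^'m^'m => real)"
proof (induction j rule: less_induct)
 case (less j)
 show ?case
 proof (cases j)
  case 0
  then show ?thesis using hp_const[of 1] by (simp add: fun_eq_iff[symmetric] ext)
 next
  case (Suc n)
  have "hp (Suc n) (%X::quat^'m^'m. inverse (real (Suc n)) * (\<Sum>i\<le>n. (-1) ^ i * rtr (mpow X (Suc i)) * Esym (n - i) X))"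
  proof (intro hp_cmult hp_sum)
   fix i assume i: "i \<in> {..n}"
   have "hp (n - i) (Esym (n - i) :: quat^'m^'m => real)" using Suc by (intro less) simp
   from hp_mult[OF hp_cmult[OF hp_rtr_mpow, where c="(-1) ^ i"] this]
   have "hp (Suc i + (n - i)) (%X::quat^'m^'m. ((-1) ^ i * rtr (mpow X (Suc i))) * Esym (n - i) X)" .
   then show "hp (Suc n) (%X::quat^'m^'m. (-1) ^ i * rtr (mpow X (Suc i)) * Esym (n - i) X)" using i by simp
  qed
  moreover have "Esym j = (%X::quat^'m^'m. inverse (real (Suc n)) * (\<Sum>i\<le>n. (-1) ^ i * rtr (mpow X (Suc i)) * Esym (n - i) X))"
   unfolding Suc by (rule ext) (simp only: Esym.simps divide_inverse mult.commute)
  ultimately show ?thesis by (simp only: Suc)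
 qed
qed

section \<open>The determinant of a Hermitian matrix\<close>

definition qcomp :: "quat => 4 => real"
 where "qcomp q c = (if c = 1 then qRe q else if c = 2 then qI q else if c = 3 then qJ q else qK q)"

definition cvec :: "quat^'m => real^('m \<times> 4)"
 where "cvec v = (\<chi> p. qcomp (v$fst p) (snd p))"

definition qvec :: "real^('m \<times> 4) => quat^'m"
 where "qvec w = (\<chi> i. Quat (w$(i, 1)) (w$(i, 2)) (w$(i, 3)) (w$(i, 4)))"

lemma qvec_cvec [simp]: "qvec (cvec v) = v" by (simp add: qvec_def cvec_def vec_eq_iff qcomp_def)

lemma cvec_qvec [simp]: "cvec (qvec w) = w"
proof -
 have "qcomp (Quat (w$(i, 1)) (w$(i, 2)) (w$(i, 3)) (w$(i, 4))) c = w$(i, c)" for i and c :: 4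
  using exhaust_4[of c] by (auto simp: qcomp_def)
 then show ?thesis by (simp add: qvec_def cvec_def vec_eq_iff split_paired_all)
qed

lemma linear_cvec: "linear cvec" by (rule linearI) (simp_all add: cvec_def vec_eq_iff qcomp_def quat_simps)

lemma linear_qvec: "linear qvec" by (rule linearI) (simp_all add: qvec_def vec_eq_iff quat_simps)

text \<open>The determinant of X as a real operator on a space of dimension 4m, whatever \<beta> is.
  It is multiplicative, and for Hermitian X it is the fourth power of the product of the
  eigenvalues.\<close>

definition rdet :: "quat^'m^'m => real"
 where "rdet X = det (matrix (%w. cvec (X *v qvec w)))"

lemma rdet_mult: "rdet (A**B) = rdet A * rdet (B :: quat^'m^'m)"
proof -
 have lin: "linear (%w. cvec (X *v qvec w))" for X :: "quat^'m^'m"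
  using linear_compose[OF linear_qvec linear_compose[OF matrix_vector_mul_linear[of X] linear_cvec]]
  by (simp add: o_def)
 have "matrix (%w. cvec (A**B *v qvec w)) = matrix (%w. cvec (A *v qvec w))**matrix (%w. cvec (B *v qvec w))"
  by (subst matrix_compose[OF lin lin, symmetric]) (simp add: o_def matrix_vector_mul_assoc)
 then show ?thesis by (simp add: rdet_def det_mul)
qed

lemma rdet_dg: "rdet (dg x) = (\<Prod>a\<in>UNIV. x a) ^ 4"
proof -
 have eq: "cvec (dg x *v qvec w)$p = x (fst p) * w$p" for w p
 proof -
  have "cvec (dg x *v qvec w)$p = x (fst p) * cvec (qvec w)$p"
   by (simp add: cvec_def qcomp_def dg_vec quat_simps)
  then show ?thesis by simp
 qed
 have "rdet (dg x) = (\<Prod>p\<in>UNIV. matrix (%w. cvec (dg x *v qvec w))$p$p)"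
  unfolding rdet_def by (rule det_diagonal) (simp add: matrix_def eq axis_def)
 also have "... = (\<Prod>p\<in>(UNIV::('a \<times> 4) set). x (fst p))" by (simp add: matrix_def eq axis_def)
 also have "... = (\<Prod>a\<in>UNIV. \<Prod>c\<in>(UNIV::4 set). x a)"
  by (simp add: prod.cartesian_product UNIV_Times_UNIV[symmetric] split_def del: UNIV_Times_UNIV prod_constant)
 finally show ?thesis by (simp add: prod_power_distrib[symmetric])
qed

lemma linear_conj: "linear (%X. A**X**B)" for A :: "quat^'m^'n" and B :: "quat^'k^'l"
 by (rule linearI) (simp_all add: matrix_linear_simps)

text \<open>For Hermitian matrices the product of the eigenvalues (\<open>hdet_unitary\<close>),
  here as a polynomial in the entries.\<close>

definition hdet :: "quat^'m^'m => real"
 where "hdet X = Esym CARD('m) X"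

lemma hp_hdet: "hp CARD('m) (hdet :: quat^'m^'m => real)" using hp_Esym by (simp add: hdet_def[abs_def])

context fld
begin

lemma eigvals_eq:
 fixes U :: "quat^'m^'m"
 assumes "U \<in> Stf"
 shows "(\<Sum>y\<leftarrow>spec (U**dg x**adj U). f y) = (\<Sum>a\<in>UNIV. f (x a) :: real)"
  and "(\<Prod>y\<leftarrow>spec (U**dg x**adj U). f y) = (\<Prod>a\<in>UNIV. f (x a))"
  and "set (spec (U**dg x**adj U)) = range x"
proof -
 note m = mset_eigvals[OF assms, of x]
 have "(\<Sum>y\<leftarrow>spec (U**dg x**adj U). f y) = sum_mset (image_mset f (mset (spec (U**dg x**adj U))))"
  by (metis mset_map sum_mset_sum_list)
 then show "(\<Sum>y\<leftarrow>spec (U**dg x**adj U). f y) = (\<Sum>a\<in>UNIV. f (x a))"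
  unfolding m by (simp add: sum_unfold_sum_mset multiset.map_comp o_def)
 have "(\<Prod>y\<leftarrow>spec (U**dg x**adj U). f y) = prod_mset (image_mset f (mset (spec (U**dg x**adj U))))"
  by (metis mset_map prod_mset_prod_list)
 then show "(\<Prod>y\<leftarrow>spec (U**dg x**adj U). f y) = (\<Prod>a\<in>UNIV. f (x a))"
  unfolding m by (simp add: prod_unfold_prod_mset multiset.map_comp o_def)
 have "set (spec (U**dg x**adj U)) = set_mset (mset (spec (U**dg x**adj U)))" by simp
 then show "set (spec (U**dg x**adj U)) = range x" unfolding m by simp
qed

lemma conj_mult:
 fixes U :: "quat^'m^'m"
 assumes "U \<in> Stf"
 shows "(U**A**adj U)**(U**B**adj U) = U**(A**B)**adj U"
proof -
 have "(U**A**adj U)**(U**B**adj U) = U**A**(adj U**U)**B**adj U" by (simp add: matrix_mul_assoc)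
 then show ?thesis by (simp add: stiefelD[OF assms] matrix_mul_assoc)
qed

lemma conj_one: "U \<in> Stf ==> U**mat 1**adj U = mat 1" for U :: "quat^'m^'m" by (simp add: unitaryD)

lemma rtr_conj: "U \<in> Stf ==> rtr (U**A**adj U) = rtr A" for U :: "quat^'m^'m"
 by (subst rtr_commute) (simp add: matrix_mul_assoc stiefelD)

lemma mpow_conj: "U \<in> Stf ==> mpow (U**A**adj U) i = U**mpow A i**adj U" for U :: "quat^'m^'m"
 by (induction i) (simp_all add: unitaryD conj_mult)

lemma mpow_dg: "mpow (dg x) i = dg (%a. x a ^ i)" by (induction i) (simp_all add: dg_one dg_mult)

lemma rtr_mpow_eigvals:
 fixes X :: "quat^'m^'m"
 assumes "X \<in> Hrm"
 shows "rtr (mpow X i) = psum i (spec X)"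
proof -
 obtain U :: "quat^'m^'m" and x where U: "U \<in> Stf" and X: "X = U**dg x**adj U" by (rule spectral[OF assms])
 show ?thesis unfolding X psum_def eigvals_eq[OF U] mpow_conj[OF U] rtr_conj[OF U] mpow_dg by simp
qed

lemma Esym_eigvals:
 fixes X :: "quat^'m^'m"
 assumes X: "X \<in> Hrm"
 shows "Esym j X = esym j (spec X)"
proof (induction j rule: less_induct)
 case (less j)
 show ?case
 proof (cases j)
  case (Suc i)
  have "Esym j X = (\<Sum>k\<le>i. (-1) ^ k * psum (Suc k) (spec X) * esym (i - k) (spec X)) / real (Suc i)"
   unfolding Suc Esym.simps rtr_mpow_eigvals[OF X] using less Suc
   by (intro arg_cong2[of _ _ _ _ "(/)"] sum.cong refl) auto
  then show ?thesis unfolding newton[symmetric] by (simp add: Suc)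
 qed simp
qed

lemma hdet_unitary: "U \<in> Stf ==> hdet (U**dg x**adj U) = (\<Prod>a\<in>UNIV. x a)" for U :: "quat^'m^'m"
 using eigvals_eq(2)[of U "%y. y" x]
 by (simp add: hdet_def Esym_eigvals stiefel_mats esym_length[symmetric] length_eigvals)

lemma mat1_stiefel: "(mat 1 :: quat^'m^'m) \<in> Stf" by (simp add: stiefel_def)

lemma hdet_dg: "hdet (dg x) = (\<Prod>a\<in>UNIV. x a)" using hdet_unitary[OF mat1_stiefel, of x] by simp

lemma rdet_herm:
 fixes X :: "quat^'m^'m"
 assumes "X \<in> Hrm"
 shows "rdet X = hdet X ^ 4"
proof -
 obtain U :: "quat^'m^'m" and x where U: "U \<in> Stf" and X: "X = U**dg x**adj U" by (rule spectral[OF assms])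
 have "rdet (dg (%_. 1) :: quat^'m^'m) = 1" by (simp only: rdet_dg) simp
 then have "rdet U * rdet (adj U) = 1" unfolding rdet_mult[symmetric] unitaryD[OF U] by (simp only: dg_one)
 then show ?thesis unfolding X hdet_unitary[OF U] rdet_mult rdet_dg by (simp add: mult_ac)
qed

section \<open>Positive semidefinite matrices and multiplicativity of the determinant\<close>

definition psd :: "quat^'m^'m => bool"
 where "psd X \<longleftrightarrow> X \<in> Hrm \<and> (\<forall>v\<in>Vcs. 0 <= v \<bullet> (X *v v))"

lemma quad_form:
 fixes U :: "quat^'m^'m"
 shows "v \<bullet> ((U**dg x**adj U) *v v) = (\<Sum>a\<in>UNIV. x a * (norm ((adj U *v v)$a))\<^sup>2)"
proof -
 have "v \<bullet> ((U**dg x**adj U) *v v) = (adj U *v v) \<bullet> (dg x *v (adj U *v v))"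
  by (simp only: inner_adj[symmetric] matrix_vector_mul_assoc matrix_mul_assoc)
 then show ?thesis by (simp add: inner_vec_def dg_vec power2_norm_eq_inner)
qed

lemma axis_vecs: "axis a 1 \<in> Vcs" by (auto simp: vecs_def axis_def)

lemma quad_form_eigenvector:
 fixes U :: "quat^'m^'m"
 assumes "U \<in> Stf"
 shows "(U *v axis a 1) \<bullet> ((U**dg x**adj U) *v (U *v axis a 1)) = x a"
  and "(U *v axis a 1) \<bullet> (U *v axis a 1) = 1" and "U *v axis a 1 \<in> Vcs"
proof -
 have 1: "adj U *v (U *v axis a 1) = axis a 1" by (simp add: matrix_vector_mul_assoc stiefelD[OF assms])
 have "x b * (norm ((axis a 1 :: quat^'m)$b))\<^sup>2 = (if b = a then x a else 0)" for b by (simp add: axis_def)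
 then have "(\<Sum>b\<in>UNIV. x b * (norm ((axis a 1 :: quat^'m)$b))\<^sup>2) = (\<Sum>b\<in>UNIV. if b = a then x a else 0)"
  by (intro sum.cong) auto
 then have "(\<Sum>b\<in>UNIV. x b * (norm ((axis a 1 :: quat^'m)$b))\<^sup>2) = x a" by simp
 then show "(U *v axis a 1) \<bullet> ((U**dg x**adj U) *v (U *v axis a 1)) = x a" unfolding quad_form 1 .
 show "(U *v axis a 1) \<bullet> (U *v axis a 1) = 1" unfolding inner_adj 1 by (simp add: inner_axis_axis quat_simps)
 show "U *v axis a 1 \<in> Vcs" using assms by (intro mats_vecs axis_vecs stiefel_mats)
qed

lemma psd_unitary:
 fixes U :: "quat^'m^'m"
 assumes U: "U \<in> Stf"
 shows "psd (U**dg x**adj U) \<longleftrightarrow> (\<forall>a. 0 <= x a)"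
proof
 assume "psd (U**dg x**adj U)"
 then show "\<forall>a. 0 <= x a" using quad_form_eigenvector(1,3)[OF U] unfolding psd_def by metis
next
 assume "\<forall>a. 0 <= x a"
 then show "psd (U**dg x**adj U)" using U by (simp add: psd_def stiefel_mats quad_form sum_nonneg)
qed

lemma norm_unitary: "U \<in> Stf ==> norm (U *v v) = norm v" for U :: "quat^'n^'m"
 by (simp add: norm_eq_sqrt_inner inner_adj matrix_vector_mul_assoc stiefelD)

lemma posdef_unitary:
 fixes U :: "quat^'m^'m"
 assumes U: "U \<in> Stf"
 shows "pdef (U**dg x**adj U) \<longleftrightarrow> (\<forall>a. 0 < x a)"
proof
 assume p: "pdef (U**dg x**adj U)"
 have "U *v axis a 1 ~= 0" for a using quad_form_eigenvector(2)[OF U, of a] by auto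
 then show "\<forall>a. 0 < x a" using p quad_form_eigenvector(1,3)[OF U] unfolding posdef_def by metis
next
 assume x: "\<forall>a. 0 < x a"
 have "0 < v \<bullet> ((U**dg x**adj U) *v v)" if "v ~= 0" for v
 proof -
  have "norm (adj U *v v) ~= 0" using norm_unitary[OF unitary_adj[OF U]] that by simp
  then have "adj U *v v ~= 0" by auto
  then obtain a where "(adj U *v v)$a ~= 0" by (auto simp: vec_eq_iff)
  then have "0 < (\<Sum>a\<in>UNIV. x a * (norm ((adj U *v v)$a))\<^sup>2)"
   using x by (intro sum_pos2[of _ a]) (auto simp: less_imp_le)
  then show ?thesis unfolding quad_form .
 qed
 then show "pdef (U**dg x**adj U)" using U by (simp add: posdef_def stiefel_mats)
qed

lemma posdef_psd: "pdef X ==> psd X" unfolding posdef_def psd_def by (metis inner_zero_left order_le_less)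

lemma psd_herm: "psd X ==> X \<in> Hrm" and posdef_herm: "pdef X ==> X \<in> Hrm" by (auto simp: psd_def posdef_def)

lemma psd_add: "psd X ==> psd Y ==> psd (X + Y)"
 by (auto simp: psd_def matrix_vector_mult_add_rdistrib inner_add_right)

lemma psd_conj: "psd X ==> g \<in> Mts ==> psd (g**X**adj g)"
proof -
 assume a: "psd X" "g \<in> Mts"
 have "v \<bullet> ((g**X**adj g) *v v) = (adj g *v v) \<bullet> (X *v (adj g *v v))" for v
  by (simp only: inner_adj[symmetric] matrix_vector_mul_assoc matrix_mul_assoc)
 with a show ?thesis by (auto simp: psd_def mats_vecs)
qed

lemma psd_gg: "g \<in> Mts ==> psd (g**adj g)" using psd_conj[of "mat 1" g] by (simp add: psd_def)

lemma psd_dg: "(!!a. 0 <= x a) ==> psd (dg x)" using psd_unitary[OF mat1_stiefel, of x] by simp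

lemma posdef_dg: "(!!a. 0 < x a) ==> pdef (dg x)" using posdef_unitary[OF mat1_stiefel, of x] by simp

lemma hdet_psd:
 fixes X :: "quat^'m^'m"
 assumes "psd X"
 shows "0 <= hdet X"
proof -
 obtain U :: "quat^'m^'m" and x where U: "U \<in> Stf" and X: "X = U**dg x**adj U"
  by (rule spectral[OF psd_herm[OF assms]])
 show ?thesis using assms unfolding X hdet_unitary[OF U] psd_unitary[OF U] by (simp add: prod_nonneg)
qed

lemma shift_unitary:
 fixes U :: "quat^'m^'m"
 assumes U: "U \<in> Stf"
 shows "(t *\<^sub>R (U**dg x**adj U)) + c *\<^sub>R mat 1 = U**dg (%a. t * x a + c)**adj U"
proof -
 have "U**dg (%a. t * x a + c)**adj U = U**(t *\<^sub>R dg x + c *\<^sub>R mat 1)**adj U"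
  by (simp add: dg_one[symmetric] dg_scaleR dg_add)
 then show ?thesis by (simp add: matrix_linear_simps conj_one[OF U, simplified])
qed

lemma posdef_shift:
 fixes X :: "quat^'m^'m"
 assumes "X \<in> Hrm"
 obtains C where "C > 0" "!!c. c > C ==> pdef (X + c *\<^sub>R mat 1)"
proof -
 obtain U :: "quat^'m^'m" and x where U: "U \<in> Stf" and X: "X = U**dg x**adj U" by (rule spectral[OF assms])
 have "pdef (X + c *\<^sub>R mat 1)" if c: "c > 1 + (\<Sum>a\<in>UNIV. \<bar>x a\<bar>)" for c
 proof -
  have "0 < x a + c" for a using member_le_sum[of a UNIV "%a. \<bar>x a\<bar>"] c by auto
  then have "pdef (U**dg (%a. 1 * x a + c)**adj U)" unfolding posdef_unitary[OF U] by simp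
  then show ?thesis unfolding shift_unitary[OF U, symmetric] X by simp
 qed
 then show ?thesis using that[of "1 + (\<Sum>a\<in>UNIV. \<bar>x a\<bar>)"] by (smt (verit) sum_nonneg)
qed

text \<open>The fourth powers agree because \<open>rdet\<close> is multiplicative, and both sides
  are nonnegative.\<close>

lemma hdet_conj_psd:
 fixes Y g :: "quat^'m^'m"
 assumes Y: "psd Y" and g: "g \<in> Mts"
 shows "hdet (g**Y**adj g) = hdet (g**adj g) * hdet Y"
proof -
 have "hdet (g**Y**adj g) ^ 4 = (hdet (g**adj g) * hdet Y) ^ 4"
  unfolding power_mult_distrib rdet_herm[OF psd_herm[OF psd_conj[OF Y g]], symmetric]
   rdet_herm[OF psd_herm[OF psd_gg[OF g]], symmetric] rdet_herm[OF psd_herm[OF Y], symmetric]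
   rdet_mult by (simp add: mult_ac)
 moreover have "0 <= hdet (g**Y**adj g)" "0 <= hdet (g**adj g) * hdet Y"
  using Y g by (simp_all add: hdet_psd psd_conj psd_gg)
 ultimately show ?thesis using power_eq_iff_eq_base[of 4] by auto
qed

text \<open>For indefinite \<open>Y\<close> the fourth root leaves a sign open; polynomial
  continuation along \<open>Y + c *\<^sub>R mat 1\<close> settles it.\<close>

lemma hdet_conj:
 fixes Y g :: "quat^'m^'m"
 assumes Y: "Y \<in> Hrm" and g: "g \<in> Mts"
 shows "hdet (g**Y**adj g) = hdet (g**adj g) * hdet Y"
proof -
 obtain C where C: "!!c. c > C ==> pdef (Y + c *\<^sub>R mat 1)" using posdef_shift[OF Y] by blast
 show ?thesis by (rule hp_eq_shift[OF hp_comp_linear[OF hp_hdet linear_conj] hp_cmult[OF hp_hdet],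
     where C=C and D="mat 1" and Y=Y and A4=g and B4="adj g"])
   (use C hdet_conj_psd[OF posdef_psd g] in blast)
qed

lemma hdet_shift:
 fixes Y :: "quat^'m^'m"
 assumes "Y \<in> Hrm"
 shows "hdet (t *\<^sub>R Y + mat 1) = (\<Sum>i\<le>CARD('m). t ^ i * Esym i Y)"
proof -
 obtain U :: "quat^'m^'m" and x where U: "U \<in> Stf" and Y: "Y = U**dg x**adj U" by (rule spectral[OF assms])
 have "hdet (t *\<^sub>R Y + mat 1) = (\<Prod>a\<in>UNIV. t * x a + 1)"
  using shift_unitary[OF U, of t x 1] hdet_unitary[OF U] by (simp add: Y)
 also have "... = (\<Prod>y\<leftarrow>spec Y. 1 + t * y)" unfolding Y eigvals_eq[OF U] by (simp add: add.commute)
 finally show ?thesis by (simp add: prod_list_esym length_eigvals[OF assms] Esym_eigvals[OF assms])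
qed

end

section \<open>Leading minors\<close>

text \<open>Leading blocks are cut out by projections inside the full matrix space; submatrices of
  varying size would each need an index type of their own.\<close>

definition Pj :: "nat => quat^'m^'m"
 where "Pj j = dg (%a. if idx a < j then 1 else 0)"

definition Qj :: "nat => quat^'m^'m"
 where "Qj j = dg (%a. if idx a < j then 0 else 1)"

lemma Pj_Qj [simp]: "Pj j + Qj j = mat 1" "Pj j**Pj j = Pj j" "Pj j**Qj j = 0" "Qj j**Pj j = 0"
 "Qj j**Qj j = Qj j" "adj (Pj j) = Pj j" "adj (Qj j) = Qj j"
proof -
 have z: "dg (%_. 0) = 0" by (simp add: vec_eq_iff)
 show "Pj j + Qj j = mat 1" unfolding Pj_def Qj_def dg_add dg_one[symmetric] by (rule arg_cong[of _ _ dg]) auto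
 show "Pj j**Pj j = Pj j" "Qj j**Qj j = Qj j" "Pj j**Qj j = 0" "Qj j**Pj j = 0"
  unfolding Pj_def Qj_def dg_mult z[symmetric] by (rule arg_cong[of _ _ dg], auto)+
 show "adj (Pj j) = Pj j" "adj (Qj j) = Qj j" by (simp_all add: Pj_def Qj_def)
qed

lemma dg_conj_nth: "(dg x**Z**dg y)$a$b = (x a * y b) *\<^sub>R Z$a$b" by (simp add: dg_mult_nth mult.commute)

text \<open>For Hermitian X the j-th leading principal minor: the compressed matrix has at most j
  nonzero eigenvalues, so e_j is their product.\<close>

definition Delta :: "nat => quat^'m^'m => real"
 where "Delta j X = Esym j (Pj j**X**Pj j)"

lemma hp_Delta: "hp j (Delta j)" unfolding Delta_def[abs_def] by (rule hp_comp_linear[OF hp_Esym linear_conj])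

definition powf :: "(nat => nat) => quat^'m^'m => real"
 where "powf la X = (\<Prod>j<CARD('m). Delta (Suc j) X ^ (la j - la (Suc j)))"

text \<open>Abel summation. The truncation at \<open>r\<close> is what the growth estimate for the
  minors produces; r = n gives the degree of \<open>powf\<close>.\<close>

lemma antimono_sum_diff:
 fixes la :: "nat => nat"
 assumes "antimono la"
 shows "(\<Sum>j<n. min (Suc j) r * (la j - la (Suc j))) + min n r * la n = (\<Sum>i<min n r. la i)"
proof (induction n)
 case (Suc n)
 have le: "la (Suc n) <= la n" using assms by (simp add: antimono_def)
 have "min (Suc n) r * (la n - la (Suc n)) + min (Suc n) r * la (Suc n) = min (Suc n) r * la n"
  using le by (simp add: add_mult_distrib2[symmetric])
 then have "(\<Sum>j<Suc n. min (Suc j) r * (la j - la (Suc j))) + min (Suc n) r * la (Suc n) =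
  (\<Sum>j<n. min (Suc j) r * (la j - la (Suc j))) + min (Suc n) r * la n" by simp
 also have "... = (\<Sum>i<min (Suc n) r. la i)"
 proof (cases "n < r")
  case True
  then have "min (Suc n) r = Suc n" "min n r = n" by auto
  then show ?thesis using Suc by simp
 next
  case False
  then have "min (Suc n) r = r" "min n r = r" by auto
  then show ?thesis using Suc by simp
 qed
 finally show ?case .
qed simp

lemma parts_sum_diff:
 assumes "la \<in> parts n k"
 shows "(\<Sum>j<n. min (Suc j) r * (la j - la (Suc j))) = (\<Sum>i<min n r. la i)"
 using antimono_sum_diff[of la r n] assms by (simp add: parts_def expos_def)

lemma hp_powf: "la \<in> parts CARD('m) k ==> hp k (powf la :: quat^'m^'m => real)"
proof -
 assume k: "la \<in> parts CARD('m) k"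
 have "(\<Sum>j<CARD('m). Suc j * (la j - la (Suc j))) = (\<Sum>j<CARD('m). min (Suc j) CARD('m) * (la j - la (Suc j)))"
  by (intro sum.cong) auto
 also have "... = k" unfolding parts_sum_diff[OF k] using k by (simp add: parts_def expos_def)
 finally show ?thesis unfolding powf_def[abs_def]
  using hp_prod[of "{..<CARD('m)}" "%j. Suc j * (la j - la (Suc j))" "%j X. Delta (Suc j) (X::quat^'m^'m) ^ (la j - la (Suc j))"]
   hp_power[OF hp_Delta] by fastforce
qed

context fld
begin

lemma PQ_mats [simp]: "Pj j \<in> Mts" "Qj j \<in> Mts" "Pj j \<in> Hrm" "Qj j \<in> Hrm" by (simp_all add: Pj_def Qj_def)

lemma PXP_herm [simp]: "X \<in> Hrm ==> Pj j**X**Pj j \<in> Hrm" by (intro herm_conjD) auto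

text \<open>For \<open>M = adj W**V\<close> the equation says that M intertwines r^2 and s^2 entry
  by entry, so M is nonzero only where r and s agree; hence it intertwines r and s as well.\<close>

lemma posdef_sqrt_unique:
 fixes R S :: "quat^'m^'m"
 assumes R: "pdef R" and S: "pdef S" and eq: "R**R = S**S"
 shows "R = S"
proof -
 obtain V :: "quat^'m^'m" and r where V: "V \<in> Stf" and RV: "R = V**dg r**adj V"
  by (rule spectral[OF posdef_herm[OF R]])
 obtain W :: "quat^'m^'m" and s where W: "W \<in> Stf" and SW: "S = W**dg s**adj W"
  by (rule spectral[OF posdef_herm[OF S]])
 have r: "0 < r a" for a using R unfolding RV posdef_unitary[OF V] by simp
 have s: "0 < s a" for a using S unfolding SW posdef_unitary[OF W] by simp
 define M where "M = adj W**V"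
 have "adj W**(V**dg (%a. r a * r a)**adj V)**V = adj W**(W**dg (%a. s a * s a)**adj W)**V"
  using eq unfolding RV SW conj_mult[OF V] conj_mult[OF W] dg_mult by simp
 then have "M**dg (%a. r a * r a)**(adj V**V) = (adj W**W)**dg (%a. s a * s a)**M"
  by (simp add: M_def matrix_mul_assoc)
 then have M2: "M**dg (%a. r a * r a) = dg (%a. s a * s a)**M" by (simp add: stiefelD V W)
 have "(r b * r b) *\<^sub>R M$a$b = (s a * s a) *\<^sub>R M$a$b" for a b
  using arg_cong[OF M2, of "%X. X$a$b"] by (simp only: dg_mult_nth)
 then have "(r b * r b - s a * s a) *\<^sub>R M$a$b = 0" for a b by (simp add: scaleR_diff_left)
 then have "r b *\<^sub>R M$a$b = s a *\<^sub>R M$a$b" for a b using power2_eq_imp_eq[of "r b" "s a"] r[of b] s[of a]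
  by (cases "M$a$b = 0") (auto simp: power2_eq_square less_imp_le)
 then have MM: "M**dg r = dg s**M" by (simp add: vec_eq_iff dg_mult_nth)
 have WM: "W**M = V" by (simp add: M_def matrix_mul_assoc unitaryD W)
 have "R = W**(M**dg r)**adj V" unfolding RV by (simp add: matrix_mul_assoc WM)
 also have "... = W**dg s**adj W**(V**adj V)" unfolding MM by (simp add: M_def matrix_mul_assoc)
 also have "... = S" by (simp add: unitaryD V SW)
 finally show ?thesis .
qed

lemma psqrt:
 fixes X :: "quat^'m^'m"
 assumes X: "pdef X"
 shows posdef_psqrt: "pdef (sqr X)" and psqrt_mult: "sqr X**sqr X = X"
proof -
 obtain U :: "quat^'m^'m" and x where U: "U \<in> Stf" and XU: "X = U**dg x**adj U"
  by (rule spectral[OF posdef_herm[OF X]])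
 have x: "0 < x a" for a using X unfolding XU posdef_unitary[OF U] by simp
 let ?R = "U**dg (%a. sqrt (x a))**adj U"
 have "pdef ?R" unfolding posdef_unitary[OF U] using x by simp
 moreover have "?R**?R = X" unfolding conj_mult[OF U] dg_mult XU using x by (simp add: less_imp_le)
 ultimately have "\<exists>!R. pdef R \<and> R**R = X" using posdef_sqrt_unique by blast
 from theI'[OF this] show "pdef (sqr X)" "sqr X**sqr X = X" by (auto simp: psqrt_def)
qed

lemma posdef_inverse:
 fixes h :: "quat^'m^'m"
 assumes "pdef h"
 obtains hi where "hi \<in> Hrm" "h**hi = mat 1" "hi**h = mat 1"
proof -
 obtain U :: "quat^'m^'m" and x where U: "U \<in> Stf" and XU: "h = U**dg x**adj U"
  by (rule spectral[OF posdef_herm[OF assms]])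
 have x: "x a ~= 0" for a using assms unfolding XU posdef_unitary[OF U] by (metis less_irrefl)
 let ?R = "U**dg (%a. inverse (x a))**adj U"
 have "?R \<in> Hrm" by (simp add: stiefel_mats U)
 moreover have "h**?R = mat 1" "?R**h = mat 1"
  unfolding XU conj_mult[OF U] dg_mult using x by (simp_all add: dg_one unitaryD U)
 ultimately show ?thesis using that by blast
qed

lemma hdet_posdef:
 fixes X :: "quat^'m^'m"
 assumes "pdef X"
 shows "0 < hdet X"
proof -
 obtain U :: "quat^'m^'m" and x where U: "U \<in> Stf" and XU: "X = U**dg x**adj U"
  by (rule spectral[OF posdef_herm[OF assms]])
 show ?thesis using assms unfolding XU posdef_unitary[OF U] hdet_unitary[OF U] by (simp add: prod_pos)
qed

lemma psd_hdet_posdef: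
 fixes X :: "quat^'m^'m"
 assumes "psd X" "hdet X ~= 0"
 shows "pdef X"
proof -
 obtain U :: "quat^'m^'m" and x where U: "U \<in> Stf" and XU: "X = U**dg x**adj U"
  by (rule spectral[OF psd_herm[OF assms(1)]])
 have "0 <= x a \<and> x a ~= 0" for a using assms unfolding XU psd_unitary[OF U] hdet_unitary[OF U] by simp
 then show ?thesis unfolding XU posdef_unitary[OF U] by (metis order_le_less)
qed

text \<open>Factoring out the square root of an invertible \<open>X\<close> turns X + Z into 1 + Y
  with \<open>Y\<close> positive semidefinite, whose determinant is at least 1. For singular
  \<open>X\<close> the left side is 0.\<close>

lemma hdet_mono:
 fixes X Z :: "quat^'m^'m"
 assumes X: "psd X" and Z: "psd Z"
 shows "hdet X <= hdet (X + Z)"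
proof (cases "hdet X = 0")
 case True
 then show ?thesis using hdet_psd[OF psd_add[OF X Z]] by simp
next
 case False
 then have pX: "pdef X" by (rule psd_hdet_posdef[OF X])
 define h where "h = sqr X"
 have h: "pdef h" "h**h = X" using psqrt[OF pX] by (auto simp: h_def)
 obtain hi where hi: "hi \<in> Hrm" "h**hi = mat 1" "hi**h = mat 1" by (rule posdef_inverse[OF h(1)])
 note [simp] = herm_adj[OF posdef_herm[OF h(1)]] herm_adj[OF hi(1)]
 define Y where "Y = hi**Z**hi"
 have Y: "psd Y" using psd_conj[OF Z herm_mats[OF hi(1)]] by (simp add: Y_def)
 obtain U :: "quat^'m^'m" and y where U: "U \<in> Stf" and YU: "Y = U**dg y**adj U"
  by (rule spectral[OF psd_herm[OF Y]])
 have y: "0 <= y a" for a using Y unfolding YU psd_unitary[OF U] by simp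
 have "h**(Y + mat 1)**h = (h**hi)**Z**(hi**h) + h**h"
  by (simp add: Y_def matrix_linear_simps matrix_mul_assoc)
 then have "hdet (X + Z) = hdet (h**(Y + mat 1)**adj h)" by (simp add: hi h(2) add.commute)
 also have "... = hdet X * hdet (Y + mat 1)"
  using h psd_herm[OF Y] by (subst hdet_conj) (auto simp: herm_mats[OF posdef_herm])
 also have "hdet (Y + mat 1) = (\<Prod>a\<in>UNIV. 1 * y a + 1)"
  using shift_unitary[OF U, of 1 y 1] hdet_unitary[OF U] by (simp add: YU)
 also have "hdet X * (\<Prod>a\<in>UNIV. 1 * y a + 1) >= hdet X * 1"
  using y by (intro mult_left_mono prod_ge_1 hdet_psd X) auto
 finally show ?thesis by simp
qed

lemma prod_idx_trunc:
 assumes "j <= CARD('m::finite)"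
 shows "(\<Prod>a\<in>(UNIV::'m set). if idx a < j then c (idx a) else 1) = (\<Prod>i<j. c i :: real)"
proof -
 have "(\<Prod>a\<in>(UNIV::'m set). if idx a < j then c (idx a) else 1) = (\<Prod>i<CARD('m). if i < j then c i else 1)"
  by (rule prod_idx)
 also have "... = (\<Prod>i<j. c i)" using assms by (intro prod.mono_neutral_cong_right) auto
 finally show ?thesis .
qed

text \<open>Scaling the block by 1/u relates the expansion of hdet(Y/u + 1) in the
  \<open>Esym i Y\<close> to u^(-j) times a polynomial \<open>r\<close> in u. After multiplication
  by u^m the right side is divisible by u^(m-j): the terms with i > j vanish, and the lowest
  coefficient is \<open>Esym j Y\<close>.\<close>

lemma Esym_trunc:
 fixes Y :: "quat^'m^'m"
 assumes Y: "Y \<in> Hrm" and PYP: "Pj j**Y**Pj j = Y" and j: "j <= CARD('m)"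
 shows "Esym j Y = hdet (Y + Qj j)" and "i > j ==> Esym i Y = 0"
proof -
 have Y0: "Y$a$b = 0" if "\<not> (idx a < j \<and> idx b < j)" for a b
  using arg_cong[OF PYP, of "%X. X$a$b"] that by (auto simp: Pj_def dg_conj_nth split: if_splits)
 obtain r where r: "!!u. hdet ((Y + Qj j) + u *\<^sub>R Pj j) = poly r u"
  using hp_line[OF hp_hdet, of "Y + Qj j" "Pj j"] by blast
 let ?m = "CARD('m)"
 define pl where "pl = (\<Sum>i\<le>?m. monom (Esym i Y) (?m - i))"
 have "pl = monom 1 (?m - j) * r"
 proof (rule poly_eq_eventually[of 0])
  fix u :: real assume u: "u > 0"
  define g :: "quat^'m^'m" where "g = dg (%a. if idx a < j then 1 / sqrt u else 1)"
  have "g**((Y + Qj j) + u *\<^sub>R Pj j)**adj g = (1/u) *\<^sub>R Y + mat 1"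
   using u Y0 by (auto simp: vec_eq_iff g_def dg_conj_nth mat_def Pj_def Qj_def field_simps
     of_real_def scaleR_add_right)
  moreover have "hdet (g**((Y + Qj j) + u *\<^sub>R Pj j)**adj g) = hdet (g**adj g) * hdet ((Y + Qj j) + u *\<^sub>R Pj j)"
   using Y by (intro hdet_conj) (auto simp: g_def)
  moreover have "hdet (g**adj g) = (1/u) ^ j"
  proof -
   have "g**adj g = dg (%a. if idx a < j then 1/u else 1)"
    unfolding g_def adj_dg dg_mult using u by (intro arg_cong[of _ _ dg]) auto
   then show ?thesis using prod_idx_trunc[OF j, of "%_. 1/u"] by (simp add: hdet_dg)
  qed
  ultimately have "hdet ((1/u) *\<^sub>R Y + mat 1) = (1/u) ^ j * poly r u" by (simp add: r)
  then have A: "u ^ ?m * (\<Sum>i\<le>?m. (1/u) ^ i * Esym i Y) = u ^ ?m * (1/u) ^ j * poly r u"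
   by (simp add: hdet_shift[OF Y])
  have pw: "u ^ ?m * (1/u) ^ i = u ^ (?m - i)" if "i <= ?m" for i
   using that u by (simp add: power_diff power_one_over field_simps)
  have "u ^ ?m * (\<Sum>i\<le>?m. (1/u) ^ i * Esym i Y) = (\<Sum>i\<le>?m. u ^ (?m - i) * Esym i Y)"
   unfolding sum_distrib_left mult.assoc[symmetric] by (intro sum.cong refl) (simp only: pw atMost_iff)
  then show "poly pl u = poly (monom 1 (?m - j) * r) u"
   using A by (simp only: pw[OF j]) (simp add: pl_def poly_sum poly_monom mult.commute)
 qed
 then have c: "coeff pl n = (if n < ?m - j then 0 else coeff r (n - (?m - j)))" for n
  by (simp add: coeff_monom_mult)
 have pl: "coeff pl (?m - i) = Esym i Y" if "i <= ?m" for i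
 proof -
  have "coeff pl (?m - i) = (\<Sum>l\<le>?m. if i = l then Esym i Y else 0)"
   unfolding pl_def coeff_sum using that by (intro sum.cong) auto
  then show ?thesis using that by simp
 qed
 have "Esym j Y = coeff r 0" using pl[OF j] c[of "?m - j"] by simp
 also have "... = poly r 0" by (simp add: poly_0_coeff_0)
 also have "... = hdet (Y + Qj j)" by (simp add: r[symmetric])
 finally show "Esym j Y = hdet (Y + Qj j)" .
 show "Esym i Y = 0" if "i > j"
 proof (cases "i <= ?m")
  case True
  then have "?m - i < ?m - j" using that by simp
  then show ?thesis using pl[OF True] c[of "?m - i"] by (simp only: if_True)
 next
  case False
  then show ?thesis by (simp add: Esym_eigvals[OF Y] esym_gt length_eigvals[OF Y])
 qed
qed

lemma PPXPP [simp]: "Pj j**(Pj j**X**Pj j)**Pj j = Pj j**X**Pj j"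
proof -
 have "Pj j**(Pj j**X**Pj j)**Pj j = (Pj j**Pj j)**X**(Pj j**Pj j)" by (simp only: matrix_mul_assoc)
 then show ?thesis by simp
qed

lemma Delta_hdet:
 fixes X :: "quat^'m^'m"
 assumes "X \<in> Hrm" "j <= CARD('m)"
 shows "Delta j X = hdet (Pj j**X**Pj j + Qj j)"
 unfolding Delta_def by (rule Esym_trunc(1)) (use assms in auto)

lemma block_conj:
 fixes g Y :: "quat^'m^'m"
 assumes "g = Pj j**g**Pj j" "Y = Pj j**Y**Pj j"
 shows "g**Y**adj g + Qj j = (g + Qj j)**(Y + Qj j)**adj (g + Qj j)"
proof -
 have gQ: "g**Qj j = 0" by (subst assms(1)) (simp add: matrix_mul_assoc[symmetric])
 have YQ: "Y**Qj j = 0" by (subst assms(2)) (simp add: matrix_mul_assoc[symmetric])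
 have QY: "Qj j**Y = 0" by (subst assms(2)) (simp add: matrix_mul_assoc)
 have Qg: "Qj j**adj g = 0" using arg_cong[OF gQ, of adj] by (simp add: adj_mult)
 have "(g + Qj j)**(Y + Qj j) = g**Y + Qj j" by (simp add: matrix_linear_simps gQ QY)
 moreover have "(g**Y + Qj j)**(adj g + Qj j) = g**Y**adj g + g**(Y**Qj j) + Qj j"
  by (simp add: matrix_linear_simps Qg matrix_mul_assoc)
 ultimately show ?thesis by (simp add: YQ)
qed

section \<open>Minors under triangular conjugation\<close>

definition lowtri :: "quat^'m^'m => bool"
 where "lowtri T \<longleftrightarrow> T \<in> Mts \<and> (\<forall>a b. idx a < idx b --> T$a$b = 0)"

lemma lowtri_P: "lowtri T ==> Pj j**T**Pj j = Pj j**T" by (auto simp: vec_eq_iff Pj_def dg_mult_nth lowtri_def)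

text \<open>The condition on \<open>Pj j\<close> says that \<open>T\<close> is block lower
  triangular at level \<open>j\<close>; the leading block of the conjugate is then the leading block
  of \<open>X\<close> conjugated by that of \<open>T\<close>.\<close>

lemma Delta_conj:
 fixes T X :: "quat^'m^'m"
 assumes T: "T \<in> Mts" "Pj j**T**Pj j = Pj j**T" and X: "X \<in> Hrm" and j: "j <= CARD('m)"
 defines "g \<equiv> Pj j**T**Pj j + Qj j"
 shows "Delta j (T**X**adj T) = hdet (g**adj g) * Delta j X"
  and "Delta j (T**adj T) = hdet (g**adj g)"
proof -
 define h where "h = Pj j**T**Pj j"
 have h: "h = Pj j**h**Pj j" by (simp add: h_def)
 have TP: "Pj j**T = h" by (simp only: h_def T(2))
 have PT: "adj T**Pj j = adj h" using arg_cong[OF TP, of adj] by (simp only: adj_mult Pj_Qj)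
 have *: "Delta j (T**X**adj T) = hdet (g**adj g) * Delta j X" if X: "X \<in> Hrm" for X
 proof -
  have "Pj j**(T**X**adj T)**Pj j = (Pj j**T)**X**(adj T**Pj j)" by (simp add: matrix_mul_assoc)
  also have "... = h**X**adj h" by (simp only: PT TP)
  also have "... = (h**Pj j)**X**(Pj j**adj h)"
  proof -
   have "h**Pj j = h" by (simp add: h_def matrix_mul_assoc[symmetric])
   moreover from arg_cong[OF this, of adj] have "Pj j**adj h = adj h" by (simp add: adj_mult)
   ultimately show ?thesis by simp
  qed
  finally have "Pj j**(T**X**adj T)**Pj j = h**(Pj j**X**Pj j)**adj h" by (simp add: matrix_mul_assoc)
  then have "Delta j (T**X**adj T) = hdet (h**(Pj j**X**Pj j)**adj h + Qj j)"
   using T X j by (subst Delta_hdet) auto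
  also have "... = hdet (g**(Pj j**X**Pj j + Qj j)**adj g)"
   by (subst block_conj[OF h]) (simp_all add: g_def h_def)
  also have "... = hdet (g**adj g) * Delta j X" using X T j by (subst hdet_conj) (auto simp: g_def Delta_hdet)
  finally show ?thesis .
 qed
 show "Delta j (T**X**adj T) = hdet (g**adj g) * Delta j X" by (rule *[OF X])
 have "Delta j (mat 1 :: quat^'m^'m) = hdet (mat 1 :: quat^'m^'m)" using j by (subst Delta_hdet) auto
 then have "Delta j (mat 1 :: quat^'m^'m) = 1" using hdet_dg[of "%_. 1"] by (simp add: dg_one)
 then show "Delta j (T**adj T) = hdet (g**adj g)" using *[of "mat 1"] by simp
qed

lemma Delta_one: "j <= CARD('m) ==> Delta j (mat 1 :: quat^'m^'m) = 1"
 using Delta_conj(1)[of "mat 1 :: quat^'m^'m" j "mat 1"] Delta_hdet[of "mat 1 :: quat^'m^'m" j]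
  hdet_dg[of "%_::'m. 1"] by (simp add: dg_one)

lemma Delta_lowtri:
 fixes T X :: "quat^'m^'m"
 assumes "lowtri T" "X \<in> Hrm" "j <= CARD('m)"
 shows "Delta j (T**X**adj T) = Delta j (T**adj T) * Delta j X"
 using Delta_conj[of T j X] assms lowtri_P[OF assms(1), of j] by (simp add: lowtri_def)

lemma powf_lowtri:
 fixes T X :: "quat^'m^'m"
 assumes "lowtri T" "X \<in> Hrm"
 shows "powf la (T**X**adj T) = powf la (T**adj T) * powf la X" unfolding powf_def prod.distrib[symmetric]
 by (intro prod.cong refl) (subst Delta_lowtri[OF assms], auto simp: power_mult_distrib)

lemma powf_one: "powf la (mat 1 :: quat^'m^'m) = 1"
 unfolding powf_def by (intro prod.neutral ballI) (simp add: Delta_one)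

section \<open>Bounds, positivity and monotonicity of the minors\<close>

lemma quad_PXP: "v \<bullet> ((Pj j**X**Pj j + Qj j) *v v) =
  (Pj j *v v) \<bullet> (X *v (Pj j *v v)) + (Qj j *v v) \<bullet> (Qj j *v v)"
 and norm_PQ: "(Pj j *v v) \<bullet> (Pj j *v v) + (Qj j *v v) \<bullet> (Qj j *v v) = v \<bullet> v"
proof -
 have PX: "v \<bullet> ((Pj j**X**Pj j) *v v) = (Pj j *v v) \<bullet> (X *v (Pj j *v v))" for X
  by (simp add: inner_adj[of "Pj j *v v"] inner_adj[of v] adj_mult matrix_vector_mul_assoc matrix_mul_assoc)
 have Q: "v \<bullet> (Qj j *v v) = (Qj j *v v) \<bullet> (Qj j *v v)"
  by (simp add: inner_adj[of "Qj j *v v"] matrix_vector_mul_assoc inner_commute)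
 show "v \<bullet> ((Pj j**X**Pj j + Qj j) *v v) =
  (Pj j *v v) \<bullet> (X *v (Pj j *v v)) + (Qj j *v v) \<bullet> (Qj j *v v)"
  by (simp add: matrix_vector_mult_add_rdistrib inner_add_right PX Q)
 show "(Pj j *v v) \<bullet> (Pj j *v v) + (Qj j *v v) \<bullet> (Qj j *v v) = v \<bullet> v"
 proof -
  have "v \<bullet> v = v \<bullet> ((Pj j + Qj j) *v v)" by simp
  also have "... = v \<bullet> (Pj j *v v) + v \<bullet> (Qj j *v v)"
   by (simp only: matrix_vector_mult_add_rdistrib inner_add_right)
  finally show ?thesis using PX[of "mat 1"] Q by simp
 qed
qed

text \<open>For Hermitian matrices a bound on all eigenvalues in absolute value; as a condition on
  the quadratic form it passes directly to compressions and unitary conjugates.\<close>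

definition qbound :: "real => quat^'m^'m => bool"
 where "qbound r X \<longleftrightarrow> (\<forall>v\<in>Vcs. \<bar>v \<bullet> (X *v v)\<bar> <= r * (v \<bullet> v))"

lemma qbound_unitary:
 fixes U :: "quat^'m^'m"
 assumes U: "U \<in> Stf"
 shows "qbound r (U**dg x**adj U) \<longleftrightarrow> (\<forall>a. \<bar>x a\<bar> <= r)"
proof
 assume "qbound r (U**dg x**adj U)"
 then show "\<forall>a. \<bar>x a\<bar> <= r" using quad_form_eigenvector[OF U] unfolding qbound_def by (metis mult.right_neutral)
next
 assume x: "\<forall>a. \<bar>x a\<bar> <= r"
 show "qbound r (U**dg x**adj U)" unfolding qbound_def
 proof
  fix v :: "quat^'m"
  have "\<bar>\<Sum>a\<in>UNIV. x a * (norm ((adj U *v v)$a))\<^sup>2\<bar> <= (\<Sum>a\<in>UNIV. r * (norm ((adj U *v v)$a))\<^sup>2)"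
   using x by (intro order_trans[OF sum_abs] sum_mono) (simp add: abs_mult mult_right_mono)
  also have "... = r * ((adj U *v v) \<bullet> (adj U *v v))"
   by (simp add: inner_vec_def power2_norm_eq_inner sum_distrib_left)
  also have "(adj U *v v) \<bullet> (adj U *v v) = v \<bullet> v"
   using norm_unitary[OF unitary_adj[OF U], of v] by (simp add: norm_eq)
  finally show "\<bar>v \<bullet> ((U**dg x**adj U) *v v)\<bar> <= r * (v \<bullet> v)" unfolding quad_form .
 qed
qed

lemma qbound_PXP: "qbound 1 X ==> qbound 1 (Pj j**X**Pj j + Qj j)"
proof -
 assume "qbound 1 X"
 then have "\<bar>(Pj j *v v) \<bullet> (X *v (Pj j *v v))\<bar> <= (Pj j *v v) \<bullet> (Pj j *v v)" if "v \<in> Vcs" for v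
  using that by (simp add: qbound_def mats_vecs)
 then show ?thesis unfolding qbound_def quad_PXP using norm_PQ inner_ge_zero by (smt (verit) mult_1)
qed

lemma hdet_qbound:
 fixes X :: "quat^'m^'m"
 assumes "X \<in> Hrm" "qbound 1 X"
 shows "\<bar>hdet X\<bar> <= 1"
proof -
 obtain U :: "quat^'m^'m" and x where U: "U \<in> Stf" and XU: "X = U**dg x**adj U" by (rule spectral[OF assms(1)])
 show ?thesis using assms(2) unfolding XU qbound_unitary[OF U] hdet_unitary[OF U]
  by (simp add: abs_prod prod_le_1)
qed

lemma Delta_qbound:
 fixes X :: "quat^'m^'m"
 assumes "X \<in> Hrm" "qbound 1 X" "j <= CARD('m)"
 shows "\<bar>Delta j X\<bar> <= 1" using assms by (simp add: Delta_hdet hdet_qbound qbound_PXP)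

lemma powf_qbound:
 fixes X :: "quat^'m^'m"
 assumes "X \<in> Hrm" "qbound 1 X"
 shows "\<bar>powf la X\<bar> <= 1" unfolding powf_def abs_prod using Delta_qbound[OF assms]
 by (intro prod_le_1) (simp add: power_abs power_le_one)

lemma psd_PXP: "psd X ==> psd (Pj j**X**Pj j + Qj j)" unfolding psd_def quad_PXP by (auto simp: mats_vecs)

lemma Delta_psd: "psd X ==> j <= CARD('m) ==> 0 <= Delta j (X :: quat^'m^'m)"
 by (simp add: Delta_hdet psd_herm hdet_psd psd_PXP)

lemma Delta_posdef:
 fixes X :: "quat^'m^'m"
 assumes X: "pdef X" and j: "j <= CARD('m)"
 shows "0 < Delta j X"
proof -
 have "0 < v \<bullet> ((Pj j**X**Pj j + Qj j) *v v)" if v: "v \<in> Vcs" "v ~= 0" for v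
 proof (cases "Pj j *v v = 0")
  case True
  then show ?thesis unfolding quad_PXP using norm_PQ[of j v] v by simp
 next
  case False
  then show ?thesis unfolding quad_PXP using X v by (intro add_pos_nonneg) (auto simp: posdef_def mats_vecs)
 qed
 then have "pdef (Pj j**X**Pj j + Qj j)" using posdef_herm[OF X] by (simp add: posdef_def)
 then show ?thesis using posdef_herm[OF X] j by (simp add: Delta_hdet hdet_posdef)
qed

lemma powf_psd: "psd X ==> 0 <= powf la (X :: quat^'m^'m)"
 unfolding powf_def by (intro prod_nonneg) (simp add: Delta_psd)

lemma Delta_mono:
 fixes X Z :: "quat^'m^'m"
 assumes "psd X" "psd Z" "j <= CARD('m)"
 shows "Delta j X <= Delta j (X + Z)"
proof -
 have "hdet (Pj j**X**Pj j + Qj j) <= hdet ((Pj j**X**Pj j + Qj j) + Pj j**Z**Pj j)"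
  using psd_conj[OF assms(2), of "Pj j"] assms(1) by (intro hdet_mono psd_PXP) auto
 also have "(Pj j**X**Pj j + Qj j) + Pj j**Z**Pj j = Pj j**(X + Z)**Pj j + Qj j"
  by (simp add: matrix_linear_simps)
 finally show ?thesis using assms psd_add[OF assms(1,2)] by (simp add: Delta_hdet psd_herm)
qed

lemma Esym_psd_nonneg:
 fixes X :: "quat^'m^'m"
 assumes "psd X"
 shows "0 <= Esym j X"
proof -
 have nn: "\<forall>x\<in>set xs. 0 <= x ==> 0 <= esym j xs" for xs by (induction j xs rule: esym.induct) auto
 obtain U :: "quat^'m^'m" and x where U: "U \<in> Stf" and XU: "X = U**dg x**adj U"
  by (rule spectral[OF psd_herm[OF assms]])
 have "\<forall>y\<in>set (spec X). 0 <= y" using assms unfolding XU psd_unitary[OF U] eigvals_eq[OF U] by auto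
 then show ?thesis unfolding Esym_eigvals[OF psd_herm[OF assms]] by (rule nn)
qed

text \<open>Only \<open>min j r\<close> of the eigenvalues of the leading block grow with \<open>t\<close>.\<close>

lemma Delta_growth:
 fixes H :: "quat^'m^'m"
 assumes H: "H \<in> Stf" and j: "j <= CARD('m)" and r: "r <= CARD('m)" and t: "1 <= t"
 shows "Delta j (adj H**(mat 1 + t *\<^sub>R Pj r)**H) <= 2 ^ CARD('m) * t ^ min j r"
proof -
 define Y where "Y = Pj j**adj H**Pj r"
 have adjY: "adj Y = Pj r**H**Pj j" by (simp add: Y_def adj_mult matrix_mul_assoc)
 have Ym: "Y \<in> Mts" using H by (simp add: Y_def stiefel_mats)
 have psdY: "psd (Y**adj Y)" by (rule psd_gg[OF Ym])
 have herm1: "adj H**(mat 1 + t *\<^sub>R Pj r)**H \<in> Hrm" using H by (simp add: stiefel_mats)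
 have YY: "Y**adj Y = Pj j**(adj H**Pj r**H)**Pj j"
 proof -
  have "Y**adj Y = Pj j**adj H**(Pj r**Pj r)**H**Pj j"
   unfolding adjY unfolding Y_def by (simp only: matrix_mul_assoc)
  then show ?thesis by (simp add: matrix_mul_assoc)
 qed
 have YY': "adj Y**Y = Pj r**(H**Pj j**adj H)**Pj r"
 proof -
  have "adj Y**Y = Pj r**H**(Pj j**Pj j)**adj H**Pj r"
   unfolding adjY unfolding Y_def by (simp only: matrix_mul_assoc)
  then show ?thesis by (simp add: matrix_mul_assoc)
 qed
 \<comment> \<open>\<open>Y**adj Y\<close> is supported on the first \<open>j\<close> coordinates
   and \<open>adj Y**Y\<close> on the first \<open>r\<close>; \<open>Esym_swap\<close> transfers the
   second vanishing to the first matrix.\<close>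
 have zero: "Esym i (Y**adj Y) = 0" if "i > min j r" for i
 proof (cases "i > j")
  case True
  show ?thesis by (rule Esym_trunc(2)[OF psd_herm[OF psdY] _ j True]) (simp add: YY)
 next
  case False
  then have "i > r" using that by simp
  have "Esym i (adj Y**Y) = 0"
   by (rule Esym_trunc(2)[OF _ _ r \<open>i > r\<close>]) (use Ym H in \<open>simp_all add: YY' stiefel_mats\<close>)
  then show ?thesis by (simp add: Esym_swap)
 qed
 have "Pj j**(adj H**(mat 1 + t *\<^sub>R Pj r)**H)**Pj j + Qj j = t *\<^sub>R (Y**adj Y) + mat 1"
 proof -
  have "adj H**(mat 1 + t *\<^sub>R Pj r)**H = mat 1 + t *\<^sub>R (adj H**Pj r**H)"
   by (simp add: matrix_linear_simps stiefelD[OF H])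
  then have "Pj j**(adj H**(mat 1 + t *\<^sub>R Pj r)**H)**Pj j = Pj j + t *\<^sub>R (Y**adj Y)"
   by (simp add: matrix_linear_simps YY)
  then have "Pj j**(adj H**(mat 1 + t *\<^sub>R Pj r)**H)**Pj j + Qj j = t *\<^sub>R (Y**adj Y) + (Pj j + Qj j)"
   by (simp only: add_ac)
  then show ?thesis by simp
 qed
 then have "Delta j (adj H**(mat 1 + t *\<^sub>R Pj r)**H) = (\<Sum>i\<le>CARD('m). t ^ i * Esym i (Y**adj Y))"
  by (simp add: Delta_hdet[OF herm1 j] hdet_shift[OF psd_herm[OF psdY]])
 also have "... <= (\<Sum>i\<le>CARD('m). t ^ min j r * Esym i (Y**adj Y))"
 proof (rule sum_mono)
  fix i assume "i \<in> {..CARD('m)}"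
  show "t ^ i * Esym i (Y**adj Y) <= t ^ min j r * Esym i (Y**adj Y)"
  proof (cases "i > min j r")
   case False
   then show ?thesis using t by (intro mult_right_mono power_increasing Esym_psd_nonneg psdY) auto
  qed (simp add: zero)
 qed
 also have "... = t ^ min j r * hdet (Y**adj Y + mat 1)"
  using hdet_shift[OF psd_herm[OF psdY], of 1] by (simp add: sum_distrib_left)
 also have "hdet (Y**adj Y + mat 1) <= 2 ^ CARD('m)"
 proof -
  obtain U :: "quat^'m^'m" and y where U: "U \<in> Stf" and YU: "Y**adj Y = U**dg y**adj U"
   by (rule spectral[OF psd_herm[OF psdY]])
  have contr: "norm (Pj i *v v) <= norm v" for i and v :: "quat^'m"
   using norm_PQ[of i v] inner_ge_zero[of "Qj i *v v"] unfolding norm_le by linarith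
  have "qbound 1 (Y**adj Y)" unfolding qbound_def
  proof
   fix v :: "quat^'m"
   have "v \<bullet> ((Y**adj Y) *v v) = (norm (adj Y *v v))\<^sup>2"
    by (simp add: matrix_vector_mul_assoc[symmetric] inner_adj[of v] power2_norm_eq_inner)
   moreover have "norm (adj Y *v v) <= norm v"
   proof -
    have "norm (adj Y *v v) = norm (Pj r *v (H *v (Pj j *v v)))"
     by (simp add: adjY matrix_vector_mul_assoc matrix_mul_assoc)
    also have "... <= norm (H *v (Pj j *v v))" by (rule contr)
    also have "... <= norm v" unfolding norm_unitary[OF H] by (rule contr)
    finally show ?thesis .
   qed
   ultimately show "\<bar>v \<bullet> ((Y**adj Y) *v v)\<bar> <= 1 * (v \<bullet> v)"
    by (simp add: power2_norm_eq_inner[symmetric] power_mono)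
  qed
  then have y: "\<bar>y a\<bar> <= 1" for a unfolding YU qbound_unitary[OF U] by simp
  have y0: "0 <= y a" for a using psdY unfolding YU psd_unitary[OF U] by simp
  have "hdet (Y**adj Y + mat 1) = (\<Prod>a\<in>UNIV. 1 * y a + 1)"
   using shift_unitary[OF U, of 1 y 1] hdet_unitary[OF U] by (simp add: YU)
  also have "... <= (\<Prod>a\<in>(UNIV::'m set). 2)"
   using y y0 by (intro prod_mono) (auto simp: abs_le_iff add_nonneg_nonneg)
  finally show ?thesis by simp
 qed
 finally show ?thesis using t by (simp add: mult.commute)
qed

end

section \<open>Invariant integration on the Stiefel manifold\<close>

lemma continuous_matrix_mult [continuous_intros]:
 fixes f :: "'a::topological_space => quat^'n^'m" and g :: "'a => quat^'k^'n"
 assumes "continuous_on S f" "continuous_on S g"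
 shows "continuous_on S (%x. f x**g x)" unfolding matrix_matrix_mult_def
 by (intro continuous_on_vec_lambda continuous_on_sum continuous_on_mult continuous_on_component assms)

lemma continuous_adj [continuous_intros]:
 fixes f :: "'a::topological_space => quat^'n^'m"
 assumes "continuous_on S f"
 shows "continuous_on S (%x. adj (f x))"
 unfolding adj_def by (intro continuous_on_vec_lambda qcnj_continuous continuous_on_component assms)

lemma continuous_hp:
 assumes "hp k F" "continuous_on S f"
 shows "continuous_on S (%x. F (f x))"
 using continuous_on_compose2[OF hp_continuous[OF assms(1), of UNIV] assms(2)] by auto

text \<open>Change of variables in the library needs a well-ordered index type.\<close>

datatype 'a ow = Ow (unow: 'a)

lemma bij_unow: "bij unow" by (rule o_bij[of Ow]) auto

instance ow :: (finite) finite by standard (rule finite_imageD[of unow], auto intro: bij_is_inj[OF bij_unow])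

instantiation ow :: (finite) wellorder
begin

definition "x <= y \<longleftrightarrow> idx (unow x) <= idx (unow y)"
definition "x < y \<longleftrightarrow> idx (unow x) < idx (unow y)"

instance
proof
 fix P :: "'a ow => bool" and a
 assume "!!x. (!!y. y < x ==> P y) ==> P x"
 then show "P a" by (induction "idx (unow a)" arbitrary: a rule: less_induct) (metis less_ow_def)
qed (auto simp: less_eq_ow_def less_ow_def intro: ow.expand)

end

lemma sum_unow: "(\<Sum>p\<in>UNIV. f (unow p)) = (\<Sum>a\<in>UNIV. f a)" using bij_unow by (rule sum.reindex_bij_betw)

lemma sum_UNIV_prod: "(\<Sum>p\<in>UNIV. f p) = (\<Sum>a\<in>UNIV. \<Sum>b\<in>UNIV. f (a, b))"
 unfolding sum.cartesian_product UNIV_Times_UNIV by (simp add: split_def)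

lemma emeasure_orthogonal_vimage:
 fixes f :: "real^'n::{finite,wellorder} => real^'n::_"
 assumes f: "orthogonal_transformation f" and B: "B \<in> sets borel" "bounded B"
 shows "emeasure lborel (f -` B) = emeasure lborel B"
proof -
 have bij: "bij f" using f by (rule orthogonal_transformation_bij)
 have eq: "f -` B = inv f ` B" by (rule bij_vimage_eq_inv_image[OF bij])
 have g: "orthogonal_transformation (inv f)" by (rule orthogonal_transformation_inv[OF f])
 have lm: "B \<in> lmeasurable" using B by (intro bounded_set_imp_lmeasurable) auto
 have "f \<in> borel_measurable borel" using orthogonal_transformation_linear[OF f]
  by (intro borel_measurable_continuous_onI linear_continuous_on) (simp add: linear_conv_bounded_linear)
 then have fB: "f -` B \<in> sets borel" using measurable_sets[of f borel borel B] B(1) by simp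
 have "emeasure lborel (f -` B) = emeasure lebesgue (f -` B)" using fB by simp
 also have "... = ennreal (measure lebesgue (inv f ` B))"
  unfolding eq by (rule emeasure_eq_measure2) (rule measurable_orthogonal_image[OF g lm])
 also have "... = ennreal (measure lebesgue B)" by (simp only: measure_orthogonal_image[OF g lm])
 also have "... = emeasure lebesgue B" by (rule emeasure_eq_measure2[OF lm, symmetric])
 also have "... = emeasure lborel B" using B by simp
 finally show ?thesis .
qed

context fld
begin

lemma compact_stiefel: "compact (Stf :: (quat^'n^'m) set)"
proof -
 have "norm H = sqrt CARD('n)" if "H \<in> Stf" for H :: "quat^'n^'m"
 proof -
  have "rtr (mat 1 :: quat^'n^'n) = CARD('n)" by (simp add: rtr_def mat_def)
  then show ?thesis using stiefelD[OF that] by (simp add: norm_eq_sqrt_inner inner_rtr)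
 qed
 then have "bounded (Stf :: (quat^'n^'m) set)" by (auto simp: bounded_iff)
 moreover have "closed (Stf :: (quat^'n^'m) set)"
 proof -
  have "closed {H :: quat^'n^'m. adj H**H = mat 1}" by (intro closed_Collect_eq continuous_intros)
  moreover have "closed (Mts :: (quat^'n^'m) set)" by (rule closed_subspace[OF subspace_mats])
  moreover have "Stf = Mts \<inter> {H :: quat^'n^'m. adj H**H = mat 1}" by (auto simp: stiefel_def)
  ultimately show ?thesis by auto
 qed
 ultimately show ?thesis by (simp add: compact_eq_bounded_closed)
qed

lemma sm_space: "stiefel_measure \<beta> \<mu> ==> space \<mu> = Stf"
 using sets_eq_imp_space_eq[of \<mu> "restrict_space borel Stf"]
 by (auto simp: stiefel_measure_def space_restrict_space)

lemma sm_prob: "stiefel_measure \<beta> \<mu> ==> prob_space \<mu>" by (simp add: stiefel_measure_def)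

lemma sm_measurable:
 assumes "stiefel_measure \<beta> \<mu>" "f \<in> borel \<rightarrow>\<^sub>M N"
 shows "f \<in> \<mu> \<rightarrow>\<^sub>M N"
proof -
 have "sets \<mu> = sets (restrict_space borel Stf)" using assms(1) by (simp add: stiefel_measure_def)
 then show ?thesis using measurable_restrict_space1[OF assms(2), of "Stf"] by (simp cong: measurable_cong_sets)
qed

lemma sm_integrable:
 fixes f :: "quat^'n^'m => 'b::{banach, second_countable_topology}"
 assumes \<mu>: "stiefel_measure \<beta> \<mu>" and f: "continuous_on UNIV f"
 shows "integrable \<mu> f"
proof -
 interpret prob_space \<mu> by (rule sm_prob[OF \<mu>])
 have "bounded (f ` Stf)"
  by (intro compact_imp_bounded compact_continuous_image compact_stiefel continuous_on_subset[OF f]) auto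
 then obtain B where "!!H. H \<in> Stf ==> norm (f H) <= B" by (auto simp: bounded_iff)
 then show ?thesis using sm_space[OF \<mu>] f
  by (intro integrable_const_bound[of _ B] sm_measurable[OF \<mu>] borel_measurable_continuous_onI) auto
qed

lemma sm_invariant:
 fixes f :: "quat^'n^'m => 'b::{banach, second_countable_topology}" and U :: "quat^'m^'m"
 assumes \<mu>: "stiefel_measure \<beta> \<mu>" and f: "continuous_on UNIV f" and U: "U \<in> Stf"
 shows "(LINT H|\<mu>. f (U**H)) = (LINT H|\<mu>. f H)"
proof -
 have s: "sets \<mu> = sets (restrict_space borel Stf)" using \<mu> by (simp add: stiefel_measure_def)
 have "(%H. U**H) \<in> borel_measurable \<mu>"
  by (intro sm_measurable[OF \<mu>] borel_measurable_continuous_onI continuous_intros)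
 then have "(%H. U**H) \<in> \<mu> \<rightarrow>\<^sub>M restrict_space borel Stf"
  by (rule measurable_restrict_space2[rotated]) (auto simp: sm_space[OF \<mu>] unitary_mult[OF U])
 then have m: "(%H. U**H) \<in> \<mu> \<rightarrow>\<^sub>M \<mu>" by (simp add: s cong: measurable_cong_sets)
 have "distr \<mu> \<mu> (%H. U**H) = \<mu>" using \<mu> U by (simp add: stiefel_measure_def)
 then have "(LINT H|\<mu>. f H) = (LINT H|distr \<mu> \<mu> (%H. U**H). f H)" by simp
 also have "... = (LINT H|\<mu>. f (U**H))"
  by (rule integral_distr[OF m]) (intro sm_measurable[OF \<mu>] borel_measurable_continuous_onI f)
 finally show ?thesis by simp
qed

lemma sm_cong: "stiefel_measure \<beta> \<mu> ==> (!!H. H \<in> Stf ==> f H = g H) ==> (LINT H|\<mu>. f H) = (LINT H|\<mu>. g H)"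
 for f :: "_ => 'b::{banach, second_countable_topology}"
 by (rule Bochner_Integration.integral_cong[OF refl]) (simp add: sm_space)

lemma sm_const: "stiefel_measure \<beta> \<mu> ==> (LINT H|\<mu>. c) = (c :: 'b::{banach, second_countable_topology})"
 using prob_space.prob_space[OF sm_prob[of \<mu>]] by simp

lemma sm_eqI: "stiefel_measure \<beta> \<mu> ==> (!!H. H \<in> Stf ==> f H = c) ==> (LINT H|\<mu>. f H) = c"
 for c :: "'b::{banach, second_countable_topology}" using sm_cong[of \<mu> f "%_. c"] by (simp only: sm_const)

lemma sm_fubini:
 fixes F :: "quat^'n^'m => quat^'l^'k => real"
 assumes \<mu>: "stiefel_measure \<beta> \<mu>" and \<nu>: "stiefel_measure \<beta> \<nu>"
  and F: "continuous_on UNIV (%p. F (fst p) (snd p))"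
 shows "(LINT H|\<mu>. LINT V|\<nu>. F H V) = (LINT V|\<nu>. LINT H|\<mu>. F H V)"
proof -
 interpret p: pair_prob_space \<mu> \<nu> using sm_prob[OF \<mu>] sm_prob[OF \<nu>]
  by (simp add: pair_prob_space_def pair_sigma_finite_def prob_space_imp_sigma_finite)
 have "bounded ((%p. F (fst p) (snd p)) ` (Stf \<times> Stf))"
  by (intro compact_imp_bounded compact_continuous_image compact_Times compact_stiefel
    continuous_on_subset[OF F]) auto
 then obtain B where B: "!!H V. H \<in> Stf ==> V \<in> Stf ==> norm (F H V) <= B" by (force simp: bounded_iff)
 have fs: "(%p. fst p) \<in> borel_measurable (\<mu> \<Otimes>\<^sub>M \<nu>)" "(%p. snd p) \<in> borel_measurable (\<mu> \<Otimes>\<^sub>M \<nu>)"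
  by (rule measurable_compose[OF measurable_fst sm_measurable[OF \<mu>]], simp,
    rule measurable_compose[OF measurable_snd sm_measurable[OF \<nu>]], simp)
 have "(%p. F (fst p) (snd p)) \<in> borel_measurable (\<mu> \<Otimes>\<^sub>M \<nu>)" using borel_measurable_continuous_Pair[OF fs F] .
 then have "integrable (\<mu> \<Otimes>\<^sub>M \<nu>) (%(H, V). F H V)" using B by (intro p.P.integrable_const_bound[of _ B] AE_I2)
   (auto simp: split_def space_pair_measure sm_space[OF \<mu>] sm_space[OF \<nu>])
 then show ?thesis using p.Fubini_integral[of F] by simp
qed

section \<open>Gram-Schmidt orthonormalization\<close>

definition col :: "quat^'n^'m => 'n => quat^'m"
 where "col W b = (\<chi> a. W$a$b)"

text \<open>Total on all matrices: a zero vector normalizes to 0. Equivariance under unitary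
  matrices and Borel measurability therefore hold without exceptional sets.\<close>

fun gsv :: "quat^'m^'m => nat => quat^'m" where
 "gsv W j = (let u = col W (ith j) - (\<Sum>l<j. rs (gsv W l) (vdot (gsv W l) (col W (ith j)))) in u /\<^sub>R norm u)"

declare gsv.simps [simp del]

definition gsm :: "quat^'m^'m => quat^'m^'m"
 where "gsm W = (\<chi> a b. gsv W (idx b)$a)"

lemma rs_simps: "rs (U *v v) q = U *v rs v q" "rs (r *\<^sub>R v) q = r *\<^sub>R rs v q"
 by (simp_all add: rs_def vec_eq_iff matrix_vector_mult_def sum_distrib_right mult.assoc)

lemma vdot_unitary: "U \<in> Stf ==> vdot (U *v v) (U *v w) = vdot v w" for U :: "quat^'n^'m"
 by (simp add: vdot_adj matrix_vector_mul_assoc stiefelD)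

lemma col_mult: "col (U**W) b = U *v col W b"
 by (simp add: col_def vec_eq_iff matrix_vector_mult_def matrix_matrix_mult_def)

lemma gsv_unitary: "U \<in> Stf ==> gsv (U**W) j = U *v gsv W j" for U :: "quat^'m^'m"
proof (induction j rule: less_induct)
 case (less j)
 have "(\<Sum>l<j. rs (gsv (U**W) l) (vdot (gsv (U**W) l) (col (U**W) (ith j)))) =
  U *v (\<Sum>l<j. rs (gsv W l) (vdot (gsv W l) (col W (ith j))))"
  using less by (simp add: col_mult vdot_unitary rs_simps linear_sum[OF matrix_vector_mul_linear])
 then show ?case by (subst (1 2) gsv.simps)
   (simp only: Let_def col_mult matrix_vector_mult_diff_distrib[symmetric] norm_unitary[OF less.prems]
     matrix_vector_scaleR)
qed

lemma gsm_unitary: "U \<in> Stf ==> gsm (U**W) = U**gsm W" for U :: "quat^'m^'m"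
 unfolding gsm_def gsv_unitary by (simp add: vec_eq_iff matrix_matrix_mult_def matrix_vector_mult_def)

text \<open>The third clause writes each vector through the columns up to \<open>j\<close>; with
  injectivity of \<open>W\<close> it shows that the vector to be normalized is nonzero.\<close>

lemma gsv_orthonormal:
 fixes W :: "quat^'m^'m"
 assumes W: "W \<in> Mts" and inj: "!!v. v \<in> Vcs ==> W *v v = 0 ==> v = 0"
 shows "j < CARD('m) ==> gsv W j \<in> Vcs \<and>
  (\<forall>l\<le>j. vdot (gsv W l) (gsv W j) = (if l = j then 1 else 0)) \<and>
  (\<exists>z\<in>Vcs. gsv W j = W *v z \<and> (\<forall>a. j < idx a --> z$a = 0)) \<and>
  (\<exists>c>0. col W (ith j) = c *\<^sub>R gsv W j + (\<Sum>l<j. rs (gsv W l) (vdot (gsv W l) (col W (ith j)))))"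
proof (induction j rule: less_induct)
 case (less j)
 let ?w = "col W (ith j)"
 define u where "u = ?w - (\<Sum>l<j. rs (gsv W l) (vdot (gsv W l) ?w))"
 have g: "gsv W j = u /\<^sub>R norm u" by (subst gsv.simps) (simp add: u_def Let_def)
 have IH: "gsv W l \<in> Vcs" "!!i. i <= l ==> vdot (gsv W i) (gsv W l) = (if i = l then 1 else 0)"
  "\<exists>z\<in>Vcs. gsv W l = W *v z \<and> (\<forall>a. l < idx a --> z$a = 0)" if "l < j" for l
  using less.IH[OF that] less.prems that by auto
 have w: "?w \<in> Vcs" using W by (auto simp: col_def vecs_def mats_def)
 have uv: "u \<in> Vcs" unfolding u_def using w IH(1)
  by (intro subspace_diff[OF subspace_vecs] subspace_sum[OF subspace_vecs] rs_vecs vdot_F) auto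
 obtain z where z: "!!l. l < j ==> z l \<in> Vcs \<and> gsv W l = W *v z l \<and> (\<forall>a. l < idx a --> z l$a = 0)"
  using IH(3) by metis
 \<comment> \<open>The coordinates of \<open>u\<close> with respect to the columns of
   \<open>W\<close>; coordinate \<open>j\<close> is 1, since the earlier vectors only use earlier
   columns.\<close>
 define y where "y = axis (ith j) 1 - (\<Sum>l<j. rs (z l) (vdot (gsv W l) ?w))"
 have "W *v axis (ith j) 1 = ?w"
  by (simp add: col_def vec_eq_iff matrix_vector_mult_def axis_def if_distrib cong: if_cong)
 then have uy: "u = W *v y"
  using z by (simp add: u_def y_def matrix_vector_mult_diff_distrib linear_sum[OF matrix_vector_mul_linear] rs_simps[symmetric])
 have yv: "y \<in> Vcs" unfolding y_def using w IH(1) z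
  by (intro subspace_diff[OF subspace_vecs] subspace_sum[OF subspace_vecs] rs_vecs vdot_F axis_vecs) auto
 have ya: "y$a = axis (ith j) 1$a" if "j <= idx a" for a using z that by (simp add: y_def rs_def)
 have "y$ith j = 1" using ya[of "ith j"] less.prems by (simp add: axis_def)
 then have "y ~= 0" by auto
 then have u0: "u ~= 0" using inj[OF yv] uy by auto
 have orth: "vdot (gsv W i) u = 0" if i: "i < j" for i
 proof -
  have s: "vdot (gsv W i) (gsv W l) = (if l = i then 1 else 0)" if l: "l < j" for l
   using IH(2)[OF l, of i] IH(2)[OF i, of l] vdot_cnj[of "gsv W l" "gsv W i"] by (cases "i <= l") auto
  have "(\<Sum>l<j. vdot (gsv W i) (gsv W l) * vdot (gsv W l) ?w) = (\<Sum>l<j. if l = i then vdot (gsv W i) ?w else 0)"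
   by (intro sum.cong) (auto simp: s)
  then show ?thesis using i by (simp add: u_def vdot_simps linear_sum[OF linear_vdot])
 qed
 have "vdot (gsv W j) (gsv W j) = 1"
  using u0 by (simp add: g vdot_self vdot_simps power2_norm_eq_inner[symmetric] power2_eq_square of_real_def)
 moreover have "vdot (gsv W l) (gsv W j) = 0" if "l < j" for l using orth[OF that] by (simp add: g vdot_simps)
 moreover have "gsv W j \<in> Vcs" using uv by (simp add: g subspace_scale[OF subspace_vecs])
 moreover have "\<exists>z\<in>Vcs. gsv W j = W *v z \<and> (\<forall>a. j < idx a --> z$a = 0)"
 proof (intro bexI conjI allI impI)
  show "gsv W j = W *v (y /\<^sub>R norm u)" by (simp add: g uy matrix_vector_scaleR)
  show "y /\<^sub>R norm u \<in> Vcs" using yv by (simp add: subspace_scale[OF subspace_vecs])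
  fix a :: 'm assume "j < idx a"
  then have "y$a = 0" using ya[of a] less.prems by (auto simp: axis_def)
  then show "(y /\<^sub>R norm u)$a = 0" by simp
 qed
 moreover have "\<exists>c>0. ?w = c *\<^sub>R gsv W j + (\<Sum>l<j. rs (gsv W l) (vdot (gsv W l) ?w))"
  using u0 by (intro exI[of _ "norm u"]) (simp add: g u_def)
 ultimately show ?case by (auto simp: le_less)
qed

lemma gsm_qr:
 fixes W :: "quat^'m^'m"
 assumes W: "W \<in> Mts" and inj: "!!v. v \<in> Vcs ==> W *v v = 0 ==> v = 0"
 shows "gsm W \<in> Stf" and "!!a b. idx b < idx a ==> (adj (gsm W)**W)$a$b = 0"
proof -
 note gs = gsv_orthonormal[OF W inj]
 have on: "vdot (gsv W (idx a)) (gsv W (idx b)) = (if a = b then 1 else 0)" for a b :: 'm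
  using gs[of "idx b"] gs[of "idx a"] vdot_cnj[of "gsv W (idx b)" "gsv W (idx a)"]
  by (cases "idx a <= idx b") (auto split: if_splits)
 have "adj (gsm W)**gsm W = mat 1"
  using on by (simp add: vec_eq_iff matrix_matrix_mult_def gsm_def mat_def vdot_def[symmetric])
 moreover have "gsm W \<in> Mts" using gs by (auto simp: gsm_def mats_def vecs_def)
 ultimately show "gsm W \<in> Stf" by (simp add: stiefel_def)
 fix a b :: 'm assume ab: "idx b < idx a"
 have 1: "(adj (gsm W)**W)$a$b = vdot (gsv W (idx a)) (col W b)"
  by (simp add: matrix_matrix_mult_def gsm_def vdot_def col_def)
 obtain c where c: "col W b = c *\<^sub>R gsv W (idx b) + (\<Sum>l<idx b. rs (gsv W l) (vdot (gsv W l) (col W b)))"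
  using gs[of "idx b"] by auto
 have z: "vdot (gsv W (idx a)) (gsv W l) = 0" if "l <= idx b" for l
 proof -
  have "l < CARD('m)" using ab that idx_less[of a] by linarith
  then show ?thesis using on[of a "ith l"] ab that by (auto split: if_splits)
 qed
 show "(adj (gsm W)**W)$a$b = 0" unfolding 1 by (subst c) (simp add: vdot_simps linear_sum[OF linear_vdot] z)
qed

text \<open>The QR decomposition of \<open>adj g\<close>, read through adjoints.\<close>

lemma lowtri_unitary_decomposition:
 fixes g :: "quat^'m^'m"
 assumes g: "g \<in> Mts" and inv: "g**gi = mat 1"
 obtains T Q where "lowtri T" "Q \<in> Stf" "g = T**Q"
proof -
 have inj: "v = 0" if "adj g *v v = 0" for v
 proof -
  have "adj gi**adj g = mat 1" using arg_cong[OF inv, of adj] by (simp add: adj_mult)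
  then have "v = adj gi *v (adj g *v v)" by (simp add: matrix_vector_mul_assoc)
  then show ?thesis using that by simp
 qed
 define Q where "Q = gsm (adj g)"
 have Q: "Q \<in> Stf" "!!a b. idx b < idx a ==> (adj Q**adj g)$a$b = 0"
  using gsm_qr[of "adj g"] g inj by (auto simp: Q_def)
 have "lowtri (adj (adj Q**adj g))" using Q g by (auto simp: lowtri_def stiefel_mats)
 moreover have "g = adj (adj Q**adj g)**adj Q"
  by (simp add: adj_mult matrix_mul_assoc[symmetric] unitaryD[OF Q(1)])
 ultimately show ?thesis using that unitary_adj[OF Q(1)] by blast
qed

lemma gsv_measurable: "(%W :: quat^'m^'m. gsv W j) \<in> borel_measurable borel"
proof (induction j rule: less_induct)
 case (less j)
 have col: "(%W :: quat^'m^'m. col W (ith j)) \<in> borel_measurable borel" unfolding col_def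
  by (intro borel_measurable_continuous_onI continuous_on_vec_lambda continuous_on_component continuous_on_id)
 have cont: "continuous_on UNIV (%p :: (quat^'m) \<times> (quat^'m). rs (fst p) (vdot (fst p) (snd p)))"
  unfolding rs_def vdot_def
  by (intro continuous_on_vec_lambda continuous_on_mult continuous_on_sum qcnj_continuous
    continuous_on_component continuous_on_fst continuous_on_snd continuous_on_id)
 have "(%W :: quat^'m^'m. rs (gsv W l) (vdot (gsv W l) (col W (ith j)))) \<in> borel_measurable borel" if "l < j" for l
  using borel_measurable_continuous_Pair[where H="%q w. rs q (vdot q w)", OF less[OF that] col cont] by simp
 then have "(%W :: quat^'m^'m. \<Sum>l<j. rs (gsv W l) (vdot (gsv W l) (col W (ith j)))) \<in> borel_measurable borel"
  by (intro borel_measurable_sum) auto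
 with col have u: "(%W :: quat^'m^'m. col W (ith j) - (\<Sum>l<j. rs (gsv W l) (vdot (gsv W l) (col W (ith j))))) \<in> borel_measurable borel"
  by (intro borel_measurable_diff)
 show ?case by (subst gsv.simps) (use u in \<open>simp add: Let_def\<close>)
qed

lemma gsm_measurable: "(gsm :: quat^'m^'m => _) \<in> borel_measurable borel"
proof -
 have "(%W :: quat^'m^'m. gsm W \<bullet> axis a (axis b q)) = (%W. gsv W (idx b) \<bullet> axis a q)" for a b :: 'm and q
  by (simp add: gsm_def inner_axis fun_eq_iff)
 moreover have "(%W :: quat^'m^'m. gsv W (idx b) \<bullet> v) \<in> borel_measurable borel" for b :: 'm and v :: "quat^'m"
  by (intro borel_measurable_inner gsv_measurable measurable_const) simp
 ultimately have "(%W. gsm W \<bullet> B) \<in> borel_measurable borel" if "B \<in> Basis" for B :: "quat^'m^'m"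
  using that by (auto simp: Basis_vec_def)
 then show ?thesis by (subst borel_measurable_euclidean_space) blast
qed

section \<open>Existence of Haar measure on the unitary group\<close>

definition fproj :: "quat => quat"
 where "fproj q = (if \<beta> = 1 then Quat (qRe q) 0 0 0 else if \<beta> = 2 then Quat (qRe q) (qI q) 0 0 else q)"

lemma fproj_simps: "fproj (x + y) = fproj x + fproj y" "fproj (r *\<^sub>R x) = r *\<^sub>R fproj x" "fproj q \<in> \<F> \<beta>"
 "u \<in> \<F> \<beta> ==> fproj (u * x) = u * fproj x" "u \<in> \<F> \<beta> ==> fproj (x * u) = fproj x * u" "u \<in> \<F> \<beta> ==> fproj u = u"
 using beta by (auto simp: fproj_def quat_simps \<F>_def)

lemma linear_fproj: "linear fproj" by (rule linearI) (simp_all add: fproj_simps)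

text \<open>Projecting from quaternionic matrices lets a single Lebesgue measure serve all three
  scalar fields; multiplication by matrices over the scalars commutes with the projection.\<close>

definition mproj :: "quat^'n^'m => quat^'n^'m"
 where "mproj X = (\<chi> a b. fproj (X$a$b))"

lemma linear_mproj: "linear mproj" by (rule linearI) (simp_all add: mproj_def vec_eq_iff fproj_simps)

lemma mproj_mats: "mproj X \<in> Mts" by (auto simp: mproj_def mats_def fproj_simps)

lemma mproj_id: "X \<in> Mts ==> mproj X = X" by (auto simp: mproj_def mats_def fproj_simps vec_eq_iff)

lemma mproj_mult: "U \<in> Mts ==> mproj (U**X) = U**mproj X"
 "V \<in> Mts ==> mproj (X**V) = mproj X**V"
 by (simp_all add: mproj_def vec_eq_iff matrix_matrix_mult_def linear_sum[OF linear_fproj] fproj_simps mats_def)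

text \<open>Isometric real coordinates (\<open>inner_mc\<close>), over the well-ordered index type
  for which orthogonal maps preserve Lebesgue measure.\<close>

definition mq :: "real^((('m \<times> 'm) \<times> 4) ow) => quat^'m^'m"
 where "mq w = (\<chi> a b. Quat (w$Ow ((a, b), 1)) (w$Ow ((a, b), 2)) (w$Ow ((a, b), 3)) (w$Ow ((a, b), 4)))"

definition mc :: "quat^'m^'m => real^((('m \<times> 'm) \<times> 4) ow)"
 where "mc X = (\<chi> p. case unow p of ((a, b), c) => qcomp (X$a$b) c)"

lemma mq_mc [simp]: "mq (mc X) = X" by (simp add: mq_def mc_def vec_eq_iff qcomp_def)

lemma mc_mq [simp]: "mc (mq w) = w"
proof -
 have "qcomp (Quat (w$Ow (i, 1)) (w$Ow (i, 2)) (w$Ow (i, 3)) (w$Ow (i, 4))) c = w$Ow (i, c)" for i and c :: 4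
  using exhaust_4[of c] by (auto simp: qcomp_def)
 then show ?thesis by (auto simp: mq_def mc_def vec_eq_iff split: ow.split prod.split)
qed

lemma linear_mc: "linear mc"
 by (rule linearI) (simp_all add: mc_def vec_eq_iff qcomp_def quat_simps split: prod.split)

lemma linear_mq: "linear mq" by (rule linearI) (simp_all add: mq_def vec_eq_iff quat_simps)

lemma inner_mc: "mc X \<bullet> mc Y = X \<bullet> Y" for X Y :: "quat^'m^'m"
proof -
 have "mc X \<bullet> mc Y = (\<Sum>p\<in>UNIV. (case unow p of ((a, b), c) => qcomp (X$a$b) c * qcomp (Y$a$b) c))"
  by (auto simp: mc_def inner_vec_def split: prod.split intro!: sum.cong)
 also have "... = (\<Sum>a\<in>UNIV. \<Sum>b\<in>UNIV. \<Sum>c\<in>UNIV. qcomp (X$a$b) c * qcomp (Y$a$b) c)"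
  by (simp add: sum_unow sum_UNIV_prod)
 also have "... = X \<bullet> Y" by (simp add: inner_vec_def sum_4 qcomp_def inner_quat_def)
 finally show ?thesis .
qed

lemma norm_mc: "norm (mc X) = norm X" by (simp add: norm_eq_sqrt_inner inner_mc)

lemma norm_mq: "norm (mq w) = norm w" by (metis norm_mc mc_mq)

text \<open>Draw a matrix uniformly from the unit ball and orthonormalize it. Left multiplication by
  a unitary matrix is an orthogonal map preserving the ball, and Gram-Schmidt commutes with it, so
  the image measure is invariant.\<close>

lemma haar_exists: "\<exists>L :: (quat^'m^'m) measure. stiefel_measure \<beta> L"
proof -
 define D where "D w = hdet (adj (mproj (mq w))**mproj (mq w))" for w :: "real^((('m \<times> 'm) \<times> 4) ow)"
 have contW: "continuous_on UNIV (%w. mproj (mq w))" using linear_compose[OF linear_mq linear_mproj]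
  by (intro linear_continuous_on) (simp add: linear_conv_bounded_linear o_def)
 have contD: "continuous_on UNIV D"
  unfolding D_def by (intro continuous_hp[OF hp_hdet] continuous_intros contW)
 \<comment> \<open>The condition on \<open>D\<close> makes the projected matrix injective.
   \<open>S\<close> contains the nonempty open set \<open>O'\<close>, so the uniform measure on it
   is well defined.\<close>
 define S where "S = {w. norm w <= 1 \<and> D w ~= 0}"
 define O' where "O' = {w. norm w < 1 \<and> D w ~= 0}"
 have "open {w. D w ~= 0}" by (intro open_Collect_neq contD continuous_on_const)
 moreover have "open {w :: real^((('m \<times> 'm) \<times> 4) ow). norm w < 1}"
  by (intro open_Collect_less continuous_intros)
 ultimately have openO: "open O'" unfolding O'_def by (simp add: open_Collect_conj)
 have "closed {w :: real^((('m \<times> 'm) \<times> 4) ow). norm w <= 1}" by (intro closed_Collect_le continuous_intros)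
 then have Sb: "S \<in> sets borel"
  using \<open>open {w. D w ~= 0}\<close> unfolding S_def Collect_conj_eq by (intro sets.Int) auto
 have bS: "bounded S" by (auto simp: S_def bounded_iff)
 \<comment> \<open>Small enough to put a scalar matrix inside the open unit ball.\<close>
 define e where "e = 1 / (1 + norm (mat 1 :: quat^'m^'m))"
 have e: "e > 0" by (simp add: e_def add_pos_nonneg)
 have "mc (e *\<^sub>R mat 1) \<in> O'"
 proof -
  have "norm (mc (e *\<^sub>R mat 1 :: quat^'m^'m)) < 1" by (simp add: norm_mc e_def field_simps add_pos_nonneg)
  moreover have "D (mc (e *\<^sub>R mat 1)) = hdet (dg (%_::'m. e * e))"
   by (simp add: D_def mproj_id matrix_linear_simps dg_one[symmetric] dg_scaleR dg_mult)
  ultimately show ?thesis using e by (simp add: O'_def hdet_dg)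
 qed
 then have "O' ~= {}" by blast
 then have "emeasure lborel O' ~= 0" using open_not_negligible[OF openO] openO
  by (auto simp: negligible_iff_null_sets null_sets_def)
 moreover have "emeasure lborel O' <= emeasure lborel S"
  using Sb by (intro emeasure_mono) (auto simp: O'_def S_def)
 ultimately have S0: "emeasure lborel S ~= 0" by auto
 have Sinf: "emeasure lborel S ~= \<infinity>" using emeasure_bounded_finite[OF bS] by simp
 define \<nu> where "\<nu> = uniform_measure lborel S"
 interpret \<nu>: prob_space \<nu> unfolding \<nu>_def by (rule prob_space_uniform_measure[OF S0 Sinf])
 have s\<nu>: "sets \<nu> = sets borel" by (simp add: \<nu>_def)
 \<comment> \<open>The default \<open>mat 1\<close> keeps all values unitary; it is taken with
   probability 0.\<close>
 define G where "G w = (if w \<in> S then gsm (mproj (mq w)) else mat 1)" for w :: "real^((('m \<times> 'm) \<times> 4) ow)"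
 have inj: "v = 0" if w: "D w ~= 0" and v: "v \<in> Vcs" "mproj (mq w) *v v = 0" for w :: "real^((('m \<times> 'm) \<times> 4) ow)" and v
 proof -
  let ?W = "mproj (mq w)"
  have "psd (adj ?W**?W)" using psd_gg[of "adj ?W"] by (simp add: mproj_mats)
  then have "pdef (adj ?W**?W)" using w by (intro psd_hdet_posdef) (simp_all add: D_def)
  moreover have "v \<bullet> ((adj ?W**?W) *v v) = 0" using v(2) by (simp add: matrix_vector_mul_assoc[symmetric])
  ultimately show ?thesis using v(1) unfolding posdef_def by (metis less_irrefl)
 qed
 have Gst: "G w \<in> Stf" for w using gsm_qr(1)[OF mproj_mats inj] by (auto simp: G_def S_def mat1_stiefel)
 have Gm: "G \<in> \<nu> \<rightarrow>\<^sub>M restrict_space borel Stf"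
 proof (rule measurable_restrict_space2)
  have "(%w. gsm (mproj (mq w))) \<in> borel_measurable borel"
   by (rule measurable_compose[OF borel_measurable_continuous_onI[OF contW] gsm_measurable])
  then have "G \<in> borel_measurable borel" unfolding G_def[abs_def] using Sb by (intro measurable_If_set) auto
  then show "G \<in> borel_measurable \<nu>" by (simp add: s\<nu> cong: measurable_cong_sets)
 qed (use Gst in auto)
 define L where "L = distr \<nu> (restrict_space borel Stf) G"
 have sL: "sets L = sets (restrict_space borel Stf)" by (simp add: L_def)
 have "distr L L (%H. U**H) = L" if U: "U \<in> Stf" for U :: "quat^'m^'m"
 proof -
  define f where "f w = mc (U**mq w)" for w :: "real^((('m \<times> 'm) \<times> 4) ow)"
  have linU: "linear (%X. U**X)" by (rule linearI) (simp_all add: matrix_linear_simps)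
  have normU: "norm (U**X) = norm X" for X :: "quat^'m^'m"
   by (simp add: norm_eq_sqrt_inner inner_rtr adj_mult matrix_mul_assoc[symmetric])
    (simp add: matrix_mul_assoc stiefelD[OF U])
  have f: "orthogonal_transformation f" unfolding orthogonal_transformation
   using linear_compose[OF linear_compose[OF linear_mq linU] linear_mc]
   by (auto simp: f_def[abs_def] o_def norm_mc normU norm_mq)
  have Df: "D (f w) = D w" for w
   using U by (simp add: D_def f_def mproj_mult stiefel_mats adj_mult matrix_mul_assoc[symmetric])
    (simp add: matrix_mul_assoc stiefelD[OF U])
  have fS: "f w \<in> S \<longleftrightarrow> w \<in> S" for w using orthogonal_transformation_norm[OF f] by (simp add: S_def Df)
  have fm: "f \<in> borel_measurable borel" using orthogonal_transformation_linear[OF f]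
   by (intro borel_measurable_continuous_onI linear_continuous_on) (simp add: linear_conv_bounded_linear)
  have f\<nu>: "distr \<nu> \<nu> f = \<nu>"
  proof (rule measure_eqI)
   fix A assume "A \<in> sets (distr \<nu> \<nu> f)"
   then have A: "A \<in> sets borel" by (simp add: s\<nu>)
   have fA: "f -` A \<in> sets borel" using measurable_sets[OF fm, of A] A by simp
   have SA: "S \<inter> f -` A = f -` (S \<inter> A)" using fS by auto
   have "emeasure (distr \<nu> \<nu> f) A = emeasure \<nu> (f -` A)"
    using A fm by (subst emeasure_distr) (auto simp: s\<nu> sets_eq_imp_space_eq[OF s\<nu>] cong: measurable_cong_sets)
   also have "... = emeasure lborel (f -` (S \<inter> A)) / emeasure lborel S"
    unfolding \<nu>_def SA[symmetric] using Sb fA by (intro emeasure_uniform_measure) auto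
   also have "... = emeasure lborel (S \<inter> A) / emeasure lborel S"
    using Sb A bS by (subst emeasure_orthogonal_vimage[OF f]) (auto intro: bounded_subset)
   also have "... = emeasure \<nu> A"
    unfolding \<nu>_def using Sb A by (intro emeasure_uniform_measure[symmetric]) auto
   finally show "emeasure (distr \<nu> \<nu> f) A = emeasure \<nu> A" .
  qed simp
  have Gf: "G (f w) = U**G w" if "w \<in> S" for w
   using that U by (simp add: G_def fS) (simp add: f_def mproj_mult stiefel_mats gsm_unitary)
  have AE: "AE w in \<nu>. w \<in> S" unfolding \<nu>_def using Sb by (intro AE_uniform_measureI) auto
  have UL: "(%H. U**H) \<in> restrict_space borel Stf \<rightarrow>\<^sub>M restrict_space borel Stf"
   by (intro measurable_restrict_space3 borel_measurable_continuous_onI continuous_intros)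
    (use unitary_mult[OF U] in auto)
  have "distr L L (%H. U**H) = distr L (restrict_space borel Stf) (%H. U**H)"
   by (rule distr_cong) (simp_all add: sL)
  also have "... = distr \<nu> (restrict_space borel Stf) (%w. U**G w)"
   unfolding L_def by (subst distr_distr[OF UL Gm]) (simp add: o_def)
  also have "... = distr \<nu> (restrict_space borel Stf) (%w. G (f w))"
  proof (rule distr_cong_AE)
   show "AE w in \<nu>. U**G w = G (f w)" using AE by eventually_elim (simp add: Gf)
   show "(%w. U**G w) \<in> \<nu> \<rightarrow>\<^sub>M restrict_space borel Stf" by (rule measurable_compose[OF Gm UL])
   show "(%w. G (f w)) \<in> \<nu> \<rightarrow>\<^sub>M restrict_space borel Stf"
    by (rule measurable_compose[OF _ Gm]) (use fm in \<open>simp add: s\<nu> cong: measurable_cong_sets\<close>)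
  qed simp_all
  also have "... = distr (distr \<nu> \<nu> f) (restrict_space borel Stf) G"
   by (subst distr_distr[OF Gm]) (use fm in \<open>simp_all add: s\<nu> o_def cong: measurable_cong_sets\<close>)
  also have "... = L" unfolding f\<nu> L_def ..
  finally show ?thesis .
 qed
 moreover have "prob_space L" unfolding L_def by (rule \<nu>.prob_space_distr[OF Gm])
 ultimately have "stiefel_measure \<beta> L" by (simp add: stiefel_measure_def sL)
 then show ?thesis ..
qed

end

section \<open>Spherical functions\<close>

text \<open>Lagrange interpolation. It replaces taking the second-order coefficient (j = 2) and
  continuation to a Hermitian matrix (j = 0) by finite sums of values, which commute with
  integrals.\<close>

lemma poly_weights:
 fixes t :: "nat => real"
 assumes inj: "inj_on t {..k}"
 shows "\<exists>v. \<forall>p. degree p <= k --> (\<Sum>i\<le>k. v i * poly p (t i)) = coeff p j"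
proof (intro exI allI impI)
 define l where "l i = (\<Prod>n\<in>{..k} - {i}. smult (1 / (t i - t n)) [:- t n, 1:])" for i
 fix p :: "real poly" assume p: "degree p <= k"
 have dl: "degree (l i) <= k" if "i <= k" for i
 proof -
  have "degree (l i) <= (\<Sum>n\<in>{..k} - {i}. degree (smult (1 / (t i - t n)) [:- t n, 1:]))"
   unfolding l_def using degree_prod_sum_le[of "{..k} - {i}" "%n. smult (1 / (t i - t n)) [:- t n, 1:]"]
   by (simp add: o_def)
  also have "... <= (\<Sum>n\<in>{..k} - {i}. 1)" by (intro sum_mono) auto
  also have "... = k" using that by simp
  finally show ?thesis .
 qed
 have pl: "poly (l i) (t n) = (if n = i then 1 else 0)" if "i <= k" "n <= k" for i n
 proof (cases "n = i")
  case True
  have "poly (l i) (t i) = (\<Prod>n\<in>{..k} - {i}. 1)" unfolding l_def poly_prod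
  proof (rule prod.cong)
   fix n assume "n \<in> {..k} - {i}"
   then have "t i ~= t n" using inj that by (auto simp: inj_on_def)
   then show "poly (smult (1 / (t i - t n)) [:- t n, 1:]) (t i) = 1"
    by (simp add: diff_divide_distrib[symmetric])
  qed simp
  then show ?thesis using True by simp
 next
  case False
  then show ?thesis
   unfolding l_def poly_prod using that by (simp add: prod_zero_iff) (metis DiffI atMost_iff singletonD)
 qed
 define q where "q = (\<Sum>i\<le>k. smult (poly p (t i)) (l i))"
 have "degree q <= k" unfolding q_def by (intro degree_sum_le) (auto intro: order_trans[OF degree_smult_le] dl)
 moreover have "poly q (t n) = poly p (t n)" if "n <= k" for n
 proof -
  have "poly q (t n) = (\<Sum>i\<le>k. if n = i then poly p (t i) else 0)"
   unfolding q_def poly_sum by (intro sum.cong) (auto simp: pl that)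
  then show ?thesis using that by simp
 qed
 moreover have "card (t ` {..k}) = Suc k" using inj by (simp add: card_image)
 ultimately have "p = q" using p by (intro poly_eqI_degree[of "t ` {..k}"]) auto
 moreover have "coeff q j = (\<Sum>i\<le>k. coeff (l i) j * poly p (t i))" by (simp add: q_def coeff_sum mult.commute)
 ultimately show "(\<Sum>i\<le>k. coeff (l i) j * poly p (t i)) = coeff p j" by simp
qed

text \<open>Ordered words give each monomial several times, but spare the multinomial coefficients
  in \<open>inner_power_words\<close>.\<close>

definition words :: "nat => 'a::euclidean_space list set"
 where "words k = {w. set w \<subseteq> Basis \<and> length w = k}"

definition wmon :: "'a::euclidean_space list => 'a => real"
 where "wmon w X = (\<Prod>b\<leftarrow>w. X \<bullet> b)"

lemma finite_words [simp]: "finite (words k)" unfolding words_def by (rule finite_lists_length_eq) simp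

lemma words_0 [simp]: "words 0 = {[]}" by (auto simp: words_def)

lemma sum_words_Suc:
 fixes f :: "'b::euclidean_space list => real"
 shows "(\<Sum>w\<in>words (Suc n). f w) = (\<Sum>b\<in>Basis. \<Sum>w\<in>words n. f (b # w))"
proof -
 have "words (Suc n) = (%(b, w). b # w) ` (Basis \<times> (words n :: 'b list set))"
  by (auto simp: words_def length_Suc_conv image_iff)
 moreover have "inj_on (%(b, w). b # w) (Basis \<times> (words n :: 'b list set))" by (auto simp: inj_on_def)
 ultimately have "(\<Sum>w\<in>words (Suc n). f w) = (\<Sum>p\<in>Basis \<times> words n. f (case p of (b, w) => b # w))"
  by (simp only: sum.reindex o_def)
 then show ?thesis by (simp add: sum.cartesian_product split_def)
qed

lemma wmon_simps [simp]: "wmon [] X = 1" "wmon (b # w) X = (X \<bullet> b) * wmon w X" by (simp_all add: wmon_def)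

lemma wmon_append: "wmon (v @ w) X = wmon v X * wmon w X" by (simp add: wmon_def)

lemma inner_power_words: "(X \<bullet> Y) ^ k = (\<Sum>w\<in>words k. wmon w X * wmon w Y)"
proof (induction k)
 case (Suc k)
 have "(X \<bullet> Y) ^ Suc k = (X \<bullet> Y) * (\<Sum>w\<in>words k. wmon w X * wmon w Y)" by (simp only: power_Suc Suc)
 also have "... = (\<Sum>b\<in>Basis. \<Sum>w\<in>words k. wmon (b # w) X * wmon (b # w) Y)"
  by (subst euclidean_inner[of X Y]) (simp add: sum_product mult_ac)
 finally show ?case by (simp add: sum_words_Suc)
qed simp

lemma wmon_hp: "hp (length w) (wmon w)"
proof (induction w)
 case Nil
 then show ?case using hp_const[of 1] by (simp add: wmon_def[abs_def])
next
 case (Cons b w)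
 then show ?case using hp_mult[OF hp_inner, of "length w" "wmon w" b] by (simp add: wmon_simps(2)[abs_def])
qed

lemma wmon_linear:
 assumes "linear l"
 shows "wmon w (l X) = (\<Sum>v\<in>words (length w). (\<Prod>(b, c)\<leftarrow>zip w v. l c \<bullet> b) * wmon v X)"
proof (induction w)
 case (Cons b w)
 have "l X = (\<Sum>c\<in>Basis. (X \<bullet> c) *\<^sub>R l c)" using linear_sum[OF assms, of "%c. (X \<bullet> c) *\<^sub>R c" Basis]
  by (simp add: linear_cmul[OF assms] euclidean_representation)
 then have "l X \<bullet> b = (\<Sum>c\<in>Basis. (X \<bullet> c) * (l c \<bullet> b))" by (simp add: inner_sum_left)
 then have "wmon (b # w) (l X) = (\<Sum>c\<in>Basis. (X \<bullet> c) * (l c \<bullet> b)) * (\<Sum>v\<in>words (length w). (\<Prod>(b, c)\<leftarrow>zip w v. l c \<bullet> b) * wmon v X)"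
  by (simp add: Cons)
 also have "... = (\<Sum>c\<in>Basis. \<Sum>v\<in>words (length w). (\<Prod>(b, c)\<leftarrow>zip (b # w) (c # v). l c \<bullet> b) * wmon (c # v) X)"
  by (simp add: sum_product mult_ac)
 finally show ?case by (simp only: sum_words_Suc list.size add_Suc_right add_0_right)
qed simp

lemma hp_words: "hp k F ==> \<exists>\<phi>. \<forall>X. F X = (\<Sum>w\<in>words k. \<phi> w * wmon w X)"
proof (induction rule: hp.induct)
 case (hp_const c)
 then show ?case by (intro exI[of _ "%_. c"]) simp
next
 case (hp_inner b)
 have "X \<bullet> b = (\<Sum>w\<in>words 1. (b \<bullet> hd w) * wmon w X)" for X
  using sum_words_Suc[of "%w. (b \<bullet> hd w) * wmon w X" 0] euclidean_inner[of X b] by (simp add: mult.commute)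
 then show ?case by (intro exI[of _ "%w. b \<bullet> hd w"] allI)
next
 case (hp_add k F G)
 then obtain f g where "\<forall>X. F X = (\<Sum>w\<in>words k. f w * wmon w X)" "\<forall>X. G X = (\<Sum>w\<in>words k. g w * wmon w X)"
  by blast
 then show ?case by (intro exI[of _ "%w. f w + g w"]) (simp add: sum.distrib distrib_right)
next
 case (hp_mult i F j G)
 then obtain f g where fg: "\<forall>X. F X = (\<Sum>w\<in>words i. f w * wmon w X)" "\<forall>X. G X = (\<Sum>w\<in>words j. g w * wmon w X)"
  by blast
 have "F X * G X = (\<Sum>w\<in>words (i + j). (f (take i w) * g (drop i w)) * wmon w X)" for X
 proof -
  have bij: "bij_betw (%(v, w). v @ w) (words i \<times> words j) (words (i + j))"
   by (rule bij_betw_byWitness[of _ "%w. (take i w, drop i w)"])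
    (auto simp: words_def dest: in_set_takeD in_set_dropD)
  have "(\<Sum>w\<in>words (i + j). (f (take i w) * g (drop i w)) * wmon w X) =
   (\<Sum>(v, w)\<in>words i \<times> words j. (f v * g w) * (wmon v X * wmon w X))"
   unfolding sum.reindex_bij_betw[OF bij, symmetric] by (intro sum.cong) (auto simp: words_def wmon_append)
  then show ?thesis using fg by (simp add: sum_product sum.cartesian_product mult_ac)
 qed
 then show ?case by (intro exI[of _ "%w. f (take i w) * g (drop i w)"] allI)
qed

context fld
begin

section \<open>Averages over the unitary group\<close>

definition haar :: "(quat^'m^'m) measure"
 where "haar = (SOME L. stiefel_measure \<beta> L)"

lemma haar: "stiefel_measure \<beta> haar" unfolding haar_def by (rule someI_ex[OF haar_exists])

lemmas haar_cong = sm_cong[OF haar]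
lemmas LINT_sum = Bochner_Integration.integral_sum
lemmas haar_const = sm_const[OF haar]
lemmas haar_eqI = sm_eqI[OF haar]

lemma haar_int: "hp k F ==> continuous_on UNIV f ==> integrable haar (%U. F (f U))"
 by (rule sm_integrable[OF haar continuous_hp])

definition kavg :: "(quat^'m^'m => real) => quat^'m^'m => real"
 where "kavg F A = (LINT V|haar. F (adj V**A**V))"

lemma kavg_integrable: "hp k F ==> integrable haar (%V. F (adj V**A**V))"
 by (intro sm_integrable[OF haar] continuous_hp[of k F] continuous_intros)

lemma kavg_conj:
 fixes U :: "quat^'m^'m"
 assumes F: "hp k F" and U: "U \<in> Stf"
 shows "kavg F (U**A**adj U) = kavg F A"
proof -
 have "(LINT V|haar. F (adj (adj U**V)**A**(adj U**V))) = (LINT V|haar. F (adj V**A**V))"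
  by (rule sm_invariant[OF haar _ unitary_adj[OF U]]) (intro continuous_hp[OF F] continuous_intros)
 then show ?thesis by (simp add: kavg_def adj_mult matrix_mul_assoc)
qed

text \<open>Expansion in words separates the dependence on \<open>A\<close> from that on
  \<open>V\<close>, so the integral only changes coefficients.\<close>

lemma hp_kavg:
 fixes F :: "quat^'m^'m => real"
 assumes F: "hp k F"
 shows "hp k (kavg F)"
proof -
 obtain \<phi> where \<phi>: "!!X. F X = (\<Sum>w\<in>words k. \<phi> w * wmon w X)" using hp_words[OF F] by blast
 define cf where "cf w v V = (\<Prod>(b, c)\<leftarrow>zip w v. (adj V**c**V) \<bullet> b)" for w v :: "(quat^'m^'m) list" and V :: "quat^'m^'m"
 have cont: "continuous_on UNIV (cf w v)" for w v
 proof -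
  have "continuous_on UNIV (%V :: quat^'m^'m. \<Prod>(b, c)\<leftarrow>xs. (adj V**c**V) \<bullet> b)" for xs
   by (induction xs) (auto intro!: continuous_intros simp: split_def)
  then show ?thesis unfolding cf_def .
 qed
 have int: "integrable haar (cf w v)" for w v by (rule sm_integrable[OF haar cont])
 have "F (adj V**A**V) = (\<Sum>w\<in>words k. \<phi> w * (\<Sum>v\<in>words k. cf w v V * wmon v A))" for V A
  unfolding \<phi> by (intro sum.cong refl) (auto simp: wmon_linear[OF linear_conj] cf_def words_def)
 then have "kavg F A = (\<Sum>w\<in>words k. \<phi> w * (\<Sum>v\<in>words k. (LINT V|haar. cf w v V) * wmon v A))" for A
  by (simp add: kavg_def int integral_sum)
 then have "kavg F = (%A. \<Sum>w\<in>words k. \<phi> w * (\<Sum>v\<in>words k. (LINT V|haar. cf w v V) * wmon v A))" by blast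
 moreover have "hp k (wmon v)" if "v \<in> words k" for v :: "(quat^'m^'m) list"
  using wmon_hp[of v] that by (simp add: words_def)
 then have "hp k (%A. \<Sum>w\<in>words k. \<phi> w * (\<Sum>v\<in>words k. (LINT V|haar. cf w v V) * wmon v A))"
  by (intro hp_sum hp_cmult)
 ultimately show ?thesis by simp
qed

definition phi :: "(nat => nat) => quat^'m^'m => real"
 where "phi la = kavg (powf la)"

lemma hp_phi: "la \<in> parts CARD('m) k ==> hp k (phi la :: quat^'m^'m => real)"
 unfolding phi_def by (intro hp_kavg hp_powf)

lemma phi_conj: "la \<in> parts CARD('m) k ==> U \<in> Stf ==> phi la (U**A**adj U) = phi la A" for U :: "quat^'m^'m"
 unfolding phi_def by (rule kavg_conj[OF hp_powf])

lemma phi_one: "phi la (mat 1 :: quat^'m^'m) = 1"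
 unfolding phi_def kavg_def by (rule haar_eqI) (simp add: stiefelD powf_one)

lemma psd_conj': "psd X ==> g \<in> Mts ==> psd (adj g**X**g)" using psd_conj[of X "adj g"] by simp

lemma kavg_mono_const:
 fixes A :: "quat^'m^'m"
 assumes "hp k F" "!!V. V \<in> Stf ==> F (adj V**A**V) <= c"
 shows "kavg F A <= c"
proof -
 have "kavg F A <= (LINT V|(haar :: (quat^'m^'m) measure). c)" unfolding kavg_def using assms
  by (intro integral_mono kavg_integrable sm_integrable[OF haar]) (auto simp: sm_space[OF haar])
 then show ?thesis by (simp only: haar_const)
qed

lemma kavg_ge_const:
 fixes A :: "quat^'m^'m"
 assumes "hp k F" "!!V. V \<in> Stf ==> c <= F (adj V**A**V)"
 shows "c <= kavg F A"
proof -
 have "(LINT V|(haar :: (quat^'m^'m) measure). c) <= kavg F A" unfolding kavg_def using assms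
  by (intro integral_mono kavg_integrable sm_integrable[OF haar]) (auto simp: sm_space[OF haar])
 then show ?thesis by (simp only: haar_const)
qed

lemma qbound_conj:
 fixes U :: "quat^'n^'m"
 assumes "U \<in> Stf" "qbound r X"
 shows "qbound r (adj U**X**U)" unfolding qbound_def
proof
 fix v :: "quat^'n" assume v: "v \<in> Vcs"
 have "v \<bullet> ((adj U**X**U) *v v) = (U *v v) \<bullet> (X *v (U *v v))"
  using inner_adj[of v "adj U" "X *v (U *v v)"] by (simp add: matrix_vector_mul_assoc matrix_mul_assoc)
 moreover have "(U *v v) \<bullet> (U *v v) = v \<bullet> v" using norm_unitary[OF assms(1), of v] by (simp add: norm_eq)
 moreover have "U *v v \<in> Vcs" using v assms(1) by (simp add: mats_vecs stiefel_mats)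
 ultimately show "\<bar>v \<bullet> ((adj U**X**U) *v v)\<bar> <= r * (v \<bullet> v)" using assms(2) unfolding qbound_def by metis
qed

lemma phi_qbound1:
 fixes A :: "quat^'m^'m"
 assumes k: "la \<in> parts CARD('m) k" and A: "A \<in> Hrm" "qbound 1 A"
 shows "\<bar>phi la A\<bar> <= 1"
proof -
 have "\<bar>powf la (adj V**A**V)\<bar> <= 1" if "V \<in> Stf" for V :: "quat^'m^'m"
  using that A by (intro powf_qbound qbound_conj) (auto simp: stiefel_mats)
 then have "phi la A <= 1" "-1 <= phi la A"
  unfolding phi_def using kavg_mono_const[OF hp_powf[OF k], of A 1] kavg_ge_const[OF hp_powf[OF k], of "-1" A]
  by (auto simp: abs_le_iff)
 then show ?thesis by (simp add: abs_le_iff)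
qed

lemma qbound_scale: "qbound r X ==> 0 <= c ==> qbound (c * r) (c *\<^sub>R X)"
 unfolding qbound_def by (auto simp: matrix_vector_scaleR abs_mult mult.assoc intro!: mult_left_mono)

lemma qbound_zero:
 fixes A :: "quat^'m^'m"
 assumes "A \<in> Hrm" "qbound 0 A"
 shows "A = 0"
proof -
 obtain U :: "quat^'m^'m" and x where U: "U \<in> Stf" and AU: "A = U**dg x**adj U" by (rule spectral[OF assms(1)])
 have "x a = 0" for a using assms(2) unfolding AU qbound_unitary[OF U] by simp
 then have "dg x = 0" by (simp add: vec_eq_iff)
 then show ?thesis by (simp add: AU)
qed

lemma phi_qbound:
 fixes A :: "quat^'m^'m"
 assumes k: "la \<in> parts CARD('m) k" and A: "A \<in> Hrm" "qbound r A" and r: "0 <= r"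
 shows "\<bar>phi la A\<bar> <= r ^ k"
proof (cases "r = 0")
 case True
 then have A0: "A = 0" using A qbound_zero by blast
 show ?thesis
 proof (cases "k = 0")
  case True
  then show ?thesis using hp_scale[OF hp_phi[OF k], of 0 "mat 1"] phi_one[of la, where 'm='m] by (simp add: A0)
 next
  case False
  then show ?thesis using hp_scale[OF hp_phi[OF k], of 0 "mat 1"] \<open>r = 0\<close> by (simp add: A0 zero_power)
 qed
next
 case False
 with r have r: "0 < r" by simp
 have "qbound 1 ((1 / r) *\<^sub>R A)" using qbound_scale[OF A(2), of "1 / r"] r by simp
 then have "\<bar>phi la ((1 / r) *\<^sub>R A)\<bar> <= 1" using A by (intro phi_qbound1[OF k]) auto
 moreover have "phi la A = r ^ k * phi la ((1 / r) *\<^sub>R A)"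
  using hp_scale[OF hp_phi[OF k], of r "(1 / r) *\<^sub>R A"] r by simp
 ultimately show ?thesis using r by (simp add: abs_mult mult_left_le)
qed

lemma posdef_conj:
 fixes X g :: "quat^'m^'m"
 assumes X: "pdef X" and g: "g \<in> Mts" and gi: "gi**g = mat 1"
 shows "pdef (adj g**X**g)"
proof -
 have "0 < v \<bullet> ((adj g**X**g) *v v)" if v: "v \<in> Vcs" "v ~= 0" for v
 proof -
  have "g *v v ~= 0"
  proof
   assume "g *v v = 0"
   then have "gi *v (g *v v) = 0" by simp
   then show False using v(2) by (simp add: matrix_vector_mul_assoc gi)
  qed
  moreover have "v \<bullet> ((adj g**X**g) *v v) = (g *v v) \<bullet> (X *v (g *v v))"
   using inner_adj[of v "adj g" "X *v (g *v v)"] by (simp add: matrix_vector_mul_assoc matrix_mul_assoc)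
  ultimately show ?thesis using X v(1) g unfolding posdef_def by (simp add: mats_vecs)
 qed
 then show ?thesis using X g by (simp add: posdef_def)
qed

definition permm :: "('m::finite => 'm) => quat^'m^'m"
 where "permm p = (\<chi> a b. if p a = b then 1 else 0)"

lemma permm_conj_nth: "(permm p**X**adj (permm p))$a$b = X$p a$p b"
proof -
 have PX: "(permm p**X)$a$b = X$p a$b" for X :: "quat^'a^'a" and a b
  using sum_delta_mult(1)[of "p a" 1 "%k. X$k$b"] by (simp add: permm_def matrix_matrix_mult_def)
 have XP: "(X**adj (permm p))$a$b = X$a$p b" for X :: "quat^'a^'a" and a b
 proof -
  have "(X**adj (permm p))$a$b = (\<Sum>k\<in>UNIV. X$a$k * (if k = p b then 1 else 0))"
   by (auto simp: permm_def matrix_matrix_mult_def intro!: sum.cong)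
  then show ?thesis by (simp only: sum_delta_mult mult_1_right)
 qed
 show ?thesis by (simp only: PX XP)
qed

lemma permm_dg: "inj p ==> permm p**dg x**adj (permm p) = dg (x \<circ> p)"
 unfolding vec_eq_iff permm_conj_nth by (simp add: inj_eq)

lemma permm_unitary: "inj p ==> permm p \<in> Stf"
proof -
 assume "inj p"
 then have "permm p**adj (permm p) = mat 1" using permm_dg[of p "%_. 1"] by (simp add: dg_one o_def)
 moreover have "permm p \<in> Mts" by (auto simp: permm_def mats_def)
 ultimately show ?thesis using matrix_left_right_inverse_quat by (auto simp: stiefel_def)
qed

definition dlist :: "real list => quat^'m^'m"
 where "dlist xs = dg (%a. xs ! idx a)"

lemma permute_dg:
 assumes \<pi>: "\<pi> permutes {..<CARD('m::finite)}"
 obtains W :: "quat^'m^'m" where "W \<in> Stf" "!!x. dg (%a. x (\<pi> (idx a))) = W**dg (%a. x (idx a))**adj W"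
proof -
 define p :: "'m => 'm" where "p a = ith (\<pi> (idx a))" for a
 have ip: "idx (p a) = \<pi> (idx a)" for a using permutes_in_image[OF \<pi>, of "idx a"] by (simp add: p_def)
 have "inj p"
 proof (rule injI)
  fix a b assume "p a = p b"
  then have "\<pi> (idx a) = \<pi> (idx b)" by (metis ip)
  then show "a = b" using permutes_inj[OF \<pi>] by (simp add: inj_eq)
 qed
 from that[OF permm_unitary[OF this]] permm_dg[OF this] show thesis by (simp add: o_def ip)
qed

lemma permuted_diagonal:
 fixes U :: "quat^'m^'m"
 assumes U: "U \<in> Stf" and xs: "mset xs = image_mset x (mset_set UNIV)"
 obtains W :: "quat^'m^'m" where "W \<in> Stf" "U**dg x**adj U = W**dlist xs**adj W"
proof -
 define ys where "ys = map (%i. x (ith i)) [0..<CARD('m)]"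
 have "mset ys = image_mset (%i. x (ith i)) (mset_set {..<CARD('m)})" by (simp add: ys_def lessThan_atLeast0)
 also have "mset_set {..<CARD('m)} = image_mset idx (mset_set (UNIV :: 'm set))"
  using idx_bij[where 'm='m] by (simp add: image_mset_mset_set bij_betw_def)
 finally have "mset ys = mset xs" by (simp add: xs multiset.map_comp o_def)
 then obtain q where q: "q permutes {..<length xs}" "permute_list q xs = ys" by (rule mset_eq_permutation)
 have len: "length xs = CARD('m)" using arg_cong[OF \<open>mset ys = mset xs\<close>, of size] by (simp add: ys_def)
 have xq: "x a = xs ! q (idx a)" for a
 proof -
  have "ys ! idx a = x a" by (simp add: ys_def)
  then show ?thesis using q by (simp add: permute_list_def len flip: q(2))
 qed
 obtain W :: "quat^'m^'m" where W: "W \<in> Stf" "dg (%a. xs ! q (idx a)) = W**dlist xs**adj W"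
  using permute_dg[of q] q(1) unfolding len dlist_def by metis
 then have "U**dg x**adj U = (U**W)**dlist xs**adj (U**W)" by (simp add: xq[abs_def] adj_mult matrix_mul_assoc)
 then show ?thesis using that unitary_mult[OF U W(1)] by blast
qed

lemma spectral_list:
 fixes A :: "quat^'m^'m"
 assumes "A \<in> Hrm" "mset xs = mset (spec A)"
 obtains W :: "quat^'m^'m" where "W \<in> Stf" "A = W**dlist xs**adj W"
proof -
 obtain U :: "quat^'m^'m" and x where U: "U \<in> Stf" and AU: "A = U**dg x**adj U" by (rule spectral[OF assms(1)])
 have "mset xs = image_mset x (mset_set UNIV)" using assms(2) unfolding AU mset_eigvals[OF U] .
 then obtain W :: "quat^'m^'m" where "W \<in> Stf" "U**dg x**adj U = W**dlist xs**adj W"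
  using permuted_diagonal[OF U] by blast
 then show ?thesis using that unfolding AU by blast
qed

lemma phi_dlist:
 fixes A :: "quat^'m^'m"
 assumes "la \<in> parts CARD('m) k" "A \<in> Hrm" "mset xs = mset (spec A)"
 shows "phi la A = phi la (dlist xs :: quat^'m^'m)"
proof -
 obtain W :: "quat^'m^'m" where W: "W \<in> Stf" and A: "A = W**dlist xs**adj W"
  by (rule spectral_list[OF assms(2,3)])
 show ?thesis unfolding A by (rule phi_conj[OF assms(1) W])
qed

lemma phi_eigvals_cong:
 fixes A B :: "quat^'m^'m"
 assumes "la \<in> parts CARD('m) k" "A \<in> Hrm" "B \<in> Hrm" "mset (spec A) = mset (spec B)"
 shows "phi la A = phi la B"
 using phi_dlist[OF assms(1,2) assms(4)[symmetric]] phi_dlist[OF assms(1,3) refl] by simp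

section \<open>The functional equation of the spherical functions\<close>

lemma unitary_lq:
 fixes g V :: "quat^'m^'m"
 assumes g: "g \<in> Mts" "gi**g = mat 1" and V: "V \<in> Stf"
 obtains T Q where "lowtri T" "T**adj T = adj V**(adj g**g)**V" "Q \<in> Stf"
  "!!X. adj V**(adj g**X**g)**V = T**(Q**X**adj Q)**adj T"
proof -
 define h where "h = adj V**adj g"
 have adjh: "g**V = adj h" by (simp add: h_def adj_mult)
 have "h**(adj gi**V) = adj V**(adj g**adj gi)**V" by (simp add: h_def matrix_mul_assoc)
 then have "h**(adj gi**V) = mat 1" using g V by (simp add: stiefelD flip: adj_mult)
 moreover have "h \<in> Mts" using g V by (simp add: h_def stiefel_mats)
 ultimately obtain T Q where T: "lowtri T" and Q: "Q \<in> Stf" and h: "h = T**Q"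
  using lowtri_unitary_decomposition by metis
 have c: "adj V**(adj g**X**g)**V = T**(Q**X**adj Q)**adj T" for X
 proof -
  have "adj V**(adj g**X**g)**V = h**X**adj h"
   by (simp only: adjh[symmetric]) (simp only: h_def matrix_mul_assoc)
  then show ?thesis by (simp only: h adj_mult matrix_mul_assoc)
 qed
 have "T**adj T = adj V**(adj g**g)**V" using c[of "mat 1"] by (simp add: unitaryD[OF Q])
 then show thesis using that T Q c by blast
qed

text \<open>Integrate over \<open>V\<close> last: for fixed \<open>V\<close> the triangular factor
  comes out of \<open>powf\<close> as a scalar, and the unitary factor is absorbed by the invariance
  of \<mu>.\<close>

lemma phi_functional_eq:
 fixes \<mu> :: "(quat^'n^'m) measure" and g :: "quat^'m^'m"
 assumes \<mu>: "stiefel_measure \<beta> \<mu>" and k: "la \<in> parts CARD('m) k" and B: "B \<in> Hrm"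
  and g: "g \<in> Mts" and gi: "gi**g = mat 1"
 shows "(LINT H|\<mu>. phi la (adj g**(H**B**adj H)**g)) =
  phi la (adj g**g) * (LINT H|\<mu>. powf la (H**B**adj H))"
proof -
 have cont: "continuous_on UNIV (%p :: (quat^'n^'m) \<times> (quat^'m^'m). powf la (adj (snd p)**(adj g**(fst p**B**adj (fst p))**g)**snd p))"
  by (intro continuous_hp[OF hp_powf[OF k]] continuous_intros)
 have contR: "continuous_on UNIV (%H :: quat^'n^'m. powf la (H**B**adj H) :: real)"
  by (intro continuous_hp[OF hp_powf[OF k]] continuous_intros)
 have inner: "(LINT H|\<mu>. powf la (adj V**(adj g**(H**B**adj H)**g)**V)) =
   powf la (adj V**(adj g**g)**V) * (LINT H|\<mu>. powf la (H**B**adj H))"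
  if V: "V \<in> Stf" for V :: "quat^'m^'m"
 proof -
  obtain T Q where T: "lowtri T" "T**adj T = adj V**(adj g**g)**V" and Q: "Q \<in> Stf"
   "!!X. adj V**(adj g**X**g)**V = T**(Q**X**adj Q)**adj T" by (rule unitary_lq[OF g gi V]) blast
  have "powf la (adj V**(adj g**(H**B**adj H)**g)**V) =
    powf la (T**adj T) * powf la ((Q**H)**B**adj (Q**H))" if "H \<in> Stf" for H
  proof -
   have "Q**(H**B**adj H)**adj Q = (Q**H)**B**adj (Q**H)" by (simp add: adj_mult matrix_mul_assoc)
   then show ?thesis unfolding Q(2) using B Q(1) that by (simp add: powf_lowtri[OF T(1)] stiefel_mats)
  qed
  then have "(LINT H|\<mu>. powf la (adj V**(adj g**(H**B**adj H)**g)**V)) =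
    (LINT H|\<mu>. powf la (T**adj T) * powf la ((Q**H)**B**adj (Q**H)))" by (rule sm_cong[OF \<mu>])
  also have "... = powf la (T**adj T) * (LINT H|\<mu>. powf la (H**B**adj H))"
   by (simp add: sm_invariant[OF \<mu> contR Q(1)])
  finally show ?thesis unfolding T(2) .
 qed
 have "(LINT H|\<mu>. phi la (adj g**(H**B**adj H)**g)) =
   (LINT V|haar. LINT H|\<mu>. powf la (adj V**(adj g**(H**B**adj H)**g)**V))"
  unfolding phi_def kavg_def by (rule sm_fubini[OF \<mu> haar cont])
 also have "... = (LINT V|haar. powf la (adj V**(adj g**g)**V) * (LINT H|\<mu>. powf la (H**B**adj H)))"
  by (rule haar_cong) (rule inner)
 also have "... = phi la (adj g**g) * (LINT H|\<mu>. powf la (H**B**adj H))" by (simp add: phi_def kavg_def)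
 finally show ?thesis .
qed

text \<open>The constant is found at g = 1, where the integrand does not depend on \<open>H\<close>:
  the eigenvalues of \<open>H**B**adj H\<close> are those of \<open>B\<close> padded with
  zeros.\<close>

lemma phi_integral:
 fixes \<mu> :: "(quat^'n^'m) measure" and g :: "quat^'m^'m" and H0 :: "quat^'n^'m"
 assumes \<mu>: "stiefel_measure \<beta> \<mu>" and k: "la \<in> parts CARD('m) k" and B: "B \<in> Hrm"
  and g: "g \<in> Mts" and gi: "gi**g = mat 1" and H0: "H0 \<in> Stf"
 shows "(LINT H|\<mu>. phi la (adj g**(H**B**adj H)**g)) =
  phi la (adj g**g) * phi la (H0**B**adj H0)"
proof -
 have "(LINT H|\<mu>. phi la (adj (mat 1)**(H**B**adj H)**mat 1)) =
   phi la (adj (mat 1)**mat 1 :: quat^'m^'m) * (LINT H|\<mu>. powf la (H**B**adj H))"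
  by (rule phi_functional_eq[OF \<mu> k B, of _ "mat 1"]) auto
 also have "(LINT H|\<mu>. phi la (adj (mat 1)**(H**B**adj H)**mat 1)) = (LINT H|\<mu>. phi la (H0**B**adj H0))"
  using B H0 by (intro Bochner_Integration.integral_cong refl phi_eigvals_cong[OF k])
   (auto simp: sm_space[OF \<mu>] stiefel_mats eigvals_stiefel_conj)
 finally have "(LINT H|\<mu>. powf la (H**B**adj H)) = phi la (H0**B**adj H0)"
  by (simp only: sm_const[OF \<mu>] phi_one adj_mat1 matrix_mul_lid mult_1_left)
 then show ?thesis using phi_functional_eq[OF \<mu> k B g gi] by simp
qed

lemma phi_integral_haar:
 fixes B g :: "quat^'m^'m"
 assumes "la \<in> parts CARD('m) k" "B \<in> Hrm" "g \<in> Mts" "gi**g = mat 1"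
 shows "(LINT U|haar. phi la (adj g**(U**B**adj U)**g)) = phi la (adj g**g) * phi la B"
 using phi_integral[OF haar assms mat1_stiefel] by (simp only: matrix_mul_lid adj_mat1 matrix_mul_rid)

end

section \<open>Homogeneous polynomials in exponent form\<close>

lemma finite_expos [simp]: "finite (expos m k)"
proof (rule finite_subset)
 show "expos m k \<subseteq> {e. \<forall>i. (i \<in> {..<m} --> e i \<in> {..k}) \<and> (i \<notin> {..<m} --> e i = 0)}"
  by (auto simp: expos_def intro: member_le_sum)
 show "finite {e. \<forall>i. (i \<in> {..<m} --> e i \<in> {..k}) \<and> (i \<notin> {..<m} --> e i = (0::nat))}"
  by (rule finite_set_of_finite_funs) auto
qed

lemma expos_le: "e \<in> expos m k ==> e i <= k" by (cases "i < m") (auto simp: expos_def intro: member_le_sum)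

lemma finite_parts [simp]: "finite (parts m k)" unfolding parts_def by simp

lemma expos_mono: "n <= m ==> expos n k \<subseteq> expos m k"
proof
 fix e assume nm: "n <= m" and "e \<in> expos n k"
 then have e: "!!i. i >= n ==> e i = 0" "(\<Sum>i<n. e i) = k" by (auto simp: expos_def)
 have "(\<Sum>i<m. e i) = (\<Sum>i<n. e i)" using nm e(1) by (intro sum.mono_neutral_right) auto
 then show "e \<in> expos m k" using e nm by (auto simp: expos_def)
qed

lemma parts_mono: "n <= m ==> parts n k \<subseteq> parts m k" using expos_mono by (auto simp: parts_def)

definition xmon :: "nat => (nat => nat) => (nat => real) => real"
 where "xmon m e x = (\<Prod>i<m. x i ^ e i)"

lemma hpoly_xmon: "hpoly m k c x = (\<Sum>e\<in>expos m k. c e * xmon m e x)" by (simp add: hpoly_def xmon_def)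

lemma hpoly_add: "hpoly m k (%e. c e + d e) x = hpoly m k c x + hpoly m k d x"
 and hpoly_cmult: "hpoly m k (%e. r * c e) x = r * hpoly m k c x"
 and hpoly_diff: "hpoly m k (%e. c e - d e) x = hpoly m k c x - hpoly m k d x"
 by (simp_all add: hpoly_xmon sum.distrib distrib_right sum_distrib_left sum_subtractf left_diff_distrib mult.assoc)

lemma hpoly_sum: "hpoly m k (%e. \<Sum>a\<in>A. f a e) x = (\<Sum>a\<in>A. hpoly m k (f a) x)"
 unfolding hpoly_xmon sum_distrib_right by (rule sum.swap)

lemma hpoly_cong: "(!!e. e \<in> expos m k ==> c e = d e) ==> hpoly m k c x = hpoly m k d x" by (simp add: hpoly_def)

lemma expos_add: "a \<in> expos m j ==> b \<in> expos m k ==> (%i. a i + b i) \<in> expos m (j + k)"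
 by (auto simp: expos_def sum.distrib)

lemma xmon_add: "xmon m (%i. a i + b i) x = xmon m a x * xmon m b x"
 by (simp add: xmon_def power_add prod.distrib)

lemma hpoly_mult:
 "hpoly m j c x * hpoly m k d x = hpoly m (j + k)
  (%e. \<Sum>(a, b)\<in>{p \<in> expos m j \<times> expos m k. (%i. fst p i + snd p i) = e}. c a * d b) x"
proof -
 let ?S = "expos m j \<times> expos m k"
 let ?g = "%p i. fst p i + snd p i"
 have "hpoly m j c x * hpoly m k d x = (\<Sum>p\<in>?S. c (fst p) * d (snd p) * xmon m (?g p) x)"
  by (simp add: hpoly_xmon sum_product sum.cartesian_product split_def xmon_add mult_ac)
 also have "... = (\<Sum>e\<in>expos m (j + k). \<Sum>p\<in>{p \<in> ?S. ?g p = e}. c (fst p) * d (snd p) * xmon m (?g p) x)"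
  by (rule sum.group[symmetric]) (auto intro: expos_add)
 also have "... = (\<Sum>e\<in>expos m (j + k). (\<Sum>p\<in>{p \<in> ?S. ?g p = e}. c (fst p) * d (snd p)) * xmon m e x)"
  unfolding sum_distrib_right by (intro sum.cong) auto
 finally show ?thesis by (simp add: hpoly_xmon split_def)
qed

definition isH :: "nat => nat => ((nat => real) => real) => bool"
 where "isH m k f \<longleftrightarrow> (\<exists>c. \<forall>x. f x = hpoly m k c x)"

lemma isH_hpoly: "isH m k (hpoly m k c)" by (auto simp: isH_def)

lemma isH_add: "isH m k f ==> isH m k g ==> isH m k (%x. f x + g x)"
proof -
 assume "isH m k f" "isH m k g"
 then obtain c d where "f = hpoly m k c" "g = hpoly m k d" by (auto simp: isH_def fun_eq_iff)
 then show ?thesis by (simp add: hpoly_add[symmetric] isH_hpoly)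
qed

lemma isH_cmult: "isH m k f ==> isH m k (%x. r * f x)"
proof -
 assume "isH m k f"
 then obtain c where "f = hpoly m k c" by (auto simp: isH_def fun_eq_iff)
 then show ?thesis by (simp add: hpoly_cmult[symmetric] isH_hpoly)
qed

lemma isH_zero: "isH m k (%_. 0)" unfolding isH_def by (intro exI[of _ "%_. 0"]) (simp add: hpoly_def)

lemma isH_sum: "(!!a. a \<in> A ==> isH m k (f a)) ==> isH m k (%x. \<Sum>a\<in>A. f a x)"
 by (induction A rule: infinite_finite_induct) (auto intro: isH_zero isH_add)

lemma isH_mult: "isH m j f ==> isH m k g ==> isH m (j + k) (%x. f x * g x)"
proof -
 assume "isH m j f" "isH m k g"
 then obtain c d where "f = hpoly m j c" "g = hpoly m k d" by (auto simp: isH_def fun_eq_iff)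
 then show ?thesis by (simp add: hpoly_mult isH_hpoly)
qed

lemma expos_0 [simp]: "expos m 0 = {%_. 0}"
proof
 show "expos m 0 \<subseteq> {%_. 0}"
 proof
  fix e assume "e \<in> expos m 0"
  then have "e i = 0" for i by (cases "i < m") (auto simp: expos_def)
  then show "e \<in> {%_. 0}" by auto
 qed
qed (auto simp: expos_def)

lemma isH_const: "isH m 0 (%_. r)" unfolding isH_def by (intro exI[of _ "%_. r"]) (simp add: hpoly_def)

lemma isH_var:
 assumes "i < m"
 shows "isH m 1 (%x. x i)"
proof -
 let ?e = "(%_. 0)(i := 1) :: nat => nat"
 have s: "?e \<in> expos m 1" using assms by (auto simp: expos_def sum.If_cases fun_upd_def)
 have "xmon m ?e x = x i" for x
 proof -
  have "xmon m ?e x = (\<Prod>j<m. if j = i then x i else 1)" unfolding xmon_def by (intro prod.cong) auto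
  then show ?thesis using assms by simp
 qed
 then have "x i = hpoly m 1 (%e. if e = ?e then 1 else 0) x" for x
  unfolding hpoly_xmon using s by (simp add: if_distrib[of "%z. z * _"] cong: if_cong)
 then show ?thesis unfolding isH_def by blast
qed

text \<open>The number with digits e 0, ..., e (m-1) in base B; for digits below B the lexicographic
  order becomes the numerical one.\<close>

fun wt :: "nat => nat => (nat => nat) => nat" where
 "wt B 0 e = 0"
| "wt B (Suc m) e = B * wt B m e + e m"

lemma wt_cong: "(!!i. i < m ==> e i = f i) ==> wt B m e = wt B m f" by (induction m) auto

lemma wt_lex:
 assumes "!!i. e i < B" "i < m" "e i < f i" "!!j. j < i ==> e j = f j"
 shows "wt B m e < wt B m f" using assms(2)
proof (induction m)
 case (Suc m)
 show ?case
 proof (cases "i = m")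
  case True
  have "wt B m e = wt B m f" by (rule wt_cong) (rule assms(4), simp add: True)
  then show ?thesis using assms(3) True by simp
 next
  case False
  then have "wt B m e + 1 <= wt B m f" using Suc by simp
  then have "B * (wt B m e + 1) <= B * wt B m f" by (rule mult_le_mono2)
  then show ?thesis using assms(1)[of m] by simp
 qed
qed simp

definition lexl :: "(nat => nat) => (nat => nat) => bool"
 where "lexl e f \<longleftrightarrow> (\<exists>i. e i < f i \<and> (\<forall>j<i. e j = f j))"

lemma lexl_wt:
 assumes "e \<in> expos m k" "f \<in> expos m k" "lexl e f"
 shows "wt (Suc k) m e < wt (Suc k) m f"
proof -
 obtain i where i: "e i < f i" "!!j. j < i ==> e j = f j" using assms(3) by (auto simp: lexl_def)
 have "i < m" using assms(2) i(1) by (cases "i < m") (auto simp: expos_def)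
 then show ?thesis using i expos_le[OF assms(1)] by (intro wt_lex[of e "Suc k" i]) (auto simp: less_Suc_eq_le)
qed

lemma lexl_total: "e ~= f ==> lexl e f \<or> lexl f e"
proof -
 assume "e ~= f"
 then have ex: "\<exists>i. e i ~= f i" by auto
 define i where "i = (LEAST i. e i ~= f i)"
 have "e i ~= f i" unfolding i_def by (rule LeastI_ex[OF ex])
 moreover have "e j = f j" if "j < i" for j
  using not_less_Least[of j "%i. e i ~= f i"] that by (auto simp: i_def)
 ultimately show ?thesis unfolding lexl_def by (metis nat_neq_iff)
qed

lemma wt_inj: "e \<in> expos m k ==> f \<in> expos m k ==> wt (Suc k) m e = wt (Suc k) m f ==> e = f"
 using lexl_total lexl_wt by (metis less_irrefl)

text \<open>The Kronecker substitution; along it the monomials are ordered lexicographically.\<close>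

definition kron :: "nat => nat => real => nat => real"
 where "kron B m t i = t ^ (B ^ (m - Suc i))"

lemma xmon_kron: "xmon m e (kron B m t) = t ^ wt B m e"
proof (induction m)
 case (Suc m)
 have k: "kron B (Suc m) t i = kron B m t i ^ B" if "i < m" for i
  using that by (simp add: kron_def power_mult[symmetric] Suc_diff_Suc mult.commute flip: power_Suc)
 have "xmon (Suc m) e (kron B (Suc m) t) = (\<Prod>i<m. kron B (Suc m) t i ^ e i) * t ^ e m"
  by (simp add: xmon_def) (simp add: kron_def)
 also have "(\<Prod>i<m. kron B (Suc m) t i ^ e i) = (\<Prod>i<m. (kron B m t i ^ e i) ^ B)"
  by (intro prod.cong refl) (simp add: k power_mult[symmetric] mult.commute)
 also have "... = xmon m e (kron B m t) ^ B" by (simp add: xmon_def prod_power_distrib)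
 finally show ?case using Suc by (simp add: power_add power_mult[symmetric] mult.commute)
qed (simp add: xmon_def)

lemma kron_pos: "t > 0 ==> kron B m t i > 0" by (simp add: kron_def)

lemma kron_less: "t > 1 ==> B > 1 ==> i < j ==> j < m ==> kron B m t j < kron B m t i"
 by (simp add: kron_def power_strict_increasing)

lemma kron_inj: "t > 1 ==> B > 1 ==> inj_on (kron B m t) {..<m}"
 using kron_less[of t B] by (auto simp: inj_on_def) (metis less_irrefl linorder_neqE_nat)

lemma hpoly_kron: "hpoly m k c (kron B m t) = poly (\<Sum>e\<in>expos m k. monom (c e) (wt B m e)) t"
 by (simp add: hpoly_xmon xmon_kron poly_sum poly_monom)

text \<open>The base k + 1 exceeds every exponent, so distinct monomials become distinct powers of
  t.\<close>

lemma hpoly_zeroD: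
 assumes "!!t. t > 1 ==> hpoly m k c (kron (Suc k) m t) = 0" "e \<in> expos m k"
 shows "c e = 0"
proof -
 let ?p = "\<Sum>e\<in>expos m k. monom (c e) (wt (Suc k) m e)"
 have "?p = 0" by (rule poly_eq_eventually[of 1]) (use assms(1) hpoly_kron in auto)
 then have "0 = coeff ?p (wt (Suc k) m e)" by simp
 also have "... = (\<Sum>f\<in>expos m k. if f = e then c e else 0)"
  unfolding coeff_sum using wt_inj[OF _ assms(2)] by (intro sum.cong) auto
 finally show ?thesis using assms(2) by simp
qed

lemma hpoly_unique:
 assumes "!!x. (!!i. 0 < x i) ==> hpoly m k c x = hpoly m k d x" "e \<in> expos m k"
 shows "c e = d e"
proof -
 have "hpoly m k (%e. c e - d e) (kron (Suc k) m t) = 0" if "t > 1" for t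
  using assms(1)[of "kron (Suc k) m t"] kron_pos[of t] that by (simp add: hpoly_diff)
 then show ?thesis using hpoly_zeroD[of m k "%e. c e - d e" e] assms(2) by simp
qed

definition symc :: "nat => nat => ((nat => nat) => real) => bool"
 where "symc m k c \<longleftrightarrow> (\<forall>\<pi> e. \<pi> permutes {..<m} --> e \<in> expos m k --> c (e \<circ> \<pi>) = c e)"

lemma expos_permute: "\<pi> permutes {..<m} ==> e \<in> expos m k ==> e \<circ> \<pi> \<in> expos m k"
 using sum.reindex_bij_betw[OF permutes_imp_bij, of \<pi> "{..<m}" e]
 by (simp add: expos_def permutes_not_in[of \<pi> "{..<m}"])

lemma hpoly_permute:
 assumes \<pi>: "\<pi> permutes {..<m}"
 shows "hpoly m k c (x \<circ> \<pi>) = hpoly m k (%e. c (e \<circ> \<pi>)) x"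
proof -
 have x: "xmon m (e \<circ> \<pi>) (x \<circ> \<pi>) = xmon m e x" for e
  unfolding xmon_def o_def using prod.reindex_bij_betw[OF permutes_imp_bij[OF \<pi>], of "%i. x i ^ e i"] .
 have bij: "bij_betw (%e. e \<circ> \<pi>) (expos m k) (expos m k)" by (rule bij_betw_byWitness[of _ "%e. e \<circ> inv \<pi>"])
   (auto simp only: comp_assoc permutes_inv_o[OF \<pi>] comp_id ball_simps
    intro!: expos_permute[OF \<pi>] expos_permute[OF permutes_inv[OF \<pi>]])
 have "hpoly m k c (x \<circ> \<pi>) = (\<Sum>e\<in>expos m k. c (e \<circ> \<pi>) * xmon m (e \<circ> \<pi>) (x \<circ> \<pi>))"
  unfolding hpoly_xmon by (rule sum.reindex_bij_betw[OF bij, symmetric])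
 then show ?thesis by (simp add: x hpoly_xmon)
qed

lemma symcI:
 assumes "!!\<pi> x. \<pi> permutes {..<m} ==> (!!i. 0 < x i) ==> hpoly m k c (x \<circ> \<pi>) = hpoly m k c x"
 shows "symc m k c" unfolding symc_def
proof (intro allI impI)
 fix \<pi> e assume \<pi>: "\<pi> permutes {..<m}" and e: "e \<in> expos m k"
 have "hpoly m k (%e. c (e \<circ> \<pi>)) x = hpoly m k c x" if "!!i. 0 < x i" for x
  using assms[OF \<pi> that] unfolding hpoly_permute[OF \<pi>] .
 from hpoly_unique[OF this e] show "c (e \<circ> \<pi>) = c e" .
qed

lemma symc_diff: "symc m k c ==> symc m k d ==> symc m k (%e. c e - r * d e)" by (simp add: symc_def)

section \<open>The Laplace--Beltrami operator on monomials\<close>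

lemma pderiv_at_sum:
 assumes S: "finite S" and i: "i < m"
 shows "pderiv_at i (%x. \<Sum>e\<in>S. c e * xmon m (h e) x) x =
  (\<Sum>e\<in>S. (c e * real (h e i)) * xmon m ((h e)(i := h e i - 1)) x)"
proof -
 have split: "xmon m n (x(i := t)) = t ^ n i * (\<Prod>j\<in>{..<m} - {i}. x j ^ n j)" for n t
  unfolding xmon_def using i by (subst prod.remove[of _ i]) auto
 have "((%t. \<Sum>e\<in>S. c e * xmon m (h e) (x(i := t))) has_field_derivative
  (\<Sum>e\<in>S. c e * (real (h e i) * x i ^ (h e i - 1) * (\<Prod>j\<in>{..<m} - {i}. x j ^ h e j)))) (at (x i))"
  unfolding split by (auto intro!: derivative_eq_intros sum.cong)
 moreover have "xmon m ((h e)(i := h e i - 1)) x = x i ^ (h e i - 1) * (\<Prod>j\<in>{..<m} - {i}. x j ^ h e j)" for e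
  using split[of "(h e)(i := h e i - 1)" "x i"] by simp
 ultimately show ?thesis unfolding pderiv_at_def by (subst DERIV_imp_deriv) (auto simp: mult.assoc)
qed

lemma pderiv_at_hpoly: "i < m ==> pderiv_at i (hpoly m k c) x =
  (\<Sum>e\<in>expos m k. (c e * real (e i)) * xmon m (e(i := e i - 1)) x)"
 unfolding hpoly_xmon[abs_def] by (rule pderiv_at_sum) auto

lemma xmon_lower: "i < m ==> e i > 0 ==> x i * xmon m (e(i := e i - 1)) x = xmon m e x"
 unfolding xmon_def by (subst (1 2) prod.remove[of _ i]) (auto simp flip: power_Suc)

lemma euler_hpoly: "i < m ==> x i * pderiv_at i (hpoly m k c) x = (\<Sum>e\<in>expos m k. c e * real (e i) * xmon m e x)"
 unfolding pderiv_at_hpoly sum_distrib_left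
proof (intro sum.cong refl)
 fix e assume "i < m"
 then show "x i * ((c e * real (e i)) * xmon m (e(i := e i - 1)) x) = c e * real (e i) * xmon m e x"
  using xmon_lower[of i m e x] by (cases "e i = 0") (simp_all add: mult.left_commute)
qed

lemma euler2_hpoly:
 assumes i: "i < m"
 shows "(x i)\<^sup>2 * pderiv_at i (pderiv_at i (hpoly m k c)) x =
  (\<Sum>e\<in>expos m k. c e * (real (e i) * (real (e i) - 1)) * xmon m e x)"
proof -
 have "pderiv_at i (hpoly m k c) = (%x. \<Sum>e\<in>expos m k. (c e * real (e i)) * xmon m (e(i := e i - 1)) x)"
  using pderiv_at_hpoly[OF i] by blast
 then have D: "pderiv_at i (pderiv_at i (hpoly m k c)) x =
  (\<Sum>e\<in>expos m k. (c e * real (e i) * real (e i - 1)) * xmon m (e(i := e i - 1 - 1)) x)"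
  by (simp add: pderiv_at_sum[OF _ i])
 have T: "(x i)\<^sup>2 * ((c e * real (e i) * real (e i - 1)) * xmon m (e(i := e i - 1 - 1)) x) =
  c e * (real (e i) * (real (e i) - 1)) * xmon m e x" for e
 proof (cases "e i <= 1")
  case True
  then have "e i = 0 \<or> e i = 1" by auto
  then show ?thesis by auto
 next
  case False
  have "(x i)\<^sup>2 * xmon m (e(i := e i - 1 - 1)) x = xmon m e x"
   using xmon_lower[of i m "e(i := e i - 1)" x] xmon_lower[of i m e x] i False
   by (simp add: power2_eq_square mult.assoc)
  then show ?thesis using False by (simp add: of_nat_diff mult.left_commute)
 qed
 show ?thesis unfolding D sum_distrib_left by (intro sum.cong refl T)
qed

text \<open>The differential operator maps the monomial x^e to this multiple of itself, where the
  multiplier still depends on x.\<close>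

definition jw :: "nat => nat => (nat => real) => (nat => nat) => real"
 where "jw \<beta> m x e = (\<Sum>i<m. real (e i) * (real (e i) - 1)) +
  real \<beta> * (\<Sum>i<m. \<Sum>j\<in>{..<m} - {i}. real (e i) * (x i / (x i - x j)))"

lemma jack_op_hpoly: "jack_op \<beta> m (hpoly m k c) x = (\<Sum>e\<in>expos m k. c e * xmon m e x * jw \<beta> m x e)"
proof -
 have "(\<Sum>i<m. \<Sum>j\<in>{..<m} - {i}. (x i)\<^sup>2 / (x i - x j) * pderiv_at i (hpoly m k c) x) =
  (\<Sum>i<m. \<Sum>j\<in>{..<m} - {i}. (x i / (x i - x j)) * (\<Sum>e\<in>expos m k. c e * real (e i) * xmon m e x))"
  by (intro sum.cong refl) (simp add: euler_hpoly[symmetric] power2_eq_square)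
 also have "... = (\<Sum>i<m. \<Sum>j\<in>{..<m} - {i}. \<Sum>e\<in>expos m k. c e * xmon m e x * (real (e i) * (x i / (x i - x j))))"
  unfolding sum_distrib_left by (intro sum.cong refl) (simp add: mult_ac)
 also have "... = (\<Sum>e\<in>expos m k. c e * xmon m e x * (\<Sum>i<m. \<Sum>j\<in>{..<m} - {i}. real (e i) * (x i / (x i - x j))))"
 proof -
  have "(\<Sum>i<m. \<Sum>j\<in>{..<m} - {i}. \<Sum>e\<in>expos m k. g e i j) = (\<Sum>e\<in>expos m k. \<Sum>i<m. \<Sum>j\<in>{..<m} - {i}. g e i j)"
   for g :: "_ => _ => _ => real" by (subst sum.swap[of _ "expos m k"]) (intro sum.cong refl sum.swap)
  then show ?thesis by (simp only: sum_distrib_left)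
 qed
 finally have 1: "(\<Sum>i<m. \<Sum>j\<in>{..<m} - {i}. (x i)\<^sup>2 / (x i - x j) * pderiv_at i (hpoly m k c) x) = ..." .
 have "(\<Sum>i<m. (x i)\<^sup>2 * pderiv_at i (pderiv_at i (hpoly m k c)) x) =
  (\<Sum>i<m. \<Sum>e\<in>expos m k. c e * xmon m e x * (real (e i) * (real (e i) - 1)))"
  by (intro sum.cong refl) (simp add: euler2_hpoly mult_ac)
 also have "... = (\<Sum>e\<in>expos m k. c e * xmon m e x * (\<Sum>i<m. real (e i) * (real (e i) - 1)))"
  by (subst sum.swap) (simp add: sum_distrib_left)
 finally show ?thesis
  unfolding jack_op_def 1 by (simp add: jw_def distrib_left sum.distrib sum_distrib_left mult.left_commute)
qed

text \<open>The limit of \<open>jw\<close> for widely separated variables: x_i / (x_i - x_j) tends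
  to 1 for i < j and to 0 for j < i, and m - 1 - i counts the former.\<close>

definition rho :: "nat => nat => (nat => nat) => real"
 where "rho \<beta> m e = (\<Sum>i<m. real (e i) * (real (e i) - 1)) +
  real \<beta> * (\<Sum>i<m. real (e i) * (real m - 1 - real i))"

lemma tendsto_power_quot:
 assumes "a < (b::nat)"
 shows "((%t::real. t ^ a / t ^ b) \<longlongrightarrow> 0) at_top"
proof -
 have "((%t::real. inverse (t ^ (b - a))) \<longlongrightarrow> 0) at_top"
  using assms by (intro tendsto_inverse_0_at_top filterlim_pow_at_top filterlim_ident) auto
 moreover have "\<forall>\<^sub>F t in at_top. inverse (t ^ (b - a)) = t ^ a / (t::real) ^ b"
  using eventually_gt_at_top[of 0] by eventually_elim (use assms in \<open>simp add: power_diff field_simps\<close>)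
 ultimately show ?thesis by (rule Lim_transform_eventually)
qed

lemma tendsto_jw:
 assumes B: "B > 1"
 shows "((%t. jw \<beta> m (kron B m t) e) \<longlongrightarrow> rho \<beta> m e) at_top"
proof -
 let ?q = "%i j t. kron B m t i / (kron B m t i - kron B m t j)"
 have lim1: "(?q i j \<longlongrightarrow> 1) at_top" if ij: "i < j" "j < m" for i j
 proof -
  define a b where "a = B ^ (m - Suc j)" and "b = B ^ (m - Suc i)"
  have "a < b" using B ij by (simp add: a_def b_def power_strict_increasing)
  then have "((%t::real. 1 / (1 - t ^ a / t ^ b)) \<longlongrightarrow> 1 / (1 - 0)) at_top"
   by (intro tendsto_intros tendsto_power_quot) auto
  moreover have "\<forall>\<^sub>F t in at_top. 1 / (1 - t ^ a / t ^ b) = ?q i j t" using eventually_gt_at_top[of 0]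
   by eventually_elim (simp add: kron_def a_def b_def divide_simps)
  ultimately have "(?q i j \<longlongrightarrow> 1 / (1 - 0)) at_top" by (rule Lim_transform_eventually)
  then show ?thesis by simp
 qed
 have lim: "(?q i j \<longlongrightarrow> (if i < j then 1 else 0)) at_top" if ij: "i < m" "j \<in> {..<m} - {i}" for i j
 proof (cases "i < j")
  case True
  then show ?thesis using lim1 ij by simp
 next
  case False
  then have ji: "j < i" using ij by auto
  have "\<forall>\<^sub>F t in at_top. 1 - ?q j i t = ?q i j t" using eventually_gt_at_top[of 1]
  proof eventually_elim
   fix t :: real assume "t > 1"
   from kron_less[OF this B ji ij(1)] show "1 - ?q j i t = ?q i j t" by (simp add: field_simps)
  qed
  from Lim_transform_eventually[OF tendsto_diff[OF tendsto_const lim1[OF ji ij(1)]] this]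
  show ?thesis using False by simp
 qed
 have "(\<Sum>j\<in>{..<m} - {i}. real (e i) * (if i < j then 1 else 0)) = real (e i) * (real m - 1 - real i)"
  if "i < m" for i
 proof -
  have "(\<Sum>j\<in>{..<m} - {i}. real (e i) * (if i < j then 1 else 0)) = (\<Sum>j\<in>{i<..<m}. real (e i))"
   by (rule sum.mono_neutral_cong_right) auto
  then show ?thesis using that by (simp add: of_nat_diff mult.commute)
 qed
 then have "rho \<beta> m e = (\<Sum>i<m. real (e i) * (real (e i) - 1)) +
  real \<beta> * (\<Sum>i<m. \<Sum>j\<in>{..<m} - {i}. real (e i) * (if i < j then 1 else 0))" by (simp add: rho_def)
 then show ?thesis
  unfolding jw_def by (simp only:) (intro tendsto_add tendsto_mult tendsto_sum tendsto_const lim; simp)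
qed

text \<open>The eigenvalue is read off the leading monomial by letting \<open>x\<^sub>1 \<gg> x\<^sub>2 \<gg> \<dots>\<close>.\<close>

lemma jack_eigenvalue:
 assumes eig: "!!x. inj_on x {..<m} ==> jack_op \<beta> m (hpoly m k c) x = r * hpoly m k c x"
  and l: "l \<in> expos m k" "c l ~= 0"
  and lead: "!!e. e \<in> expos m k ==> c e ~= 0 ==> e ~= l ==> lexl e l"
 shows "r = rho \<beta> m l"
proof (cases "k = 0")
 case True
 define x where "x i = real i" for i
 have "inj_on x {..<m}" by (auto simp: inj_on_def x_def)
 from eig[OF this] show ?thesis using True l by (simp add: jack_op_hpoly hpoly_xmon jw_def rho_def xmon_def)
next
 case False
 \<comment> \<open>Only for k > 0 is this base above 1, so that the substituted points are distinct;
   hence the separate case k = 0.\<close>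
 define B where "B = Suc k"
 have B: "B > 1" using False by (simp add: B_def)
 define w where "w e = wt B m e" for e
 have lim: "((%t. c e * (t ^ w e / t ^ w l) * g t) \<longlongrightarrow> (if e = l then c l * G else 0)) at_top"
  if e: "e \<in> expos m k" and g: "(g \<longlongrightarrow> G) at_top" for e and g :: "real => real" and G
 proof (cases "e = l")
  case True
  have ev: "\<forall>\<^sub>F t in at_top. c l * g t = c l * (t ^ w l / t ^ w l) * g t"
   using eventually_gt_at_top[of 0] by eventually_elim simp
  have "((%t. c l * g t) \<longlongrightarrow> c l * G) at_top" by (intro tendsto_mult tendsto_const g)
  from Lim_transform_eventually[OF this ev]
  have "((%t. c l * (t ^ w l / t ^ w l) * g t) \<longlongrightarrow> c l * G) at_top" .
  then show ?thesis using True by simp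
 next
  case False
  show ?thesis
  proof (cases "c e = 0")
   case True
   then show ?thesis using False by simp
  next
   case ce: False
   have "w e < w l" unfolding w_def B_def by (rule lexl_wt[OF e l(1) lead[OF e ce False]])
   then have "((%t. c e * (t ^ w e / t ^ w l) * g t) \<longlongrightarrow> c e * 0 * G) at_top"
    by (intro tendsto_intros tendsto_power_quot g)
   then show ?thesis using False by simp
  qed
 qed
 have L1: "((%t. \<Sum>e\<in>expos m k. c e * (t ^ w e / t ^ w l) * jw \<beta> m (kron B m t) e) \<longlongrightarrow>
   (\<Sum>e\<in>expos m k. if e = l then c l * rho \<beta> m l else 0)) at_top"
  by (intro tendsto_sum tendsto_eq_rhs[OF lim[OF _ tendsto_jw[OF B]]]) auto
 have L2: "((%t. \<Sum>e\<in>expos m k. c e * (t ^ w e / t ^ w l) * r) \<longlongrightarrow>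
   (\<Sum>e\<in>expos m k. if e = l then c l * r else 0)) at_top" by (intro tendsto_sum lim tendsto_const)
 have "\<forall>\<^sub>F t in at_top. (\<Sum>e\<in>expos m k. c e * (t ^ w e / t ^ w l) * jw \<beta> m (kron B m t) e) =
   (\<Sum>e\<in>expos m k. c e * (t ^ w e / t ^ w l) * r)" using eventually_gt_at_top[of 1]
 proof eventually_elim
  fix t :: real assume t: "t > 1"
  have "(\<Sum>e\<in>expos m k. c e * t ^ w e * jw \<beta> m (kron B m t) e) = r * (\<Sum>e\<in>expos m k. c e * t ^ w e)"
   using eig[OF kron_inj[OF t B]] by (simp add: jack_op_hpoly hpoly_xmon xmon_kron w_def)
  then have "(\<Sum>e\<in>expos m k. c e * t ^ w e * jw \<beta> m (kron B m t) e) / t ^ w l =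
    (r * (\<Sum>e\<in>expos m k. c e * t ^ w e)) / t ^ w l" by simp
  then show "(\<Sum>e\<in>expos m k. c e * (t ^ w e / t ^ w l) * jw \<beta> m (kron B m t) e) =
   (\<Sum>e\<in>expos m k. c e * (t ^ w e / t ^ w l) * r)" by (simp add: sum_divide_distrib sum_distrib_left mult_ac)
 qed
 then have "(\<Sum>e\<in>expos m k. if e = l then c l * r else 0) = (\<Sum>e\<in>expos m k. if e = l then c l * rho \<beta> m l else 0)"
  using tendsto_unique[OF _ Lim_transform_eventually[OF L1] L2] by simp
 then show ?thesis using l by simp
qed

definition dom :: "nat => (nat => nat) => (nat => nat) => bool"
 where "dom m e la \<longleftrightarrow> (\<forall>j\<le>m. (\<Sum>i<j. e i) <= (\<Sum>i<j. la i))"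

lemma dom_lexl:
 assumes "dom m e la" "e \<in> expos m k" "la \<in> expos m k" "e ~= la"
 shows "lexl e la"
proof (rule ccontr)
 assume "\<not> lexl e la"
 then have "lexl la e" using lexl_total[OF assms(4)] by blast
 then obtain i where i: "la i < e i" "!!j. j < i ==> la j = e j" by (auto simp: lexl_def)
 have "i < m" using i(1) assms(2) by (cases "i < m") (auto simp: expos_def)
 then have "(\<Sum>j<Suc i. e j) <= (\<Sum>j<Suc i. la j)" using assms(1) unfolding dom_def by (metis Suc_leI)
 moreover have "(\<Sum>j<i. e j) = (\<Sum>j<i. la j)" using i(2) by (intro sum.cong) auto
 ultimately show False using i(1) by simp
qed

lemma summation_by_parts:
 fixes S w :: "nat => real"
 shows "(\<Sum>i<n. (S (Suc i) - S i) * w i) = S n * w n - S 0 * w 0 + (\<Sum>i<n. S (Suc i) * (w i - w (Suc i)))"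
 by (induction n) (auto simp: algebra_simps)

text \<open>Summation by parts: dominance makes the differences \<open>S\<close> of partial sums
  nonnegative, and the weights \<open>w\<close> drop by at least \<beta> at every step.\<close>

lemma rho_strict_mono:
 assumes b: "\<beta> > 0" and e: "e \<in> parts m k" and la: "la \<in> parts m k" and dom: "dom m e la" and ne: "e ~= la"
 shows "rho \<beta> m e < rho \<beta> m la"
proof -
 define S where "S j = (\<Sum>i<j. real (la i)) - (\<Sum>i<j. real (e i))" for j
 define w where "w i = real (la i) + real (e i) - 1 + real \<beta> * (real m - 1 - real i)" for i
 have S0: "S 0 = 0" by (simp add: S_def)
 have Sm: "S m = 0" using e la by (simp add: S_def parts_def expos_def flip: of_nat_sum)
 have Snn: "0 <= S j" if "j <= m" for j using dom that by (simp add: S_def dom_def flip: of_nat_sum)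
 have w: "w i - w (Suc i) > 0" for i
 proof -
  have "la (Suc i) <= la i" "e (Suc i) <= e i" using e la by (auto simp: parts_def antimono_def)
  then have "w i - w (Suc i) >= real \<beta>" by (simp add: w_def algebra_simps)
  then show ?thesis using b by linarith
 qed
 have "rho \<beta> m la - rho \<beta> m e = (\<Sum>i<m. (S (Suc i) - S i) * w i)"
  by (simp add: rho_def S_def w_def sum_subtractf[symmetric] sum_distrib_left sum.distrib[symmetric] algebra_simps)
 also have "... = (\<Sum>i<m. S (Suc i) * (w i - w (Suc i)))" by (simp add: summation_by_parts S0 Sm)
 also have "... > 0"
 proof -
  have "\<exists>j<m. S (Suc j) ~= 0"
  proof (rule ccontr)
   assume "\<not> ?thesis"
   then have Sz: "S j = 0" if "j <= m" for j using that S0 by (cases j) auto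
   have "e i = la i" for i
   proof (cases "i < m")
    case True
    then show ?thesis using Sz[of i] Sz[of "Suc i"] by (simp add: S_def)
   next
    case False
    then show ?thesis using e la by (simp add: parts_def expos_def)
   qed
   then show False using ne by auto
  qed
  then obtain j where "j < m" "S (Suc j) ~= 0" by blast
  then show ?thesis using w Snn by (intro sum_pos2[of _ j]) (auto simp: less_le zero_less_mult_iff)
 qed
 finally show ?thesis by simp
qed

text \<open>The lexicographically largest exponent is decreasing, since swapping an ascent would
  give a larger one with the same coefficient.\<close>

lemma symmetric_leading_exponent:
 assumes sym: "symc m k c" and ex: "\<exists>e\<in>expos m k. c e ~= 0"
 obtains l where "l \<in> parts m k" "c l ~= 0" "!!e. e \<in> expos m k ==> c e ~= 0 ==> e ~= l ==> lexl e l"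
proof -
 define S where "S = {e \<in> expos m k. c e ~= 0}"
 have "finite (wt (Suc k) m ` S)" "wt (Suc k) m ` S ~= {}" using ex by (auto simp: S_def)
 then obtain l where l: "l \<in> S" "wt (Suc k) m l = Max (wt (Suc k) m ` S)" using Max_in by (metis imageE)
 then have max: "wt (Suc k) m e <= wt (Suc k) m l" if "e \<in> S" for e using that by (simp add: S_def)
 have lead: "lexl e l" if "e \<in> S" "e ~= l" for e
 proof (rule ccontr)
  assume "\<not> lexl e l"
  then have "lexl l e" using lexl_total[OF that(2)] by blast
  then have "wt (Suc k) m l < wt (Suc k) m e" using that(1) l(1) by (intro lexl_wt) (auto simp: S_def)
  then show False using max[OF that(1)] by simp
 qed
 have "l (Suc i) <= l i" for i
 proof (rule ccontr)
  assume "\<not> l (Suc i) <= l i"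
  then have lt: "l i < l (Suc i)" by simp
  then have im: "Suc i < m" using l(1) by (cases "Suc i < m") (auto simp: S_def expos_def)
  define t where "t = Transposition.transpose i (Suc i)"
  have t: "t permutes {..<m}" using im unfolding t_def by (intro permutes_swap_id) auto
  have "l \<circ> t \<in> S" using l(1) sym t by (auto simp: S_def symc_def expos_permute)
  moreover have "lexl l (l \<circ> t)" unfolding lexl_def using lt
   by (intro exI[of _ i]) (auto simp: t_def transpose_def)
  then have "wt (Suc k) m l < wt (Suc k) m (l \<circ> t)"
   using l(1) t by (intro lexl_wt) (auto simp: S_def expos_permute)
  ultimately show False using max by fastforce
 qed
 then have "antimono l" by (simp add: decseq_Suc_iff)
 then show ?thesis using that[of l] l(1) lead by (auto simp: S_def parts_def)
qed

text \<open>Otherwise the leading exponent would be a partition strictly dominated by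
  \<open>la\<close> but with the same eigenvalue.\<close>

lemma jack_eigenfunction_zero:
 assumes b: "\<beta> > 0" and sym: "symc m k c" and la: "la \<in> parts m k"
  and dom: "!!e. e \<in> expos m k ==> c e ~= 0 ==> dom m e la" and c: "c la = 0"
  and eig: "!!x. inj_on x {..<m} ==> jack_op \<beta> m (hpoly m k c) x = rho \<beta> m la * hpoly m k c x"
  and e: "e \<in> expos m k"
 shows "c e = 0"
proof (rule ccontr)
 assume "c e ~= 0"
 with e obtain l where l: "l \<in> parts m k" "c l ~= 0" "!!e. e \<in> expos m k ==> c e ~= 0 ==> e ~= l ==> lexl e l"
  using symmetric_leading_exponent[OF sym] by blast
 have le: "l \<in> expos m k" using l(1) by (simp add: parts_def)
 have "rho \<beta> m la = rho \<beta> m l" by (rule jack_eigenvalue[OF eig le l(2,3)])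
 moreover have "rho \<beta> m l < rho \<beta> m la"
  using l(2) c by (intro rho_strict_mono[OF b l(1) la dom[OF le l(2)]]) auto
 ultimately show False by simp
qed

section \<open>Uniqueness and stability of Jack polynomials\<close>

definition trig :: "nat => nat => ((nat => nat) => (nat => nat) => real) => bool"
 where "trig m k d \<longleftrightarrow> (\<forall>la\<in>parts m k. symc m k (d la) \<and> d la la ~= 0 \<and>
  (\<forall>e\<in>expos m k. d la e ~= 0 --> dom m e la))"

lemma trigD:
 assumes "trig m k d" "la \<in> parts m k"
 shows "symc m k (d la)" "d la la ~= 0" "!!e. e \<in> expos m k ==> d la e ~= 0 ==> dom m e la"
  "!!e. e \<in> expos m k ==> d la e ~= 0 ==> e ~= la ==> lexl e la"
proof -
 show "symc m k (d la)" "d la la ~= 0" "!!e. e \<in> expos m k ==> d la e ~= 0 ==> dom m e la"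
  using assms by (auto simp: trig_def)
 then show "!!e. e \<in> expos m k ==> d la e ~= 0 ==> e ~= la ==> lexl e la"
  using assms(2) by (intro dom_lexl) (auto simp: parts_def)
qed

lemma parts_expos: "la \<in> parts m k ==> la \<in> expos m k" by (simp add: parts_def)

text \<open>At the lexicographically largest index with nonzero coefficient only one member
  contributes to that exponent.\<close>

lemma trig_independent:
 assumes t: "trig m k d" and z: "!!e. e \<in> expos m k ==> (\<Sum>la\<in>parts m k. a la * d la e) = 0"
  and la: "la \<in> parts m k"
 shows "a la = 0"
proof (rule ccontr)
 assume "a la ~= 0"
 define S where "S = {la \<in> parts m k. a la ~= 0}"
 let ?w = "wt (Suc k) m"
 have "finite (?w ` S)" "?w ` S ~= {}" using la \<open>a la ~= 0\<close> by (auto simp: S_def)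
 then obtain l where l: "l \<in> S" "?w l = Max (?w ` S)" using Max_in by (metis imageE)
 have le: "l \<in> expos m k" "l \<in> parts m k" using l(1) by (auto simp: S_def parts_def)
 have "a \<mu> * d \<mu> l = (if \<mu> = l then a l * d l l else 0)" if \<mu>: "\<mu> \<in> parts m k" for \<mu>
 proof (cases "\<mu> = l \<or> a \<mu> = 0 \<or> d \<mu> l = 0")
  case False
  then have "lexl l \<mu>" using trigD(4)[OF t \<mu> le(1)] by auto
  then have "?w l < ?w \<mu>" using le \<mu> by (intro lexl_wt parts_expos)
  moreover have "?w \<mu> <= Max (?w ` S)" using False \<mu> by (intro Max_ge) (auto simp: S_def)
  ultimately show ?thesis using l(2) by simp
 qed auto
 then have "(\<Sum>\<mu>\<in>parts m k. a \<mu> * d \<mu> l) = (\<Sum>\<mu>\<in>parts m k. if \<mu> = l then a l * d l l else 0)"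
  by (intro sum.cong) auto
 then have "a l * d l l = 0" using z[OF le(1)] le(2) by simp
 then show False using l(1) trigD(2)[OF t le(2)] by (auto simp: S_def)
qed

text \<open>Subtract the multiple of the member indexed by the leading exponent that cancels the
  leading term, and induct on the size of this exponent.\<close>

lemma trig_span:
 assumes t: "trig m k d" and sym: "symc m k c"
 shows "\<exists>a. \<forall>e\<in>expos m k. c e = (\<Sum>la\<in>parts m k. a la * d la e)"
proof -
 let ?w = "wt (Suc k) m"
 have "\<exists>a. \<forall>e\<in>expos m k. c e = (\<Sum>la\<in>parts m k. a la * d la e)"
  if "symc m k c" "!!e. e \<in> expos m k ==> c e ~= 0 ==> ?w e < N" for N c using that
 proof (induction N arbitrary: c rule: less_induct)
  case (less N)
  show ?case
  proof (cases "\<exists>e\<in>expos m k. c e ~= 0")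
   case False
   then show ?thesis by (intro exI[of _ "%_. 0"]) auto
  next
   case True
   then obtain l where l: "l \<in> parts m k" "c l ~= 0"
    "!!e. e \<in> expos m k ==> c e ~= 0 ==> e ~= l ==> lexl e l"
    using symmetric_leading_exponent[OF less.prems(1)] by blast
   note le = parts_expos[OF l(1)]
   define r where "r = c l / d l l"
   define c' where "c' e = c e - r * d l e" for e
   have "symc m k c'" unfolding c'_def[abs_def] by (rule symc_diff[OF less.prems(1) trigD(1)[OF t l(1)]])
   moreover have "?w e < ?w l" if e: "e \<in> expos m k" "c' e ~= 0" for e
   proof -
    have "c' l = 0" using trigD(2)[OF t l(1)] by (simp add: c'_def r_def)
    then have "e ~= l" using e(2) by auto
    moreover have "c e ~= 0 \<or> d l e ~= 0" using e(2) by (auto simp: c'_def)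
    ultimately have "lexl e l" using l(3)[OF e(1)] trigD(4)[OF t l(1) e(1)] by blast
    then show ?thesis using e(1) le by (intro lexl_wt)
   qed
   moreover have "?w l < N" using less.prems(2)[OF le l(2)] .
   ultimately obtain a where a: "\<forall>e\<in>expos m k. c' e = (\<Sum>la\<in>parts m k. a la * d la e)"
    using less.IH[of "?w l" c'] by blast
   have "c e = (\<Sum>la\<in>parts m k. (a la + (if la = l then r else 0)) * d la e)" if e: "e \<in> expos m k" for e
   proof -
    have "(\<Sum>la\<in>parts m k. (if la = l then r else 0) * d la e) = (\<Sum>la\<in>parts m k. if la = l then r * d l e else 0)"
     by (intro sum.cong) auto
    then have "(\<Sum>la\<in>parts m k. (a la + (if la = l then r else 0)) * d la e) = c' e + r * d l e"
     using a e l(1) by (simp add: distrib_right sum.distrib)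
    then show ?thesis by (simp add: c'_def)
   qed
   then show ?thesis by (intro exI[of _ "%la. a la + (if la = l then r else 0)"]) blast
  qed
 qed
 from this[OF sym, of "Suc (Max (?w ` expos m k))"] show ?thesis by (auto simp: less_Suc_eq_le)
qed

lemma jack_familyD:
 assumes "jack_family \<beta> m k c"
 shows "trig m k c" "!!x. (\<Sum>la\<in>parts m k. hpoly m k (c la) x) = (\<Sum>i<m. x i) ^ k"
  "!!la. la \<in> parts m k ==> \<exists>\<rho>. \<forall>x. inj_on x {..<m} --> jack_op \<beta> m (hpoly m k (c la)) x = \<rho> * hpoly m k (c la) x"
 using assms unfolding jack_family_def trig_def symc_def dom_def by auto

lemma jack_familyI:
 assumes t: "trig m k c" and s: "!!x. (\<Sum>la\<in>parts m k. hpoly m k (c la) x) = (\<Sum>i<m. x i) ^ k"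
  and e: "!!la. la \<in> parts m k ==> \<exists>\<rho>. \<forall>x. inj_on x {..<m} --> jack_op \<beta> m (hpoly m k (c la)) x = \<rho> * hpoly m k (c la) x"
 shows "jack_family \<beta> m k c" unfolding jack_family_def
proof (intro conjI ballI allI s e)
 fix la assume la: "la \<in> parts m k"
 show "c la la ~= 0" by (rule trigD(2)[OF t la])
 show "\<pi> permutes {..<m} --> e \<in> expos m k --> c la (e \<circ> \<pi>) = c la e" for \<pi> e
  using trigD(1)[OF t la] by (auto simp: symc_def)
 fix e assume e: "e \<in> expos m k"
 show "c la e ~= 0 --> e ~= la --> (\<exists>i. e i < la i \<and> (\<forall>j<i. e j = la j))"
  using trigD(4)[OF t la e] by (auto simp: lexl_def)
 show "c la e ~= 0 --> (\<forall>j\<le>m. (\<Sum>i<j. e i) <= (\<Sum>i<j. la i))" using trigD(3)[OF t la e] by (auto simp: dom_def)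
qed

lemma jack_family_eigen:
 assumes "jack_family \<beta> m k c" "la \<in> parts m k" "inj_on x {..<m}"
 shows "jack_op \<beta> m (hpoly m k (c la)) x = rho \<beta> m la * hpoly m k (c la) x"
proof -
 note t = jack_familyD(1)[OF assms(1)]
 obtain r where r: "!!x. inj_on x {..<m} ==> jack_op \<beta> m (hpoly m k (c la)) x = r * hpoly m k (c la) x"
  using jack_familyD(3)[OF assms(1,2)] by blast
 have "r = rho \<beta> m la"
  by (rule jack_eigenvalue[OF r parts_expos[OF assms(2)] trigD(2)[OF t assms(2)] trigD(4)[OF t assms(2)]])
 then show ?thesis using r[OF assms(3)] by simp
qed

lemma jack_op_diff:
 "jack_op \<beta> m (hpoly m k (%e. c e - r * d e)) x = jack_op \<beta> m (hpoly m k c) x - r * jack_op \<beta> m (hpoly m k d) x"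
 by (simp add: jack_op_hpoly algebra_simps sum_subtractf sum_distrib_left)

text \<open>Members with the same index are proportional: matching the leading coefficients leaves
  an eigenfunction to which \<open>jack_eigenfunction_zero\<close> applies. The common sum then
  forces all ratios to be 1 by linear independence.\<close>

lemma jack_family_unique:
 assumes b: "\<beta> > 0" and c: "jack_family \<beta> m k c" and d: "jack_family \<beta> m k d"
  and la: "la \<in> parts m k" and e: "e \<in> expos m k"
 shows "c la e = d la e"
proof -
 note tc = jack_familyD(1)[OF c] and td = jack_familyD(1)[OF d]
 define r where "r la = c la la / d la la" for la
 have ratio: "c la e = r la * d la e" if la: "la \<in> parts m k" and e: "e \<in> expos m k" for la e
 proof -
  have "c la e - r la * d la e = 0"
  proof (rule jack_eigenfunction_zero[OF b symc_diff[OF trigD(1)[OF tc la] trigD(1)[OF td la]] la _ _ _ e])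
   show "c la la - r la * d la la = 0" using trigD(2)[OF td la] by (simp add: r_def)
   show "dom m f la" if "f \<in> expos m k" "c la f - r la * d la f ~= 0" for f
    using trigD(3)[OF tc la that(1)] trigD(3)[OF td la that(1)] that(2) by fastforce
   show "jack_op \<beta> m (hpoly m k (%e. c la e - r la * d la e)) x =
     rho \<beta> m la * hpoly m k (%e. c la e - r la * d la e) x" if "inj_on x {..<m}" for x
    by (simp add: jack_op_diff jack_family_eigen[OF c la that] jack_family_eigen[OF d la that]
      hpoly_diff hpoly_cmult algebra_simps)
  qed
  then show ?thesis by simp
 qed
 have "(\<Sum>la\<in>parts m k. (r la - 1) * d la e) = 0" if e: "e \<in> expos m k" for e
 proof -
  have "hpoly m k (%e. \<Sum>la\<in>parts m k. c la e) x = hpoly m k (%e. \<Sum>la\<in>parts m k. d la e) x" for x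
   by (simp add: hpoly_sum jack_familyD(2)[OF c] jack_familyD(2)[OF d])
  then have "(\<Sum>la\<in>parts m k. c la e) = (\<Sum>la\<in>parts m k. d la e)" by (rule hpoly_unique[OF _ e])
  then show ?thesis using ratio[OF _ e] by (simp add: left_diff_distrib sum_subtractf)
 qed
 then have "r la - 1 = 0" by (rule trig_independent[OF td _ la])
 then show ?thesis using ratio[OF la e] by simp
qed

lemma jack_hpoly:
 assumes b: "\<beta> > 0" and c: "jack_family \<beta> (length xs) k c" and la: "la \<in> parts (length xs) k"
 shows "jack \<beta> k la xs = hpoly (length xs) k (c la) (%i. xs ! i)"
proof -
 have "jack_family \<beta> (length xs) k (SOME c. jack_family \<beta> (length xs) k c)"
  by (rule someI[of "jack_family \<beta> (length xs) k", OF c])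
 then show ?thesis unfolding jack_def by (intro hpoly_cong jack_family_unique[OF b _ c la])
qed

lemma hpoly_restrict:
 assumes nm: "n <= m" and x: "!!i. i < n ==> y i = x i" "!!i. n <= i ==> i < m ==> y i = 0"
 shows "hpoly m k c y = hpoly n k c x"
proof -
 have "hpoly m k c y = (\<Sum>e\<in>expos n k. c e * xmon m e y)" unfolding hpoly_xmon
 proof (rule sum.mono_neutral_right)
  show "\<forall>e\<in>expos m k - expos n k. c e * xmon m e y = 0"
  proof
   fix e assume e: "e \<in> expos m k - expos n k"
   have "\<exists>i\<ge>n. e i ~= 0"
   proof (rule ccontr)
    assume "\<not> (\<exists>i\<ge>n. e i ~= 0)"
    then have z: "!!i. i >= n ==> e i = 0" by blast
    then have "(\<Sum>i<m. e i) = (\<Sum>i<n. e i)" using nm by (intro sum.mono_neutral_right) auto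
    then show False using e z by (auto simp: expos_def)
   qed
   then obtain i where i: "n <= i" "e i ~= 0" by blast
   moreover have "i < m" using i(2) e by (cases "i < m") (auto simp: expos_def)
   ultimately have "xmon m e y = 0" unfolding xmon_def using x(2) by (intro prod_zero) auto
   then show "c e * xmon m e y = 0" by simp
  qed
 qed (use expos_mono[OF nm] in auto)
 also have "... = hpoly n k c x" unfolding hpoly_xmon
 proof (intro sum.cong refl arg_cong2[of _ _ _ _ "(*)"])
  fix e assume "e \<in> expos n k"
  then have "xmon m e y = (\<Prod>i<n. y i ^ e i)"
   unfolding xmon_def using nm by (intro prod.mono_neutral_right) (auto simp: expos_def)
  then show "xmon m e y = xmon n e x" by (simp add: xmon_def x(1))
 qed
 finally show ?thesis .
qed

lemma expos_Suc: "e \<in> expos (Suc n) k ==> e n = 0 ==> e \<in> expos n k"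
 by (auto simp: expos_def) (metis Suc_leI le_neq_implies_less)

text \<open>The last variable tends to 0 from the right instead of being set to 0: another x_i may
  already be 0, and the eigenvalue equation is available at distinct points only. In the limit the
  multiplier gains the constant \<beta>k.\<close>

lemma tendsto_jw_restrict:
 assumes e: "e \<in> expos (Suc n) k"
 shows "((%s. xmon (Suc n) e (x(n := s)) * jw \<beta> (Suc n) (x(n := s)) e) \<longlongrightarrow>
  (if e n = 0 then xmon n e x * (jw \<beta> n x e + real \<beta> * real k) else 0)) (at_right 0)"
proof -
 \<comment> \<open>The limit of x_i / (x_i - s). The value 0 at x_i = 0 does no harm: either e_i = 0
   or the monomial vanishes.\<close>
 define f where "f i = (if x i = 0 then 0 else 1 :: real)" for i
 have xm: "xmon (Suc n) e (x(n := s)) = xmon n e x * s ^ e n" for s by (simp add: xmon_def)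
 have jw: "jw \<beta> (Suc n) (x(n := s)) e = (\<Sum>i<n. real (e i) * (real (e i) - 1)) + real (e n) * (real (e n) - 1) +
  real \<beta> * ((\<Sum>i<n. (\<Sum>j\<in>{..<n} - {i}. real (e i) * (x i / (x i - x j))) + real (e i) * (x i / (x i - s))) +
   (\<Sum>j<n. real (e n) * (s / (s - x j))))" for s
 proof -
  have "{..<Suc n} - {i} = insert n ({..<n} - {i})" if "i < n" for i using that by auto
  moreover have "{..<Suc n} - {n} = {..<n}" by auto
  ultimately show ?thesis unfolding jw_def by (simp add: add.commute)
 qed
 have l1: "((%s. x i / (x i - s)) \<longlongrightarrow> f i) (at_right 0)" for i
 proof (cases "x i = 0")
  case False
  then have "((%s. x i / (x i - s)) \<longlongrightarrow> x i / (x i - 0)) (at_right 0)" by (intro tendsto_intros) auto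
  then show ?thesis using False by (simp add: f_def)
 qed (simp add: f_def)
 have l2: "((%s. s / (s - x j)) \<longlongrightarrow> 1 - f j) (at_right 0)" for j
 proof (cases "x j = 0")
  case True
  have "\<forall>\<^sub>F s in at_right 0. 1 = s / (s - x j)"
   using eventually_at_right_less[of 0] by eventually_elim (simp add: True)
  from Lim_transform_eventually[OF tendsto_const this] show ?thesis using True by (simp add: f_def)
 next
  case False
  then have "((%s. s / (s - x j)) \<longlongrightarrow> 0 / (0 - x j)) (at_right 0)" by (intro tendsto_intros) auto
  then show ?thesis using False by (simp add: f_def)
 qed
 define J where "J = (\<Sum>i<n. real (e i) * (real (e i) - 1)) + real (e n) * (real (e n) - 1) +
  real \<beta> * ((\<Sum>i<n. (\<Sum>j\<in>{..<n} - {i}. real (e i) * (x i / (x i - x j))) + real (e i) * f i) +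
   (\<Sum>j<n. real (e n) * (1 - f j)))"
 have "((%s. jw \<beta> (Suc n) (x(n := s)) e) \<longlongrightarrow> J) (at_right 0)"
  unfolding jw J_def by (intro tendsto_add tendsto_mult tendsto_sum tendsto_const l1 l2)
 moreover have "((%s. s ^ e n) \<longlongrightarrow> 0 ^ e n) (at_right (0::real))" by (intro tendsto_intros)
 ultimately have lim: "((%s. xmon (Suc n) e (x(n := s)) * jw \<beta> (Suc n) (x(n := s)) e) \<longlongrightarrow> xmon n e x * 0 ^ e n * J) (at_right 0)"
  unfolding xm by (intro tendsto_intros)
 show ?thesis
 proof (cases "e n = 0")
  case True
  have "xmon n e x * (real (e i) * f i) = xmon n e x * real (e i)" if "i < n" for i
  proof (cases "x i = 0 \<and> e i > 0")
   case True
   then have "xmon n e x = 0" unfolding xmon_def using that by (intro prod_zero) auto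
   then show ?thesis by simp
  qed (auto simp: f_def)
  then have "xmon n e x * (\<Sum>i<n. real (e i) * f i) = xmon n e x * (\<Sum>i<n. real (e i))"
   unfolding sum_distrib_left by (intro sum.cong) auto
  also have "(\<Sum>i<n. real (e i)) = real k" using expos_Suc[OF e True] by (simp add: expos_def flip: of_nat_sum)
  finally have J: "xmon n e x * J = xmon n e x * (jw \<beta> n x e + real \<beta> * real k)"
   using True by (simp add: J_def jw_def sum.distrib distrib_left mult.left_commute[of _ "real \<beta>"])
  have "xmon n e x * 0 ^ e n * J = (if e n = 0 then xmon n e x * (jw \<beta> n x e + real \<beta> * real k) else 0)"
   unfolding J[symmetric] using True by simp
  then show ?thesis using lim by simp
 next
  case False
  then show ?thesis using lim by (simp add: power_0_left)
 qed
qed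

text \<open>The same coefficients serve in n and in n + 1 variables: letting the last variable tend
  to 0 keeps the eigenfunctions, with eigenvalue lowered by \<beta>k, and by dominance kills the
  members with n + 1 parts.\<close>

lemma jack_family_Suc:
 assumes c: "jack_family \<beta> (Suc n) k c"
 shows "jack_family \<beta> n k c"
proof -
 note t = jack_familyD(1)[OF c]
 have sub: "parts n k \<subseteq> parts (Suc n) k" "expos n k \<subseteq> expos (Suc n) k" by (rule parts_mono expos_mono; simp)+
 show ?thesis
 proof (rule jack_familyI)
  show "trig n k c" unfolding trig_def
  proof (intro ballI conjI impI)
   fix la assume "la \<in> parts n k"
   then have la: "la \<in> parts (Suc n) k" using sub by blast
   show "symc n k (c la)" unfolding symc_def
   proof (intro allI impI)
    fix \<pi> e assume "\<pi> permutes {..<n}" "e \<in> expos n k"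
    then have "\<pi> permutes {..<Suc n}" "e \<in> expos (Suc n) k"
     using permutes_subset[of \<pi> "{..<n}" "{..<Suc n}"] sub by auto
    then show "c la (e \<circ> \<pi>) = c la e" using trigD(1)[OF t la] by (simp add: symc_def)
   qed
   show "c la la ~= 0" by (rule trigD(2)[OF t la])
   show "dom n e la" if "e \<in> expos n k" "c la e ~= 0" for e
    using trigD(3)[OF t la, of e] that sub by (auto simp: dom_def)
  qed
  show "(\<Sum>la\<in>parts n k. hpoly n k (c la) x) = (\<Sum>i<n. x i) ^ k" for x
  proof -
   have h: "hpoly (Suc n) k (c la) (x(n := 0)) = hpoly n k (c la) x" for la by (rule hpoly_restrict) auto
   have "(\<Sum>la\<in>parts n k. hpoly n k (c la) x) = (\<Sum>la\<in>parts (Suc n) k. hpoly n k (c la) x)"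
   proof (rule sum.mono_neutral_left)
    show "\<forall>la\<in>parts (Suc n) k - parts n k. hpoly n k (c la) x = 0"
    proof
     fix la assume "la \<in> parts (Suc n) k - parts n k"
     then have la: "la \<in> parts (Suc n) k" "la n ~= 0" using expos_Suc[of la n k] by (auto simp: parts_def)
     have "c la e = 0" if e: "e \<in> expos n k" for e
     proof (rule ccontr)
      assume "c la e ~= 0"
      then have "(\<Sum>i<n. e i) <= (\<Sum>i<n. la i)" using trigD(3)[OF t la(1), of e] e sub by (auto simp: dom_def)
      then show False using e la by (auto simp: expos_def parts_def)
     qed
     then show "hpoly n k (c la) x = 0" by (simp add: hpoly_def)
    qed
   qed (use sub in auto)
   also have "... = (\<Sum>i<Suc n. (x(n := 0)) i) ^ k" using jack_familyD(2)[OF c, of "x(n := 0)"] by (simp add: h)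
   finally show ?thesis by simp
  qed
  fix la assume "la \<in> parts n k"
  then have la: "la \<in> parts (Suc n) k" using sub by blast
  let ?f = "hpoly n k (c la)"
  define r where "r = rho \<beta> (Suc n) la"
  have "jack_op \<beta> n ?f x = (r - real \<beta> * real k) * ?f x" if x: "inj_on x {..<n}" for x
  proof -
   let ?E = "expos (Suc n) k" and ?F = "hpoly (Suc n) k (c la)"
   let ?g = "%e. xmon n e x * (jw \<beta> n x e + real \<beta> * real k)"
   have S0: "(\<Sum>e\<in>?E. c la e * (if e n = 0 then g e else 0)) = (\<Sum>e\<in>expos n k. c la e * g e)" for g
   proof (rule sum.mono_neutral_cong_right)
    show "\<forall>e\<in>?E - expos n k. c la e * (if e n = 0 then g e else 0) = 0" using expos_Suc[of _ n k] by auto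
    show "c la e * (if e n = 0 then g e else 0) = c la e * g e" if "e \<in> expos n k" for e
     using that by (simp add: expos_def)
   qed (use sub in auto)
   have L1: "((%s. jack_op \<beta> (Suc n) ?F (x(n := s))) \<longlongrightarrow> jack_op \<beta> n ?f x + real \<beta> * real k * ?f x) (at_right 0)"
   proof -
    have "((%s. \<Sum>e\<in>?E. c la e * (xmon (Suc n) e (x(n := s)) * jw \<beta> (Suc n) (x(n := s)) e)) \<longlongrightarrow>
     (\<Sum>e\<in>?E. c la e * (if e n = 0 then ?g e else 0))) (at_right 0)"
     by (intro tendsto_sum tendsto_mult tendsto_const tendsto_jw_restrict)
    moreover have "(\<Sum>e\<in>?E. c la e * (if e n = 0 then ?g e else 0)) = jack_op \<beta> n ?f x + real \<beta> * real k * ?f x"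
     unfolding S0 jack_op_hpoly hpoly_xmon sum_distrib_left sum.distrib[symmetric]
     by (intro sum.cong refl) (simp add: algebra_simps)
    ultimately show ?thesis unfolding jack_op_hpoly[of \<beta> "Suc n"] by (simp only: mult.assoc)
   qed
   have "((%s. \<Sum>e\<in>?E. c la e * (xmon n e x * s ^ e n)) \<longlongrightarrow> (\<Sum>e\<in>?E. c la e * (xmon n e x * 0 ^ e n))) (at_right 0)"
    by (intro tendsto_intros)
   moreover have "(\<Sum>e\<in>?E. c la e * (xmon n e x * 0 ^ e n)) = ?f x"
    unfolding hpoly_xmon S0[of "%e. xmon n e x", symmetric] by (intro sum.cong) auto
   moreover have "?F (x(n := s)) = (\<Sum>e\<in>?E. c la e * (xmon n e x * s ^ e n))" for s
    unfolding hpoly_xmon by (simp add: xmon_def)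
   ultimately have L2: "((%s. r * ?F (x(n := s))) \<longlongrightarrow> r * ?f x) (at_right 0)"
    by (intro tendsto_mult tendsto_const) simp
   have "\<forall>\<^sub>F s in at_right 0. \<forall>i\<in>{..<n}. s ~= x i"
   proof (intro eventually_ball_finite ballI)
    fix i show "\<forall>\<^sub>F s in at_right 0. s ~= x i"
    proof (cases "x i = 0")
     case True
     then show ?thesis using eventually_at_right_less[of 0] by (auto elim: eventually_mono)
    next
     case False
     then have "\<forall>\<^sub>F s in nhds 0. s ~= x i" by (intro t1_space_nhds) auto
     then show ?thesis unfolding at_within_def by (rule filter_leD[rotated]) simp
    qed
   qed simp
   then have "\<forall>\<^sub>F s in at_right 0. jack_op \<beta> (Suc n) ?F (x(n := s)) =
     r * ?F (x(n := s))"
   proof eventually_elim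
    fix s assume "\<forall>i\<in>{..<n}. s ~= x i"
    then have "inj_on (x(n := s)) {..<Suc n}" using x by (auto simp: inj_on_def less_Suc_eq)
    then show "jack_op \<beta> (Suc n) ?F (x(n := s)) =
     r * ?F (x(n := s))" unfolding r_def by (rule jack_family_eigen[OF c la])
   qed
   then have "jack_op \<beta> n ?f x + real \<beta> * real k * ?f x = r * ?f x"
    using tendsto_unique[OF _ Lim_transform_eventually[OF L1] L2] by simp
   then show ?thesis by (simp add: algebra_simps)
  qed
  then show "\<exists>\<rho>. \<forall>x. inj_on x {..<n} --> jack_op \<beta> n ?f x = \<rho> * ?f x" by blast
 qed
qed

lemma jack_family_restrict: "n <= m ==> jack_family \<beta> m k c ==> jack_family \<beta> n k c"
 by (induction m rule: dec_induct) (auto intro: jack_family_Suc)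

lemma hpoly_too_many_parts:
 assumes t: "trig m k c" and la: "la \<in> parts m k" "la \<notin> parts n k" and nm: "n <= m"
 shows "hpoly n k (c la) x = 0"
proof -
 have "c la e = 0" if e: "e \<in> expos n k" for e
 proof (rule ccontr)
  assume "c la e ~= 0"
  then have "(\<Sum>i<n. e i) <= (\<Sum>i<n. la i)"
   using trigD(3)[OF t la(1), of e] e expos_mono[OF nm, of k] nm by (auto simp: dom_def)
  moreover have "(\<Sum>i<n. la i) + (\<Sum>i\<in>{n..<m}. la i) = k" using la(1) nm sum.atLeastLessThan_concat[of 0 n m la]
   by (simp add: parts_def expos_def lessThan_atLeast0)
  moreover have "(\<Sum>i<n. e i) = k" using e by (simp add: expos_def)
  ultimately have "(\<Sum>i\<in>{n..<m}. la i) = 0" by linarith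
  then have "la i = 0" if "i >= n" for i using that la(1) by (cases "i < m") (auto simp: parts_def expos_def)
  moreover have "(\<Sum>i<n. la i) = k" using \<open>_ + _ = k\<close> \<open>(\<Sum>i\<in>{n..<m}. la i) = 0\<close> by simp
  ultimately show False using la by (simp add: parts_def expos_def)
 qed
 then show ?thesis by (simp add: hpoly_def)
qed

section \<open>The Laplacian on Hermitian matrices\<close>

text \<open>Second-order Taylor data, with \<open>l\<close> the differential and \<open>B\<close>
  half the Hessian on the diagonal. It is tested on parabolas because unitary orbits are
  curved.\<close>

definition jet2 :: "('a::euclidean_space => real) => 'a => ('a => real) => ('a => 'a => real) => bool"
 where "jet2 F X l B \<longleftrightarrow> linear l \<and> bilinear B \<and>
  (\<forall>Y Y'. \<exists>p. (\<forall>t. F (X + t *\<^sub>R Y + t\<^sup>2 *\<^sub>R Y') = poly p t) \<and>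
   coeff p 0 = F X \<and> coeff p 1 = l Y \<and> coeff p 2 = l Y' + B Y Y)"

lemma jet2D:
 assumes "jet2 F X l B"
 shows "linear l" "bilinear B" "(\<forall>t. F (X + t *\<^sub>R Y + t\<^sup>2 *\<^sub>R Y') = poly p t) ==> coeff p 1 = l Y \<and> coeff p 2 = l Y' + B Y Y"
proof -
 show "linear l" "bilinear B" using assms by (auto simp: jet2_def)
 assume p: "\<forall>t. F (X + t *\<^sub>R Y + t\<^sup>2 *\<^sub>R Y') = poly p t"
 obtain q where q: "\<forall>t. F (X + t *\<^sub>R Y + t\<^sup>2 *\<^sub>R Y') = poly q t" "coeff q 1 = l Y" "coeff q 2 = l Y' + B Y Y"
  using assms unfolding jet2_def by blast
 have "p = q" using p q(1) by (intro iffD1[OF poly_eq_poly_eq_iff] ext) auto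
 then show "coeff p 1 = l Y \<and> coeff p 2 = l Y' + B Y Y" using q by simp
qed

lemma hp_jet2:
 assumes "hp k F"
 obtains l B where "jet2 F X l B"
proof -
 have "\<exists>l B. jet2 F X l B" using assms
 proof induction
  case (hp_const c)
  have "jet2 (%_. c) X (%_. 0) (%_ _. 0)" unfolding jet2_def
  proof (intro conjI allI)
   show "\<exists>p. (\<forall>t. c = poly p t) \<and> coeff p 0 = c \<and> coeff p 1 = 0 \<and> coeff p 2 = 0 + 0"
    by (intro exI[of _ "[:c:]"]) (simp add: numeral_2_eq_2)
  qed (auto simp: bilinear_def linear_iff)
  then show ?case by blast
 next
  case (hp_inner b)
  have "jet2 (%X. X \<bullet> b) X (%Y. Y \<bullet> b) (%_ _. 0)" unfolding jet2_def
  proof (intro conjI allI)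
   fix Y Y' :: 'a
   show "\<exists>p. (\<forall>t. (X + t *\<^sub>R Y + t\<^sup>2 *\<^sub>R Y') \<bullet> b = poly p t) \<and> coeff p 0 = X \<bullet> b \<and> coeff p 1 = Y \<bullet> b \<and>
     coeff p 2 = Y' \<bullet> b + 0" by (intro exI[of _ "[:X \<bullet> b, Y \<bullet> b, Y' \<bullet> b:]"])
     (simp add: numeral_2_eq_2 algebra_simps inner_add_left power2_eq_square)
  qed (auto simp: bilinear_def linear_iff inner_add_left)
  then show ?case by blast
 next
  case (hp_add k F G)
  then obtain l B l' B' where F: "jet2 F X l B" and G: "jet2 G X l' B'" by blast
  have "jet2 (%X. F X + G X) X (%Y. l Y + l' Y) (%Y Z. B Y Z + B' Y Z)" unfolding jet2_def
  proof (intro conjI allI)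
   fix Y Y'
   obtain p q where "\<forall>t. F (X + t *\<^sub>R Y + t\<^sup>2 *\<^sub>R Y') = poly p t" "coeff p 0 = F X" "coeff p 1 = l Y" "coeff p 2 = l Y' + B Y Y"
    "\<forall>t. G (X + t *\<^sub>R Y + t\<^sup>2 *\<^sub>R Y') = poly q t" "coeff q 0 = G X" "coeff q 1 = l' Y" "coeff q 2 = l' Y' + B' Y Y"
    using F G unfolding jet2_def by metis
   then show "\<exists>p. (\<forall>t. F (X + t *\<^sub>R Y + t\<^sup>2 *\<^sub>R Y') + G (X + t *\<^sub>R Y + t\<^sup>2 *\<^sub>R Y') = poly p t) \<and>
     coeff p 0 = F X + G X \<and> coeff p 1 = l Y + l' Y \<and> coeff p 2 = l Y' + l' Y' + (B Y Y + B' Y Y)"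
    by (intro exI[of _ "p + q"]) simp
  qed (use jet2D(1,2)[OF F] jet2D(1,2)[OF G] in \<open>auto simp: bilinear_def linear_iff algebra_simps\<close>)
  then show ?case by blast
 next
  case (hp_mult i F j G)
  then obtain l B l' B' where F: "jet2 F X l B" and G: "jet2 G X l' B'" by blast
  have "jet2 (%X. F X * G X) X (%Y. F X * l' Y + l Y * G X)
    (%Y Z. F X * B' Y Z + B Y Z * G X + l Y * l' Z)" unfolding jet2_def
  proof (intro conjI allI)
   fix Y Y'
   obtain p q where "\<forall>t. F (X + t *\<^sub>R Y + t\<^sup>2 *\<^sub>R Y') = poly p t" "coeff p 0 = F X" "coeff p 1 = l Y" "coeff p 2 = l Y' + B Y Y"
    "\<forall>t. G (X + t *\<^sub>R Y + t\<^sup>2 *\<^sub>R Y') = poly q t" "coeff q 0 = G X" "coeff q 1 = l' Y" "coeff q 2 = l' Y' + B' Y Y"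
    using F G unfolding jet2_def by metis
   then show "\<exists>p. (\<forall>t. F (X + t *\<^sub>R Y + t\<^sup>2 *\<^sub>R Y') * G (X + t *\<^sub>R Y + t\<^sup>2 *\<^sub>R Y') = poly p t) \<and>
     coeff p 0 = F X * G X \<and> coeff p 1 = F X * l' Y + l Y * G X \<and>
     coeff p 2 = F X * l' Y' + l Y' * G X + (F X * B' Y Y + B Y Y * G X + l Y * l' Y)"
    by (intro exI[of _ "p * q"]) (simp add: coeff_mult numeral_2_eq_2 algebra_simps)
  qed (use jet2D(1,2)[OF F] jet2D(1,2)[OF G] in \<open>auto simp: bilinear_def linear_iff algebra_simps\<close>)
  then show ?case by blast
 qed
 then show ?thesis using that by blast
qed

lemma jet2_euler:
 assumes F: "hp k F" and j: "jet2 F X l B"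
 shows "l X = real k * F X"
proof -
 have c: "coeff ([:1, 1:] ^ k :: real poly) 0 = 1 \<and> coeff ([:1, 1:] ^ k :: real poly) 1 = real k"
  by (induction k) (auto simp: coeff_pCons)
 have "\<forall>t. F (X + t *\<^sub>R X + t\<^sup>2 *\<^sub>R 0) = poly (smult (F X) ([:1, 1:] ^ k)) t"
  using hp_scale[OF F, of "1 + _" X] by (auto simp: scaleR_add_left poly_power mult.commute)
 then have "coeff (smult (F X) ([:1, 1:] ^ k)) 1 = l X" using jet2D(3)[OF j] by blast
 then show ?thesis using c by (simp add: mult.commute)
qed

text \<open>The trace of a bilinear form does not depend on the orthonormal basis; \<open>S\<close>
  is the transpose of \<open>T\<close>.\<close>

lemma sum_Basis_orthogonal:
 fixes B :: "'a::euclidean_space => 'a => real"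
 assumes B: "bilinear B" and T: "!!x y. T x \<bullet> y = x \<bullet> S y" "!!x y. S x \<bullet> S y = x \<bullet> y"
 shows "(\<Sum>b\<in>Basis. B (T b) (T b)) = (\<Sum>b\<in>Basis. B b b)"
proof -
 have rep: "B u v = (\<Sum>c\<in>Basis. \<Sum>d\<in>Basis. (u \<bullet> c) * (v \<bullet> d) * B c d)" for u v
 proof -
  have l: "linear (%x. B x y)" "linear (%y. B x y)" for x y using B by (auto simp: bilinear_def)
  have "B u v = B (\<Sum>c\<in>Basis. (u \<bullet> c) *\<^sub>R c) v" by (simp add: euclidean_representation)
  also have "... = (\<Sum>c\<in>Basis. (u \<bullet> c) * B c v)" by (simp add: linear_sum[OF l(1)] linear_cmul[OF l(1)])
  also have "... = (\<Sum>c\<in>Basis. (u \<bullet> c) * B c (\<Sum>d\<in>Basis. (v \<bullet> d) *\<^sub>R d))" by (simp add: euclidean_representation)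
  also have "... = (\<Sum>c\<in>Basis. (u \<bullet> c) * (\<Sum>d\<in>Basis. (v \<bullet> d) * B c d))"
   by (simp add: linear_sum[OF l(2)] linear_cmul[OF l(2)])
  finally show ?thesis by (simp add: sum_distrib_left mult.assoc)
 qed
 have "(\<Sum>b\<in>Basis. B (T b) (T b)) = (\<Sum>b\<in>Basis. \<Sum>c\<in>Basis. \<Sum>d\<in>Basis. (b \<bullet> S c) * (b \<bullet> S d) * B c d)"
  by (subst rep) (simp add: T(1))
 also have "... = (\<Sum>c\<in>Basis. \<Sum>b\<in>Basis. \<Sum>d\<in>Basis. (b \<bullet> S c) * (b \<bullet> S d) * B c d)" by (rule sum.swap)
 also have "... = (\<Sum>c\<in>Basis. \<Sum>d\<in>Basis. \<Sum>b\<in>Basis. (b \<bullet> S c) * (b \<bullet> S d) * B c d)"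
  by (intro sum.cong refl sum.swap)
 also have "... = (\<Sum>c\<in>Basis. \<Sum>d\<in>Basis. (S c \<bullet> S d) * B c d)"
  by (intro sum.cong refl) (simp add: euclidean_inner[of "S _" "S _"] sum_distrib_right inner_commute)
 also have "... = (\<Sum>c\<in>Basis. \<Sum>d\<in>Basis. if c = d then B c d else 0)"
  by (intro sum.cong refl) (simp add: T(2) inner_Basis)
 finally show ?thesis by simp
qed

lemma sum_Basis_vec: "(\<Sum>b\<in>(Basis :: ('a::euclidean_space^'n) set). f b) = (\<Sum>i\<in>UNIV. \<Sum>u\<in>Basis. f (axis i u))"
proof -
 have eq: "(Basis :: ('a^'n) set) = (%(i, u). axis i u) ` (UNIV \<times> Basis)" by (auto simp: Basis_vec_def)
 have inj: "inj_on (%(i, u). axis i u :: 'a^'n) (UNIV \<times> Basis)" by (auto simp: inj_on_def axis_eq_axis)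
 show ?thesis unfolding eq sum.reindex[OF inj] by (simp add: sum.cartesian_product case_prod_unfold)
qed

definition el :: "'m => 'm => quat => quat^'m^'m"
 where "el i j q = (\<chi> a b. if a = i \<and> b = j then q else 0)"

lemma el_nth [simp]: "el i j q$a$b = (if a = i \<and> b = j then q else 0)" by (simp add: el_def)

lemma axis_axis: "axis i (axis j q) = el i j q" by (simp add: vec_eq_iff axis_def)

lemma el_simps [simp]: "adj (el i j q) = el j i (qcnj q)"
 "el i j q**el k l r = (if j = k then el i l (q * r) else 0)"
 "dg y**el i j q = y i *\<^sub>R el i j q" "el i j q**dg y = y j *\<^sub>R el i j q"
proof -
 show "adj (el i j q) = el j i (qcnj q)" by (simp add: vec_eq_iff)
 show "el i j q**el k l r = (if j = k then el i l (q * r) else 0)"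
 proof -
  have "(\<Sum>c\<in>UNIV. (if a = i \<and> c = j then q else 0) * (if c = k \<and> b = l then r else 0)) =
    (\<Sum>c\<in>UNIV. if c = j then if a = i \<and> b = l \<and> j = k then q * r else 0 else 0)" for a b
   by (intro sum.cong) auto
  then show ?thesis by (simp add: vec_eq_iff matrix_matrix_mult_def)
 qed
 show "dg y**el i j q = y i *\<^sub>R el i j q" "el i j q**dg y = y j *\<^sub>R el i j q"
  by (simp_all add: vec_eq_iff dg_mult_nth)
qed

lemma el_add: "el i j q + el i j r = el i j (q + r)" and el_scaleR: "s *\<^sub>R el i j q = el i j (s *\<^sub>R q)"
 and el_0: "el i j 0 = 0" by (simp_all add: vec_eq_iff)

lemma el_dg: "el i i (of_real r) = dg (%a. if a = i then r else 0)" by (simp add: vec_eq_iff)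

lemma isH_hp_dg:
 assumes "hp k (F :: quat^'m^'m => real)"
 shows "isH CARD('m) k (%x. F (dg (%a. x (idx a))))" using assms
proof induction
 case (hp_inner b)
 have "dg (%a. x (idx a)) \<bullet> b = (\<Sum>a\<in>UNIV. (1 \<bullet> (b$a$a)) * x (idx a))" for x
 proof -
  have "dg (%a. x (idx a)) \<bullet> b = (\<Sum>a\<in>UNIV. \<Sum>c\<in>UNIV. if a = c then x (idx a) * (1 \<bullet> (b$a$a)) else 0)"
   unfolding inner_vec_def by (intro sum.cong refl) (simp add: of_real_def)
  then show ?thesis by (simp add: mult.commute)
 qed
 then show ?case by (simp only:) (intro isH_sum isH_cmult isH_var idx_less)
qed (auto intro: isH_const isH_add isH_mult)

lemma pderiv_at_poly:
 assumes p: "!!s. f (x(i := s)) = poly p (s - x i)"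
 shows "pderiv_at i f x = coeff p 1" "pderiv_at i (pderiv_at i f) x = 2 * coeff p 2"
proof -
 have d: "deriv (%s. poly q (s - c)) s = poly (pderiv q) (s - c)" for q and c s :: real
 proof (rule DERIV_imp_deriv)
  show "((%s. poly q (s - c)) has_real_derivative poly (pderiv q) (s - c)) (at s)"
   by (rule DERIV_chain'[where g = "%s. poly q s" and f = "%s. s - c" and D = 1, simplified])
    (auto intro!: derivative_eq_intros poly_DERIV)
 qed
 have 1: "pderiv_at i f (x(i := s)) = poly (pderiv p) (s - x i)" for s
  unfolding pderiv_at_def by (simp add: p d)
 show "pderiv_at i f x = coeff p 1" using 1[of "x i"] by (simp add: poly_0_coeff_0 coeff_pderiv)
 show "pderiv_at i (pderiv_at i f) x = 2 * coeff p 2" unfolding pderiv_at_def[of i "pderiv_at i f"] 1 d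
  by (simp add: poly_0_coeff_0 coeff_pderiv numeral_2_eq_2)
qed

context fld
begin

text \<open>The plane rotation with tangent t. Clearing the factor 1 + t^2 turns the orbit of
  \<open>dg x\<close> into a parabola, to which \<open>jet2\<close> applies.\<close>

lemma rotation:
 fixes x :: "'m::finite => real" and t :: real
 assumes q: "q \<in> \<F> \<beta>" "q \<bullet> q = 1" and ij: "i ~= j"
 obtains U :: "quat^'m^'m" where "U \<in> Stf"
  "(1 + t\<^sup>2) *\<^sub>R (U**dg x**adj U) = dg x + t *\<^sub>R ((x j - x i) *\<^sub>R (el i j q + el j i (qcnj q))) +
   t\<^sup>2 *\<^sub>R (dg x + (x j - x i) *\<^sub>R (el i i 1 - el j j 1))"
proof -
 define s where "s = sqrt (1 + t\<^sup>2)"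
 have s: "s * s = 1 + t\<^sup>2" "s ~= 0"
 proof -
  have "0 < 1 + t\<^sup>2" by (simp add: add_pos_nonneg)
  then show "s * s = 1 + t\<^sup>2" "s ~= 0" by (simp_all add: s_def)
 qed
 define \<delta> where "\<delta> a = (if a = i \<or> a = j then 1 / s else 1)" for a
 define S where "S = el i j q - el j i (qcnj q)"
 define U where "U = dg \<delta> + (t / s) *\<^sub>R S"
 have qq: "q * qcnj q = 1" "qcnj q * q = 1" using q(2) by (simp_all add: qcnj_mult_self)
 have S: "adj S = - S" "dg \<delta>**S = (1 / s) *\<^sub>R S" "S**dg \<delta> = (1 / s) *\<^sub>R S"
  "S**S = - (el i i 1 + el j j 1)" "S**dg x = x j *\<^sub>R el i j q - x i *\<^sub>R el j i (qcnj q)"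
  "dg x**S = x i *\<^sub>R el i j q - x j *\<^sub>R el j i (qcnj q)"
  "S**dg x**S = - (x j *\<^sub>R el i i 1 + x i *\<^sub>R el j j 1)" using ij qq
  by (simp_all add: S_def \<delta>_def matrix_diff_distrib matrix_scaleR_left algebra_simps el_scaleR)
 have adjU: "adj U = dg \<delta> - (t / s) *\<^sub>R S" by (simp add: U_def S)
 show ?thesis
 proof
  have "S \<in> Mts" using q ij by (auto simp: S_def mats_def)
  then have "U \<in> Mts" by (simp add: U_def)
  moreover have "adj U**U = dg \<delta>**dg \<delta> - ((t / s) * (t / s)) *\<^sub>R (S**S)" unfolding adjU unfolding U_def
   by (simp add: matrix_diff_distrib matrix_linear_simps S(2,3) algebra_simps)
  moreover have "dg \<delta>**dg \<delta> - ((t / s) * (t / s)) *\<^sub>R (S**S) = mat 1"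
  proof -
   have "1 / (s * s) + (t / s) * (t / s) = 1"
   proof -
    have "1 / (s * s) + (t / s) * (t / s) = (1 + t\<^sup>2) / (s * s)"
     by (simp add: add_divide_distrib power2_eq_square)
    also have "... = (s * s) / (s * s)" by (simp only: s(1))
    finally show ?thesis using s(2) by simp
   qed
   then show ?thesis unfolding S(4) dg_mult dg_one[symmetric]
    by (simp add: el_dg[of _ 1, simplified] dg_add dg_scaleR) (use ij in \<open>auto simp: vec_eq_iff \<delta>_def\<close>)
  qed
  ultimately show "U \<in> Stf" by (simp add: stiefel_def)
  have "U**dg x**adj U = dg \<delta>**dg x**dg \<delta> + (t / s) *\<^sub>R ((S**dg x)**dg \<delta> - dg \<delta>**(dg x**S)) -
    ((t / s) * (t / s)) *\<^sub>R (S**dg x**S)" unfolding adjU unfolding U_def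
   by (simp add: matrix_diff_distrib matrix_linear_simps algebra_simps matrix_mul_assoc)
  also have "(S**dg x)**dg \<delta> - dg \<delta>**(dg x**S) = (1 / s) *\<^sub>R ((x j - x i) *\<^sub>R (el i j q + el j i (qcnj q)))"
   unfolding S(5,6) by (simp add: matrix_diff_distrib matrix_scaleR_left matrix_scaleR_right \<delta>_def algebra_simps)
  also have "dg \<delta>**dg x**dg \<delta> = dg (%a. \<delta> a * x a * \<delta> a)" by (simp add: dg_mult)
  finally have e1: "(1 + t\<^sup>2) *\<^sub>R (U**dg x**adj U) = (1 + t\<^sup>2) *\<^sub>R dg (%a. \<delta> a * x a * \<delta> a) +
   t *\<^sub>R ((x j - x i) *\<^sub>R (el i j q + el j i (qcnj q))) + t\<^sup>2 *\<^sub>R (x j *\<^sub>R el i i 1 + x i *\<^sub>R el j j 1)"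
   unfolding S(7) s(1)[symmetric] using s(2) by (simp add: scaleR_add_right scaleR_diff_right power2_eq_square)
  have e2: "(1 + t\<^sup>2) *\<^sub>R dg (%a. \<delta> a * x a * \<delta> a) + t\<^sup>2 *\<^sub>R (x j *\<^sub>R el i i 1 + x i *\<^sub>R el j j 1) =
    dg x + t\<^sup>2 *\<^sub>R (dg x + (x j - x i) *\<^sub>R (el i i 1 - el j j 1))"
  proof -
   have "(1 + t\<^sup>2) * (\<delta> a * x a * \<delta> a) = (if a = i \<or> a = j then x a else (1 + t\<^sup>2) * x a)" for a
    unfolding s(1)[symmetric] \<delta>_def using s(2) by simp
   then show ?thesis by (simp add: el_dg[of _ 1, simplified] dg_add dg_scaleR)
     (use ij in \<open>auto simp: vec_eq_iff algebra_simps of_real_def\<close>)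
  qed
  have arrange: "a = p + q + r ==> p + r = s1 + s3 ==> a = s1 + q + s3" for a p q r s1 s3 :: "quat^'m^'m"
   by (simp add: algebra_simps)
  show "(1 + t\<^sup>2) *\<^sub>R (U**dg x**adj U) = dg x + t *\<^sub>R ((x j - x i) *\<^sub>R (el i j q + el j i (qcnj q))) +
   t\<^sup>2 *\<^sub>R (dg x + (x j - x i) *\<^sub>R (el i i 1 - el j j 1))" by (rule arrange[OF e1 e2])
 qed
qed

text \<open>By invariance and homogeneity F equals (1 + t^2)^k F(dg x) along the parabola of
  \<open>rotation\<close>. The t^2 coefficient, simplified by Euler's identity, expresses the
  off-diagonal second derivative through first derivatives.\<close>

lemma jet2_rotation:
 fixes F :: "quat^'m^'m => real"
 assumes F: "hp k F" and inv: "!!U X. U \<in> Stf ==> F (U**X**adj U) = F X"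
  and J: "jet2 F (dg x) l B" and q: "q \<in> \<F> \<beta>" "q \<bullet> q = 1" and x: "x i ~= x j"
 shows "B (el i j q + el j i (qcnj q)) (el i j q + el j i (qcnj q)) = (l (el i i 1) - l (el j j 1)) / (x i - x j)"
proof -
 let ?Z = "el i j q + el j i (qcnj q)"
 have ij: "i ~= j" using x by auto
 define Y' where "Y' = dg x + (x j - x i) *\<^sub>R (el i i 1 - el j j 1)"
 have "F (dg x + t *\<^sub>R ((x j - x i) *\<^sub>R ?Z) + t\<^sup>2 *\<^sub>R Y') = poly (smult (F (dg x)) ([:1, 0, 1:] ^ k)) t" for t
 proof -
  obtain U :: "quat^'m^'m" where U: "U \<in> Stf"
   "(1 + t\<^sup>2) *\<^sub>R (U**dg x**adj U) = dg x + t *\<^sub>R ((x j - x i) *\<^sub>R ?Z) + t\<^sup>2 *\<^sub>R Y'"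
   using rotation[OF q ij, of t x] unfolding Y'_def by blast
  then show ?thesis
   unfolding U(2)[symmetric] hp_scale[OF F] inv[OF U(1)] by (simp add: poly_power power2_eq_square)
 qed
 then have "coeff (smult (F (dg x)) ([:1, 0, 1:] ^ k)) 2 = l Y' + B ((x j - x i) *\<^sub>R ?Z) ((x j - x i) *\<^sub>R ?Z)"
  using jet2D(3)[OF J] by blast
 moreover have "coeff ([:1, 0, 1:] ^ k :: real poly) 0 = 1 \<and> coeff ([:1, 0, 1:] ^ k :: real poly) 1 = 0 \<and>
  coeff ([:1, 0, 1:] ^ k :: real poly) 2 = real k" by (induction k) (auto simp: coeff_pCons numeral_2_eq_2)
 moreover have "l Y' = real k * F (dg x) + (x j - x i) * (l (el i i 1) - l (el j j 1))"
  using jet2D(1)[OF J] by (simp add: Y'_def linear_add linear_cmul linear_diff jet2_euler[OF F J])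
 moreover have "B ((x j - x i) *\<^sub>R ?Z) ((x j - x i) *\<^sub>R ?Z) = (x j - x i) * ((x j - x i) * B ?Z ?Z)"
  by (simp only: bilinear_lmul[OF jet2D(2)[OF J]] bilinear_rmul[OF jet2D(2)[OF J]] real_scaleR_def)
 ultimately have "(x j - x i) * ((l (el i i 1) - l (el j j 1)) + (x j - x i) * B ?Z ?Z) = 0"
  by (simp add: algebra_simps)
 then have "(l (el i i 1) - l (el j j 1)) + (x j - x i) * B ?Z ?Z = 0" using x by simp
 then have "(l (el i i 1) - l (el j j 1)) = (x i - x j) * B ?Z ?Z" by (simp add: algebra_simps)
 then show ?thesis using x by simp
qed

text \<open>The projection onto the Hermitian matrices over the scalars, so that a sum over the
  basis of all quaternionic matrices computes a trace over that subspace.\<close>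

definition hproj :: "quat^'m^'m => quat^'m^'m"
 where "hproj X = (1/2) *\<^sub>R (mproj X + adj (mproj X))"

lemma hproj_herm: "hproj X \<in> Hrm" by (simp add: hproj_def herm_def mproj_mats add.commute)

lemma hproj_conj: "U \<in> Stf ==> hproj (U**X**adj U) = U**hproj X**adj U"
 by (simp add: hproj_def stiefel_mats mproj_mult matrix_linear_simps adj_mult matrix_mul_assoc)

lemma linear_hproj: "linear hproj"
 by (auto simp: hproj_def linear_iff linear_add[OF linear_mproj] linear_cmul[OF linear_mproj] algebra_simps)

lemma hproj_el: "hproj (el i j q) = (1/2) *\<^sub>R (el i j (fproj q) + el j i (qcnj (fproj q)))"
proof -
 have "mproj (el i j q) = el i j (fproj q)" by (simp add: vec_eq_iff mproj_def linear_0[OF linear_fproj])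
 then show ?thesis by (simp add: hproj_def)
qed

lemma fproj_Basis: "q \<in> Basis ==> fproj q = (if q \<in> \<F> \<beta> then q else 0)"
 using beta by (auto simp: Basis_quat_def fproj_def \<F>_def zero_quat_def)

lemma fbasis_simps: "q \<in> fbasis ==> q \<in> \<F> \<beta>" "q \<in> fbasis ==> q \<bullet> q = 1" "(\<Sum>q\<in>fbasis. (qRe q)\<^sup>2) = 1"
proof -
 show "q \<in> fbasis ==> q \<in> \<F> \<beta>" "q \<in> fbasis ==> q \<bullet> q = 1" by (auto simp: fbasis_def)
 have "(\<Sum>q\<in>fbasis. (qRe q)\<^sup>2) = (\<Sum>q\<in>{1}. (qRe q)\<^sup>2)"
 proof (rule sum.mono_neutral_right)
  show "finite fbasis" by (rule finite_fbasis)
  show "{1} \<subseteq> fbasis" by (auto simp: fbasis_def Basis_quat_def one_quat_def F_simps(2)[unfolded one_quat_def])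
  show "\<forall>i\<in>fbasis - {1}. (qRe i)\<^sup>2 = 0" by (auto simp: fbasis_def Basis_quat_def one_quat_def)
 qed
 then show "(\<Sum>q\<in>fbasis. (qRe q)\<^sup>2) = 1" by simp
qed

text \<open>The radial part of the invariant Laplacian. Diagonal directions give the second-order
  terms; every off-diagonal position has \<beta> directions, evaluated by
  \<open>jet2_rotation\<close>, and the factor 1/4 is the square of the 1/2 in
  \<open>hproj\<close>.\<close>

lemma laplacian_diagonal:
 fixes F :: "quat^'m^'m => real"
 assumes F: "hp k F" and inv: "!!U X. U \<in> Stf ==> F (U**X**adj U) = F X"
  and J: "jet2 F (dg x) l B" and x: "inj x" "!!a. 0 < x a"
 defines "g \<equiv> dg (%a. sqrt (x a))"
 shows "(\<Sum>b\<in>Basis. B (g**hproj b**g) (g**hproj b**g)) =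
  (\<Sum>i\<in>UNIV. (x i)\<^sup>2 * B (el i i 1) (el i i 1)) +
  real \<beta> / 4 * (\<Sum>i\<in>UNIV. \<Sum>j\<in>UNIV. x i * x j * (l (el i i 1) - l (el j j 1)) / (x i - x j))"
proof -
 define Z where "Z i j q = el i j q + el j i (qcnj q)" for i j :: 'm and q
 have Bs: "B (s *\<^sub>R Y) (s *\<^sub>R Y) = s\<^sup>2 * B Y Y" for s Y
  by (simp only: bilinear_lmul[OF jet2D(2)[OF J]] bilinear_rmul[OF jet2D(2)[OF J]] real_scaleR_def power2_eq_square mult.assoc)
 have gg: "g**hproj (el i j q)**g = (sqrt (x i) * sqrt (x j) / 2) *\<^sub>R Z i j (fproj q)" for i j q
  by (simp add: g_def hproj_el Z_def matrix_linear_simps algebra_simps)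
 have sq: "(sqrt (x i) * sqrt (x j) / 2)\<^sup>2 = x i * x j / 4" for i j
  using x(2)[of i] x(2)[of j] by (simp add: power_mult_distrib power_divide)
 have "(\<Sum>b\<in>Basis. B (g**hproj b**g) (g**hproj b**g)) =
  (\<Sum>i\<in>UNIV. \<Sum>j\<in>UNIV. \<Sum>q\<in>Basis. x i * x j / 4 * B (Z i j (fproj q)) (Z i j (fproj q)))"
  by (simp only: sum_Basis_vec axis_axis gg Bs sq)
 also have "... = (\<Sum>i\<in>UNIV. \<Sum>j\<in>UNIV. x i * x j / 4 * (\<Sum>q\<in>fbasis. B (Z i j q) (Z i j q)))"
 proof (intro sum.cong refl)
  fix i j
  have "(\<Sum>q\<in>fbasis. B (Z i j q) (Z i j q)) = (\<Sum>q\<in>Basis. B (Z i j (fproj q)) (Z i j (fproj q)))"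
  proof (rule sum.mono_neutral_cong_left)
   show "\<forall>q\<in>Basis - fbasis. B (Z i j (fproj q)) (Z i j (fproj q)) = 0"
    by (auto simp: fbasis_def fproj_Basis Z_def el_0 bilinear_lzero[OF jet2D(2)[OF J]])
   show "B (Z i j q) (Z i j q) = B (Z i j (fproj q)) (Z i j (fproj q))" if "q \<in> fbasis" for q
    using that by (auto simp: fbasis_def fproj_Basis)
  qed (auto simp: fbasis_def)
  then show "(\<Sum>q\<in>Basis. x i * x j / 4 * B (Z i j (fproj q)) (Z i j (fproj q))) =
   x i * x j / 4 * (\<Sum>q\<in>fbasis. B (Z i j q) (Z i j q))" by (simp add: sum_distrib_left)
 qed
 also have "... = (\<Sum>i\<in>UNIV. \<Sum>j\<in>UNIV. (if i = j then (x i)\<^sup>2 * B (el i i 1) (el i i 1) else 0) +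
  real \<beta> / 4 * (x i * x j * (l (el i i 1) - l (el j j 1)) / (x i - x j)))"
 proof (intro sum.cong refl)
  fix i j
  show "x i * x j / 4 * (\<Sum>q\<in>fbasis. B (Z i j q) (Z i j q)) =
   (if i = j then (x i)\<^sup>2 * B (el i i 1) (el i i 1) else 0) +
   real \<beta> / 4 * (x i * x j * (l (el i i 1) - l (el j j 1)) / (x i - x j))"
  proof (cases "i = j")
   case True
   have "Z i i q = (2 * qRe q) *\<^sub>R el i i 1" for q
    by (simp add: Z_def el_add el_scaleR quat_eq_iff qcnj_def plus_quat_def scaleR_quat_def one_quat_def)
   then have "B (Z i i q) (Z i i q) = (qRe q)\<^sup>2 * (4 * B (el i i 1) (el i i 1))" for q
    by (simp add: Bs power_mult_distrib)
   then have "(\<Sum>q\<in>fbasis. B (Z i i q) (Z i i q)) = (\<Sum>q\<in>fbasis. (qRe q)\<^sup>2) * (4 * B (el i i 1) (el i i 1))"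
    by (simp only: sum_distrib_right)
   then show ?thesis using True unfolding fbasis_simps(3) by (simp add: power2_eq_square)
  next
   case False
   then have "x i ~= x j" using x(1) by (auto dest: injD)
   then have "B (Z i j q) (Z i j q) = (l (el i i 1) - l (el j j 1)) / (x i - x j)" if "q \<in> fbasis" for q
    unfolding Z_def using that by (intro jet2_rotation[OF F inv J]) (auto intro: fbasis_simps)
   then have "(\<Sum>q\<in>fbasis. B (Z i j q) (Z i j q)) = real \<beta> * ((l (el i i 1) - l (el j j 1)) / (x i - x j))"
    by (simp add: card_fbasis)
   then show ?thesis using False by simp
  qed
 qed
 finally show ?thesis by (simp add: sum.distrib sum_distrib_left)
qed

end

lemma poly_tendsto_coeff:
 fixes p :: "real poly"
 assumes "degree p <= N"
 shows "((%t. poly p t / t ^ N) \<longlongrightarrow> coeff p N) at_top"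
proof -
 have l: "((%t. poly p t / t ^ degree p) \<longlongrightarrow> lead_coeff p) at_top"
  by (rule tendsto_mono[OF at_top_le_at_infinity poly_divide_tendsto_aux])
 show ?thesis
 proof (cases "degree p = N")
  case True
  then show ?thesis using l by simp
 next
  case False
  then have d: "degree p < N" using assms by simp
  have "((%t. (poly p t / t ^ degree p) * (t ^ degree p / t ^ N)) \<longlongrightarrow> lead_coeff p * 0) at_top"
   by (rule tendsto_mult[OF l tendsto_power_quot[OF d]])
  moreover have "\<forall>\<^sub>F t in at_top. (poly p t / t ^ degree p) * (t ^ degree p / t ^ N) = poly p t / t ^ N"
   using eventually_gt_at_top[of 0] by eventually_elim simp
  ultimately show ?thesis using d Lim_transform_eventually by (fastforce simp: coeff_eq_0)
 qed
qed

lemma poly_growth: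
 fixes p :: "real poly"
 assumes b: "!!t. t >= 1 ==> \<bar>poly p t\<bar> <= C * t ^ R" and N: "R < N"
 shows "coeff p N = 0"
proof -
 have "degree p <= R"
 proof (rule ccontr)
  assume "\<not> degree p <= R"
  then have d: "R < degree p" by simp
  have lim: "((%t. C * (t ^ R / t ^ degree p)) \<longlongrightarrow> C * 0) at_top"
   by (intro tendsto_mult tendsto_const tendsto_power_quot d)
  have "\<forall>\<^sub>F t in at_top. norm (poly p t / t ^ degree p) <= C * (t ^ R / t ^ degree p)"
   using eventually_ge_at_top[of 1]
  proof eventually_elim
   fix t :: real assume "1 <= t"
   then show "norm (poly p t / t ^ degree p) <= C * (t ^ R / t ^ degree p)"
    using divide_right_mono[OF b[of t], of "t ^ degree p"] by (simp add: abs_divide power_abs)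
  qed
  then have "((%t. poly p t / t ^ degree p) \<longlongrightarrow> 0) at_top"
   by (rule Lim_null_comparison[OF _ lim[simplified mult_zero_right]])
  then have "lead_coeff p = 0" using tendsto_unique[OF _ poly_tendsto_coeff[of p "degree p"]] by simp
  then show False using d by simp
 qed
 then show ?thesis using N by (simp add: coeff_eq_0)
qed

text \<open>Exchange i and j in the second half; the diagonal terms vanish because division by 0
  gives 0.\<close>

lemma jack_op_quotient_sum:
 fixes x L :: "nat => real"
 shows "(\<Sum>i<m. \<Sum>j<m. x i * x j * (L i - L j) / (x i - x j)) =
  2 * (\<Sum>i<m. \<Sum>j<m. x i * x j * L i / (x i - x j))"
proof -
 have "(\<Sum>i<m. \<Sum>j<m. x i * x j * L j / (x i - x j)) = (\<Sum>j<m. \<Sum>i<m. x i * x j * L j / (x i - x j))"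
  by (rule sum.swap)
 also have "... = (\<Sum>j<m. \<Sum>i<m. - (x j * x i * L j / (x j - x i)))"
 proof (intro sum.cong refl)
  fix i j
  have "x i - x j = - (x j - x i)" by simp
  then show "x i * x j * L j / (x i - x j) = - (x j * x i * L j / (x j - x i))"
   by (simp only: divide_minus_right mult.commute[of "x i"])
 qed
 finally show ?thesis by (simp add: right_diff_distrib diff_divide_distrib sum_subtractf sum_negf)
qed

context fld
begin

section \<open>Spherical functions are eigenfunctions\<close>

lemma phi_isH:
 assumes "la \<in> parts CARD('m) k"
 obtains c where "!!x. phi la (dg (%a::'m::finite. x (idx a))) = hpoly CARD('m) k c x"
 using isH_hp_dg[OF hp_phi[OF assms]] unfolding isH_def by blast

text \<open>The monomial coefficients of \<open>phi la\<close> on diagonal matrices. The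
  \<open>itself\<close> argument carries the dimension, which the other arguments do not
  determine.\<close>

definition pcoef :: "'m::finite itself => nat => (nat => nat) => (nat => nat) => real"
 where "pcoef (_ :: 'm itself) k la = (SOME c. \<forall>x. phi la (dg (%a::'m. x (idx a))) = hpoly CARD('m) k c x)"

lemma pcoef:
 assumes "la \<in> parts CARD('m) k"
 shows "phi la (dg (%a::'m::finite. x (idx a))) = hpoly CARD('m) k (pcoef TYPE('m) k la) x"
proof -
 have "\<exists>c. \<forall>x. phi la (dg (%a::'m. x (idx a))) = hpoly CARD('m) k c x" using phi_isH[OF assms] by blast
 then have "\<forall>x. phi la (dg (%a::'m. x (idx a))) = hpoly CARD('m) k (pcoef TYPE('m) k la) x"
  unfolding pcoef_def by (rule someI_ex)
 then show ?thesis by blast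
qed

lemma pcoef_symc:
 assumes la: "la \<in> parts CARD('m::finite) k"
 shows "symc CARD('m) k (pcoef TYPE('m) k la)"
proof (rule symcI)
 fix \<pi> and x :: "nat => real" assume \<pi>: "\<pi> permutes {..<CARD('m)}"
 obtain W :: "quat^'m^'m" where W: "W \<in> Stf" "dg (%a. x (\<pi> (idx a))) = W**dg (%a. x (idx a))**adj W"
  using permute_dg[OF \<pi>] by metis
 then have "phi la (dg (%a::'m. (x \<circ> \<pi>) (idx a))) = phi la (dg (%a::'m. x (idx a)))"
  using phi_conj[OF la W(1)] by simp
 then show "hpoly CARD('m) k (pcoef TYPE('m) k la) (x \<circ> \<pi>) = hpoly CARD('m) k (pcoef TYPE('m) k la) x"
  by (simp only: pcoef[OF la])
qed

text \<open>Apply the functional equation to 1 + tZ and take the t^2 coefficient, summed over a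
  basis of directions Z: the Laplacian at \<open>dg x\<close> becomes \<open>phi la (dg x)\<close>
  times the Laplacian at the identity, which is \<open>c\<close>.\<close>

lemma phi_laplacian:
 assumes la: "la \<in> parts CARD('m::finite) k"
 obtains c where "!!x l B. (!!a::'m. 0 < x a) ==> jet2 (phi la) (dg x) l B ==>
  (\<Sum>b\<in>Basis. B (dg (%a. sqrt (x a))**hproj b**dg (%a. sqrt (x a)))
         (dg (%a. sqrt (x a))**hproj b**dg (%a. sqrt (x a)))) = c * phi la (dg x)"
proof -
 \<comment> \<open>These weights extract the t^2 coefficient from values at 0, ..., k, so that only
   values of \<open>phi la\<close> are integrated.\<close>
 obtain v :: "nat => real" where v: "!!p. degree p <= k ==> (\<Sum>i\<le>k. v i * poly p (real i)) = coeff p 2"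
  using poly_weights[of real k 2] by (auto simp: inj_on_def)
 define c where "c = (\<Sum>b\<in>(Basis :: (quat^'m^'m) set). \<Sum>i\<le>k. v i * phi la (mat 1 + real i *\<^sub>R hproj b))"
 show thesis
 proof
  fix x :: "'m => real" and l B
  assume x: "!!a. 0 < x a" and J: "jet2 (phi la) (dg x) l B"
  define g :: "quat^'m^'m" where "g = dg (%a. sqrt (x a))"
  define gi :: "quat^'m^'m" where "gi = dg (%a. 1 / sqrt (x a))"
  have g: "g \<in> Mts" "adj g = g" "gi**g = mat 1" "g**g = dg x"
   using x by (simp_all add: g_def gi_def dg_mult order_less_imp_le less_imp_neq[symmetric] flip: dg_one)
  have BZ: "B Z Z = (\<Sum>i\<le>k. v i * phi la (dg x + real i *\<^sub>R Z))" for Z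
  proof -
   obtain p where p: "degree p <= k" "!!t. phi la (dg x + t *\<^sub>R Z) = poly p t"
    using hp_line[OF hp_phi[OF la]] by blast
   have "\<forall>t. phi la (dg x + t *\<^sub>R Z + t\<^sup>2 *\<^sub>R 0) = poly p t" by (simp add: p(2))
   then have "coeff p 2 = l 0 + B Z Z" using jet2D(3)[OF J] by blast
   then show ?thesis using v[OF p(1)] by (simp add: p(2) linear_0[OF jet2D(1)[OF J]])
  qed
  define S where "S = (\<Sum>b\<in>Basis. B (g**hproj b**g) (g**hproj b**g))"
  define G where "G U = (\<Sum>b\<in>(Basis :: (quat^'m^'m) set). \<Sum>i\<le>k. v i * phi la (adj g**(U**(mat 1 + real i *\<^sub>R hproj b)**adj U)**g))" for U :: "quat^'m^'m"
  \<comment> \<open>Conjugating the directions by \<open>U\<close> rotates the basis and so leaves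
    the trace unchanged; averaging over \<open>U\<close> is therefore free.\<close>
  have GS: "G U = S" if U: "U \<in> Stf" for U :: "quat^'m^'m"
  proof -
   have lin: "linear (%Y. g**hproj Y**g)"
    using linear_compose[OF linear_hproj linear_conj[of g g]] by (simp add: o_def)
   have bil: "bilinear (%Y Z. B (g**hproj Y**g) (g**hproj Z**g))"
    using jet2D(2)[OF J] linear_compose[OF lin] unfolding bilinear_def o_def by blast
   have T: "(U**X**adj U) \<bullet> Y = X \<bullet> (adj U**Y**U)" for X Y :: "quat^'m^'m"
   proof -
    have "(U**X**adj U) \<bullet> Y = rtr (U**(adj X**adj U**Y))" by (simp add: inner_rtr adj_mult matrix_mul_assoc)
    also have "... = rtr ((adj X**adj U**Y)**U)" by (rule rtr_commute)
    finally show ?thesis by (simp add: inner_rtr matrix_mul_assoc)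
   qed
   have S': "(adj U**X**U) \<bullet> (adj U**Y**U) = X \<bullet> Y" for X Y :: "quat^'m^'m"
   proof -
    have "(adj U**X**U) \<bullet> (adj U**Y**U) = (U**(adj U**X**U)**adj U) \<bullet> Y" by (simp only: T)
    also have "U**(adj U**X**U)**adj U = (U**adj U)**X**(U**adj U)" by (simp only: matrix_mul_assoc)
    finally show ?thesis by (simp add: unitaryD[OF U])
   qed
   have "G U = (\<Sum>b\<in>Basis. B (g**hproj (U**b**adj U)**g) (g**hproj (U**b**adj U)**g))"
   proof -
    have "adj g**(U**(mat 1 + r *\<^sub>R hproj b)**adj U)**g = dg x + r *\<^sub>R (g**hproj (U**b**adj U)**g)" for r b
    proof -
     have "U**(mat 1 + r *\<^sub>R hproj b)**adj U = mat 1 + r *\<^sub>R hproj (U**b**adj U)"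
      by (simp add: hproj_conj[OF U] matrix_linear_simps unitaryD[OF U])
     then show ?thesis by (simp add: g matrix_linear_simps)
    qed
    then show ?thesis unfolding G_def BZ by simp
   qed
   also have "... = S" unfolding S_def by (rule sum_Basis_orthogonal[OF bil T S'])
   finally show ?thesis .
  qed
  have "S = (LINT U|haar. G U)" by (rule haar_eqI[OF GS, symmetric])
  also have "... = (\<Sum>b\<in>(Basis :: (quat^'m^'m) set). \<Sum>i\<le>k. v i *
    (LINT U|haar. phi la (adj g**(U**(mat 1 + real i *\<^sub>R hproj b)**adj U)**g)))"
  proof -
   have int: "integrable haar (%U. phi la (adj g**(U**Y**adj U)**g))" for Y :: "quat^'m^'m"
    by (intro haar_int[OF hp_phi[OF la]] continuous_intros)
   show ?thesis unfolding G_def by (simp add: LINT_sum int)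
  qed
  also have "... = (\<Sum>b\<in>(Basis :: (quat^'m^'m) set). \<Sum>i\<le>k. v i * (phi la (dg x) * phi la (mat 1 + real i *\<^sub>R hproj b)))"
  proof -
   have e: "(LINT U|haar. phi la (adj g**(U**Y**adj U)**g)) = phi la (dg x) * phi la Y"
    if "Y \<in> Hrm" for Y :: "quat^'m^'m" using phi_integral_haar[OF la that g(1,3)] g by simp
   have "mat 1 + r *\<^sub>R hproj b \<in> Hrm" for r and b :: "quat^'m^'m" by (simp add: hproj_herm)
   then show ?thesis by (simp only: e)
  qed
  also have "... = c * phi la (dg x)"
   unfolding c_def sum_distrib_right by (intro sum.cong refl) (simp add: mult_ac)
  finally show "(\<Sum>b\<in>Basis. B (dg (%a. sqrt (x a))**hproj b**dg (%a. sqrt (x a)))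
         (dg (%a. sqrt (x a))**hproj b**dg (%a. sqrt (x a)))) = c * phi la (dg x)"
   unfolding S_def g_def .
 qed
qed

text \<open>The radial form becomes \<open>jack_op\<close> through x_i x_j / (x_i - x_j) = x_i^2 /
  (x_i - x_j) - x_i. The correction is Euler's operator, which multiplies by k.\<close>

lemma pcoef_eigen_pos:
 assumes la: "la \<in> parts CARD('m::finite) k"
 obtains r where "!!x. inj_on x {..<CARD('m)} ==> (!!i. i < CARD('m) ==> 0 < x i) ==>
  jack_op \<beta> CARD('m) (hpoly CARD('m) k (pcoef TYPE('m) k la)) x = r * hpoly CARD('m) k (pcoef TYPE('m) k la) x"
proof -
 let ?m = "CARD('m)" and ?c = "pcoef TYPE('m) k la"
 let ?f = "hpoly ?m k (?c)"
 define E where "E a = el a a 1" for a :: 'm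
 obtain c where c: "!!x l B. (!!a::'m. 0 < x a) ==> jet2 (phi la) (dg x) l B ==>
  (\<Sum>b\<in>Basis. B (dg (%a. sqrt (x a))**hproj b**dg (%a. sqrt (x a)))
         (dg (%a. sqrt (x a))**hproj b**dg (%a. sqrt (x a)))) = c * phi la (dg x)"
  using phi_laplacian[OF la] by blast
 show thesis
 proof
  fix x :: "nat => real" assume x: "inj_on x {..<?m}" "!!i. i < ?m ==> 0 < x i"
  define y where "y a = x (idx a)" for a :: 'm
  have "inj y"
  proof (rule injI)
   fix a b assume "y a = y b"
   then have "idx a = idx b" using inj_onD[OF x(1), of "idx a" "idx b"] by (simp add: y_def)
   then show "a = b" by simp
  qed
  then have y: "inj y" "!!a. 0 < y a" using x(2) by (simp_all add: y_def)
  obtain l B where J: "jet2 (phi la) (dg y) l B" using hp_jet2[OF hp_phi[OF la]] by blast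
  have pd: "pderiv_at (idx a) ?f x = l (E a)" "pderiv_at (idx a) (pderiv_at (idx a) ?f) x = 2 * B (E a) (E a)" for a :: 'm
  proof -
   obtain p where p: "!!t. phi la (dg y + t *\<^sub>R E a) = poly p t" using hp_line[OF hp_phi[OF la]] by blast
   have "\<forall>t. phi la (dg y + t *\<^sub>R E a + t\<^sup>2 *\<^sub>R 0) = poly p t" by (simp add: p)
   then have cp: "coeff p 1 = l (E a) \<and> coeff p 2 = l 0 + B (E a) (E a)" using jet2D(3)[OF J] by blast
   have "?f (x(idx a := s)) = poly p (s - x (idx a))" for s
   proof -
    have "dg (%b::'m. (x(idx a := s)) (idx b)) = dg y + (s - x (idx a)) *\<^sub>R E a"
     by (auto simp: E_def vec_eq_iff y_def of_real_def algebra_simps)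
    then show ?thesis by (simp add: p flip: pcoef[OF la])
   qed
   from pderiv_at_poly[of ?f, OF this] cp linear_0[OF jet2D(1)[OF J]]
   show "pderiv_at (idx a) ?f x = l (E a)" "pderiv_at (idx a) (pderiv_at (idx a) ?f) x = 2 * B (E a) (E a)"
    by simp_all
  qed
  define L where "L i = pderiv_at i ?f x" for i
  define D where "D i = pderiv_at i (pderiv_at i ?f) x" for i
  have "c * ?f x = (\<Sum>a\<in>UNIV. (y a)\<^sup>2 * B (E a) (E a)) +
   real \<beta> / 4 * (\<Sum>a\<in>UNIV. \<Sum>b\<in>UNIV. y a * y b * (l (E a) - l (E b)) / (y a - y b))"
  proof -
   have "phi la (dg y) = ?f x" unfolding y_def by (rule pcoef[OF la])
   then show ?thesis
    using c[OF y(2) J] laplacian_diagonal[OF hp_phi[OF la] phi_conj[OF la] J y] by (simp add: E_def)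
  qed
  also have "(\<Sum>a\<in>UNIV. (y a)\<^sup>2 * B (E a) (E a)) = (\<Sum>a\<in>(UNIV::'m set). (%i. (x i)\<^sup>2 * (D i / 2)) (idx a))"
   by (intro sum.cong refl) (simp add: y_def D_def pd)
  also have "... = (\<Sum>i<?m. (x i)\<^sup>2 * (D i / 2))" by (rule sum_idx)
  also have "(\<Sum>a\<in>UNIV. \<Sum>b\<in>UNIV. y a * y b * (l (E a) - l (E b)) / (y a - y b)) =
   (\<Sum>a\<in>(UNIV::'m set). \<Sum>b\<in>(UNIV::'m set). (%j. x (idx a) * x j * (L (idx a) - L j) / (x (idx a) - x j)) (idx b))"
   by (intro sum.cong refl) (simp add: y_def L_def pd)
  also have "... = (\<Sum>a\<in>(UNIV::'m set). (%i. \<Sum>j<?m. x i * x j * (L i - L j) / (x i - x j)) (idx a))"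
   by (intro sum.cong refl) (rule sum_idx)
  also have "... = (\<Sum>i<?m. \<Sum>j<?m. x i * x j * (L i - L j) / (x i - x j))" by (rule sum_idx)
  also have "... = 2 * (\<Sum>i<?m. \<Sum>j<?m. x i * x j * L i / (x i - x j))" by (rule jack_op_quotient_sum)
  also have "(\<Sum>i<?m. \<Sum>j<?m. x i * x j * L i / (x i - x j)) =
   (\<Sum>i<?m. (\<Sum>j\<in>{..<?m} - {i}. (x i)\<^sup>2 / (x i - x j) * L i) - (real ?m - 1) * (x i * L i))"
  proof (intro sum.cong refl)
   fix i assume "i \<in> {..<?m}"
   then have i: "i < ?m" by simp
   have "(\<Sum>j<?m. x i * x j * L i / (x i - x j)) = (\<Sum>j\<in>{..<?m} - {i}. x i * x j * L i / (x i - x j))"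
    by (rule sum.mono_neutral_right) auto
   also have "... = (\<Sum>j\<in>{..<?m} - {i}. (x i)\<^sup>2 / (x i - x j) * L i - x i * L i)"
   proof (intro sum.cong refl)
    fix j assume "j \<in> {..<?m} - {i}"
    then have "x i - x j ~= 0" using x(1) i by (auto simp: inj_on_def)
    then show "x i * x j * L i / (x i - x j) = (x i)\<^sup>2 / (x i - x j) * L i - x i * L i"
     by (simp add: field_simps power2_eq_square)
   qed
   also have "... = (\<Sum>j\<in>{..<?m} - {i}. (x i)\<^sup>2 / (x i - x j) * L i) - (real ?m - 1) * (x i * L i)"
    using i by (simp add: sum_subtractf of_nat_diff)
   finally show "(\<Sum>j<?m. x i * x j * L i / (x i - x j)) = ..." .
  qed
  also have "... = (\<Sum>i<?m. \<Sum>j\<in>{..<?m} - {i}. (x i)\<^sup>2 / (x i - x j) * L i) - (real ?m - 1) * (real k * ?f x)"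
  proof -
   have "(\<Sum>i<?m. x i * L i) = (\<Sum>i<?m. \<Sum>e\<in>expos ?m k. ?c e * real (e i) * xmon ?m e x)"
    by (intro sum.cong refl) (simp add: L_def euler_hpoly)
   also have "... = (\<Sum>e\<in>expos ?m k. \<Sum>i<?m. ?c e * real (e i) * xmon ?m e x)" by (rule sum.swap)
   also have "... = (\<Sum>e\<in>expos ?m k. real k * (?c e * xmon ?m e x))"
   proof (intro sum.cong refl)
    fix e assume "e \<in> expos ?m k"
    then have "(\<Sum>i<?m. real (e i)) = real k" by (simp add: expos_def flip: of_nat_sum)
    then show "(\<Sum>i<?m. ?c e * real (e i) * xmon ?m e x) = real k * (?c e * xmon ?m e x)"
     by (simp flip: sum_distrib_left sum_distrib_right)
   qed
   finally show ?thesis by (simp add: sum_subtractf hpoly_xmon flip: sum_distrib_left)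
  qed
  finally have eq: "c * ?f x = (\<Sum>i<?m. (x i)\<^sup>2 * (D i / 2)) + real \<beta> / 4 * (2 * ((\<Sum>i<?m. \<Sum>j\<in>{..<?m} - {i}. (x i)\<^sup>2 / (x i - x j) * L i) -
   (real ?m - 1) * (real k * ?f x)))" .
  have half: "(\<Sum>i<?m. (x i)\<^sup>2 * (D i / 2)) = (\<Sum>i<?m. (x i)\<^sup>2 * D i) / 2" by (simp add: sum_divide_distrib)
  have "jack_op \<beta> ?m ?f x = (\<Sum>i<?m. (x i)\<^sup>2 * D i) + real \<beta> * (\<Sum>i<?m. \<Sum>j\<in>{..<?m} - {i}. (x i)\<^sup>2 / (x i - x j) * L i)"
   unfolding jack_op_def D_def L_def ..
  then show "jack_op \<beta> ?m ?f x = (2 * c + real \<beta> * (real ?m - 1) * real k) * ?f x"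
   using eq unfolding half by (simp add: algebra_simps)
 qed
qed

text \<open>Translate all variables by s. Their differences stay fixed, so both sides are
  polynomials in s, and they agree for large s, where the point is positive.\<close>

lemma jack_op_shift:
 assumes pos: "!!x. inj_on x {..<m} ==> (!!i. i < m ==> 0 < x i) ==> jack_op \<beta> m (hpoly m k c) x = r * hpoly m k c x"
  and x: "inj_on x {..<m}"
 shows "jack_op \<beta> m (hpoly m k c) x = r * hpoly m k c x"
proof -
 define P where "P s = jack_op \<beta> m (hpoly m k c) (%i. x i + s) - r * hpoly m k c (%i. x i + s)" for s
 have aff: "real_polynomial_function (%s. x i + s)" for i
  by (intro real_polynomial_function.intros bounded_linear_ident)
 have jw: "jw \<beta> m (%i. x i + s) e = (\<Sum>i<m. real (e i) * (real (e i) - 1)) +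
  real \<beta> * (\<Sum>i<m. \<Sum>j\<in>{..<m} - {i}. (real (e i) / (x i - x j)) * (x i + s))" for s e unfolding jw_def by simp
 have "real_polynomial_function P" unfolding P_def jack_op_hpoly unfolding hpoly_xmon xmon_def jw
  by (intro real_polynomial_function_diff real_polynomial_function_sum real_polynomial_function.intros(4)
    real_polynomial_function.intros(3) real_polynomial_function_prod real_polynomial_function_power
    real_polynomial_function.intros(2) aff finite_lessThan finite_expos finite_Diff) auto
 then obtain a n where P: "!!s. P s = (\<Sum>i\<le>n. a i * s ^ i)" unfolding real_polynomial_function_iff_sum by metis
 define p where "p = (\<Sum>i\<le>n. monom (a i) i)"
 have Pp: "P s = poly p s" for s by (simp add: P p_def poly_sum poly_monom)
 define C where "C = (\<Sum>i<m. \<bar>x i\<bar>)"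
 have "poly p s = poly 0 s" if "s > C" for s
 proof -
  have "0 < x i + s" if "i < m" for i
   using member_le_sum[of i "{..<m}" "%i. \<bar>x i\<bar>"] that \<open>s > C\<close> by (simp add: C_def)
  moreover have "inj_on (%i. x i + s) {..<m}" using x by (simp add: inj_on_def)
  ultimately show ?thesis using pos by (simp add: Pp[symmetric] P_def)
 qed
 then have "p = 0" by (rule poly_eq_eventually)
 then have "P 0 = 0" by (simp add: Pp)
 then show ?thesis by (simp add: P_def)
qed

lemma pcoef_eigen:
 assumes la: "la \<in> parts CARD('m::finite) k"
 shows "\<exists>r. \<forall>x. inj_on x {..<CARD('m)} -->
  jack_op \<beta> CARD('m) (hpoly CARD('m) k (pcoef TYPE('m) k la)) x = r * hpoly CARD('m) k (pcoef TYPE('m) k la) x"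
proof -
 obtain r where "!!x. inj_on x {..<CARD('m)} ==> (!!i. i < CARD('m) ==> 0 < x i) ==>
  jack_op \<beta> CARD('m) (hpoly CARD('m) k (pcoef TYPE('m) k la)) x = r * hpoly CARD('m) k (pcoef TYPE('m) k la) x"
  using pcoef_eigen_pos[OF la] by blast
 from jack_op_shift[OF this] show ?thesis by blast
qed

end

section \<open>Triangularity and leading coefficients of the spherical functions\<close>

lemma prod_parts:
 fixes x :: "nat => real"
 assumes la: "la \<in> parts m k"
 shows "(\<Prod>j<m. (\<Prod>i<Suc j. x i) ^ (la j - la (Suc j))) = xmon m la x"
proof -
 have am: "la (Suc n) <= la n" for n using la by (auto simp: parts_def antimono_def)
 have "(\<Prod>j<n. (\<Prod>i<Suc j. x i) ^ (la j - la (Suc j))) * (\<Prod>i<n. x i) ^ la n = (\<Prod>i<n. x i ^ la i)" for n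
 proof (induction n)
  case (Suc n)
  have "(\<Prod>i<Suc n. x i) ^ (la n - la (Suc n)) * (\<Prod>i<Suc n. x i) ^ la (Suc n) = (\<Prod>i<Suc n. x i) ^ la n"
   using am[of n] by (simp only: power_add[symmetric] le_add_diff_inverse2)
  then have "(\<Prod>j<Suc n. (\<Prod>i<Suc j. x i) ^ (la j - la (Suc j))) * (\<Prod>i<Suc n. x i) ^ la (Suc n) =
   (\<Prod>j<n. (\<Prod>i<Suc j. x i) ^ (la j - la (Suc j))) * (\<Prod>i<Suc n. x i) ^ la n"
   by (simp only: prod.lessThan_Suc[of _ n] mult.assoc)
  also have "(\<Prod>i<Suc n. x i) ^ la n = (\<Prod>i<n. x i) ^ la n * x n ^ la n" by (simp add: power_mult_distrib)
  finally have E: "(\<Prod>j<Suc n. (\<Prod>i<Suc j. x i) ^ (la j - la (Suc j))) * (\<Prod>i<Suc n. x i) ^ la (Suc n) =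
   (\<Prod>j<n. (\<Prod>i<Suc j. x i) ^ (la j - la (Suc j))) * ((\<Prod>i<n. x i) ^ la n * x n ^ la n)" .
  have "(\<Prod>i<Suc n. x i ^ la i) = (\<Prod>i<n. x i ^ la i) * x n ^ la n" by simp
  also have "... = (\<Prod>j<n. (\<Prod>i<Suc j. x i) ^ (la j - la (Suc j))) * (\<Prod>i<n. x i) ^ la n * x n ^ la n"
   by (simp only: Suc)
  finally show ?case unfolding E by (simp only: mult.assoc)
 qed simp
 from this[of m] show ?thesis using la by (simp add: xmon_def parts_def expos_def)
qed

lemma coeff_sum_monom:
 assumes "finite S"
 shows "coeff (\<Sum>e\<in>S. monom (f e) (w e)) N = (\<Sum>e\<in>S. if w e = N then f e else 0)"
 using assms by (simp add: coeff_sum)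

context fld
begin

text \<open>The diagonal matrix is dominated by a multiple of 1 + t P_r, for which
  \<open>Delta_growth\<close> is uniform in \<open>V\<close>; Abel summation then gives the exponent
  of t.\<close>

lemma phi_growth:
 fixes y :: "nat => real"
 assumes la: "la \<in> parts CARD('m::finite) k" and y: "!!i. 0 < y i" and r: "r <= CARD('m)"
 obtains C where "!!t. 1 <= t ==> \<bar>phi la (dg (%a::'m. (if idx a < r then t else 1) * y (idx a)))\<bar> <= C * t ^ (\<Sum>i<r. la i)"
proof
 let ?m = "CARD('m)"
 define M where "M = (\<Sum>i<?m. y i)"
 have yM: "y (idx a) <= M" for a :: 'm
  unfolding M_def using y by (intro member_le_sum) (auto intro: less_imp_le)
 have M0: "0 <= M" using y by (simp add: M_def sum_nonneg less_imp_le)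
 define C where "C = (\<Prod>j<?m. (M ^ Suc j * 2 ^ ?m) ^ (la j - la (Suc j)))"
 fix t :: real assume t: "1 <= t"
 define X :: "quat^'m^'m" where "X = dg (%a. (if idx a < r then t else 1) * y (idx a))"
 \<comment> \<open>Exactly what fills \<open>X\<close> up to M(1 + t P_r).\<close>
 define Z :: "quat^'m^'m" where "Z = dg (%a. (if idx a < r then t else 1) * (M - y (idx a)) + (if idx a < r then M else 0))"
 have XZ: "X + Z = M *\<^sub>R (mat 1 + t *\<^sub>R Pj r)" unfolding X_def Z_def Pj_def dg_one[symmetric] dg_scaleR dg_add
  by (rule arg_cong[of _ _ dg]) (auto simp: fun_eq_iff algebra_simps)
 have psd: "psd X" "psd Z"
  using t y yM M0 by (auto simp: X_def Z_def less_imp_le intro!: psd_dg add_nonneg_nonneg mult_nonneg_nonneg)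
 have up: "powf la (adj V**X**V) <= C * t ^ (\<Sum>i<r. la i)" if V: "V \<in> Stf" for V :: "quat^'m^'m"
 proof -
  have psd': "psd (adj V**X**V)" "psd (adj V**Z**V)" using psd stiefel_mats[OF V] by (auto intro: psd_conj')
  have "powf la (adj V**X**V) <= (\<Prod>j<?m. ((M ^ Suc j * 2 ^ ?m) * t ^ min (Suc j) r) ^ (la j - la (Suc j)))"
   unfolding powf_def
  proof (rule prod_mono)
   fix j assume j: "j \<in> {..<?m}"
   have n: "0 <= Delta (Suc j) (adj V**X**V)" using j by (intro Delta_psd psd') auto
   have "Delta (Suc j) (adj V**X**V) <= Delta (Suc j) (adj V**X**V + adj V**Z**V)"
    using j by (intro Delta_mono psd') auto
   also have "adj V**X**V + adj V**Z**V = adj V**(X + Z)**V"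
    by (simp add: matrix_add_ldistrib matrix_add_rdistrib)
   also have "... = M *\<^sub>R (adj V**(mat 1 + t *\<^sub>R Pj r)**V)"
    unfolding XZ by (simp only: matrix_scaleR_left matrix_scaleR_right)
   also have "Delta (Suc j) ... = M ^ Suc j * Delta (Suc j) (adj V**(mat 1 + t *\<^sub>R Pj r)**V)"
    by (rule hp_scale[OF hp_Delta])
   also have "... <= M ^ Suc j * (2 ^ ?m * t ^ min (Suc j) r)"
    using M0 j r by (intro mult_left_mono Delta_growth[OF V _ r t]) auto
   finally have "Delta (Suc j) (adj V**X**V) <= M ^ Suc j * 2 ^ ?m * t ^ min (Suc j) r"
    by (simp only: mult.assoc)
   with n show "0 <= Delta (Suc j) (adj V**X**V) ^ (la j - la (Suc j)) \<and>
    Delta (Suc j) (adj V**X**V) ^ (la j - la (Suc j)) <= (M ^ Suc j * 2 ^ ?m * t ^ min (Suc j) r) ^ (la j - la (Suc j))"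
    by (simp add: power_mono)
  qed
  also have "... = C * t ^ (\<Sum>j<?m. min (Suc j) r * (la j - la (Suc j)))"
   unfolding C_def power_mult_distrib[of _ "t ^ _"] prod.distrib power_mult[symmetric] power_sum[symmetric] ..
  also have "(\<Sum>j<?m. min (Suc j) r * (la j - la (Suc j))) = (\<Sum>i<r. la i)"
   using parts_sum_diff[OF la, of r] r by (simp add: min_absorb2)
  finally show ?thesis .
 qed
 have "phi la X <= C * t ^ (\<Sum>i<r. la i)" unfolding phi_def by (rule kavg_mono_const[OF hp_powf[OF la] up])
 moreover have "0 <= phi la X" unfolding phi_def using psd(1)
  by (intro kavg_ge_const[OF hp_powf[OF la]] powf_psd psd_conj' stiefel_mats)
 ultimately show "\<bar>phi la (dg (%a::'m. (if idx a < r then t else 1) * y (idx a)))\<bar> <= C * t ^ (\<Sum>i<r. la i)"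
  by (simp add: X_def)
qed

text \<open>Scale the first r variables by t. By \<open>phi_growth\<close> no power of t beyond la_0
  + ... + la_(r-1) survives, for any values of the variables, so all coefficients with a larger
  partial sum vanish.\<close>

lemma pcoef_dom:
 assumes la: "la \<in> parts CARD('m::finite) k" and e: "e \<in> expos CARD('m) k" "pcoef TYPE('m) k la e ~= 0"
 shows "dom CARD('m) e la" unfolding dom_def
proof (intro allI impI)
 let ?m = "CARD('m)"
 fix r assume r: "r <= ?m"
 show "(\<Sum>i<r. e i) <= (\<Sum>i<r. la i)"
 proof (rule ccontr)
  define N where "N = (\<Sum>i<r. e i)"
  assume "\<not> (\<Sum>i<r. e i) <= (\<Sum>i<r. la i)"
  then have N: "(\<Sum>i<r. la i) < N" by (simp add: N_def)
  define c' where "c' f = (if (\<Sum>i<r. f i) = N then pcoef TYPE('m) k la f else 0)" for f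
  have "hpoly ?m k c' y = hpoly ?m k (%_. 0) y" if y: "!!i. 0 < y i" for y
  proof -
   define p where "p = (\<Sum>f\<in>expos ?m k. monom (pcoef TYPE('m) k la f * xmon ?m f y) (\<Sum>i<r. f i))"
   have "xmon ?m f (%i. (if i < r then t else 1) * y i) = xmon ?m f y * t ^ (\<Sum>i<r. f i)" for f t
   proof -
    have "(\<Prod>i<?m. (if i < r then t else 1) ^ f i) = (\<Prod>i<r. t ^ f i)"
     using r by (intro prod.mono_neutral_cong_right) auto
    then show ?thesis by (simp add: xmon_def power_mult_distrib prod.distrib power_sum)
   qed
   then have p: "poly p t = phi la (dg (%a::'m. (if idx a < r then t else 1) * y (idx a)))" for t
    unfolding pcoef[OF la, of "%i. (if i < r then t else 1) * y i"] hpoly_xmon p_def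
    by (simp add: poly_sum poly_monom mult.assoc)
   obtain C where "!!t. 1 <= t ==> \<bar>poly p t\<bar> <= C * t ^ (\<Sum>i<r. la i)"
    using phi_growth[OF la, of y] y r unfolding p by blast
   then have "coeff p N = 0" using N by (rule poly_growth)
   moreover have "coeff p N = hpoly ?m k c' y"
    unfolding p_def coeff_sum_monom[OF finite_expos] hpoly_xmon c'_def by (intro sum.cong) auto
   ultimately show ?thesis by (simp add: hpoly_def)
  qed
  then have "c' e = 0" by (rule hpoly_unique[OF _ e(1)])
  then show False using e(2) by (simp add: c'_def N_def)
 qed
qed

definition gblock :: "nat => quat^'m^'m => quat^'m^'m"
 where "gblock j V = Pj j**adj V**Pj j + Qj j"

text \<open>Monotonicity allows the diagonal entries outside the leading block to be dropped; the
  rest factors through the leading block of \<open>adj V\<close>.\<close>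

lemma Delta_diagonal_lower:
 fixes V :: "quat^'m^'m"
 assumes V: "V \<in> Stf" and x: "!!i. 0 < x i" and j: "j <= CARD('m)"
 shows "(\<Prod>i<j. x i) * hdet (gblock j V**adj (gblock j V)) <= Delta j (adj V**dg (%a. x (idx a))**V)"
proof -
 define Y :: "quat^'m^'m" where "Y = dg (%a. if idx a < j then x (idx a) else 0)"
 define Z :: "quat^'m^'m" where "Z = dg (%a. if idx a < j then 0 else x (idx a))"
 have psd: "psd Y" "psd Z" using x by (auto simp: Y_def Z_def less_imp_le intro!: psd_dg)
 then have psd': "psd (adj V**Y**V)" "psd (adj V**Z**V)" using stiefel_mats[OF V] by (auto intro: psd_conj')
 have YZ: "Y + Z = dg (%a. x (idx a))"
  unfolding Y_def Z_def dg_add by (rule arg_cong[of _ _ dg]) (auto simp: fun_eq_iff)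
 have PY: "Pj j**Y**Pj j = Y" by (simp add: Pj_def Y_def dg_mult if_distrib cong: if_cong)
 define W where "W = Pj j**adj V**Pj j"
 have W: "W = Pj j**W**Pj j" by (simp add: W_def)
 have gW: "gblock j V = W + Qj j" by (simp add: gblock_def W_def)
 have gm: "gblock j V \<in> Mts" using V by (simp add: gblock_def stiefel_mats)
 have "Delta j (adj V**Y**V) = hdet (Pj j**(adj V**Y**V)**Pj j + Qj j)"
  using psd'(1) by (intro Delta_hdet j psd_herm)
 also have "Pj j**(adj V**Y**V)**Pj j = Pj j**(adj V**(Pj j**Y**Pj j)**V)**Pj j" by (simp only: PY)
 also have "... = W**Y**adj W" by (simp add: W_def adj_mult matrix_mul_assoc)
 also have "W**Y**adj W + Qj j = gblock j V**(Y + Qj j)**adj (gblock j V)"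
  unfolding gW by (rule block_conj[OF W PY[symmetric]])
 also have "hdet ... = hdet (gblock j V**adj (gblock j V)) * hdet (Y + Qj j)"
  using psd(1) by (intro hdet_conj gm herm_simps psd_herm PQ_mats)
 also have "Y + Qj j = dg (%a. if idx a < j then x (idx a) else 1)"
  unfolding Y_def Qj_def dg_add by (rule arg_cong[of _ _ dg]) (auto simp: fun_eq_iff)
 also have "hdet ... = (\<Prod>i<j. x i)" unfolding hdet_dg by (rule prod_idx_trunc[OF j])
 finally have "Delta j (adj V**Y**V) = (\<Prod>i<j. x i) * hdet (gblock j V**adj (gblock j V))" by simp
 moreover have "adj V**dg (%a. x (idx a))**V = adj V**Y**V + adj V**Z**V"
  by (simp add: YZ[symmetric] matrix_add_ldistrib matrix_add_rdistrib)
 ultimately show ?thesis using Delta_mono[OF psd' j] by simp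
qed

text \<open>Finitely many translates of the set where h exceeds h(1)/2 cover the compact group, and
  all translates of h have the same integral.\<close>

lemma haar_positive:
 fixes h :: "quat^'m^'m => real"
 assumes h: "continuous_on UNIV h" "!!V. V \<in> Stf ==> 0 <= h V" "0 < h (mat 1)"
 shows "0 < (LINT V|haar. h V)"
proof -
 define s where "s = h (mat 1) / 2"
 have s: "0 < s" "s < h (mat 1)" using h(3) by (simp_all add: s_def)
 define O' where "O' W = {V :: quat^'m^'m. s < h (adj W**V)}" for W
 have "open (O' W)" for W
 proof -
  have "continuous_on UNIV (%V. h (adj W**V))"
   by (rule continuous_on_compose2[OF h(1)]) (auto intro!: continuous_intros)
  then show ?thesis unfolding O'_def by (intro open_Collect_less continuous_on_const)
 qed
 moreover have "Stf \<subseteq> (\<Union>W\<in>Stf. O' W)" using s by (auto simp: O'_def stiefelD)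
 ultimately obtain T where T: "T \<subseteq> (Stf :: (quat^'m^'m) set)" "finite T" "Stf \<subseteq> (\<Union>W\<in>T. O' W)"
  using compactE_image[OF compact_stiefel, of "Stf" O'] by metis
 have cont: "continuous_on UNIV (%V. h (adj W**V))" for W :: "quat^'m^'m"
  by (rule continuous_on_compose2[OF h(1)]) (auto intro!: continuous_intros)
 have int: "integrable haar (%V. h (adj W**V))" for W :: "quat^'m^'m" by (intro sm_integrable[OF haar] cont)
 have "s = (LINT V|(haar :: (quat^'m^'m) measure). s)" by (simp only: haar_const)
 also have "... <= (LINT V|haar. (\<Sum>W\<in>T. h (adj W**V)))"
 proof (intro integral_mono sm_integrable[OF haar] continuous_on_const continuous_on_sum cont)
  fix V :: "quat^'m^'m" assume "V \<in> space haar"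
  then have V: "V \<in> Stf" by (simp add: sm_space[OF haar])
  then obtain W where W: "W \<in> T" "s < h (adj W**V)" using T(3) by (auto simp: O'_def)
  have "h (adj W**V) <= (\<Sum>W\<in>T. h (adj W**V))"
   using T(1,2) W(1) V by (intro member_le_sum) (auto intro!: h(2) unitary_mult unitary_adj)
  then show "s <= (\<Sum>W\<in>T. h (adj W**V))" using W(2) by simp
 qed
 also have "... = (\<Sum>W\<in>T. (LINT V|haar. h (adj W**V)))" by (simp add: LINT_sum int)
 also have "... = (\<Sum>W\<in>T. (LINT V|haar. h V))"
  using T(1) by (intro sum.cong refl sm_invariant[OF haar h(1)] unitary_adj) auto
 finally have "s <= real (card T) * (LINT V|haar. h V)" by simp
 then have "0 < real (card T) * (LINT V|haar. h V)" using s(1) by linarith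
 then show ?thesis by (simp add: zero_less_mult_iff)
qed

lemma phi_diagonal_lower:
 assumes la: "la \<in> parts CARD('m::finite) k"
 obtains \<delta> where "0 < \<delta>" "!!x. (!!i. 0 < x i) ==> \<delta> * xmon CARD('m) la x <= phi la (dg (%a::'m. x (idx a)))"
proof -
 let ?m = "CARD('m)"
 define h where "h V = (\<Prod>j<?m. hdet (gblock (Suc j) V**adj (gblock (Suc j) V)) ^ (la j - la (Suc j)))" for V :: "quat^'m^'m"
 have gg: "psd (gblock j V**adj (gblock j V))" if "V \<in> Stf" for j and V :: "quat^'m^'m"
  using that by (intro psd_gg) (simp add: gblock_def stiefel_mats)
 have cont: "continuous_on UNIV h"
  unfolding h_def gblock_def by (intro continuous_intros continuous_hp[OF hp_hdet])
 have pos: "0 < (LINT V|haar. h V)"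
 proof (rule haar_positive[OF cont])
  show "0 <= h V" if "V \<in> Stf" for V
   unfolding h_def using that by (intro prod_nonneg ballI zero_le_power hdet_psd gg)
  have "gblock j (mat 1 :: quat^'m^'m) = mat 1" for j by (simp add: gblock_def)
  then show "0 < h (mat 1)" using hdet_dg[of "%_::'m. 1"] by (simp add: h_def dg_one)
 qed
 show thesis
 proof (rule that[OF pos])
  fix x :: "nat => real" assume x: "!!i. 0 < x i"
  define X :: "quat^'m^'m" where "X = dg (%a. x (idx a))"
  have "(LINT V|haar. xmon ?m la x * h V) <= (LINT V|haar. powf la (adj V**X**V))"
  proof (intro integral_mono kavg_integrable[OF hp_powf[OF la]])
   show "integrable haar (%V. xmon ?m la x * h V)" by (intro sm_integrable[OF haar] continuous_intros cont)
   fix V :: "quat^'m^'m" assume "V \<in> space haar"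
   then have V: "V \<in> Stf" by (simp add: sm_space[OF haar])
   have "xmon ?m la x * h V = (\<Prod>j<?m. ((\<Prod>i<Suc j. x i) * hdet (gblock (Suc j) V**adj (gblock (Suc j) V))) ^ (la j - la (Suc j)))"
    unfolding h_def prod_parts[OF la, symmetric] power_mult_distrib prod.distrib ..
   also have "... <= powf la (adj V**X**V)" unfolding powf_def
   proof (rule prod_mono)
    fix j assume j: "j \<in> {..<?m}"
    have "0 <= (\<Prod>i<Suc j. x i) * hdet (gblock (Suc j) V**adj (gblock (Suc j) V))"
     using x by (intro mult_nonneg_nonneg prod_nonneg hdet_psd gg V) (auto intro: less_imp_le)
    moreover have "(\<Prod>i<Suc j. x i) * hdet (gblock (Suc j) V**adj (gblock (Suc j) V)) <= Delta (Suc j) (adj V**X**V)"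
     unfolding X_def using j by (intro Delta_diagonal_lower V x) auto
    ultimately show "0 <= ((\<Prod>i<Suc j. x i) * hdet (gblock (Suc j) V**adj (gblock (Suc j) V))) ^ (la j - la (Suc j)) \<and>
     ((\<Prod>i<Suc j. x i) * hdet (gblock (Suc j) V**adj (gblock (Suc j) V))) ^ (la j - la (Suc j)) \<le>
     Delta (Suc j) (adj V**X**V) ^ (la j - la (Suc j))" by (blast intro: power_mono zero_le_power)
   qed
   finally show "xmon ?m la x * h V <= powf la (adj V**X**V)" .
  qed
  then show "(LINT V|haar. h V) * xmon ?m la x <= phi la (dg (%a::'m. x (idx a)))"
   by (simp add: phi_def kavg_def X_def mult.commute)
 qed
qed

text \<open>Along the Kronecker curve x^la is the fastest growing monomial of \<open>phi la\<close>,
  so the lower bound by a positive multiple of x^la survives in its coefficient.\<close>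

lemma pcoef_leading:
 assumes la: "la \<in> parts CARD('m::finite) k"
 shows "0 < pcoef TYPE('m) k la la"
proof -
 let ?m = "CARD('m)" and ?c = "pcoef TYPE('m) k la" and ?w = "wt (Suc k) CARD('m)"
 obtain \<delta> where \<delta>: "0 < \<delta>" "!!x. (!!i. 0 < x i) ==> \<delta> * xmon CARD('m) la x <= phi la (dg (%a::'m. x (idx a)))"
  using phi_diagonal_lower[OF la] by blast
 note la_e = parts_expos[OF la]
 define p where "p = (\<Sum>e\<in>expos ?m k. monom (?c e) (?w e))"
 have lt: "?w e < ?w la" if "e \<in> expos ?m k" "?c e ~= 0" "e ~= la" for e
  using that by (intro lexl_wt[OF _ la_e] dom_lexl[OF pcoef_dom[OF la] _ la_e])
 have d: "degree p <= ?w la" unfolding p_def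
 proof (intro degree_sum_le finite_expos)
  fix e assume e: "e \<in> expos ?m k"
  show "degree (monom (?c e) (?w e)) <= ?w la"
  proof (cases "?c e = 0 \<or> e = la")
   case True
   then show ?thesis by (auto simp: degree_monom_le)
  next
   case False
   then show ?thesis using lt[OF e] degree_monom_le[of "?c e" "?w e"] by simp
  qed
 qed
 have "coeff p (?w la) = (\<Sum>e\<in>expos ?m k. if e = la then ?c la else 0)"
  unfolding p_def coeff_sum_monom[OF finite_expos] using wt_inj[OF _ la_e] by (intro sum.cong) auto
 then have cp: "coeff p (?w la) = ?c la" using la_e by simp
 have "\<forall>\<^sub>F t in at_top. \<delta> <= poly p t / t ^ ?w la" using eventually_gt_at_top[of 0]
 proof eventually_elim
  fix t :: real assume t: "0 < t"
  have "\<delta> * t ^ ?w la <= poly p t" using \<delta>(2)[of "kron (Suc k) ?m t"] kron_pos[OF t]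
   unfolding pcoef[OF la] hpoly_kron xmon_kron p_def by simp
  then show "\<delta> <= poly p t / t ^ ?w la" using t by (simp add: pos_le_divide_eq)
 qed
 then have "\<delta> <= ?c la" unfolding cp[symmetric] by (intro tendsto_lowerbound[OF poly_tendsto_coeff[OF d]]) auto
 then show ?thesis using \<delta>(1) by simp
qed

lemma pcoef_trig: "trig CARD('m::finite) k (pcoef TYPE('m) k)" unfolding trig_def
proof (intro ballI conjI impI)
 fix la assume la: "la \<in> parts CARD('m) k"
 show "symc CARD('m) k (pcoef TYPE('m) k la)" by (rule pcoef_symc[OF la])
 show "pcoef TYPE('m) k la la ~= 0" using pcoef_leading[OF la] by simp
 show "dom CARD('m) e la" if "e \<in> expos CARD('m) k" "pcoef TYPE('m) k la e ~= 0" for e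
  by (rule pcoef_dom[OF la that])
qed

text \<open>An invariant polynomial is determined by its symmetric restriction to diagonal matrices,
  and triangularity makes the restricted \<open>phi\<close> span the symmetric polynomials.\<close>

lemma invariant_expansion:
 fixes F :: "quat^'m^'m => real"
 assumes F: "hp k F" and inv: "!!U X. U \<in> Stf ==> F (U**X**adj U) = F X"
 obtains a where "!!X. X \<in> Hrm ==> F X = (\<Sum>la\<in>parts CARD('m) k. a la * phi la X)"
proof -
 let ?m = "CARD('m)"
 obtain c where c: "!!x. F (dg (%a. x (idx a))) = hpoly ?m k c x"
  using isH_hp_dg[OF F] unfolding isH_def by blast
 have "symc ?m k c"
 proof (rule symcI)
  fix \<pi> and x :: "nat => real" assume \<pi>: "\<pi> permutes {..<?m}"
  obtain W :: "quat^'m^'m" where W: "W \<in> Stf" "dg (%a. x (\<pi> (idx a))) = W**dg (%a. x (idx a))**adj W"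
   using permute_dg[OF \<pi>] by metis
  then have "F (dg (%a::'m. (x \<circ> \<pi>) (idx a))) = F (dg (%a::'m. x (idx a)))" using inv[OF W(1)] by simp
  then show "hpoly ?m k c (x \<circ> \<pi>) = hpoly ?m k c x" by (simp only: c)
 qed
 then obtain a where a: "!!e. e \<in> expos ?m k ==> c e = (\<Sum>la\<in>parts ?m k. a la * pcoef TYPE('m) k la e)"
  using trig_span[OF pcoef_trig] by blast
 have eq: "F (dg (%a. x (idx a))) = (\<Sum>la\<in>parts ?m k. a la * phi la (dg (%a::'m. x (idx a))))" for x
 proof -
  have "hpoly ?m k c x = hpoly ?m k (%e. \<Sum>la\<in>parts ?m k. a la * pcoef TYPE('m) k la e) x"
   by (rule hpoly_cong[OF a])
  then show ?thesis by (simp add: c hpoly_sum hpoly_cmult pcoef)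
 qed
 show thesis
 proof (rule that)
  fix X :: "quat^'m^'m" assume X: "X \<in> Hrm"
  obtain U :: "quat^'m^'m" and x where U: "U \<in> Stf" "X = U**dg x**adj U" by (rule spectral[OF X])
  show "F X = (\<Sum>la\<in>parts ?m k. a la * phi la X)"
   using eq[of "%i. x (ith i)"] by (simp add: U(2) inv[OF U(1)] phi_conj[OF _ U(1)])
 qed
qed

end

section \<open>Positivity and Cauchy-Schwarz\<close>

definition point_functional :: "'x set => (('x => real) => real) => bool"
 where "point_functional X D \<longleftrightarrow> (\<exists>I y. finite I \<and> I \<subseteq> X \<and> (\<forall>F. D F = (\<Sum>x\<in>I. y x * F x)))"

lemma point_functional_eval: "x \<in> X ==> point_functional X (%F. F x)"
 unfolding point_functional_def by (intro exI[of _ "{x}"] exI[of _ "%_. 1"]) auto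

lemma point_functional_cmult:
 assumes "point_functional X D"
 shows "point_functional X (%F. c * D F)"
proof -
 obtain I y where "finite I" "I \<subseteq> X" "\<forall>F. D F = (\<Sum>x\<in>I. y x * F x)"
  using assms unfolding point_functional_def by blast
 then show ?thesis unfolding point_functional_def
  by (intro exI[of _ I] exI[of _ "%x. c * y x"]) (simp add: sum_distrib_left mult.assoc)
qed

lemma point_functional_add:
 assumes "point_functional X D" "point_functional X E"
 shows "point_functional X (%F. D F + E F)"
proof -
 obtain I y J z where I: "finite I" "I \<subseteq> X" "\<forall>F. D F = (\<Sum>x\<in>I. y x * F x)"
  and J: "finite J" "J \<subseteq> X" "\<forall>F. E F = (\<Sum>x\<in>J. z x * F x)" using assms unfolding point_functional_def by metis
 have "D F + E F = (\<Sum>x\<in>I \<union> J. ((if x \<in> I then y x else 0) + (if x \<in> J then z x else 0)) * F x)" for F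
 proof -
  have "(\<Sum>x\<in>I. y x * F x) = (\<Sum>x\<in>I \<union> J. (if x \<in> I then y x else 0) * F x)"
   using I(1) J(1) by (intro sum.mono_neutral_cong_left) auto
  moreover have "(\<Sum>x\<in>J. z x * F x) = (\<Sum>x\<in>I \<union> J. (if x \<in> J then z x else 0) * F x)"
   using I(1) J(1) by (intro sum.mono_neutral_cong_left) auto
  ultimately show ?thesis using I(3) J(3) by (simp add: distrib_right sum.distrib)
 qed
 then show ?thesis unfolding point_functional_def using I J
  by (intro exI[of _ "I \<union> J"] exI[of _ "%x. (if x \<in> I then y x else 0) + (if x \<in> J then z x else 0)"]) blast
qed

lemma point_functional_sum:
 assumes "finite S" "!!a. a \<in> S ==> point_functional X (D a)"
 shows "point_functional X (%F. \<Sum>a\<in>S. D a F)" using assms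
proof (induction S rule: finite_induct)
 case empty
 show ?case unfolding point_functional_def by (intro exI[of _ "{}"]) auto
qed (auto intro: point_functional_add)

text \<open>Induction on \<open>L\<close>: by independence the new function differs at some x0 from
  the combination that the old functionals predict, and the corrected evaluation at x0 is the new
  dual functional.\<close>

lemma dual_functionals:
 fixes f :: "'l => 'x => real"
 assumes "finite L" "!!a. (!!x. x \<in> X ==> (\<Sum>l\<in>L. a l * f l x) = 0) ==> \<forall>l\<in>L. a l = 0"
 shows "\<exists>D. \<forall>k\<in>L. point_functional X (D k) \<and> (\<forall>l\<in>L. D k (f l) = (if l = k then 1 else 0))" using assms
proof (induction L rule: finite_induct)
 case (insert u L)
 have "\<forall>l\<in>L. a l = 0" if a: "!!x. x \<in> X ==> (\<Sum>l\<in>L. a l * f l x) = 0" for a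
 proof -
  have "(\<Sum>l\<in>insert u L. (if l = u then 0 else a l) * f l x) = 0" if "x \<in> X" for x
  proof -
   have "(\<Sum>l\<in>L. (if l = u then 0 else a l) * f l x) = (\<Sum>l\<in>L. a l * f l x)"
    using insert.hyps by (intro sum.cong) auto
   then show ?thesis using a[OF that] insert.hyps by simp
  qed
  then have "\<forall>l\<in>insert u L. (if l = u then 0 else a l) = 0" by (rule insert.prems)
  then show ?thesis using insert.hyps by (metis insertI2)
 qed
 then obtain D where D: "!!k. k \<in> L ==> point_functional X (D k)"
  "!!k l. k \<in> L ==> l \<in> L ==> D k (f l) = (if l = k then 1 else 0)" using insert.IH by blast
 define r where "r x = f u x - (\<Sum>l\<in>L. D l (f u) * f l x)" for x
 obtain x0 where x0: "x0 \<in> X" "r x0 ~= 0"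
 proof -
  have "\<exists>x\<in>X. r x ~= 0"
  proof (rule ccontr)
   assume z: "\<not> (\<exists>x\<in>X. r x ~= 0)"
   have "(\<Sum>l\<in>insert u L. (if l = u then 1 else - D l (f u)) * f l x) = 0" if "x \<in> X" for x
   proof -
    have "(\<Sum>l\<in>L. (if l = u then 1 else - D l (f u)) * f l x) = (\<Sum>l\<in>L. - (D l (f u) * f l x))"
     using insert.hyps by (intro sum.cong) auto
    then show ?thesis using z that insert.hyps by (simp add: r_def sum_negf)
   qed
   from insert.prems[OF this] have "(1::real) = 0" by (auto dest: bspec[of _ _ u])
   then show False by simp
  qed
  then show thesis using that by blast
 qed
 define E where "E F = (1 / r x0) * (F x0 + (\<Sum>l\<in>L. (- f l x0) * D l F))" for F
 have E: "point_functional X E" unfolding E_def[abs_def] using insert.hyps x0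
  by (intro point_functional_cmult point_functional_add point_functional_eval point_functional_sum D)
 have EL: "E (f l) = 0" if "l \<in> L" for l
 proof -
  have "(\<Sum>i\<in>L. (- f i x0) * D i (f l)) = (\<Sum>i\<in>L. if i = l then - f l x0 else 0)"
   using that D(2) by (intro sum.cong) auto
  then show ?thesis using that insert.hyps by (simp add: E_def)
 qed
 have Eu: "E (f u) = 1"
 proof -
  have "f u x0 + (\<Sum>l\<in>L. (- f l x0) * D l (f u)) = r x0" by (simp add: r_def sum_negf mult.commute)
  then show ?thesis using x0 by (simp add: E_def)
 qed
 define D' where "D' k F = (if k = u then E F else D k F + (- D k (f u)) * E F)" for k F
 show ?case
 proof (intro exI[of _ D'] ballI conjI)
  fix k assume k: "k \<in> insert u L"
  show "point_functional X (D' k)"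
  proof (cases "k = u")
   case True
   then show ?thesis using E by (simp add: D'_def[abs_def])
  next
   case False
   then have "D' k = (%F. D k F + (- D k (f u)) * E F)" by (simp add: D'_def fun_eq_iff)
   then show ?thesis using False k by (simp only:) (intro point_functional_add point_functional_cmult D E; simp)
  qed
  fix l assume l: "l \<in> insert u L"
  show "D' k (f l) = (if l = k then 1 else 0)" using k l insert.hyps D(2) EL Eu by (auto simp: D'_def)
 qed
qed auto

context fld
begin

text \<open>The expansion coefficients of the k-th power of the trace. As the Jack polynomials of
  degree k must sum to that power, these are the factors that normalize \<open>phi\<close>.\<close>

definition acoef :: "'m::finite itself => nat => (nat => nat) => real"
 where "acoef (_ :: 'm itself) k = (SOME a.
  \<forall>X\<in>Hrm :: (quat^'m^'m) set. rtr X ^ k = (\<Sum>la\<in>parts CARD('m) k. a la * phi la X))"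

lemma rtr_power_acoef:
 assumes "X \<in> Hrm"
 shows "rtr (X :: quat^'m^'m) ^ k = (\<Sum>la\<in>parts CARD('m) k. acoef TYPE('m) k la * phi la X)"
proof -
 let ?P = "%a. \<forall>X\<in>Hrm :: (quat^'m^'m) set. rtr X ^ k = (\<Sum>la\<in>parts CARD('m) k. a la * phi la X)"
 have "hp k (%X :: quat^'m^'m. rtr X ^ k)" using hp_power[OF hp_linear[OF linear_rtr], of k] by simp
 then have "\<exists>a. ?P a" by (rule invariant_expansion) (auto simp: rtr_conj)
 then obtain a where "?P a" ..
 then have "?P (acoef TYPE('m) k)" unfolding acoef_def by (rule someI[of ?P])
 then show ?thesis using assms by blast
qed

lemma sum_power_acoef:
 "(\<Sum>la\<in>parts CARD('m::finite) k. acoef TYPE('m) k la * hpoly CARD('m) k (pcoef TYPE('m) k la) x) = (\<Sum>i<CARD('m). x i) ^ k"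
proof -
 have "rtr (dg (%a::'m. x (idx a))) = (\<Sum>i<CARD('m). x i)" unfolding rtr_dg by (rule sum_idx)
 then show ?thesis using rtr_power_acoef[of "dg (%a::'m. x (idx a))" k] by (simp add: pcoef)
qed

text \<open>Finitely many weighted samples isolate the coefficient of one \<open>phi\<close>; the
  points are positive definite so that square roots can be taken there.\<close>

lemma phi_duals:
 assumes la: "la \<in> parts CARD('m::finite) k"
 obtains I and y :: "quat^'m^'m => real" where "finite I" "!!B. B \<in> I ==> pdef B"
  "!!l. l \<in> parts CARD('m) k ==> (\<Sum>B\<in>I. y B * phi l B) = (if l = la then 1 else 0)"
  "!!d. (\<Sum>B\<in>I. y B * (\<Sum>l\<in>parts CARD('m) k. d l * phi l B)) = d la"
proof -
 let ?L = "parts CARD('m) k" and ?X = "{B :: quat^'m^'m. pdef B}"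
 have "\<exists>D. \<forall>k\<in>?L. point_functional ?X (D k) \<and> (\<forall>l\<in>?L. D k (phi l) = (if l = k then 1 else 0))"
 proof (rule dual_functionals[OF finite_parts])
  fix a assume z: "!!x. x \<in> ?X ==> (\<Sum>l\<in>?L. a l * phi l x) = 0"
  have "(\<Sum>l\<in>?L. a l * pcoef TYPE('m) k l e) = 0" if e: "e \<in> expos CARD('m) k" for e
  proof -
   have "hpoly CARD('m) k (%e. \<Sum>l\<in>?L. a l * pcoef TYPE('m) k l e) x = hpoly CARD('m) k (%_. 0) x"
    if x: "!!i. 0 < x i" for x
   proof -
    have "(\<Sum>l\<in>?L. a l * phi l (dg (%a::'m. x (idx a)))) = 0" using x by (intro z) (simp add: posdef_dg)
    then show ?thesis by (simp add: hpoly_sum hpoly_cmult pcoef hpoly_def[of _ _ "%_. 0"])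
   qed
   from hpoly_unique[OF this e] show ?thesis .
  qed
  then show "\<forall>l\<in>?L. a l = 0" using trig_independent[OF pcoef_trig] by blast
 qed
 then obtain D where D: "point_functional ?X (D la)" "!!l. l \<in> ?L ==> D la (phi l) = (if l = la then 1 else 0)"
  using la by blast
 then obtain I y where "finite I" "I \<subseteq> ?X" "!!F. D la F = (\<Sum>x\<in>I. y x * F x)"
  unfolding point_functional_def by blast
 then have I: "finite I" "!!B. B \<in> I ==> pdef B"
  and y: "!!l. l \<in> ?L ==> (\<Sum>B\<in>I. y B * phi l B) = (if l = la then 1 else 0)" using D(2) by auto
 have "(\<Sum>B\<in>I. y B * (\<Sum>l\<in>?L. d l * phi l B)) = d la" for d
 proof -
  have "(\<Sum>B\<in>I. y B * (\<Sum>l\<in>?L. d l * phi l B)) = (\<Sum>l\<in>?L. d l * (\<Sum>B\<in>I. y B * phi l B))"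
   unfolding sum_distrib_left by (subst sum.swap) (simp add: mult.left_commute)
  also have "... = (\<Sum>l\<in>?L. if l = la then d la else 0)" by (intro sum.cong) (auto simp: y)
  finally show ?thesis using la by simp
 qed
 then show ?thesis using that I y by blast
qed

lemma posdef_one: "pdef (mat 1 :: quat^'m^'m)" using posdef_dg[of "%_. 1"] by (simp add: dg_one)

lemma posdef_mult_inverse:
 fixes g c :: "quat^'m^'m"
 assumes "pdef g" "pdef c"
 obtains gi where "gi**(g**c) = mat 1"
proof -
 obtain hi where hi: "hi**g = mat 1" using posdef_inverse[OF assms(1)] by metis
 obtain ci where ci: "ci**c = mat 1" using posdef_inverse[OF assms(2)] by metis
 have "(ci**hi)**(g**c) = ci**(hi**g)**c" by (simp only: matrix_mul_assoc)
 then show thesis using that hi ci by simp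
qed

text \<open>By polar decomposition G = h W with \<open>h\<close> the square root of
  \<open>G**adj G\<close>, so \<open>adj G**G\<close> is the conjugate of \<open>G**adj G\<close> by
  the unitary \<open>adj W\<close>.\<close>

lemma eigvals_swap:
 fixes G :: "quat^'m^'m"
 assumes G: "G \<in> Mts" and gi: "gi**G = mat 1"
 shows "spec (adj G**G) = spec (G**adj G)"
proof -
 have "G**gi = mat 1" using gi by (rule matrix_left_right_inverse_quat)
 then have "adj gi**adj G = mat 1" by (simp flip: adj_mult)
 from posdef_conj[OF posdef_one _ this] G have pd: "pdef (G**adj G)" by simp
 define h where "h = sqr (G**adj G)"
 have h: "pdef h" "h**h = G**adj G" using posdef_psqrt[OF pd] psqrt_mult[OF pd] by (simp_all add: h_def)
 obtain hi where hi: "hi \<in> Hrm" "h**hi = mat 1" "hi**h = mat 1" by (rule posdef_inverse[OF h(1)])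
 define W where "W = hi**G"
 have adjW: "adj W = adj G**hi" by (simp add: W_def adj_mult herm_adj[OF hi(1)])
 have "W**adj W = hi**(G**adj G)**hi" unfolding adjW by (simp add: W_def matrix_mul_assoc)
 also have "... = (hi**h)**(h**hi)" unfolding h(2)[symmetric] by (simp only: matrix_mul_assoc)
 finally have "adj W \<in> Stf" using G hi by (simp add: stiefel_def W_def herm_mats)
 moreover have "adj W**(G**adj G)**adj (adj W) = adj G**G"
 proof -
  have "adj W**(G**adj G)**adj (adj W) = adj G**hi**(G**adj G)**hi**G"
   unfolding adj_adj unfolding adjW unfolding W_def by (simp only: matrix_mul_assoc)
  also have "... = adj G**(hi**h)**(h**hi)**G" unfolding h(2)[symmetric] by (simp only: matrix_mul_assoc)
  finally show ?thesis by (simp add: hi)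
 qed
 ultimately show ?thesis using eigvals_conj[of "G**adj G" "adj W"] G by simp
qed

lemma phi_swap:
 fixes G :: "quat^'m^'m"
 assumes "la \<in> parts CARD('m) k" "G \<in> Mts" "gi**G = mat 1"
 shows "phi la (adj G**G) = phi la (G**adj G)"
 by (rule phi_eigvals_cong[OF assms(1)]) (use assms in \<open>simp_all add: eigvals_swap\<close>)

text \<open>With the square root \<open>c\<close> of X the inner product is the trace of a Hermitian
  matrix; its k-th power is expanded in the \<open>phi\<close>, and each term is integrated by the
  functional equation.\<close>

lemma inner_power_average:
 fixes X M B :: "quat^'m^'m"
 assumes X: "pdef X" and M: "pdef M" and B: "B \<in> Hrm"
 shows "(LINT V|haar. (X \<bullet> (sqr M**(V**B**adj V)**sqr M)) ^ k) =
  (\<Sum>la\<in>parts CARD('m) k. acoef TYPE('m) k la * (phi la (sqr M**X**sqr M) * phi la B))"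
proof -
 let ?a = "acoef TYPE('m) k" and ?P = "parts CARD('m) k"
 define c where "c = sqr X"
 define g where "g = sqr M"
 have c: "pdef c" "c**c = X" using posdef_psqrt[OF X] psqrt_mult[OF X] by (simp_all add: c_def)
 have g: "pdef g" using posdef_psqrt[OF M] by (simp add: g_def)
 note adjs = herm_adj[OF posdef_herm[OF c(1)]] herm_adj[OF posdef_herm[OF g]] herm_adj[OF posdef_herm[OF X]]
 have G: "g**c \<in> Mts" using c g by (simp add: herm_mats posdef_herm)
 obtain gi where gi: "gi**(g**c) = mat 1" using posdef_mult_inverse[OF g c(1)] by blast
 have adjG: "adj (g**c) = c**g" by (simp add: adj_mult adjs)
 define K where "K V = adj (g**c)**(V**B**adj V)**(g**c)" for V :: "quat^'m^'m"
 have "(X \<bullet> (g**(V**B**adj V)**g)) ^ k = (\<Sum>la\<in>?P. ?a la * phi la (K V))"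
  if V: "V \<in> Stf" for V :: "quat^'m^'m"
 proof -
  have "X \<bullet> (g**(V**B**adj V)**g) = rtr (c**(c**(g**(V**B**adj V)**g)))"
   by (simp add: inner_rtr adjs) (simp only: matrix_mul_assoc flip: c(2))
  also have "... = rtr ((c**(g**(V**B**adj V)**g))**c)" by (rule rtr_commute)
  also have "(c**(g**(V**B**adj V)**g))**c = K V" unfolding K_def adjG by (simp only: matrix_mul_assoc)
  finally show ?thesis using rtr_power_acoef[of "K V" k] B V G by (simp add: K_def stiefel_mats)
 qed
 then have "(LINT V|haar. (X \<bullet> (g**(V**B**adj V)**g)) ^ k) = (LINT V|haar. (\<Sum>la\<in>?P. ?a la * phi la (K V)))"
  by (rule haar_cong)
 also have "... = (\<Sum>la\<in>?P. ?a la * (LINT V|haar. phi la (K V)))"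
 proof -
  have "integrable haar (%V. phi la (K V))" if "la \<in> ?P" for la
   unfolding K_def by (intro haar_int[OF hp_phi[OF that]] continuous_intros)
  then show ?thesis by (simp add: LINT_sum)
 qed
 also have "... = (\<Sum>la\<in>?P. ?a la * (phi la (g**X**g) * phi la B))"
 proof (intro sum.cong refl arg_cong2[of _ _ _ _ "(*)"])
  fix la assume la: "la \<in> ?P"
  have "phi la (adj (g**c)**(g**c)) = phi la ((g**c)**adj (g**c))" by (rule phi_swap[OF la G gi])
  also have "(g**c)**adj (g**c) = g**X**g" unfolding adjG c(2)[symmetric] by (simp only: matrix_mul_assoc)
  finally show "(LINT V|haar. phi la (K V)) = phi la (g**X**g) * phi la B"
   unfolding K_def using phi_integral_haar[OF la B G gi] by simp
 qed
 finally show ?thesis by (simp add: g_def)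
qed

lemma psqrt_one: "sqr (mat 1 :: quat^'m^'m) = mat 1"
 by (rule posdef_sqrt_unique[OF posdef_psqrt[OF posdef_one] posdef_one]) (simp add: psqrt_mult[OF posdef_one])

text \<open>Sampling \<open>B\<close> in \<open>inner_power_average\<close> leaves the single
  partition \<open>la\<close>. Pairing \<open>f\<close> with monomials of \<open>X\<close>
  (\<open>one\<close>) already reproduces the kernel, and averaging this once more
  (\<open>two\<close>) turns the monomials into \<open>f\<close> itself, a Gram representation. At
  the identity it gives a_\<kappa> as a sum of squares; were that zero, the sampled value of
  \<open>phi la\<close> would be 0 instead of 1.\<close>

lemma phi_kernel:
 assumes la: "la \<in> parts CARD('m::finite) k"
 obtains f :: "(quat^'m^'m) list => quat^'m^'m => real" where
  "!!A M. pdef A ==> pdef M ==>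
   acoef TYPE('m) k la * phi la (sqr M**A**sqr M) = (\<Sum>w\<in>words k. f w A * f w M)"
  "0 < acoef TYPE('m) k la"
proof -
 let ?a = "acoef TYPE('m) k" and ?P = "parts CARD('m) k"
 obtain I and y :: "quat^'m^'m => real" where I: "finite I" "!!B. B \<in> I ==> pdef B"
  "!!l. l \<in> ?P ==> (\<Sum>B\<in>I. y B * phi l B) = (if l = la then 1 else 0)"
  "!!d. (\<Sum>B\<in>I. y B * (\<Sum>l\<in>?P. d l * phi l B)) = d la" using phi_duals[OF la] by blast
 define S where "S M B V = sqr M**(V**B**adj V)**sqr M" for M B V :: "quat^'m^'m"
 define f where "f w M = (\<Sum>B\<in>I. y B * (LINT V|haar. wmon w (S M B V)))" for w M
 have fsum: "(\<Sum>w\<in>words k. c w * f w M) = (\<Sum>B\<in>I. y B * (LINT V|haar. (\<Sum>w\<in>words k. c w * wmon w (S M B V))))" for c M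
 proof -
  have "integrable haar (%V. wmon w (S M B V))" if "w \<in> words k" for w B
   unfolding S_def using that wmon_hp[of w]
   by (intro haar_int[of k "wmon w"]) (auto simp: words_def intro!: continuous_intros)
  then have "(\<Sum>B\<in>I. y B * (LINT V|haar. (\<Sum>w\<in>words k. c w * wmon w (S M B V)))) =
   (\<Sum>B\<in>I. \<Sum>w\<in>words k. c w * (y B * (LINT V|haar. wmon w (S M B V))))"
   by (simp add: LINT_sum sum_distrib_left mult.left_commute)
  also have "... = (\<Sum>w\<in>words k. \<Sum>B\<in>I. c w * (y B * (LINT V|haar. wmon w (S M B V))))" by (rule sum.swap)
  finally show ?thesis by (simp add: f_def sum_distrib_left)
 qed
 have one: "(\<Sum>w\<in>words k. wmon w X * f w M) = ?a la * phi la (sqr M**X**sqr M)"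
  if X: "pdef X" and M: "pdef M" for X M
 proof -
  have "(\<Sum>w\<in>words k. wmon w X * f w M) = (\<Sum>B\<in>I. y B * (\<Sum>l\<in>?P. (?a l * phi l (sqr M**X**sqr M)) * phi l B))"
   unfolding fsum inner_power_words[symmetric]
   by (intro sum.cong refl) (simp add: S_def inner_power_average[OF X M] posdef_herm I(2) mult.assoc)
  then show ?thesis by (simp only: I(4))
 qed
 have two: "?a la * phi la (sqr M**A**sqr M) = (\<Sum>w\<in>words k. f w A * f w M)"
  if A: "pdef A" and M: "pdef M" for A M
 proof -
  define r where "r = sqr A"
  define g where "g = sqr M"
  have r: "pdef r" "r**r = A" using posdef_psqrt[OF A] psqrt_mult[OF A] by (simp_all add: r_def)
  have g: "pdef g" using posdef_psqrt[OF M] by (simp add: g_def)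
  note adjs = herm_adj[OF posdef_herm[OF r(1)]] herm_adj[OF posdef_herm[OF g]]
  have G: "r**g \<in> Mts" using r g by (simp add: herm_mats posdef_herm)
  obtain gi where gi: "gi**(r**g) = mat 1" using posdef_mult_inverse[OF r(1) g] by blast
  obtain ri where ri: "ri**r = mat 1" using posdef_inverse[OF r(1)] by metis
  have "(\<Sum>w\<in>words k. f w A * f w M) = (\<Sum>w\<in>words k. f w M * f w A)" by (simp add: mult.commute)
  also have "... = (\<Sum>B\<in>I. y B * (?a la * (phi la (g**A**g) * phi la B)))" unfolding fsum
  proof (intro sum.cong refl arg_cong2[of _ _ _ _ "(*)"])
   fix B assume B: "B \<in> I"
   have "(LINT V|haar. (\<Sum>w\<in>words k. f w M * wmon w (S A B V))) =
    (LINT V|haar. ?a la * phi la (adj (r**g)**(V**B**adj V)**(r**g)))"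
   proof (rule haar_cong)
    fix V :: "quat^'m^'m" assume V: "V \<in> Stf"
    have "pdef (V**B**adj V)"
     using posdef_conj[OF I(2)[OF B], of "adj V" V] V by (simp add: stiefel_mats unitaryD)
    then have "pdef (r**(V**B**adj V)**r)"
     using posdef_conj[OF _ _ ri, of "V**B**adj V"] r by (simp add: herm_mats posdef_herm adjs)
    from one[OF this M] show "(\<Sum>w\<in>words k. f w M * wmon w (S A B V)) =
     ?a la * phi la (adj (r**g)**(V**B**adj V)**(r**g))"
     by (simp add: S_def adj_mult adjs matrix_mul_assoc mult.commute flip: r_def g_def)
   qed
   also have "... = ?a la * (phi la (adj (r**g)**(r**g)) * phi la B)"
    using phi_integral_haar[OF la posdef_herm[OF I(2)[OF B]] G gi] by simp
   also have "adj (r**g)**(r**g) = g**A**g" by (simp add: adj_mult adjs r(2)[symmetric] matrix_mul_assoc)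
   finally show "(LINT V|haar. (\<Sum>w\<in>words k. f w M * wmon w (S A B V))) =
    ?a la * (phi la (g**A**g) * phi la B)" .
  qed
  also have "... = (?a la * phi la (g**A**g)) * (\<Sum>B\<in>I. y B * phi la B)" by (simp add: sum_distrib_left mult_ac)
  also have "(\<Sum>B\<in>I. y B * phi la B) = 1" using I(3)[OF la] by simp
  finally show ?thesis by (simp add: g_def)
 qed
 have "?a la = (\<Sum>w\<in>words k. (f w (mat 1))\<^sup>2)"
  using two[OF posdef_one posdef_one] by (simp add: psqrt_one phi_one power2_eq_square)
 moreover have "(\<Sum>w\<in>words k. (f w (mat 1))\<^sup>2) ~= 0"
 proof
  assume "(\<Sum>w\<in>words k. (f w (mat 1))\<^sup>2) = 0"
  then have z: "\<forall>w\<in>words k. f w (mat 1) = 0" by (simp add: sum_nonneg_eq_0_iff)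
  obtain c where c: "\<forall>X. phi la (X :: quat^'m^'m) = (\<Sum>w\<in>words k. c w * wmon w X)"
   using hp_words[OF hp_phi[OF la]] by blast
  have "0 = (\<Sum>w\<in>words k. c w * f w (mat 1))" using z by simp
  also have "... = (\<Sum>B\<in>I. y B * (LINT V|haar. phi la (V**B**adj V)))"
   unfolding fsum using c by (simp add: S_def psqrt_one)
  also have "... = (\<Sum>B\<in>I. y B * phi la B)"
   by (intro sum.cong refl arg_cong2[of _ _ _ _ "(*)"] haar_eqI phi_conj[OF la])
  also have "... = 1" using I(3)[OF la] by simp
  finally show False by simp
 qed
 ultimately have "0 < ?a la" using sum_nonneg[of "words k" "%w. (f w (mat 1 :: quat^'m^'m))\<^sup>2"] by simp
 then show ?thesis using that[of f] two by blast
qed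

lemma acoef_pos: "la \<in> parts CARD('m::finite) k ==> 0 < acoef TYPE('m) k la" using phi_kernel[where 'm='m] by blast

lemma jack_family_exists: "jack_family \<beta> CARD('m::finite) k (%la e. acoef TYPE('m) k la * pcoef TYPE('m) k la e)"
proof (rule jack_familyI)
 show "trig CARD('m) k (%la e. acoef TYPE('m) k la * pcoef TYPE('m) k la e)"
  using pcoef_trig[where 'm='m and k=k] acoef_pos[where 'm='m and k=k] by (fastforce simp: trig_def symc_def)
 show "(\<Sum>la\<in>parts CARD('m) k. hpoly CARD('m) k (%e. acoef TYPE('m) k la * pcoef TYPE('m) k la e) x) = (\<Sum>i<CARD('m). x i) ^ k" for x
  by (simp only: hpoly_cmult sum_power_acoef)
 fix la assume la: "la \<in> parts CARD('m) k"
 obtain r where r: "!!x. inj_on x {..<CARD('m)} ==>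
  jack_op \<beta> CARD('m) (hpoly CARD('m) k (pcoef TYPE('m) k la)) x = r * hpoly CARD('m) k (pcoef TYPE('m) k la) x"
  using pcoef_eigen[OF la] by blast
 have "jack_op \<beta> CARD('m) (hpoly CARD('m) k (%e. s * c e)) x = s * jack_op \<beta> CARD('m) (hpoly CARD('m) k c) x" for s c x
  by (simp add: jack_op_hpoly sum_distrib_left mult.assoc)
 then show "\<exists>\<rho>. \<forall>x. inj_on x {..<CARD('m)} -->
   jack_op \<beta> CARD('m) (hpoly CARD('m) k (%e. acoef TYPE('m) k la * pcoef TYPE('m) k la e)) x =
   \<rho> * hpoly CARD('m) k (%e. acoef TYPE('m) k la * pcoef TYPE('m) k la e) x"
  using r by (auto simp: hpoly_cmult)
qed

text \<open>The passage from n to m variables: conjugation by \<open>H\<close> pads the spectrum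
  with zeros, and the coefficients are stable under restriction.\<close>

lemma jack_phi:
 fixes B :: "quat^'n^'n" and H :: "quat^'n^'m"
 assumes nm: "CARD('n) <= CARD('m)" and B: "B \<in> Hrm" and H: "H \<in> Stf"
 shows "la \<in> parts CARD('n) k ==> jack \<beta> k la (spec B) = acoef TYPE('m) k la * phi la (H**B**adj H)"
  and "la \<in> parts CARD('m) k ==> la \<notin> parts CARD('n) k ==> phi la (H**B**adj H) = 0"
proof -
 define xs where "xs = spec B @ replicate (CARD('m) - CARD('n)) 0"
 note len = length_eigvals[OF B]
 have phi: "phi la (H**B**adj H) = hpoly CARD('n) k (pcoef TYPE('m) k la) (%i. spec B ! i)"
  if la: "la \<in> parts CARD('m) k" for la
 proof -
  have "phi la (H**B**adj H) = phi la (dlist xs :: quat^'m^'m)"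
   by (rule phi_dlist[OF la]) (use B H in \<open>simp_all add: xs_def eigvals_stiefel_conj stiefel_mats\<close>)
  also have "... = hpoly CARD('m) k (pcoef TYPE('m) k la) (%i. xs ! i)" unfolding dlist_def by (rule pcoef[OF la])
  also have "... = hpoly CARD('n) k (pcoef TYPE('m) k la) (%i. spec B ! i)"
   by (rule hpoly_restrict[OF nm]) (auto simp: xs_def nth_append len)
  finally show ?thesis .
 qed
 have fam: "jack_family \<beta> (length (spec B)) k (%la e. acoef TYPE('m) k la * pcoef TYPE('m) k la e)"
  unfolding len by (rule jack_family_restrict[OF nm jack_family_exists])
 show "jack \<beta> k la (spec B) = acoef TYPE('m) k la * phi la (H**B**adj H)" if la: "la \<in> parts CARD('n) k"
 proof -
  have "la \<in> parts CARD('m) k" using parts_mono[OF nm] la by blast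
  then show ?thesis using jack_hpoly[OF beta_pos fam] la by (simp add: len phi hpoly_cmult)
 qed
 show "phi la (H**B**adj H) = 0" if "la \<in> parts CARD('m) k" "la \<notin> parts CARD('n) k"
  unfolding phi[OF that(1)] by (rule hpoly_too_many_parts[OF pcoef_trig that nm])
qed

lemma jack_phi_square:
 fixes X :: "quat^'m^'m"
 assumes "X \<in> Hrm" "la \<in> parts CARD('m) k"
 shows "jack \<beta> k la (spec X) = acoef TYPE('m) k la * phi la X"
 using jack_phi(1)[OF order.refl assms(1) mat1_stiefel assms(2)] by simp

end

section \<open>Symmetric polynomials of products\<close>

lemma rpf_line:
 assumes "real_polynomial_function g"
 shows "\<exists>p. \<forall>t. g (X + t *\<^sub>R Y) = poly p t" using assms
proof induction
 case (linear f)
 then have "f (X + t *\<^sub>R Y) = poly [:f X, f Y:] t" for t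
  by (simp add: bounded_linear.linear linear_add linear_cmul)
 then show ?case by blast
next
 case (const c)
 have "c = poly [:c:] t" for t by simp
 then show ?case by blast
next
 case (add f g)
 then obtain p q where "\<forall>t. f (X + t *\<^sub>R Y) = poly p t" "\<forall>t. g (X + t *\<^sub>R Y) = poly q t" by blast
 then have "f (X + t *\<^sub>R Y) + g (X + t *\<^sub>R Y) = poly (p + q) t" for t by simp
 then show ?case by blast
next
 case (mult f g)
 then obtain p q where "\<forall>t. f (X + t *\<^sub>R Y) = poly p t" "\<forall>t. g (X + t *\<^sub>R Y) = poly q t" by blast
 then have "f (X + t *\<^sub>R Y) * g (X + t *\<^sub>R Y) = poly (p * q) t" for t by simp
 then show ?case by blast
qed

context fld
begin

lemma rpf_posdef_unique:
 fixes g g' :: "quat^'m^'m => real"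
 assumes g: "real_polynomial_function g" "real_polynomial_function g'"
  and eq: "!!X. pdef X ==> g X = g' X" and A: "A \<in> Hrm"
 shows "g A = g' A"
proof -
 obtain p q where p: "\<forall>t. g (A + t *\<^sub>R mat 1) = poly p t" and q: "\<forall>t. g' (A + t *\<^sub>R mat 1) = poly q t"
  using rpf_line[OF g(1)] rpf_line[OF g(2)] by metis
 obtain C where C: "!!c. c > C ==> pdef (A + c *\<^sub>R mat 1)" using posdef_shift[OF A] by blast
 have "p = q" by (rule poly_eq_eventually[of C]) (use p q C eq in metis)
 then show ?thesis using p[rule_format, of 0] q[rule_format, of 0] by simp
qed

text \<open>The working form of the definite description: any polynomial with the right values on
  positive definite matrices determines it.\<close>

lemma sym_prod_eqI:
 fixes A M :: "quat^'m^'m"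
 assumes A: "A \<in> Hrm" and g: "real_polynomial_function g"
  "!!X. pdef X ==> g X = f (spec (sqr X**M**sqr X))"
 shows "sprod f A M = g A" unfolding sym_prod_def
proof (rule the_equality)
 show "\<exists>g'. real_polynomial_function g' \<and>
  (\<forall>X. pdef X --> g' X = f (spec (sqr X**M**sqr X))) \<and> g A = g' A" using g by blast
 fix v assume "\<exists>g. real_polynomial_function g \<and>
  (\<forall>X. pdef X --> g X = f (spec (sqr X**M**sqr X))) \<and> v = g A"
 then obtain g' where g': "real_polynomial_function g'" "v = g' A"
  "!!X. pdef X ==> g' X = f (spec (sqr X**M**sqr X))" by blast
 then show "v = g A" using rpf_posdef_unique[OF g'(1) g(1) _ A] g(2) by simp
qed

text \<open>Functions of the spectrum that are homogeneous polynomials in the entries, on Hermitian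
  matrices; for these the continuation in \<open>sym_prod\<close> exists.\<close>

definition eigpoly :: "'m::finite itself => nat => (real list => real) => bool"
 where "eigpoly (_ :: 'm itself) k f \<longleftrightarrow>
  (\<exists>F. hp k F \<and> (\<forall>X\<in>Hrm :: (quat^'m^'m) set. f (spec X) = F X))"

lemma eigpolyI: "hp k F ==> (!!X. X \<in> (Hrm :: (quat^'m^'m) set) ==> f (spec X) = F X) ==> eigpoly TYPE('m::finite) k f"
 unfolding eigpoly_def by blast

lemma eigpoly_mult: "eigpoly TYPE('m::finite) j f ==> eigpoly TYPE('m) k g ==> eigpoly TYPE('m) (j + k) (%xs. f xs * g xs)"
 unfolding eigpoly_def by (metis (no_types, lifting) hp_mult)

lemma eigpoly_cmult: "eigpoly TYPE('m::finite) k f ==> eigpoly TYPE('m) k (%xs. c * f xs)"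
 unfolding eigpoly_def by (metis (no_types, lifting) hp_cmult)

lemma eigpoly_sum:
 assumes "!!a. a \<in> S ==> eigpoly TYPE('m::finite) k (f a)"
 shows "eigpoly TYPE('m) k (%xs. \<Sum>a\<in>S. f a xs)"
proof -
 have "\<forall>a\<in>S. \<exists>F. hp k F \<and> (\<forall>X\<in>Hrm :: (quat^'m^'m) set. f a (spec X) = F X)"
  using assms unfolding eigpoly_def by blast
 then obtain F where F: "!!a. a \<in> S ==> hp k (F a)"
  "!!a X. a \<in> S ==> X \<in> (Hrm :: (quat^'m^'m) set) ==> f a (spec X) = F a X" by metis
 show ?thesis by (rule eigpolyI[of k "%X. \<Sum>a\<in>S. F a X"]) (use F in \<open>auto intro: hp_sum\<close>)
qed

lemma eigpoly_const: "eigpoly TYPE('m::finite) 0 (%_. c)" by (rule eigpolyI[OF hp_const]) simp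

lemma eigpoly_esym: "eigpoly TYPE('m::finite) j (esym j)"
 by (rule eigpolyI[OF hp_Esym]) (simp add: Esym_eigvals)

lemma eigpoly_jack: "la \<in> parts CARD('m::finite) k ==> eigpoly TYPE('m) k (jack \<beta> k la)"
 by (rule eigpolyI[OF hp_cmult[OF hp_phi]]) (auto simp: jack_phi_square)

lemma sum_list_eigvals: "X \<in> Hrm ==> sum_list (spec X) = rtr (X :: quat^'m^'m)"
 using rtr_mpow_eigvals[of X 1] by (simp add: psum_def)

lemma eigpoly_sum_list: "eigpoly TYPE('m::finite) 1 sum_list"
 by (rule eigpolyI[OF hp_linear[OF linear_rtr]]) (simp add: sum_list_eigvals)

lemma eigpoly_power:
 assumes "eigpoly TYPE('m::finite) 1 f"
 shows "eigpoly TYPE('m) k (%xs. f xs ^ k)"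
proof (induction k)
 case (Suc k)
 then show ?case using eigpoly_mult[OF assms Suc] by simp
qed (simp add: eigpoly_const)

lemma psqrt_mats: "pdef X ==> sqr X \<in> Mts" "pdef X ==> adj (sqr X) = sqr X"
 "pdef X ==> sqr X \<in> Hrm" for X :: "quat^'m^'m"
 using posdef_herm[OF posdef_psqrt[of X]] by (auto simp: herm_mats herm_adj)

lemma psqrt_conj_herm: "pdef X ==> M \<in> Hrm ==> sqr X**M**sqr X \<in> Hrm" for X :: "quat^'m^'m"
 by (intro herm_conjD psqrt_mats)

lemma eigvals_psqrt_swap:
 fixes X N :: "quat^'m^'m"
 assumes X: "pdef X" and N: "pdef N"
 shows "spec (sqr X**N**sqr X) = spec (sqr N**X**sqr N)"
proof -
 define G where "G = sqr N**sqr X"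
 have aG: "adj G = sqr X**sqr N" by (simp add: G_def adj_mult psqrt_mats X N)
 have "G \<in> Mts" by (simp add: G_def psqrt_mats X N)
 moreover obtain gi where "gi**G = mat 1"
  using posdef_mult_inverse[OF posdef_psqrt[OF N] posdef_psqrt[OF X]] unfolding G_def by blast
 ultimately have "spec (adj G**G) = spec (G**adj G)" by (rule eigvals_swap)
 moreover have "adj G**G = sqr X**(sqr N**sqr N)**sqr X"
  unfolding aG unfolding G_def by (simp only: matrix_mul_assoc)
 moreover have "G**adj G = sqr N**(sqr X**sqr X)**sqr N"
  unfolding aG unfolding G_def by (simp only: matrix_mul_assoc)
 ultimately show ?thesis by (simp add: psqrt_mult X N)
qed

text \<open>Shifts beyond a threshold land in the positive definite cone, and the Lagrange weights
  recover the value at shift 0; the same weights serve every polynomial of degree k, every base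
  point and every direction.\<close>

lemma shift_nodes:
 fixes A :: "quat^'m^'m"
 assumes "A \<in> Hrm"
 obtains X and c w :: "nat => real" where "!!i. pdef (X i)" "!!i. X i = A + c i *\<^sub>R mat 1"
  "!!F Y Z. hp k F ==> (\<Sum>i\<le>k. w i * F (Y + c i *\<^sub>R Z)) = F (Y :: quat^'m^'m)"
proof -
 obtain C where C: "!!c. c > C ==> pdef (A + c *\<^sub>R mat 1)" using posdef_shift[OF assms] by blast
 define c where "c i = C + 1 + real i" for i
 have "inj_on c {..k}" by (simp add: inj_on_def c_def)
 from poly_weights[OF this, of 0] obtain w :: "nat => real"
  where w: "!!p. degree p <= k ==> (\<Sum>i\<le>k. w i * poly p (c i)) = coeff p 0" by blast
 show thesis
 proof (rule that[of "%i. A + c i *\<^sub>R mat 1" c w])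
  fix F :: "quat^'m^'m => real" and Y Z assume "hp k F"
  from hp_line[OF this] obtain p where p: "degree p <= k" "!!t. F (Y + t *\<^sub>R Z) = poly p t" by blast
  show "(\<Sum>i\<le>k. w i * F (Y + c i *\<^sub>R Z)) = F Y" using w[OF p(1)] p(2)[of 0] by (simp add: p(2) poly_0_coeff_0)
 qed (use C in \<open>simp_all add: c_def\<close>)
qed

text \<open>\<open>sqr Y\<close> is not polynomial in \<open>Y\<close>. For positive definite M,
  however, the spectrum of \<open>sqr Y**M**sqr Y\<close> is that of \<open>sqr M**Y**sqr M\<close>,
  where \<open>Y\<close> enters linearly; a general M is reached by interpolation in M.\<close>

lemma sym_prod_poly:
 fixes M :: "quat^'m^'m"
 assumes f: "eigpoly TYPE('m) k f" and M: "M \<in> Hrm"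
 obtains g where "hp k g" "!!X. pdef X ==> g X = f (spec (sqr X**M**sqr X))"
  "!!A. A \<in> Hrm ==> sprod f A M = g A"
proof -
 obtain F where F: "hp k F" "!!X. X \<in> (Hrm :: (quat^'m^'m) set) ==> f (spec X) = F X"
  using f unfolding eigpoly_def by blast
 obtain X c w where X: "!!i. pdef (X i)" "!!i. X i = M + c i *\<^sub>R mat 1"
  and w: "!!F Y Z. hp k F ==> (\<Sum>i\<le>k. w i * F (Y + c i *\<^sub>R Z)) = F (Y :: quat^'m^'m)" using shift_nodes[OF M] by blast
 define g where "g Y = (\<Sum>i\<le>k. w i * F (sqr (X i)**Y**sqr (X i)))" for Y
 have hp: "hp k g" unfolding g_def by (intro hp_sum hp_cmult hp_comp_linear[OF F(1)] linear_conj)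
 have gY: "g Y = f (spec (sqr Y**M**sqr Y))" if Y: "pdef Y" for Y
 proof -
  have "F (sqr (X i)**Y**sqr (X i)) = F (sqr Y**M**sqr Y + c i *\<^sub>R Y)" for i
  proof -
   have "F (sqr (X i)**Y**sqr (X i)) = F (sqr Y**X i**sqr Y)"
    by (simp add: psqrt_conj_herm X(1) Y posdef_herm eigvals_psqrt_swap flip: F(2))
   then show ?thesis by (simp add: X(2) matrix_linear_simps psqrt_mult[OF Y])
  qed
  then show ?thesis by (simp add: g_def w[OF F(1)] F(2) psqrt_conj_herm Y M)
 qed
 show thesis by (rule that[OF hp gY sym_prod_eqI[OF _ hp_rpf[OF hp] gY]])
qed

lemma sym_prod_mult:
 fixes A M :: "quat^'m^'m"
 assumes f: "eigpoly TYPE('m) j f" "eigpoly TYPE('m) k f'" and A: "A \<in> Hrm" and M: "M \<in> Hrm"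
 shows "sprod (%xs. f xs * f' xs) A M = sprod f A M * sprod f' A M"
proof -
 obtain g where g: "hp j g" "!!X. pdef X ==> g X = f (spec (sqr X**M**sqr X))"
  "sprod f A M = g A" using sym_prod_poly[OF f(1) M] A by metis
 obtain h where h: "hp k h" "!!X. pdef X ==> h X = f' (spec (sqr X**M**sqr X))"
  "sprod f' A M = h A" using sym_prod_poly[OF f(2) M] A by metis
 show ?thesis unfolding g(3) h(3)
  by (rule sym_prod_eqI[OF A, of "%X. g X * h X"]) (simp_all add: g h hp_rpf[OF hp_mult[OF g(1) h(1)]])
qed

lemma sym_prod_sum:
 fixes A M :: "quat^'m^'m"
 assumes S: "finite S" and f: "!!a. a \<in> S ==> eigpoly TYPE('m) (k a) (f a)" and A: "A \<in> Hrm" and M: "M \<in> Hrm"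
 shows "sprod (%xs. \<Sum>a\<in>S. c a * f a xs) A M = (\<Sum>a\<in>S. c a * sprod (f a) A M)"
proof -
 have "\<forall>a\<in>S. \<exists>g. hp (k a) g \<and> (\<forall>X. pdef X --> g X = f a (spec (sqr X**M**sqr X))) \<and>
  sprod (f a) A M = g A"
 proof
  fix a assume "a \<in> S"
  from sym_prod_poly[OF f[OF this] M] A
  show "\<exists>g. hp (k a) g \<and> (\<forall>X. pdef X --> g X = f a (spec (sqr X**M**sqr X))) \<and>
   sprod (f a) A M = g A" by metis
 qed
 then obtain g where g: "!!a. a \<in> S ==> hp (k a) (g a)"
  "!!a X. a \<in> S ==> pdef X ==> g a X = f a (spec (sqr X**M**sqr X))"
  "!!a. a \<in> S ==> sprod (f a) A M = g a A" by metis
 have "sprod (%xs. \<Sum>a\<in>S. c a * f a xs) A M = (\<Sum>a\<in>S. c a * g a A)"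
 proof (rule sym_prod_eqI[OF A, of "%X. \<Sum>a\<in>S. c a * g a X"])
  show "real_polynomial_function (%X. \<Sum>a\<in>S. c a * g a X)"
   using S g(1) by (intro real_polynomial_function_sum real_polynomial_function.intros(2,4) hp_rpf) auto
 qed (simp add: g(2))
 then show ?thesis by (simp add: g(3))
qed

lemma sym_prod_cong:
 fixes A M :: "quat^'m^'m"
 assumes "!!X. X \<in> (Hrm :: (quat^'m^'m) set) ==> f (spec X) = f' (spec X)" "M \<in> Hrm"
 shows "sprod f A M = sprod f' A M"
proof -
 have "f (spec (sqr X**M**sqr X)) = f' (spec (sqr X**M**sqr X))"
  if "pdef X" for X :: "quat^'m^'m" using assms psqrt_conj_herm[OF that] by blast
 then show ?thesis unfolding sym_prod_def by (simp cong: conj_cong imp_cong)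
qed

lemma sym_prod_const: "A \<in> Hrm ==> sprod (%_. c) A M = c" for A :: "quat^'m^'m"
 by (rule sym_prod_eqI[of _ "%_. c"]) auto

lemma sym_prod_power:
 fixes A M :: "quat^'m^'m"
 assumes f: "eigpoly TYPE('m) 1 f" and A: "A \<in> Hrm" and M: "M \<in> Hrm"
 shows "sprod (%xs. f xs ^ k) A M = sprod f A M ^ k"
proof (induction k)
 case (Suc k)
 then show ?case using sym_prod_mult[OF f eigpoly_power[OF f] A M, of k] by simp
qed (simp add: sym_prod_const A)

lemma sym_prod_interpolation:
 fixes A :: "quat^'m^'m"
 assumes A: "A \<in> Hrm"
 obtains X and c w :: "nat => real" where "!!i. pdef (X i)" "!!i. X i = A + c i *\<^sub>R mat 1"
  "!!F Y Z. hp k F ==> (\<Sum>i\<le>k. w i * F (Y + c i *\<^sub>R Z)) = F (Y :: quat^'m^'m)"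
  "!!f M. eigpoly TYPE('m) k f ==> M \<in> Hrm ==> sprod f A M = (\<Sum>i\<le>k. w i * f (spec (sqr (X i)**M**sqr (X i))))"
proof -
 obtain X c w where X: "!!i. pdef (X i)" "!!i. X i = A + c i *\<^sub>R mat 1"
  and w: "!!F Y Z. hp k F ==> (\<Sum>i\<le>k. w i * F (Y + c i *\<^sub>R Z)) = F (Y :: quat^'m^'m)" using shift_nodes[OF A] by blast
 have "sprod f A M = (\<Sum>i\<le>k. w i * f (spec (sqr (X i)**M**sqr (X i))))"
  if f: "eigpoly TYPE('m) k f" and M: "M \<in> Hrm" for f and M :: "quat^'m^'m"
 proof -
  obtain g where g: "hp k g" "!!X. pdef X ==> g X = f (spec (sqr X**M**sqr X))"
   "sprod f A M = g A" using sym_prod_poly[OF f M] A by metis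
  then show ?thesis using w[OF g(1), of A "mat 1"] by (simp add: X(1) flip: X(2))
 qed
 then show thesis using that X w by blast
qed

text \<open>At each node the functional equation applies with g the square root of the node; the
  weights then reassemble \<open>phi la A\<close>.\<close>

lemma sym_prod_jack_integral:
 fixes A :: "quat^'m^'m" and B :: "quat^'n^'n" and \<mu> :: "(quat^'n^'m) measure"
 assumes A: "A \<in> Hrm" and B: "B \<in> Hrm" and \<mu>: "stiefel_measure \<beta> \<mu>" and la: "la \<in> parts CARD('m) k"
  and H0: "H0 \<in> (Stf :: (quat^'n^'m) set)"
 shows "integrable \<mu> (%H. sprod (jack \<beta> k la) A (H**B**adj H))" (is ?int)
  and "(LINT H|\<mu>. sprod (jack \<beta> k la) A (H**B**adj H)) =
   acoef TYPE('m) k la * (phi la A * phi la (H0**B**adj H0))" (is ?eq)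
proof -
 let ?a = "acoef TYPE('m) k la"
 obtain X c w where X: "!!i. pdef (X i)" "!!i. X i = A + c i *\<^sub>R mat 1"
  and w: "!!F Y Z. hp k F ==> (\<Sum>i\<le>k. w i * F (Y + c i *\<^sub>R Z)) = F (Y :: quat^'m^'m)"
  and spr: "!!f M. eigpoly TYPE('m) k f ==> M \<in> Hrm ==> sprod f A M = (\<Sum>i\<le>k. w i * f (spec (sqr (X i)**M**sqr (X i))))"
  using sym_prod_interpolation[OF A, of k] by blast
 define r where "r i = sqr (X i)" for i
 have r: "r i \<in> Mts" "adj (r i) = r i" "r i \<in> Hrm" "r i**r i = X i" for i
  using psqrt_mats[OF X(1)] psqrt_mult[OF X(1)] by (simp_all add: r_def)
 define S where "S H = (\<Sum>i\<le>k. w i * (?a * phi la (adj (r i)**(H**B**adj H)**r i)))" for H :: "quat^'n^'m"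
 have HB: "H**B**adj H \<in> Hrm" if "H \<in> Stf" for H :: "quat^'n^'m" using that B by (simp add: stiefel_mats)
 have S: "sprod (jack \<beta> k la) A (H**B**adj H) = S H" if "H \<in> Stf" for H
  unfolding S_def using spr[OF eigpoly_jack[OF la] HB[OF that]] HB[OF that]
  by (simp add: jack_phi_square[OF _ la] herm_conjD r flip: r_def)
 have int: "integrable \<mu> (%H. phi la (adj (r i)**(H**B**adj H)**r i))" for i
  by (intro sm_integrable[OF \<mu>] continuous_hp[OF hp_phi[OF la]] continuous_intros)
 have intS: "integrable \<mu> S" unfolding S_def by (simp add: int)
 have eq: "!!H. H \<in> space \<mu> ==> sprod (jack \<beta> k la) A (H**B**adj H) = S H" by (simp add: S sm_space[OF \<mu>])
 show ?int using intS by (subst Bochner_Integration.integrable_cong[OF refl eq])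
 have "(LINT H|\<mu>. sprod (jack \<beta> k la) A (H**B**adj H)) = (LINT H|\<mu>. S H)"
  by (rule Bochner_Integration.integral_cong[OF refl eq])
 also have "... = (\<Sum>i\<le>k. w i * (?a * (LINT H|\<mu>. phi la (adj (r i)**(H**B**adj H)**r i))))"
  unfolding S_def by (simp add: LINT_sum int)
 also have "... = (\<Sum>i\<le>k. w i * (?a * (phi la (X i) * phi la (H0**B**adj H0))))"
 proof (intro sum.cong refl arg_cong2[of _ _ _ _ "(*)"])
  fix i
  obtain gi where gi: "gi**r i = mat 1" using posdef_inverse[OF posdef_psqrt[OF X(1)]] unfolding r_def by metis
  from phi_integral[OF \<mu> la B r(1) gi H0]
  show "(LINT H|\<mu>. phi la (adj (r i)**(H**B**adj H)**r i)) = phi la (X i) * phi la (H0**B**adj H0)"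
   by (simp add: r)
 qed
 also have "... = ?a * phi la (H0**B**adj H0) * (\<Sum>i\<le>k. w i * phi la (X i))" by (simp add: sum_distrib_left mult_ac)
 also have "(\<Sum>i\<le>k. w i * phi la (X i)) = phi la A" unfolding X(2) by (rule w[OF hp_phi[OF la]])
 finally show ?eq by (simp add: mult_ac)
qed

text \<open>All nodes commute, so the sandwiched product is (A + c_i)(A + c_j), affine in either
  shift; interpolating twice evaluates it at c_i = c_j = 0.\<close>

lemma phi_square_interpolation:
 fixes A :: "quat^'m^'m"
 assumes la: "la \<in> parts CARD('m) k" and X: "!!i. pdef (X i)" "!!i. X i = A + c i *\<^sub>R mat 1"
  and w: "!!F Y Z. hp k F ==> (\<Sum>i\<le>k. w i * F (Y + c i *\<^sub>R Z)) = F (Y :: quat^'m^'m)"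
 shows "(\<Sum>i\<le>k. \<Sum>j\<le>k. w i * w j * phi la (sqr (X i)**X j**sqr (X i))) = phi la (A**A)"
proof -
 note lin = w[OF hp_phi[OF la]]
 have "sqr (X i)**X j**sqr (X i) = A**A + c i *\<^sub>R A + c j *\<^sub>R X i" for i j
 proof -
  let ?r = "sqr (X i)"
  have rr: "?r**?r = X i" by (rule psqrt_mult[OF X(1)])
  have "?r**(?r**?r)**?r = (?r**?r)**(?r**?r)" by (simp only: matrix_mul_assoc)
  moreover have "X j = ?r**?r + (c j - c i) *\<^sub>R mat 1" unfolding rr by (simp add: X(2) algebra_simps)
  ultimately have "?r**X j**?r = X i**X i + (c j - c i) *\<^sub>R X i" by (simp add: matrix_linear_simps rr)
  then show ?thesis by (simp add: X(2) matrix_linear_simps algebra_simps)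
 qed
 then have "(\<Sum>i\<le>k. \<Sum>j\<le>k. w i * w j * phi la (sqr (X i)**X j**sqr (X i))) =
  (\<Sum>i\<le>k. w i * (\<Sum>j\<le>k. w j * phi la (A**A + c i *\<^sub>R A + c j *\<^sub>R X i)))"
  by (simp add: sum_distrib_left mult.assoc)
 then show ?thesis by (simp only: lin)
qed

lemma phi_square_bound:
 fixes A :: "quat^'m^'m"
 assumes A: "A \<in> Hrm" "qbound r A" and la: "la \<in> parts CARD('m) k" and r: "0 <= r"
 shows "phi la (A**A) <= (r ^ k)\<^sup>2"
proof -
 obtain U :: "quat^'m^'m" and x where U: "U \<in> Stf" "A = U**dg x**adj U" by (rule spectral[OF A(1)])
 have "qbound (r * r) (U**dg (%a. x a * x a)**adj U)"
 proof -
  have "\<bar>x a\<bar> * \<bar>x a\<bar> <= r * r" for a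
   using A(2) r unfolding U(2) qbound_unitary[OF U(1)] by (intro mult_mono) auto
  then show ?thesis unfolding qbound_unitary[OF U(1)] abs_mult by blast
 qed
 moreover have "A**A = U**dg (%a. x a * x a)**adj U" unfolding U(2) conj_mult[OF U(1)] dg_mult ..
 moreover have "A**A \<in> Hrm" using herm_conj(2)[of "mat 1" A] herm_conj(4)[OF herm_mats[OF A(1)]] herm_adj[OF A(1)] by simp
 ultimately have "\<bar>phi la (A**A)\<bar> <= (r * r) ^ k" using r by (intro phi_qbound[OF la]) simp_all
 then show ?thesis by (simp add: power2_eq_square power_mult_distrib)
qed

text \<open>\<open>P\<close> and \<open>Q\<close> are the interpolated Gram vectors of A and M.
  Their squared norms are multiples of \<open>phi la (A**A)\<close> and
  \<open>phi la (M**M)\<close>, so the possibly large interpolation weights disappear from the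
  bound.\<close>

lemma sym_prod_jack_bound:
 fixes A M :: "quat^'m^'m"
 assumes A: "A \<in> Hrm" "qbound r A" "0 <= r" and M: "M \<in> Hrm" "qbound s M" "0 <= s" and la: "la \<in> parts CARD('m) k"
 shows "\<bar>sprod (jack \<beta> k la) A M\<bar> <= acoef TYPE('m) k la * (r * s) ^ k"
proof -
 let ?a = "acoef TYPE('m) k la"
 obtain X c w where X: "!!i. pdef (X i)" "!!i. X i = A + c i *\<^sub>R mat 1"
  and w: "!!F Y Z. hp k F ==> (\<Sum>i\<le>k. w i * F (Y + c i *\<^sub>R Z)) = F (Y :: quat^'m^'m)"
  and spr: "!!f M. eigpoly TYPE('m) k f ==> M \<in> Hrm ==> sprod f A M = (\<Sum>i\<le>k. w i * f (spec (sqr (X i)**M**sqr (X i))))"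
  using sym_prod_interpolation[OF A(1), of k] by blast
 obtain Y d v where Y: "!!i. pdef (Y i)" "!!i. Y i = M + d i *\<^sub>R mat 1"
  and v: "!!F Y Z. hp k F ==> (\<Sum>i\<le>k. v i * F (Y + d i *\<^sub>R Z)) = F (Y :: quat^'m^'m)" using shift_nodes[OF M(1)] by blast
 obtain f :: "(quat^'m^'m) list => quat^'m^'m => real" where f: "!!A M. pdef A ==> pdef M ==>
   ?a * phi la (sqr M**A**sqr M) = (\<Sum>w\<in>words k. f w A * f w M)" using phi_kernel[OF la] by blast
 define P where "P u = (\<Sum>i\<le>k. w i * f u (X i))" for u
 define Q where "Q u = (\<Sum>j\<le>k. v j * f u (Y j))" for u
 have ker: "(\<Sum>i\<le>k. \<Sum>j\<le>k. a i * b j * (?a * phi la (sqr (Z i)**Z' j**sqr (Z i)))) =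
  (\<Sum>u\<in>words k. (\<Sum>i\<le>k. a i * f u (Z i)) * (\<Sum>j\<le>k. b j * f u (Z' j)))"
  if "!!i. pdef (Z i)" "!!i. pdef (Z' i)" for a b :: "nat => real" and Z Z'
 proof -
  have "a i * b j * (?a * phi la (sqr (Z i)**Z' j**sqr (Z i))) =
   (\<Sum>u\<in>words k. a i * f u (Z i) * (b j * f u (Z' j)))" for i j by (simp add: f that sum_distrib_left mult_ac)
  then show ?thesis by (simp only: sum_product sum.swap[of _ "words k" "{..k}"])
 qed
 have "sprod (jack \<beta> k la) A M = (\<Sum>i\<le>k. w i * (?a * phi la (sqr (X i)**M**sqr (X i))))"
  using spr[OF eigpoly_jack[OF la] M(1)] psqrt_conj_herm[OF X(1) M(1)] by (simp add: jack_phi_square[OF _ la])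
 also have "... = (\<Sum>i\<le>k. w i * (?a * (\<Sum>j\<le>k. v j * phi la (sqr (X i)**Y j**sqr (X i)))))"
 proof (intro sum.cong refl arg_cong2[of _ _ _ _ "(*)"])
  fix i
  let ?r = "sqr (X i)"
  have "?r**Y j**?r = ?r**M**?r + d j *\<^sub>R (?r**?r)" for j by (simp add: Y(2) matrix_linear_simps)
  then show "phi la (?r**M**?r) = (\<Sum>j\<le>k. v j * phi la (?r**Y j**?r))" by (simp only: v[OF hp_phi[OF la]])
 qed
 also have "... = (\<Sum>i\<le>k. \<Sum>j\<le>k. w i * v j * (?a * phi la (sqr (X i)**Y j**sqr (X i))))"
  by (simp add: sum_distrib_left mult_ac)
 also have "... = (\<Sum>u\<in>words k. P u * Q u)" unfolding P_def Q_def by (rule ker[OF X(1) Y(1)])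
 finally have main: "sprod (jack \<beta> k la) A M = (\<Sum>u\<in>words k. P u * Q u)" .
 have a: "0 < ?a" by (rule acoef_pos[OF la])
 have sq: "(\<Sum>u\<in>words k. (\<Sum>i\<le>k. w i * f u (X i))\<^sup>2) <= ?a * (r ^ k)\<^sup>2"
  if A: "A \<in> Hrm" "qbound r A" "0 <= r" and X: "!!i. pdef (X i)" "!!i. X i = A + c i *\<^sub>R mat 1"
   and w: "!!F Y Z. hp k F ==> (\<Sum>i\<le>k. w i * F (Y + c i *\<^sub>R Z)) = F (Y :: quat^'m^'m)" for A r X c w
 proof -
  have "(\<Sum>u\<in>words k. (\<Sum>i\<le>k. w i * f u (X i))\<^sup>2) =
   ?a * (\<Sum>i\<le>k. \<Sum>j\<le>k. w i * w j * phi la (sqr (X i)**X j**sqr (X i)))"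
   unfolding power2_eq_square ker[OF X(1) X(1), symmetric] by (simp add: sum_distrib_left mult_ac)
  also have "(\<Sum>i\<le>k. \<Sum>j\<le>k. w i * w j * phi la (sqr (X i)**X j**sqr (X i))) = phi la (A**A)"
   by (rule phi_square_interpolation[OF la X]) (rule w)
  finally show ?thesis using phi_square_bound[OF A(1,2) la A(3)] a by simp
 qed
 have P: "(\<Sum>u\<in>words k. (P u)\<^sup>2) <= ?a * (r ^ k)\<^sup>2" unfolding P_def by (rule sq[OF A X]) (rule w)
 have Q: "(\<Sum>u\<in>words k. (Q u)\<^sup>2) <= ?a * (s ^ k)\<^sup>2" unfolding Q_def by (rule sq[OF M Y]) (rule v)
 have "(\<Sum>u\<in>words k. P u * Q u)\<^sup>2 <= (\<Sum>u\<in>words k. (P u)\<^sup>2) * (\<Sum>u\<in>words k. (Q u)\<^sup>2)"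
  by (rule Cauchy_Schwarz_ineq_sum)
 also have "... <= (?a * (r ^ k)\<^sup>2) * (?a * (s ^ k)\<^sup>2)" using P Q a by (intro mult_mono) (auto intro: sum_nonneg)
 also have "... = (?a * (r * s) ^ k)\<^sup>2" by (simp add: power2_eq_square power_mult_distrib)
 finally have "\<bar>\<Sum>u\<in>words k. P u * Q u\<bar> <= \<bar>?a * (r * s) ^ k\<bar>" by (simp only: abs_le_square_iff)
 then show ?thesis unfolding main using a A(3) M(3) by (simp add: abs_mult)
qed

lemma qbound_eignorm: "A \<in> Hrm ==> qbound (eignorm \<beta> A) A" "A \<in> Hrm ==> 0 <= eignorm \<beta> A" for A :: "quat^'m^'m"
proof -
 assume A: "A \<in> Hrm"
 obtain U :: "quat^'m^'m" and x where U: "U \<in> Stf" "A = U**dg x**adj U" by (rule spectral[OF A])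
 have e: "eignorm \<beta> A = Max (abs ` range x)" unfolding eignorm_def U(2) eigvals_eq(3)[OF U(1)] ..
 have le: "\<bar>x a\<bar> <= eignorm \<beta> A" for a unfolding e by (rule Max_ge) auto
 then show "qbound (eignorm \<beta> A) A" by (subst U(2)) (simp add: qbound_unitary[OF U(1)])
 show "0 <= eignorm \<beta> A" using order_trans[OF abs_ge_zero le] .
qed

lemma eignorm_stiefel:
 fixes B :: "quat^'n^'n" and H :: "quat^'n^'m"
 assumes B: "B \<in> Hrm" and H: "H \<in> Stf"
 shows "eignorm \<beta> (H**B**adj H) <= eignorm \<beta> B"
proof -
 have "H**B**adj H \<in> Hrm" using B H by (simp add: stiefel_mats)
 then have len: "length (spec (H**B**adj H)) = CARD('m)" by (rule length_eigvals)
 have "set (spec (H**B**adj H)) \<subseteq> insert 0 (set (spec B))"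
  using arg_cong[OF eigvals_stiefel_conj[OF B H], of set_mset] by (auto split: if_splits)
 then have "\<bar>x\<bar> <= eignorm \<beta> B" if "x \<in> set (spec (H**B**adj H))" for x
 proof (cases "x = 0")
  case True
  then show ?thesis using qbound_eignorm(2)[OF B] by simp
 next
  case False
  then have "x \<in> set (spec B)" using that \<open>_ \<subseteq> _\<close> by blast
  then show ?thesis by (simp add: eignorm_def)
 qed
 moreover have "set (spec (H**B**adj H)) ~= {}" using len by auto
 ultimately show ?thesis unfolding eignorm_def[of _ "H**B**adj H"] by (intro Max.boundedI) auto
qed

end

section \<open>The Pieri rule\<close>

context fld
begin

text \<open>Only left invariance is part of the definition of the measure; Fubini over two copies
  exchanges conjugation by U with conjugation by its adjoint.\<close>

lemma kavg_flip:
 fixes B :: "quat^'m^'m"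
 assumes F: "hp k F"
 shows "kavg F B = (LINT U|haar. F (U**B**adj U))"
proof -
 have "kavg F B = (LINT U|haar. LINT V|haar. F (adj V**(U**B**adj U)**V))"
  by (rule haar_eqI[symmetric]) (simp add: kavg_conj[OF F] flip: kavg_def)
 also have "... = (LINT V|haar. LINT U|haar. F (adj V**(U**B**adj U)**V))"
  by (rule sm_fubini[OF haar haar]) (intro continuous_hp[OF F] continuous_intros)
 also have "... = (LINT U|haar. F (U**B**adj U))"
 proof (rule haar_eqI)
  fix V :: "quat^'m^'m" assume "V \<in> Stf"
  then have V: "adj V \<in> Stf" by (rule unitary_adj)
  have "(LINT U|haar. F ((adj V**U)**B**adj (adj V**U))) = (LINT U|haar. F (U**B**adj U))"
   by (rule sm_invariant[OF haar _ V, where f = "%U. F (U**B**adj U)"])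
    (intro continuous_hp[OF F] continuous_intros)
  then show "(LINT U|haar. F (adj V**(U**B**adj U)**V)) = (LINT U|haar. F (U**B**adj U))"
   by (simp add: adj_mult matrix_mul_assoc)
 qed
 finally show ?thesis .
qed

lemma Delta_dg:
 fixes y :: "'m::finite => real"
 assumes "j <= CARD('m)"
 shows "Delta j (dg y) = (\<Prod>i<j. y (ith i))"
proof -
 have "Delta j (dg y) = hdet (Pj j**dg y**Pj j + Qj j)" using assms by (intro Delta_hdet) simp_all
 also have "Pj j**dg y**Pj j + Qj j = dg (%a. if idx a < j then y (ith (idx a)) else 1)"
  unfolding Pj_def Qj_def dg_mult dg_add by (rule arg_cong[of _ _ dg]) (auto simp: fun_eq_iff)
 also have "hdet ... = (\<Prod>i<j. y (ith i))"
  unfolding hdet_dg by (rule prod_idx_trunc[OF assms, of "%i. y (ith i)"])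
 finally show ?thesis .
qed

text \<open>Conjugation by the diagonal matrix of powers of t leaves the minors unchanged and
  multiplies entries below the diagonal by positive powers of t; the limit t to 0 leaves the
  diagonal of \<open>T\<close>.\<close>

lemma Delta_lowtri_prod:
 fixes T :: "quat^'m^'m"
 assumes T: "lowtri T" and j: "j <= CARD('m)"
 shows "Delta j (T**adj T) = (\<Prod>i<j. (norm (T$ith i$ith i))\<^sup>2)"
proof -
 \<comment> \<open>Above the diagonal the truncated exponent is 0, but there \<open>T\<close>
   vanishes.\<close>
 define S where "S t = (\<chi> a b. t ^ (idx a - idx b) *\<^sub>R T$a$b)" for t :: real
 have S: "Delta j (S t**adj (S t)) = Delta j (T**adj T)" if t: "t ~= 0" for t
 proof -
  define D :: "quat^'m^'m" where "D = dg (%a. t ^ idx a)"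
  define E :: "quat^'m^'m" where "E = dg (%a. (1 / t) ^ idx a)"
  have DE: "D**(E**E)**D = mat 1"
   using t by (simp add: D_def E_def dg_mult power_mult_distrib[symmetric] flip: dg_one)
  have St: "S t = D**T**E"
  proof -
   have "t ^ (idx a - idx b) *\<^sub>R T$a$b = (t ^ idx a * (1 / t) ^ idx b) *\<^sub>R T$a$b" for a b
   proof (cases "idx a < idx b")
    case True
    then show ?thesis using T by (simp add: lowtri_def)
   next
    case False
    then show ?thesis using t by (simp add: power_diff power_divide)
   qed
   then show ?thesis by (simp add: vec_eq_iff S_def D_def E_def dg_conj_nth)
  qed
  have low: "lowtri D" by (simp add: lowtri_def D_def)
  have adjs: "adj D = D" "adj E = E" by (simp_all add: D_def E_def)
  have EE: "E**E \<in> Hrm" by (simp add: E_def dg_mult)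
  have Tm: "T \<in> Mts" using T by (simp add: lowtri_def)
  have "S t**adj (S t) = D**(T**(E**E)**adj T)**adj D" by (simp add: St adj_mult adjs matrix_mul_assoc)
  also have "Delta j ... = Delta j (D**adj D) * (Delta j (T**adj T) * Delta j (E**E))"
   using EE Tm by (simp add: Delta_lowtri[OF low _ j] Delta_lowtri[OF T EE j])
  also have "... = Delta j (T**adj T) * Delta j (D**(E**E)**adj D)" by (simp add: Delta_lowtri[OF low EE j])
  also have "... = Delta j (T**adj T)" by (simp add: adjs DE Delta_one[OF j])
  finally show ?thesis .
 qed
 have "continuous_on UNIV (%t. S t)" unfolding S_def by (intro continuous_intros continuous_on_vec_lambda)
 then have "continuous_on UNIV (%t. Delta j (S t**adj (S t)))"
  by (intro continuous_hp[OF hp_Delta] continuous_intros)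
 then have "((%t. Delta j (S t**adj (S t))) \<longlongrightarrow> Delta j (S 0**adj (S 0))) (at 0)"
  by (simp add: continuous_on_eq_continuous_at isCont_def)
 moreover have "((%t. Delta j (S t**adj (S t))) \<longlongrightarrow> Delta j (T**adj T)) (at 0)"
 proof (rule Lim_transform_eventually[OF tendsto_const])
  show "\<forall>\<^sub>F t in at 0. Delta j (T**adj T) = Delta j (S t**adj (S t))"
   using S by (simp add: eventually_at_filter)
 qed
 ultimately have "Delta j (T**adj T) = Delta j (S 0**adj (S 0))" using tendsto_unique[OF at_neq_bot] by blast
 also have "S 0**adj (S 0) = dg (%a. (norm (T$a$a))\<^sup>2)"
 proof -
  have S0: "S 0$a$b = (if a = b then T$a$a else 0)" for a b
  proof -
   consider "a = b" | "idx a < idx b" | "idx b < idx a" using idx_eq_iff[of a b] by linarith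
   then show ?thesis using T by cases (auto simp: S_def lowtri_def power_0_left)
  qed
  have "(\<Sum>c\<in>UNIV. S 0$a$c * qcnj (S 0$b$c)) = (\<Sum>c\<in>UNIV. if c = a then (if a = b then T$a$a * qcnj (T$a$a) else 0) else 0)" for a b
   by (intro sum.cong) (auto simp: S0)
  then show ?thesis by (simp add: vec_eq_iff matrix_matrix_mult_def qcnj_mult_self power2_norm_eq_inner)
 qed
 finally show ?thesis by (simp add: Delta_dg[OF j])
qed

text \<open>Raising part i multiplies \<open>powf\<close> by the quotient of the minors of orders i
  + 1 and i, which is the squared modulus of a diagonal entry of \<open>T\<close>; for i = 0 the
  denominator is the empty minor 1.\<close>

lemma powf_raise:
 fixes T :: "quat^'m^'m"
 assumes la: "la \<in> parts CARD('m) k" and r: "i = 0 \<or> la i < la (i - 1)" "i < CARD('m)"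
  and T: "lowtri T" and pd: "pdef (T**adj T)"
 shows "powf (la(i := Suc (la i))) (T**adj T) = (norm (T$ith i$ith i))\<^sup>2 * powf la (T**adj T)"
proof -
 let ?m = "CARD('m)" and ?D = "%j. Delta j (T**adj T)"
 define la' where "la' = la(i := Suc (la i))"
 have am: "la (Suc n) <= la n" for n using la by (auto simp: parts_def antimono_def)
 have step: "?D (Suc i) = (norm (T$ith i$ith i))\<^sup>2 * ?D i" using r(2) by (simp add: Delta_lowtri_prod[OF T])
 have rest: "?D (Suc j) ^ (la' j - la' (Suc j)) = ?D (Suc j) ^ (la j - la (Suc j))" if "j ~= i" "Suc j ~= i" for j
  using that by (simp add: la'_def)
 have at_i: "?D (Suc i) ^ (la' i - la' (Suc i)) = ?D (Suc i) * ?D (Suc i) ^ (la i - la (Suc i))"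
  using am[of i] by (simp add: la'_def Suc_diff_le)
 show ?thesis
 proof (cases i)
  case 0
  have D0: "?D 0 = 1" by (simp add: Delta_def)
  have "powf la' (T**adj T) = ?D (Suc i) * powf la (T**adj T)"
   unfolding powf_def prod.remove[OF finite_lessThan, of i]
   using r(2) at_i rest 0 by (subst (1 2) prod.remove[of _ i]) (auto intro!: prod.cong)
  then show ?thesis using step D0 0 by (simp add: la'_def)
 next
  case (Suc l)
  then have l: "l < ?m" "la i < la l" using r by auto
  have "la l - la i = Suc (la' l - la' i)" using l(2) Suc by (simp add: la'_def)
  then have at_l: "?D (Suc l) ^ (la l - la (Suc l)) = ?D i * ?D (Suc l) ^ (la' l - la' (Suc l))" using Suc by simp
  define R where "R = (\<Prod>j\<in>{..<?m} - {i} - {l}. ?D (Suc j) ^ (la j - la (Suc j)))"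
  have R': "(\<Prod>j\<in>{..<?m} - {i} - {l}. ?D (Suc j) ^ (la' j - la' (Suc j))) = R"
   unfolding R_def using Suc by (intro prod.cong refl rest) auto
  have split: "(\<Prod>j<?m. h j) = h i * (h l * (\<Prod>j\<in>{..<?m} - {i} - {l}. h j))" for h :: "nat => real"
   using r(2) l(1) Suc prod.remove[of "{..<?m}" i h] prod.remove[of "{..<?m} - {i}" l h] by simp
  have pos: "?D i > 0" using r(2) by (intro Delta_posdef pd) simp
  have "?D i * powf la' (T**adj T) = ?D (Suc i) * powf la (T**adj T)"
   unfolding powf_def split R' R_def[symmetric] at_i at_l by (simp add: mult_ac)
  then show ?thesis using step pos by (simp add: la'_def)
 qed
qed

text \<open>One diagonal entry times the power function. The sum over \<open>a\<close> is the trace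
  times \<open>powf\<close>; the summands are averaged separately.\<close>

definition pieri :: "(nat => nat) => 'm => quat^'m^'m => real"
 where "pieri la a X = qRe (X$a$a) * powf la X"

lemma linear_qRe_entry: "linear (%X :: quat^'m^'m. qRe (c * X$a$b * d))"
 by (rule linearI) (simp_all add: algebra_simps)

lemma hp_entry_powf:
 "la \<in> parts CARD('m) k ==> hp (Suc k) (%X :: quat^'m^'m. qRe (c * X$a$b * d) * powf la X)"
 using hp_mult[OF hp_linear[OF linear_qRe_entry[of c a b d]] hp_powf] by simp

lemma hp_pieri: "la \<in> parts CARD('m) k ==> hp (Suc k) (pieri la a :: quat^'m^'m => real)"
 using hp_entry_powf[of la k 1 a a 1] by (simp add: pieri_def[abs_def])

text \<open>Changing the sign of coordinate \<open>a\<close> flips an off-diagonal entry but not the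
  power function, so its average vanishes; diagonal entries of a Hermitian matrix are real.\<close>

lemma entry_average:
 fixes B :: "quat^'m^'m"
 assumes la: "la \<in> parts CARD('m) k" and B: "B \<in> Hrm"
 shows "(LINT U|haar. qRe (c * (U**B**adj U)$a$b * qcnj d) * powf la (U**B**adj U)) =
  (if a = b then qRe (c * qcnj d) * kavg (pieri la a) B else 0)"
proof (cases "a = b")
 case True
 have "(LINT U|haar. qRe (c * (U**B**adj U)$a$b * qcnj d) * powf la (U**B**adj U)) =
  (LINT U|haar. qRe (c * qcnj d) * pieri la a (U**B**adj U))"
 proof (rule haar_cong)
  fix U :: "quat^'m^'m"
  have "adj (U**B**adj U) = U**B**adj U" by (simp add: adj_mult herm_adj[OF B] matrix_mul_assoc)
  then have "qcnj ((U**B**adj U)$a$a) = (U**B**adj U)$a$a" by (metis adj_nth)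
  then obtain s where s: "(U**B**adj U)$a$a = of_real s"
   by (cases "(U**B**adj U)$a$a") (auto simp: qcnj_def of_real_quat)
  show "qRe (c * (U**B**adj U)$a$b * qcnj d) * powf la (U**B**adj U) = qRe (c * qcnj d) * pieri la a (U**B**adj U)"
   using s True by (simp add: pieri_def of_real_mult_quat)
 qed
 then show ?thesis using True by (simp add: kavg_flip[OF hp_pieri[OF la]])
next
 case False
 define D :: "quat^'m^'m" where "D = dg (%i. if i = a then -1 else 1)"
 have D: "D \<in> Stf" "lowtri D" "adj D = D" "D**D = mat 1"
 proof -
  show "adj D = D" "lowtri D" by (simp_all add: D_def lowtri_def)
  have "(%i. (if i = a then -1 else 1) * (if i = a then -1 else 1)) = (%_. 1 :: real)" by auto
  then show "D**D = mat 1" by (simp add: D_def dg_mult flip: dg_one)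
  then show "D \<in> Stf" by (simp add: stiefel_def D_def)
 qed
 let ?F = "%X :: quat^'m^'m. qRe (c * X$a$b * qcnj d) * powf la X"
 have "(LINT U|haar. ?F (U**B**adj U)) = (LINT U|haar. ?F ((D**U)**B**adj (D**U)))"
  by (rule sm_invariant[OF haar _ D(1), where f = "%U. ?F (U**B**adj U)", symmetric])
   (intro continuous_hp[OF hp_entry_powf[OF la]] continuous_intros)
 also have "... = (LINT U|haar. - ?F (U**B**adj U))"
 proof (rule haar_cong)
  fix U :: "quat^'m^'m" assume "U \<in> Stf"
  then have "U**B**adj U \<in> Hrm" using B by (simp add: stiefel_mats)
  from powf_lowtri[OF D(2) this, of la]
  have "powf la (D**(U**B**adj U)**adj D) = powf la (U**B**adj U)" by (simp add: D powf_one)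
  moreover have "(D**(U**B**adj U)**adj D)$a$b = - (U**B**adj U)$a$b"
   using False by (simp add: D(3)) (simp add: D_def dg_conj_nth)
  moreover have "(D**U)**B**adj (D**U) = D**(U**B**adj U)**adj D" by (simp add: adj_mult matrix_mul_assoc)
  ultimately show "?F ((D**U)**B**adj (D**U)) = - ?F (U**B**adj U)" by (simp add: linear_neg[OF linear_qRe])
 qed
 finally show ?thesis using False by simp
qed

text \<open>Expand the diagonal entry of the triangular conjugate: the off-diagonal terms average to
  zero, leaving the squared moduli of row j of \<open>T\<close>.\<close>

lemma pieri_functional:
 fixes g V :: "quat^'m^'m"
 assumes la: "la \<in> parts CARD('m) k" and g: "g \<in> Mts" "gi**g = mat 1" and V: "V \<in> Stf"
 obtains T where "lowtri T" "T**adj T = adj V**(adj g**g)**V"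
  "!!B j. B \<in> Hrm ==> (LINT U|haar. pieri la j (adj V**(adj g**(U**B**adj U)**g)**V)) =
   powf la (T**adj T) * (\<Sum>a\<in>UNIV. (norm (T$j$a))\<^sup>2 * kavg (pieri la a) B)"
proof -
 obtain T Q where T: "lowtri T" "T**adj T = adj V**(adj g**g)**V" and Q: "Q \<in> Stf"
  and Qc: "!!X. adj V**(adj g**X**g)**V = T**(Q**X**adj Q)**adj T" by (rule unitary_lq[OF g V]) blast
 have "(LINT U|haar. pieri la j (adj V**(adj g**(U**B**adj U)**g)**V)) =
   powf la (T**adj T) * (\<Sum>a\<in>UNIV. (norm (T$j$a))\<^sup>2 * kavg (pieri la a) B)" if B: "B \<in> Hrm" for B j
 proof -
  have conj: "adj V**(adj g**(U**B**adj U)**g)**V = T**((Q**U)**B**adj (Q**U))**adj T" for U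
   unfolding Qc by (simp add: adj_mult matrix_mul_assoc)
  have "(LINT U|haar. pieri la j (adj V**(adj g**(U**B**adj U)**g)**V)) =
   (LINT U|haar. pieri la j (T**(U**B**adj U)**adj T))"
   unfolding conj by (rule sm_invariant[OF haar _ Q, where f = "%U. pieri la j (T**(U**B**adj U)**adj T)"])
    (intro continuous_hp[OF hp_pieri[OF la]] continuous_intros)
  also have "... = (LINT U|haar. powf la (T**adj T) * (\<Sum>a\<in>UNIV. \<Sum>b\<in>UNIV.
   qRe (T$j$a * (U**B**adj U)$a$b * qcnj (T$j$b)) * powf la (U**B**adj U)))"
  proof (rule haar_cong)
   fix U :: "quat^'m^'m" assume "U \<in> Stf"
   then have X: "U**B**adj U \<in> Hrm" using B by (simp add: stiefel_mats)
   have e: "qRe ((T**X**adj T)$j$j) = (\<Sum>a\<in>UNIV. \<Sum>b\<in>UNIV. qRe (T$j$a * X$a$b * qcnj (T$j$b)))" for X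
   proof -
    have "qRe ((T**X**adj T)$j$j) = (\<Sum>b\<in>UNIV. \<Sum>a\<in>UNIV. qRe (T$j$a * X$a$b * qcnj (T$j$b)))"
     by (simp add: matrix_matrix_mult_def qRe_sum sum_distrib_right)
    also have "... = (\<Sum>a\<in>UNIV. \<Sum>b\<in>UNIV. qRe (T$j$a * X$a$b * qcnj (T$j$b)))" by (rule sum.swap)
    finally show ?thesis .
   qed
   show "pieri la j (T**(U**B**adj U)**adj T) = powf la (T**adj T) * (\<Sum>a\<in>UNIV. \<Sum>b\<in>UNIV.
    qRe (T$j$a * (U**B**adj U)$a$b * qcnj (T$j$b)) * powf la (U**B**adj U))"
    unfolding pieri_def powf_lowtri[OF T(1) X] e sum_distrib_right[symmetric] by (simp only: mult.left_commute)
  qed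
  also have "... = powf la (T**adj T) * (\<Sum>a\<in>UNIV. \<Sum>b\<in>UNIV.
   (LINT U|haar. qRe (T$j$a * (U**B**adj U)$a$b * qcnj (T$j$b)) * powf la (U**B**adj U)))"
  proof -
   have "integrable haar (%U. qRe (c * (U**B**adj U)$a$b * d) * powf la (U**B**adj U))" for a b c d
    by (intro haar_int[OF hp_entry_powf[OF la]] continuous_intros)
   then show ?thesis by (simp add: LINT_sum)
  qed
  also have "... = powf la (T**adj T) * (\<Sum>a\<in>UNIV. (norm (T$j$a))\<^sup>2 * kavg (pieri la a) B)"
   by (simp add: entry_average[OF la B] qcnj_mult_self power2_norm_eq_inner)
  finally show ?thesis .
 qed
 then show thesis using that[OF T] by blast
qed

lemma Esym_conj_unitary: "U \<in> Stf ==> Esym j (U**X**adj U) = Esym j X" for U :: "quat^'m^'m"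
 using Esym_swap[of j "U**X" "adj U"] by (simp add: matrix_mul_assoc stiefelD)

text \<open>Swapping the coordinates l and l + 1 changes only the minor of order l + 1, whose
  exponent in \<open>powf\<close> is 0 for equal parts.\<close>

lemma pieri_block:
 fixes B :: "quat^'m^'m"
 assumes la: "la \<in> parts CARD('m) k" and l: "Suc l < CARD('m)" "la l = la (Suc l)"
 shows "kavg (pieri la (ith l)) B = kavg (pieri la (ith (Suc l))) B"
proof -
 define a :: 'm where "a = ith l"
 define b :: 'm where "b = ith (Suc l)"
 have ab: "idx a = l" "idx b = Suc l" using l by (simp_all add: a_def b_def)
 define p where "p = Transposition.transpose a b"
 have p: "p a = b" "p b = a" "inj p" by (simp_all add: p_def inj_transpose)
 note Pi = permm_unitary[OF p(3)] and Pd = permm_dg[OF p(3)]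
 have comm: "permm p**Pj (Suc j) = Pj (Suc j)**permm p" if "j ~= l" for j
 proof -
  have "(%i. if idx i < Suc j then 1 else 0) \<circ> p = (%i::'m. if idx i < Suc j then 1 else (0::real))"
  proof
   fix i show "((%i. if idx i < Suc j then 1 else 0) \<circ> p) i = (if idx i < Suc j then 1 else (0::real))"
    using that ab by (cases "i = a"; cases "i = b") (auto simp: p_def)
  qed
  then have "permm p**Pj (Suc j)**adj (permm p) = Pj (Suc j)" by (simp add: Pj_def Pd)
  then have "permm p**Pj (Suc j)**(adj (permm p)**permm p) = Pj (Suc j)**permm p"
   by (simp only: matrix_mul_assoc)
  then show ?thesis by (simp add: stiefelD[OF Pi])
 qed
 have Delta: "Delta (Suc j) (permm p**X**adj (permm p)) = Delta (Suc j) X" if "j ~= l" for j and X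
 proof -
  have "adj (permm p**Pj (Suc j)) = adj (Pj (Suc j)**permm p)" by (simp only: comm[OF that])
  then have "adj (permm p)**Pj (Suc j) = Pj (Suc j)**adj (permm p)" by (simp add: adj_mult)
  then have "Pj (Suc j)**(permm p**X**adj (permm p))**Pj (Suc j) =
   (Pj (Suc j)**permm p)**X**(Pj (Suc j)**adj (permm p))" by (metis matrix_mul_assoc)
  also have "... = permm p**(Pj (Suc j)**X**Pj (Suc j))**adj (permm p)"
   unfolding comm[OF that, symmetric] by (simp only: matrix_mul_assoc)
  finally show ?thesis by (simp add: Delta_def Esym_conj_unitary[OF Pi])
 qed
 have "powf la (permm p**X**adj (permm p)) = powf la X" for X unfolding powf_def
 proof (intro prod.cong refl)
  fix j show "Delta (Suc j) (permm p**X**adj (permm p)) ^ (la j - la (Suc j)) = Delta (Suc j) X ^ (la j - la (Suc j))"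
   using Delta[of j X] l(2) by (cases "j = l") auto
 qed
 then have sw: "pieri la a (permm p**X**adj (permm p)) = pieri la b X" for X
  by (simp add: pieri_def permm_conj_nth p)
 have "(LINT U|haar. pieri la a (U**B**adj U)) = (LINT U|haar. pieri la a ((permm p**U)**B**adj (permm p**U)))"
  by (rule sm_invariant[OF haar _ Pi, where f = "%U. pieri la a (U**B**adj U)", symmetric])
   (intro continuous_hp[OF hp_pieri[OF la]] continuous_intros)
 also have "... = (LINT U|haar. pieri la b (U**B**adj U))"
  unfolding sw[symmetric] by (simp add: adj_mult matrix_mul_assoc)
 finally show ?thesis by (simp add: kavg_flip[OF hp_pieri[OF la]] a_def b_def)
qed

text \<open>Only partitions with one added box occur. If \<open>l\<close> occurs, sample its
  coefficient in \<open>pieri_functional\<close> for the first index \<open>j\<close> that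
  contributes: the triangular shape of \<open>T\<close> leaves the term |T_jj|^2, and this raises
  part j. Hence \<open>phi l\<close> agrees with the raised \<open>phi\<close> on all samples, and
  the dual functionals identify the two partitions.\<close>

lemma pieri_rule:
 assumes la: "la \<in> parts CARD('m::finite) k"
 obtains b where "!!X :: quat^'m^'m. X \<in> Hrm ==> rtr X * phi la X = (\<Sum>l\<in>parts CARD('m) (Suc k). b l * phi l X)"
  "!!l. l \<in> parts CARD('m) (Suc k) ==> b l ~= 0 ==> \<exists>i<CARD('m). l = la(i := Suc (la i))"
proof -
 let ?m = "CARD('m)" and ?P = "parts CARD('m) (Suc k)"
 define s where "s a = kavg (pieri la a)" for a :: 'm
 have hs: "hp (Suc k) (s a)" for a unfolding s_def by (rule hp_kavg[OF hp_pieri[OF la]])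
 have "\<forall>a. \<exists>c. \<forall>X\<in>Hrm. s a X = (\<Sum>l\<in>?P. c l * phi l X)"
 proof
  fix a
  have inv: "s a (U**X**adj U) = s a X" if "U \<in> Stf" for U X :: "quat^'m^'m"
   unfolding s_def by (rule kavg_conj[OF hp_pieri[OF la] that])
  show "\<exists>c. \<forall>X\<in>Hrm. s a X = (\<Sum>l\<in>?P. c l * phi l X)" by (rule invariant_expansion[OF hs inv]) blast+
 qed
 from choice[OF this] obtain c where "\<forall>a. \<forall>X\<in>Hrm. s a X = (\<Sum>l\<in>?P. c a l * phi l X)" ..
 then have c: "s a X = (\<Sum>l\<in>?P. c a l * phi l X)" if "X \<in> Hrm" for a X using that by blast
 have key: "\<exists>i<?m. l = la(i := Suc (la i))" if l: "l \<in> ?P" and ca: "c a l ~= 0" for a l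
 proof -
  obtain I and y :: "quat^'m^'m => real" where I: "finite I" "!!B. B \<in> I ==> pdef B"
   "!!n. n \<in> ?P ==> (\<Sum>B\<in>I. y B * phi n B) = (if n = l then 1 else 0)"
   and dual: "!!d. (\<Sum>B\<in>I. y B * (\<Sum>n\<in>?P. d n * phi n B)) = d l" using phi_duals[OF l] by blast
  \<comment> \<open>The contributing index that comes first in the enumeration; minimality removes
    the entries of row j before the diagonal.\<close>
  obtain j where j: "c j l ~= 0" "!!a. c a l ~= 0 ==> idx j <= idx a"
   using ex_has_least_nat[of "%a. c a l ~= 0" a idx, OF ca] by blast
  define i where "i = idx j"
  have im: "i < ?m" by (simp add: i_def)
  have ij: "ith i = j" by (simp add: i_def)
  have am: "la (Suc n) <= la n" for n using la by (auto simp: parts_def antimono_def)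
  have cs: "c a l = (\<Sum>B\<in>I. y B * s a B)" for a using dual[of "c a"] I(2) by (simp add: c posdef_herm)
  \<comment> \<open>Were part i equal to the previous one, \<open>pieri_block\<close> would give a
    contributing index before \<open>j\<close>. So raising part i yields a partition.\<close>
  have ri: "i = 0 \<or> la i < la (i - 1)"
  proof (rule ccontr)
   assume "\<not> (i = 0 \<or> la i < la (i - 1))"
   then obtain n where n: "i = Suc n" "\<not> la i < la n" by (cases i) auto
   then have "la n = la (Suc n)" using am[of n] by simp
   from pieri_block[OF la _ this] have "c (ith n) l = c j l" unfolding cs s_def using n im ij by simp
   then have "i <= idx (ith n :: 'm)" using j unfolding i_def by metis
   then show False using n im by simp
  qed
  define la' where "la' = la(i := Suc (la i))"
  have la': "la' \<in> ?P"
  proof -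
   have "antimono la'"
   proof (rule antimonoI)
    fix u v :: nat assume uv: "u <= v"
    have k: "la v <= la u" using la uv by (auto simp: parts_def antimono_def)
    show "la' v <= la' u"
    proof (cases "v = i \<and> u ~= i")
     case True
     then have "u <= i - 1" "i ~= 0" using uv by auto
     then have "la (i - 1) <= la u" using la by (auto simp: parts_def antimono_def)
     then show ?thesis using True ri \<open>i ~= 0\<close> by (simp add: la'_def)
    next
     case False
     then show ?thesis using k by (auto simp: la'_def)
    qed
   qed
   moreover have "(\<Sum>v<?m. la' v) = Suc (\<Sum>v<?m. la v)" using im by (simp add: la'_def sum.remove[of "{..<?m}" i])
   ultimately show ?thesis using la im by (auto simp: parts_def expos_def la'_def)
  qed
  have eq: "phi l (adj g**g) = phi la' (adj g**g)" if g: "g \<in> Mts" "gi**g = mat 1" for g gi :: "quat^'m^'m"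
  proof -
   define f where "f B U V = pieri la j (adj V**(adj g**(U**B**adj U)**g)**V)" for B U V :: "quat^'m^'m"
   have fV: "continuous_on UNIV (%V. f B U V)" and fU: "continuous_on UNIV (%U. f B U V)"
    and fUV: "continuous_on UNIV (%p. f B (fst p) (snd p))" for B U V
    unfolding f_def by (intro continuous_hp[OF hp_pieri[OF la]] continuous_intros)+
   have sf: "(LINT V|haar. f B U V) = s j (adj g**(U**B**adj U)**g)" for B U
    by (simp add: f_def s_def kavg_def)
   have "(\<Sum>B\<in>I. y B * (LINT U|haar. LINT V|haar. f B U V)) = (\<Sum>B\<in>I. y B * (\<Sum>n\<in>?P. (c j n * phi n (adj g**g)) * phi n B))"
   proof (intro sum.cong refl arg_cong2[of _ _ _ _ "(*)"])
    fix B assume "B \<in> I"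
    then have B: "B \<in> Hrm" using I(2) by (simp add: posdef_herm)
    have int: "integrable haar (%U. phi n (adj g**(U**B**adj U)**g))" if "n \<in> ?P" for n
     by (intro haar_int[OF hp_phi[OF that]] continuous_intros)
    have "(LINT U|haar. LINT V|haar. f B U V) = (LINT U|haar. (\<Sum>n\<in>?P. c j n * phi n (adj g**(U**B**adj U)**g)))"
     unfolding sf by (rule haar_cong) (use B g in \<open>simp add: c stiefel_mats\<close>)
    also have "... = (\<Sum>n\<in>?P. (c j n * phi n (adj g**g)) * phi n B)"
     by (simp add: LINT_sum int phi_integral_haar[OF _ B g] mult.assoc)
    finally show "(LINT U|haar. LINT V|haar. f B U V) = ..." .
   qed
   then have left: "(\<Sum>B\<in>I. y B * (LINT U|haar. LINT V|haar. f B U V)) = c j l * phi l (adj g**g)"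
    by (simp only: dual)
   have "(\<Sum>B\<in>I. y B * (LINT U|haar. LINT V|haar. f B U V)) = (LINT U|haar. (\<Sum>B\<in>I. y B * (LINT V|haar. f B U V)))"
   proof -
    have "integrable haar (%U. LINT V|haar. f B U V)" for B
     unfolding sf by (intro haar_int[OF hs] continuous_intros)
    then show ?thesis by (simp add: LINT_sum)
   qed
   also have "... = (LINT U|haar. LINT V|haar. (\<Sum>B\<in>I. y B * f B U V))"
    by (simp add: LINT_sum sm_integrable[OF haar fV])
   also have "... = (LINT V|haar. LINT U|haar. (\<Sum>B\<in>I. y B * f B U V))"
    by (rule sm_fubini[OF haar haar]) (intro continuous_intros fUV)
   also have "... = (LINT V|haar. (\<Sum>B\<in>I. y B * (LINT U|haar. f B U V)))"
    by (simp add: LINT_sum sm_integrable[OF haar fU])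
   also have "... = (LINT V|haar. c j l * powf la' (adj V**(adj g**g)**V))"
   proof (rule haar_cong)
    fix V :: "quat^'m^'m" assume V: "V \<in> Stf"
    obtain T where T: "lowtri T" "T**adj T = adj V**(adj g**g)**V"
     and pf: "!!B j. B \<in> Hrm ==> (LINT U|haar. pieri la j (adj V**(adj g**(U**B**adj U)**g)**V)) =
      powf la (T**adj T) * (\<Sum>a\<in>UNIV. (norm (T$j$a))\<^sup>2 * kavg (pieri la a) B)"
     by (rule pieri_functional[OF la g V]) blast
    note T = T pf[of _ j, folded s_def f_def]
    have "pdef (adj g**g)" using posdef_conj[OF posdef_one g] by simp
    then have pd: "pdef (T**adj T)"
     unfolding T(2) using V by (intro posdef_conj[where gi = "adj V"]) (simp_all add: stiefel_mats stiefelD)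
    have "(\<Sum>B\<in>I. y B * (LINT U|haar. f B U V)) =
     (\<Sum>B\<in>I. \<Sum>a\<in>UNIV. powf la (T**adj T) * (norm (T$j$a))\<^sup>2 * (y B * s a B))"
     by (intro sum.cong refl) (simp add: T(3) I(2) posdef_herm sum_distrib_left mult_ac)
    also have "... = (\<Sum>a\<in>UNIV. powf la (T**adj T) * (norm (T$j$a))\<^sup>2 * c a l)"
     unfolding cs sum_distrib_left by (rule sum.swap)
    also have "... = (\<Sum>a\<in>UNIV. if a = j then powf la (T**adj T) * (norm (T$j$j))\<^sup>2 * c j l else 0)"
    proof (intro sum.cong refl)
     fix a
     \<comment> \<open>Entries after the diagonal vanish since \<open>T\<close> is lower triangular,
       and coefficients before it by the choice of \<open>j\<close>.\<close>
     have "c a l = 0 \<or> T$j$a = 0" if "a ~= j"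
      using j(2)[of a] T(1) that idx_eq_iff[of a j] unfolding lowtri_def by (metis le_neq_implies_less)
     then show "powf la (T**adj T) * (norm (T$j$a))\<^sup>2 * c a l =
      (if a = j then powf la (T**adj T) * (norm (T$j$j))\<^sup>2 * c j l else 0)" by auto
    qed
    also have "... = c j l * powf la' (T**adj T)" unfolding la'_def powf_raise[OF la ri im T(1) pd] ij by simp
    finally show "(\<Sum>B\<in>I. y B * (LINT U|haar. f B U V)) = c j l * powf la' (adj V**(adj g**g)**V)"
     unfolding T(2) .
   qed
   finally have "c j l * phi l (adj g**g) = c j l * phi la' (adj g**g)"
    unfolding left by (simp add: phi_def kavg_def)
   then show ?thesis using j(1) by simp
  qed
  have "phi l B = phi la' B" if B: "B \<in> I" for B
  proof -
   note pd = posdef_psqrt[OF I(2)[OF B]]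
   obtain gi where "gi**sqr B = mat 1" using posdef_inverse[OF pd] by metis
   from eq[OF psqrt_mats(1)[OF I(2)[OF B]] this] show ?thesis by (simp add: psqrt_mats I(2) B psqrt_mult)
  qed
  then have "(\<Sum>B\<in>I. y B * phi la' B) = 1" using I(3)[OF l] by simp
  then have "la' = l" using I(3)[OF la'] by (simp split: if_splits)
  then show ?thesis using im unfolding la'_def by blast
 qed
 show thesis
 proof (rule that[of "%l. \<Sum>a\<in>UNIV. c a l"])
  fix X :: "quat^'m^'m" assume X: "X \<in> Hrm"
  have "rtr X * phi la X = (LINT V|haar. rtr X * powf la (adj V**X**V))" by (simp add: phi_def kavg_def)
  also have "... = (LINT V|haar. (\<Sum>a\<in>UNIV. pieri la a (adj V**X**V)))"
  proof (rule haar_cong)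
   fix V :: "quat^'m^'m" assume "V \<in> Stf"
   then have "adj V \<in> Stf" by (rule unitary_adj)
   from rtr_conj[OF this, of X] show "rtr X * powf la (adj V**X**V) = (\<Sum>a\<in>UNIV. pieri la a (adj V**X**V))"
    unfolding pieri_def sum_distrib_right[symmetric] by (simp add: rtr_def)
  qed
  also have "... = (\<Sum>a\<in>UNIV. s a X)"
   unfolding s_def kavg_def by (simp add: LINT_sum kavg_integrable[OF hp_pieri[OF la]])
  also have "... = (\<Sum>a\<in>UNIV. \<Sum>l\<in>?P. c a l * phi l X)" by (simp add: c[OF X])
  also have "... = (\<Sum>l\<in>?P. (\<Sum>a\<in>UNIV. c a l) * phi l X)" unfolding sum_distrib_right by (rule sum.swap)
  finally show "rtr X * phi la X = (\<Sum>l\<in>?P. (\<Sum>a\<in>UNIV. c a l) * phi l X)" .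
 next
  fix l assume "l \<in> ?P" "(\<Sum>a\<in>UNIV. c a l) ~= 0"
  then obtain a where "c a l ~= 0" by (meson sum.neutral)
  then show "\<exists>i<?m. l = la(i := Suc (la i))" using key \<open>l \<in> ?P\<close> by blast
 qed
qed

end

section \<open>The binomial theorem\<close>

abbreviation incr :: "nat => (nat => nat) => nat => nat"
 where "incr i e \<equiv> e(i := Suc (e i))"

lemma sum_incr: "i < m ==> (\<Sum>j<m. incr i e j) = Suc (\<Sum>j<m. e j)" by (simp add: sum.remove[of "{..<m}" i])

lemma incr_expos: "e \<in> expos m k ==> i < m ==> incr i e \<in> expos m (Suc k)"
 by (simp add: expos_def sum_incr del: fun_upd_apply) simp

lemma sum_expos_incr:
 fixes g :: "(nat => nat) => nat => real"
 shows "(\<Sum>e\<in>expos m k. \<Sum>i<m. g (incr i e) i) =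
  (\<Sum>e\<in>expos m (Suc k). \<Sum>i<m. if e i = 0 then 0 else g e i)"
proof -
 have "(\<Sum>e\<in>expos m k. \<Sum>i<m. g (incr i e) i) = (\<Sum>p\<in>expos m k \<times> {..<m}. g (incr (snd p) (fst p)) (snd p))"
  by (simp add: sum.cartesian_product case_prod_unfold)
 also have "... = (\<Sum>p\<in>{p \<in> expos m (Suc k) \<times> {..<m}. fst p (snd p) ~= 0}. g (fst p) (snd p))"
 proof (rule sum.reindex_bij_witness[of _ "%p. ((fst p)(snd p := fst p (snd p) - 1), snd p)" "%p. (incr (snd p) (fst p), snd p)"])
  fix p assume "p \<in> {p \<in> expos m (Suc k) \<times> {..<m}. fst p (snd p) ~= 0}"
  then have p: "fst p \<in> expos m (Suc k)" "snd p < m" "fst p (snd p) ~= 0" by auto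
  then have e: "incr (snd p) ((fst p)(snd p := fst p (snd p) - 1)) = fst p" by (simp add: fun_eq_iff)
  then show "(incr (snd ((fst p)(snd p := fst p (snd p) - 1), snd p)) (fst ((fst p)(snd p := fst p (snd p) - 1), snd p)),
   snd ((fst p)(snd p := fst p (snd p) - 1), snd p)) = p" by (simp add: prod_eq_iff del: fun_upd_apply)
  have "Suc (\<Sum>j<m. ((fst p)(snd p := fst p (snd p) - 1)) j) = Suc k"
   using sum_incr[OF p(2), of "(fst p)(snd p := fst p (snd p) - 1)"] p(1) unfolding e by (simp add: expos_def)
  then show "((fst p)(snd p := fst p (snd p) - 1), snd p) \<in> expos m k \<times> {..<m}"
   using p by (simp add: expos_def)
 qed (auto simp: incr_expos simp del: fun_upd_apply, auto)
 also have "... = (\<Sum>p\<in>expos m (Suc k) \<times> {..<m}. if fst p (snd p) = 0 then 0 else g (fst p) (snd p))"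
  by (rule sum.mono_neutral_cong_left) auto
 also have "... = (\<Sum>e\<in>expos m (Suc k). \<Sum>i<m. if e i = 0 then 0 else g e i)"
  by (simp add: sum.cartesian_product case_prod_unfold)
 finally show ?thesis .
qed

lemma xmon_incr: "i < m ==> xmon m (incr i e) x = x i * xmon m e x"
proof -
 assume i: "i < m"
 have "(\<Prod>j\<in>{..<m} - {i}. x j ^ incr i e j) = (\<Prod>j\<in>{..<m} - {i}. x j ^ e j)" by (intro prod.cong) auto
 then show ?thesis using i unfolding xmon_def by (simp add: prod.remove[of "{..<m}" i])
qed

text \<open>The coefficients after multiplication by the first power sum.\<close>

definition raisec :: "nat => ((nat => nat) => real) => (nat => nat) => real"
 where "raisec m c e = (\<Sum>i<m. if e i = 0 then 0 else c (e(i := e i - 1)))"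

lemma sum_raisec: "(\<Sum>e\<in>expos m (Suc k). raisec m c e * G e) = (\<Sum>e\<in>expos m k. \<Sum>i<m. c e * G (incr i e))"
proof -
 have "(\<Sum>e\<in>expos m k. \<Sum>i<m. c e * G (incr i e)) =
  (\<Sum>e\<in>expos m k. \<Sum>i<m. (%f i. c (f(i := f i - 1)) * G f) (incr i e) i)" by simp
 also have "... = (\<Sum>e\<in>expos m (Suc k). \<Sum>i<m. if e i = 0 then 0 else c (e(i := e i - 1)) * G e)"
  by (rule sum_expos_incr)
 also have "... = (\<Sum>e\<in>expos m (Suc k). raisec m c e * G e)"
  unfolding raisec_def sum_distrib_right by (intro sum.cong refl) simp
 finally show ?thesis by simp
qed

lemma hpoly_raisec: "hpoly m (Suc k) (raisec m c) x = (\<Sum>i<m. x i) * hpoly m k c x"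
proof -
 have "hpoly m (Suc k) (raisec m c) x = (\<Sum>e\<in>expos m k. \<Sum>i<m. c e * (x i * xmon m e x))"
  unfolding hpoly_xmon sum_raisec by (intro sum.cong refl) (simp add: xmon_incr del: fun_upd_apply)
 also have "... = (\<Sum>e\<in>expos m k. (\<Sum>i<m. x i) * (c e * xmon m e x))"
  unfolding sum_distrib_right by (intro sum.cong refl) simp
 finally show ?thesis by (simp add: hpoly_xmon sum_distrib_left)
qed

text \<open>The operator with terms x_i^2 d/dx_i, applied to \<open>hpoly m k c\<close>.\<close>

definition eop :: "nat => nat => ((nat => nat) => real) => (nat => real) => real"
 where "eop m k c x = (\<Sum>e\<in>expos m k. \<Sum>i<m. c e * (real (e i) * (x i * xmon m e x)))"

lemma jw_incr:
 assumes i: "i < m"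
 shows "jw \<beta> m x (incr i e) = jw \<beta> m x e + 2 * real (e i) + real \<beta> * (\<Sum>j\<in>{..<m} - {i}. x i / (x i - x j))"
proof -
 have 1: "(\<Sum>l<m. real (incr i e l) * (real (incr i e l) - 1)) = (\<Sum>l<m. real (e l) * (real (e l) - 1)) + 2 * real (e i)"
  using i by (simp add: sum.remove[of "{..<m}" i] algebra_simps)
 have "(\<Sum>l<m. \<Sum>j\<in>{..<m} - {l}. real (incr i e l) * (x l / (x l - x j))) =
  (\<Sum>l<m. (\<Sum>j\<in>{..<m} - {l}. real (e l) * (x l / (x l - x j))) + (if l = i then \<Sum>j\<in>{..<m} - {i}. x i / (x i - x j) else 0))"
  by (intro sum.cong refl) (auto simp: algebra_simps sum.distrib add_divide_distrib)
 also have "... = (\<Sum>l<m. \<Sum>j\<in>{..<m} - {l}. real (e l) * (x l / (x l - x j))) + (\<Sum>j\<in>{..<m} - {i}. x i / (x i - x j))"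
  using i by (simp add: sum.distrib)
 finally show ?thesis unfolding jw_def 1 by (simp add: distrib_left)
qed

lemma sum_quotients:
 fixes x :: "nat => real"
 assumes x: "inj_on x {..<m}"
 shows "(\<Sum>i<m. \<Sum>j\<in>{..<m} - {i}. x i * (x i / (x i - x j))) = (real m - 1) * (\<Sum>i<m. x i)"
proof -
 have "(\<Sum>i<m. \<Sum>j\<in>{..<m} - {i}. x i * (x i / (x i - x j))) =
  (\<Sum>i<m. (\<Sum>j\<in>{..<m} - {i}. x i * x j / (x i - x j)) + (real m - 1) * x i)"
 proof (rule sum.cong[OF refl])
  fix i assume i: "i \<in> {..<m}"
  have "(\<Sum>j\<in>{..<m} - {i}. x i * (x i / (x i - x j))) = (\<Sum>j\<in>{..<m} - {i}. x i * x j / (x i - x j) + x i)"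
  proof (rule sum.cong[OF refl])
   fix j assume "j \<in> {..<m} - {i}"
   then have "x i - x j ~= 0" using x i by (auto simp: inj_on_def)
   then show "x i * (x i / (x i - x j)) = x i * x j / (x i - x j) + x i" by (simp add: field_simps)
  qed
  then show "(\<Sum>j\<in>{..<m} - {i}. x i * (x i / (x i - x j))) = (\<Sum>j\<in>{..<m} - {i}. x i * x j / (x i - x j)) + (real m - 1) * x i"
   using i by (simp add: sum.distrib of_nat_diff)
 qed
 moreover have "(\<Sum>i<m. \<Sum>j\<in>{..<m} - {i}. x i * x j / (x i - x j)) = (\<Sum>i<m. \<Sum>j<m. x i * x j / (x i - x j))"
  by (rule sum.cong[OF refl], rule sum.mono_neutral_left) auto
 ultimately show ?thesis
  using jack_op_quotient_sum[of x "%_. 1" m] by (simp add: sum.distrib flip: sum_distrib_left)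
qed

text \<open>The commutator of the operator with multiplication by p_1 is twice the operator of
  \<open>eop\<close> plus a multiple of p_1; eigenvalue differences thus give access to
  \<open>eop\<close>.\<close>

lemma jack_op_raisec:
 assumes x: "inj_on x {..<m}"
 shows "jack_op \<beta> m (hpoly m (Suc k) (raisec m c)) x =
  (\<Sum>i<m. x i) * jack_op \<beta> m (hpoly m k c) x + 2 * eop m k c x + real \<beta> * (real m - 1) * (\<Sum>i<m. x i) * hpoly m k c x"
proof -
 have "jack_op \<beta> m (hpoly m (Suc k) (raisec m c)) x =
  (\<Sum>e\<in>expos m k. \<Sum>i<m. c e * (xmon m (incr i e) x * jw \<beta> m x (incr i e)))"
  unfolding jack_op_hpoly mult.assoc sum_raisec ..
 also have "... = (\<Sum>e\<in>expos m k. (\<Sum>i<m. x i) * (c e * xmon m e x * jw \<beta> m x e) +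
  2 * (\<Sum>i<m. c e * (real (e i) * (x i * xmon m e x))) +
  (real \<beta> * (c e * xmon m e x)) * (\<Sum>i<m. \<Sum>j\<in>{..<m} - {i}. x i * (x i / (x i - x j))))"
 proof (intro sum.cong refl)
  fix e
  have "(\<Sum>i<m. c e * (xmon m (incr i e) x * jw \<beta> m x (incr i e))) =
   (\<Sum>i<m. x i * (c e * xmon m e x * jw \<beta> m x e) + 2 * (c e * (real (e i) * (x i * xmon m e x))) +
   (real \<beta> * (c e * xmon m e x)) * (\<Sum>j\<in>{..<m} - {i}. x i * (x i / (x i - x j))))"
  proof (intro sum.cong refl)
   fix i assume "i \<in> {..<m}"
   then have i: "i < m" by simp
   show "c e * (xmon m (incr i e) x * jw \<beta> m x (incr i e)) = x i * (c e * xmon m e x * jw \<beta> m x e) + 2 * (c e * (real (e i) * (x i * xmon m e x))) +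
   (real \<beta> * (c e * xmon m e x)) * (\<Sum>j\<in>{..<m} - {i}. x i * (x i / (x i - x j)))"
    unfolding xmon_incr[OF i] jw_incr[OF i] sum_distrib_left[symmetric] by (simp only: algebra_simps)
  qed
  then show "(\<Sum>i<m. c e * (xmon m (incr i e) x * jw \<beta> m x (incr i e))) = (\<Sum>i<m. x i) * (c e * xmon m e x * jw \<beta> m x e) +
  2 * (\<Sum>i<m. c e * (real (e i) * (x i * xmon m e x))) +
  (real \<beta> * (c e * xmon m e x)) * (\<Sum>i<m. \<Sum>j\<in>{..<m} - {i}. x i * (x i / (x i - x j)))"
   unfolding sum.distrib sum_distrib_left[symmetric] sum_distrib_right[symmetric] .
 qed
 also have "... = (\<Sum>i<m. x i) * jack_op \<beta> m (hpoly m k c) x + 2 * eop m k c x + real \<beta> * (real m - 1) * (\<Sum>i<m. x i) * hpoly m k c x"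
  unfolding sum.distrib sum_quotients[OF x] jack_op_hpoly hpoly_xmon eop_def
  unfolding sum_distrib_left[symmetric] sum_distrib_right[symmetric] by (simp add: mult_ac)
 finally show ?thesis .
qed

text \<open>The Taylor coefficients of the product of the (1 - x_i)^(-a).\<close>

definition hbin :: "nat => real => (nat => nat) => real"
 where "hbin m a e = (\<Prod>i<m. pochhammer a (e i) / fact (e i))"

lemma hbin_incr: "i < m ==> real (Suc (e i)) * hbin m a (incr i e) = (a + real (e i)) * hbin m a e"
proof -
 assume i: "i < m"
 define R where "R = (\<Prod>j\<in>{..<m} - {i}. pochhammer a (e j) / fact (e j))"
 have "(\<Prod>j\<in>{..<m} - {i}. pochhammer a (incr i e j) / fact (incr i e j)) = R"
  unfolding R_def by (intro prod.cong) auto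
 then have 1: "hbin m a (incr i e) = pochhammer a (Suc (e i)) / fact (Suc (e i)) * R"
  using i unfolding hbin_def by (simp add: prod.remove[of "{..<m}" i] del: fact_Suc)
 have 2: "hbin m a e = pochhammer a (e i) / fact (e i) * R"
  using i unfolding hbin_def R_def by (simp add: prod.remove[of "{..<m}" i])
 have "real (Suc (e i)) * (pochhammer a (Suc (e i)) / fact (Suc (e i))) = (a + real (e i)) * (pochhammer a (e i) / fact (e i))"
  by (simp add: pochhammer_Suc field_simps del: of_nat_Suc)
 then show ?thesis unfolding 1 2 mult.assoc[symmetric] by (simp only:)
qed

text \<open>Each factor f = (1 - x)^(-a) satisfies x f' = x^2 f' + a x f; take the part of degree k
  + 1 of the product.\<close>

lemma hbin_recurrence:
 "real (Suc k) * hpoly m (Suc k) (hbin m a) x = eop m k (hbin m a) x + a * (\<Sum>i<m. x i) * hpoly m k (hbin m a) x"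
proof -
 have "eop m k (hbin m a) x + a * (\<Sum>i<m. x i) * hpoly m k (hbin m a) x =
  (\<Sum>e\<in>expos m k. \<Sum>i<m. ((a + real (e i)) * hbin m a e) * (x i * xmon m e x))"
  unfolding eop_def hpoly_xmon by (simp add: sum_distrib_left sum_distrib_right algebra_simps sum.distrib)
 also have "... = (\<Sum>e\<in>expos m k. \<Sum>i<m. (%f i. real (f i) * hbin m a f * xmon m f x) (incr i e) i)"
  by (intro sum.cong refl) (simp add: xmon_incr hbin_incr[symmetric] del: fun_upd_apply of_nat_Suc, simp)
 also have "... = (\<Sum>e\<in>expos m (Suc k). \<Sum>i<m. if e i = 0 then 0 else real (e i) * hbin m a e * xmon m e x)"
  by (rule sum_expos_incr)
 also have "... = (\<Sum>e\<in>expos m (Suc k). (\<Sum>i<m. real (e i)) * (hbin m a e * xmon m e x))"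
  unfolding sum_distrib_right by (intro sum.cong refl) simp
 also have "... = (\<Sum>e\<in>expos m (Suc k). real (Suc k) * (hbin m a e * xmon m e x))"
 proof (intro sum.cong refl)
  fix e assume "e \<in> expos m (Suc k)"
  then have "(\<Sum>i<m. real (e i)) = real (Suc k)" by (simp add: expos_def flip: of_nat_sum)
  then show "(\<Sum>i<m. real (e i)) * (hbin m a e * xmon m e x) = real (Suc k) * (hbin m a e * xmon m e x)" by simp
 qed
 finally show ?thesis by (simp add: hpoly_xmon sum_distrib_left)
qed

lemma rho_incr:
 assumes "i < m"
 shows "rho \<beta> m (incr i e) = rho \<beta> m e + 2 * real (e i) + real \<beta> * (real m - 1 - real i)"
proof -
 have 1: "(\<Sum>l<m. real (incr i e l) * (real (incr i e l) - 1)) = (\<Sum>l<m. real (e l) * (real (e l) - 1)) + 2 * real (e i)"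
  using assms by (simp add: sum.remove[of "{..<m}" i] algebra_simps)
 have 2: "(\<Sum>l<m. real (incr i e l) * (real m - 1 - real l)) = (\<Sum>l<m. real (e l) * (real m - 1 - real l)) + (real m - 1 - real i)"
  using assms by (simp add: sum.remove[of "{..<m}" i] algebra_simps)
 show ?thesis unfolding rho_def 1 2 by (simp add: distrib_left)
qed

context fld
begin

definition rpoch :: "nat => real => (nat => nat) => real"
 where "rpoch m a la = (\<Prod>i<m. pochhammer (a - real i / 2 * real \<beta>) (la i))"

lemma rpoch_incr: "i < m ==> rpoch m a (incr i la) = rpoch m a la * (a - real i / 2 * real \<beta> + real (la i))"
proof -
 assume i: "i < m"
 have "(\<Prod>j\<in>{..<m} - {i}. pochhammer (a - real j / 2 * real \<beta>) (incr i la j)) = (\<Prod>j\<in>{..<m} - {i}. pochhammer (a - real j / 2 * real \<beta>) (la j))"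
  by (intro prod.cong) auto
 then show ?thesis using i unfolding rpoch_def by (simp add: prod.remove[of "{..<m}" i] pochhammer_Suc)
qed

definition jcoef :: "'m::finite itself => nat => (nat => nat) => (nat => nat) => real"
 where "jcoef T k la e = acoef T k la * pcoef T k la e"

lemma jcoef_family: "jack_family \<beta> CARD('m::finite) k (jcoef TYPE('m) k)"
 unfolding jcoef_def[abs_def] by (rule jack_family_exists)

lemma jcoef_phi: "la \<in> parts CARD('m::finite) k ==>
  hpoly CARD('m) k (jcoef TYPE('m) k la) x = acoef TYPE('m) k la * phi la (dg (%a::'m. x (idx a)))"
 unfolding jcoef_def hpoly_cmult by (simp add: pcoef)

lemma pieri_jcoef:
 assumes la: "la \<in> parts CARD('m::finite) k"
 shows "\<exists>b. (\<forall>x. (\<Sum>i<CARD('m). x i) * hpoly CARD('m) k (jcoef TYPE('m) k la) x =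
   (\<Sum>l\<in>parts CARD('m) (Suc k). b l * hpoly CARD('m) (Suc k) (jcoef TYPE('m) (Suc k) l) x)) \<and>
  (\<forall>l\<in>parts CARD('m) (Suc k). b l ~= 0 --> (\<exists>i<CARD('m). l = incr i la))"
proof -
 let ?P = "parts CARD('m) (Suc k)"
 obtain b where b: "!!X :: quat^'m^'m. X \<in> Hrm ==> rtr X * phi la X = (\<Sum>l\<in>?P. b l * phi l X)"
  "!!l. l \<in> ?P ==> b l ~= 0 ==> \<exists>i<CARD('m). l = incr i la" using pieri_rule[OF la] by blast
 define b' where "b' l = acoef TYPE('m) k la * b l / acoef TYPE('m) (Suc k) l" for l
 have "(\<Sum>i<CARD('m). x i) * hpoly CARD('m) k (jcoef TYPE('m) k la) x =
   (\<Sum>l\<in>?P. b' l * hpoly CARD('m) (Suc k) (jcoef TYPE('m) (Suc k) l) x)" for x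
 proof -
  let ?X = "dg (%a::'m. x (idx a))"
  have "(\<Sum>i<CARD('m). x i) = rtr ?X" unfolding rtr_dg by (rule sum_idx[symmetric])
  then have "(\<Sum>i<CARD('m). x i) * hpoly CARD('m) k (jcoef TYPE('m) k la) x = acoef TYPE('m) k la * (rtr ?X * phi la ?X)"
   by (simp add: jcoef_phi[OF la])
  also have "... = (\<Sum>l\<in>?P. acoef TYPE('m) k la * (b l * phi l ?X))" by (simp only: b(1)[OF herm_simps(4)] sum_distrib_left)
  also have "... = (\<Sum>l\<in>?P. b' l * hpoly CARD('m) (Suc k) (jcoef TYPE('m) (Suc k) l) x)"
  proof (intro sum.cong refl)
   fix l assume l: "l \<in> ?P"
   show "acoef TYPE('m) k la * (b l * phi l ?X) = b' l * hpoly CARD('m) (Suc k) (jcoef TYPE('m) (Suc k) l) x"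
    using acoef_pos[OF l] by (simp add: jcoef_phi[OF l] b'_def)
  qed
  finally show ?thesis .
 qed
 moreover have "\<exists>i<CARD('m). l = incr i la" if "l \<in> ?P" "b' l ~= 0" for l
  using b(2)[OF that(1)] that(2) by (auto simp: b'_def)
 ultimately show ?thesis by blast
qed

lemma eop_cong: "(!!e. e \<in> expos m k ==> c e = d e) ==> eop m k c x = eop m k d x"
 unfolding eop_def by (intro sum.cong refl) simp

lemma eop_sum: "eop m k (%e. \<Sum>a\<in>S. w a * c a e) x = (\<Sum>a\<in>S. w a * eop m k (c a) x)"
proof -
 have "eop m k (%e. \<Sum>a\<in>S. w a * c a e) x = (\<Sum>e\<in>expos m k. \<Sum>i<m. \<Sum>a\<in>S. w a * (c a e * (real (e i) * (x i * xmon m e x))))"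
  unfolding eop_def sum_distrib_right by (simp add: mult.assoc)
 also have "... = (\<Sum>e\<in>expos m k. \<Sum>a\<in>S. \<Sum>i<m. w a * (c a e * (real (e i) * (x i * xmon m e x))))"
  by (intro sum.cong refl sum.swap)
 also have "... = (\<Sum>a\<in>S. \<Sum>e\<in>expos m k. \<Sum>i<m. w a * (c a e * (real (e i) * (x i * xmon m e x))))"
  by (rule sum.swap)
 finally show ?thesis unfolding eop_def by (simp add: sum_distrib_left)
qed

lemma hpoly_lin: "hpoly m k (%e. \<Sum>a\<in>S. w a * c a e) x = (\<Sum>a\<in>S. w a * hpoly m k (c a) x)"
 by (simp add: hpoly_sum hpoly_cmult)

lemma jack_op_lin: "jack_op \<beta> m (hpoly m k (%e. \<Sum>a\<in>S. w a * c a e)) x = (\<Sum>a\<in>S. w a * jack_op \<beta> m (hpoly m k (c a)) x)"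
proof -
 have "jack_op \<beta> m (hpoly m k (%e. \<Sum>a\<in>S. w a * c a e)) x = (\<Sum>e\<in>expos m k. \<Sum>a\<in>S. w a * (c a e * xmon m e x * jw \<beta> m x e))"
  unfolding jack_op_hpoly sum_distrib_right by (simp add: mult.assoc)
 also have "... = (\<Sum>a\<in>S. \<Sum>e\<in>expos m k. w a * (c a e * xmon m e x * jw \<beta> m x e))" by (rule sum.swap)
 finally show ?thesis by (simp add: jack_op_hpoly sum_distrib_left)
qed

lemma jack_op_cong: "(!!e. e \<in> expos m k ==> c e = d e) ==> jack_op \<beta> m (hpoly m k c) x = jack_op \<beta> m (hpoly m k d) x"
 unfolding jack_op_hpoly by (intro sum.cong refl) simp

text \<open>Comparing \<open>p\<^sub>1 C\<^sub>\<kappa>\<close> with its image under the differential operator gives the action of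
 \<open>\<Sum>x\<^sub>i\<^sup>2 \<partial>\<^sub>i + a p\<^sub>1\<close>, which raises the generalized Pochhammer symbol by one factor.\<close>

lemma raising:
 assumes la: "la \<in> parts CARD('m::finite) k"
  and b: "!!x. (\<Sum>i<CARD('m). x i) * hpoly CARD('m) k (jcoef TYPE('m) k la) x =
   (\<Sum>l\<in>parts CARD('m) (Suc k). b l * hpoly CARD('m) (Suc k) (jcoef TYPE('m) (Suc k) l) x)"
  and b0: "!!l. l \<in> parts CARD('m) (Suc k) ==> b l ~= 0 ==> \<exists>i<CARD('m). l = incr i la"
  and x: "inj_on x {..<CARD('m)}"
 shows "rpoch CARD('m) a la * (eop CARD('m) k (jcoef TYPE('m) k la) x + a * (\<Sum>i<CARD('m). x i) * hpoly CARD('m) k (jcoef TYPE('m) k la) x) =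
  (\<Sum>l\<in>parts CARD('m) (Suc k). b l * (rpoch CARD('m) a l * hpoly CARD('m) (Suc k) (jcoef TYPE('m) (Suc k) l) x))"
proof -
 let ?m = "CARD('m)" and ?P = "parts CARD('m) (Suc k)"
 let ?c = "jcoef TYPE('m) k la" and ?d = "jcoef TYPE('m) (Suc k)"
 let ?p = "\<Sum>i<?m. x i"
 let ?h = "hpoly ?m k ?c x" and ?H = "%l. hpoly ?m (Suc k) (?d l) x" and ?e = "eop ?m k ?c x"
 let ?r = "%l. rho \<beta> ?m l - rho \<beta> ?m la - real \<beta> * (real ?m - 1) + 2 * a"
 have coef: "raisec ?m ?c e = (\<Sum>l\<in>?P. b l * ?d l e)" if "e \<in> expos ?m (Suc k)" for e
  by (rule hpoly_unique[OF _ that]) (simp add: hpoly_raisec hpoly_lin b)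
 have "jack_op \<beta> ?m (hpoly ?m (Suc k) (raisec ?m ?c)) x = jack_op \<beta> ?m (hpoly ?m (Suc k) (%e. \<Sum>l\<in>?P. b l * ?d l e)) x"
  by (rule jack_op_cong[OF coef])
 also have "... = (\<Sum>l\<in>?P. b l * (rho \<beta> ?m l * ?H l))"
  unfolding jack_op_lin by (intro sum.cong refl) (simp add: jack_family_eigen[OF jcoef_family _ x])
 finally have "?p * (rho \<beta> ?m la * ?h) + 2 * ?e + real \<beta> * (real ?m - 1) * ?p * ?h =
  (\<Sum>l\<in>?P. b l * (rho \<beta> ?m l * ?H l))" unfolding jack_op_raisec[OF x] jack_family_eigen[OF jcoef_family la x] .
 then have "2 * (?e + a * ?p * ?h) =
  (\<Sum>l\<in>?P. b l * (rho \<beta> ?m l * ?H l)) +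
  (2 * a - rho \<beta> ?m la - real \<beta> * (real ?m - 1)) * (?p * ?h)" by (simp add: algebra_simps)
 also have "... = (\<Sum>l\<in>?P. b l * (?r l * ?H l))"
  unfolding b by (simp add: sum_distrib_left sum.distrib[symmetric] algebra_simps)
 finally have "rpoch ?m a la * (2 * (?e + a * ?p * ?h)) =
  rpoch ?m a la * (\<Sum>l\<in>?P. b l * (?r l * ?H l))" by simp
 also have "... = (\<Sum>l\<in>?P. 2 * (b l * (rpoch ?m a l * ?H l)))" unfolding sum_distrib_left
 proof (intro sum.cong refl)
  fix l assume l: "l \<in> ?P"
  show "rpoch ?m a la * (b l * (?r l * ?H l)) =
   2 * (b l * (rpoch ?m a l * ?H l))"
  proof (cases "b l = 0")
   case False
   then obtain i where i: "i < ?m" "l = incr i la" using b0[OF l] by blast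
   have "?r l = 2 * (a - real i / 2 * real \<beta> + real (la i))"
    unfolding i(2) rho_incr[OF i(1)] by (simp add: algebra_simps)
   then show ?thesis unfolding i(2) rpoch_incr[OF i(1)] by simp
  qed simp
 qed
 finally have "2 * (rpoch ?m a la * (?e + a * ?p * ?h)) =
  2 * (\<Sum>l\<in>?P. b l * (rpoch ?m a l * ?H l))"
  by (simp only: mult.left_commute[of _ 2] sum_distrib_left[symmetric])
 moreover have "2 * u = 2 * v ==> u = v" for u v :: real by simp
 ultimately show ?thesis by blast
qed

text \<open>Induction on k: by \<open>raising\<close> the left side obeys the recurrence
  \<open>hbin_recurrence\<close>, because the Pieri coefficients leading to a fixed partition sum to
  one.\<close>

theorem binomial_coefficients:
 assumes "e \<in> expos CARD('m::finite) k"
 shows "(\<Sum>la\<in>parts CARD('m) k. rpoch CARD('m) a la / fact k * jcoef TYPE('m) k la e) = hbin CARD('m) a e"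
 using assms
proof (induction k arbitrary: e)
 case 0
 have p: "parts CARD('m) 0 = {%_. 0}" by (auto simp: parts_def antimono_def)
 have "(\<Sum>la\<in>parts CARD('m) 0. hpoly CARD('m) 0 (jcoef TYPE('m) 0 la) (%_. 0)) = 1"
  using jack_familyD(2)[OF jcoef_family[where 'm='m and k=0], of "%_. 0"] by simp
 then have "jcoef TYPE('m) 0 (%_. 0) (%_. 0) = 1" by (simp add: p hpoly_xmon xmon_def)
 then show ?case using 0 by (simp add: p rpoch_def hbin_def)
next
 case (Suc k)
 let ?m = "CARD('m)" and ?P = "parts CARD('m) k" and ?Q = "parts CARD('m) (Suc k)"
 let ?c = "jcoef TYPE('m) k" and ?d = "jcoef TYPE('m) (Suc k)"
 have "\<forall>la\<in>?P. \<exists>b. (\<forall>x. (\<Sum>i<?m. x i) * hpoly ?m k (?c la) x = (\<Sum>l\<in>?Q. b l * hpoly ?m (Suc k) (?d l) x)) \<and>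
  (\<forall>l\<in>?Q. b l ~= 0 --> (\<exists>i<?m. l = incr i la))" using pieri_jcoef by blast
 from bchoice[OF this] obtain b where
  "\<forall>la\<in>?P. (\<forall>x. (\<Sum>i<?m. x i) * hpoly ?m k (?c la) x = (\<Sum>l\<in>?Q. b la l * hpoly ?m (Suc k) (?d l) x)) \<and>
  (\<forall>l\<in>?Q. b la l ~= 0 --> (\<exists>i<?m. l = incr i la))" ..
 then have b: "(\<Sum>i<?m. x i) * hpoly ?m k (?c la) x = (\<Sum>l\<in>?Q. b la l * hpoly ?m (Suc k) (?d l) x)"
  and b0: "l \<in> ?Q ==> b la l ~= 0 ==> \<exists>i<?m. l = incr i la" if "la \<in> ?P" for la x l using that by blast+
 \<comment> \<open>Multiply the expansion of p_1^k into Jack polynomials by p_1 and compare with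
   that of p_1^(k+1).\<close>
 have one: "(\<Sum>la\<in>?P. b la l) = 1" if l: "l \<in> ?Q" for l
 proof -
  have "(\<Sum>l\<in>?Q. ((\<Sum>la\<in>?P. b la l) - 1) * ?d l e) = 0" if e: "e \<in> expos ?m (Suc k)" for e
  proof -
   have "hpoly ?m (Suc k) (%e. \<Sum>l\<in>?Q. ((\<Sum>la\<in>?P. b la l) - 1) * ?d l e) x = hpoly ?m (Suc k) (%_. 0) x" for x
   proof -
    have "(\<Sum>l\<in>?Q. (\<Sum>la\<in>?P. b la l) * hpoly ?m (Suc k) (?d l) x) = (\<Sum>l\<in>?Q. \<Sum>la\<in>?P. b la l * hpoly ?m (Suc k) (?d l) x)"
     by (simp only: sum_distrib_right)
    also have "... = (\<Sum>la\<in>?P. \<Sum>l\<in>?Q. b la l * hpoly ?m (Suc k) (?d l) x)" by (rule sum.swap)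
    also have "... = (\<Sum>la\<in>?P. (\<Sum>i<?m. x i) * hpoly ?m k (?c la) x)" by (intro sum.cong refl b[symmetric])
    also have "... = (\<Sum>l\<in>?Q. hpoly ?m (Suc k) (?d l) x)"
     by (simp add: jack_familyD(2)[OF jcoef_family] flip: sum_distrib_left)
    finally show ?thesis
     unfolding hpoly_lin unfolding left_diff_distrib sum_subtractf by (simp add: hpoly_def[of _ _ "%_. 0"])
   qed
   then show ?thesis by (rule hpoly_unique[OF _ e])
  qed
  from trig_independent[OF jack_familyD(1)[OF jcoef_family] this l] show ?thesis by simp
 qed
 have eq: "real (Suc k) * hpoly ?m (Suc k) (%e. \<Sum>l\<in>?Q. rpoch ?m a l / fact (Suc k) * ?d l e) x =
   real (Suc k) * hpoly ?m (Suc k) (hbin ?m a) x" if x: "inj_on x {..<?m}" for x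
 proof -
  have "eop ?m k (hbin ?m a) x + a * (\<Sum>i<?m. x i) * hpoly ?m k (hbin ?m a) x =
   eop ?m k (%e. \<Sum>la\<in>?P. rpoch ?m a la / fact k * ?c la e) x +
   a * (\<Sum>i<?m. x i) * hpoly ?m k (%e. \<Sum>la\<in>?P. rpoch ?m a la / fact k * ?c la e) x"
   by (intro arg_cong2[of _ _ _ _ "(+)"] arg_cong2[of _ _ _ _ "(*)"] refl eop_cong hpoly_cong Suc.IH[symmetric])
  also have "... = (\<Sum>la\<in>?P. (rpoch ?m a la * (eop ?m k (?c la) x + a * (\<Sum>i<?m. x i) * hpoly ?m k (?c la) x)) / fact k)"
   unfolding eop_sum hpoly_lin by (simp add: sum_distrib_left sum.distrib[symmetric] algebra_simps add_divide_distrib)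
  also have "... = (\<Sum>la\<in>?P. (\<Sum>l\<in>?Q. b la l * (rpoch ?m a l * hpoly ?m (Suc k) (?d l) x)) / fact k)"
   by (intro sum.cong refl arg_cong2[of _ _ _ _ "(/)"] raising b b0 x)
  also have "... = (\<Sum>la\<in>?P. \<Sum>l\<in>?Q. b la l * (rpoch ?m a l * hpoly ?m (Suc k) (?d l) x / fact k))"
   by (simp add: sum_divide_distrib)
  also have "... = (\<Sum>l\<in>?Q. \<Sum>la\<in>?P. b la l * (rpoch ?m a l * hpoly ?m (Suc k) (?d l) x / fact k))"
   by (rule sum.swap)
  also have "... = (\<Sum>l\<in>?Q. rpoch ?m a l * hpoly ?m (Suc k) (?d l) x / fact k)"
   unfolding sum_distrib_right[symmetric] by (intro sum.cong refl) (simp add: one)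
  also have "... = real (Suc k) * hpoly ?m (Suc k) (%e. \<Sum>l\<in>?Q. rpoch ?m a l / fact (Suc k) * ?d l e) x"
   unfolding hpoly_lin sum_distrib_left by (intro sum.cong refl) (simp add: field_simps del: of_nat_Suc)
  finally show ?thesis by (simp only: hbin_recurrence)
 qed
 have "(\<Sum>l\<in>?Q. rpoch ?m a l / fact (Suc k) * ?d l e) - hbin ?m a e = 0"
 proof (rule hpoly_zeroD[OF _ Suc.prems])
  fix t :: real assume "1 < t"
  then have "inj_on (kron (Suc (Suc k)) ?m t) {..<?m}" by (intro kron_inj) auto
  from eq[OF this] show "hpoly ?m (Suc k) (%e. (\<Sum>l\<in>?Q. rpoch ?m a l / fact (Suc k) * ?d l e) - hbin ?m a e) (kron (Suc (Suc k)) ?m t) = 0"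
   by (simp add: hpoly_diff)
 qed
 then show ?case by simp
qed

end

section \<open>Generating functions\<close>

text \<open>The coefficient of t^k in the product of the (1 - tx)^(-a) over the list.\<close>

definition hsum :: "real => nat => real list => real"
 where "hsum a k xs = hpoly (length xs) k (hbin (length xs) a) (%i. xs ! i)"

lemma hbin_Suc: "hbin (Suc n) a e = hbin n a e * (pochhammer a (e n) / fact (e n))" by (simp add: hbin_def)

lemma xmon_Suc: "xmon (Suc n) e x = xmon n e x * x n ^ e n" by (simp add: xmon_def)

lemma hpoly_hbin_Suc:
 "hpoly (Suc n) k (hbin (Suc n) a) x = (\<Sum>j\<le>k. hpoly n j (hbin n a) x * (pochhammer a (k - j) / fact (k - j) * x n ^ (k - j)))"
proof -
 have "(\<Sum>j\<le>k. hpoly n j (hbin n a) x * (pochhammer a (k - j) / fact (k - j) * x n ^ (k - j))) =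
  (\<Sum>p\<in>Sigma {..k} (%j. expos n j). hbin n a (snd p) * xmon n (snd p) x * (pochhammer a (k - fst p) / fact (k - fst p) * x n ^ (k - fst p)))"
  unfolding hpoly_xmon sum_distrib_right by (subst sum.Sigma) (simp_all add: case_prod_unfold)
 also have "... = (\<Sum>e\<in>expos (Suc n) k. hbin (Suc n) a e * xmon (Suc n) e x)"
 proof (rule sum.reindex_bij_witness[of _ "%e. (k - e n, e(n := 0))" "%p. (snd p)(n := k - fst p)"])
  fix p assume "p \<in> Sigma {..k} (%j. expos n j)"
  then have p: "fst p <= k" "snd p \<in> expos n (fst p)" by auto
  then have z: "snd p n = 0" by (simp add: expos_def)
  show "(k - ((snd p)(n := k - fst p)) n, ((snd p)(n := k - fst p))(n := 0)) = p"
   using p z by (auto simp: prod_eq_iff fun_eq_iff)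
  show "(snd p)(n := k - fst p) \<in> expos (Suc n) k" using p by (auto simp: expos_def)
  have "hbin n a ((snd p)(n := k - fst p)) = hbin n a (snd p)" unfolding hbin_def by (intro prod.cong) auto
  moreover have "xmon n ((snd p)(n := k - fst p)) x = xmon n (snd p) x" unfolding xmon_def by (intro prod.cong) auto
  ultimately show "hbin (Suc n) a ((snd p)(n := k - fst p)) * xmon (Suc n) ((snd p)(n := k - fst p)) x =
   hbin n a (snd p) * xmon n (snd p) x * (pochhammer a (k - fst p) / fact (k - fst p) * x n ^ (k - fst p))"
   unfolding hbin_Suc xmon_Suc by simp
 next
  fix e assume e: "e \<in> expos (Suc n) k"
  then have le: "e n <= k" by (rule expos_le)
  then show "(snd (k - e n, e(n := 0)))(n := k - fst (k - e n, e(n := 0))) = e" by (simp add: fun_eq_iff)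
  have "(\<Sum>i<n. e i) = k - e n" using e by (auto simp: expos_def)
  then show "(k - e n, e(n := 0)) \<in> Sigma {..k} (%j. expos n j)"
  proof -
   have "e i = 0" if "n <= i" "i ~= n" for i using e that by (simp add: expos_def)
   then show ?thesis using \<open>(\<Sum>i<n. e i) = k - e n\<close> by (simp add: expos_def)
  qed
 qed
 finally show ?thesis by (simp add: hpoly_xmon)
qed

definition gfps :: "real => real => real fps"
 where "gfps a x = Abs_fps (%n. pochhammer a n / fact n * x ^ n)"

lemma gfps_nth: "fps_nth (gfps a x) n = pochhammer a n / fact n * x ^ n" by (simp add: gfps_def)

lemma gfps_hsum: "fps_nth (\<Prod>x\<leftarrow>xs. gfps a x) k = hsum a k xs"
proof (induction xs arbitrary: k rule: rev_induct)
 case Nil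
 have "expos 0 k = (if k = 0 then {%_. 0} else {})" by (auto simp: expos_def)
 then show ?case by (simp add: hsum_def hpoly_def hbin_def)
next
 case (snoc x xs)
 have h: "hpoly (length xs) j c (%i. (xs @ [x]) ! i) = hpoly (length xs) j c (%i. xs ! i)" for j c
  unfolding hpoly_def by (intro sum.cong refl arg_cong2[of _ _ _ _ "(*)"] prod.cong) (auto simp: nth_append)
 have "fps_nth (\<Prod>x\<leftarrow>xs @ [x]. gfps a x) k = (\<Sum>j\<le>k. hsum a j xs * (pochhammer a (k - j) / fact (k - j) * x ^ (k - j)))"
  by (simp add: fps_mult_nth snoc gfps_nth atMost_atLeast0)
 also have "... = hsum a k (xs @ [x])" by (simp add: hsum_def hpoly_hbin_Suc h)
 finally show ?case .
qed

lemma esym_fps: "fps_nth (\<Prod>x\<leftarrow>xs. 1 - fps_const x * fps_X) j = (-1) ^ j * esym j xs"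
proof (induction xs arbitrary: j)
 case Nil
 then show ?case by simp
next
 case (Cons x xs)
 show ?case by (cases j) (simp_all add: Cons left_diff_distrib mult.assoc, simp_all add: algebra_simps)
qed

lemma gfps_step: "(1 - fps_const x * fps_X) * gfps (a + 1) x = gfps a x"
proof (rule fps_ext)
 fix n
 show "fps_nth ((1 - fps_const x * fps_X) * gfps (a + 1) x) n = fps_nth (gfps a x) n"
 proof (cases n)
  case 0
  then show ?thesis by (simp add: gfps_nth)
 next
  case (Suc l)
  have "pochhammer (a + 1) (Suc l) / fact (Suc l) - pochhammer (a + 1) l / fact l = pochhammer a (Suc l) / fact (Suc l)"
  proof -
   have "pochhammer (a + 1) l / fact l = pochhammer (a + 1) l * real (Suc l) / fact (Suc l)"
    by (simp del: of_nat_Suc)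
   then show ?thesis unfolding pochhammer_Suc[of "a + 1"] pochhammer_rec[of a]
    by (simp add: diff_divide_distrib[symmetric] algebra_simps del: fact_Suc)
  qed
  then have "(pochhammer (a + 1) (Suc l) / fact (Suc l) - pochhammer (a + 1) l / fact l) * x ^ Suc l = pochhammer a (Suc l) / fact (Suc l) * x ^ Suc l"
   by simp
  then show ?thesis
   unfolding Suc by (simp add: gfps_nth left_diff_distrib mult.assoc algebra_simps del: fact_Suc)
 qed
qed

text \<open>Multiplying the series for a + 1 by the product of the 1 - tx gives the series for a;
  compare coefficients.\<close>

lemma hsum_recurrence: "(\<Sum>j\<le>k. (-1) ^ j * esym j xs * hsum (a + 1) (k - j) xs) = hsum a k xs"
proof -
 have "(\<Prod>x\<leftarrow>xs. 1 - fps_const x * fps_X) * (\<Prod>x\<leftarrow>xs. gfps (a + 1) x) = (\<Prod>x\<leftarrow>xs. gfps a x)"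
 proof (induction xs)
  case (Cons x xs)
  have "(\<Prod>x\<leftarrow>x # xs. 1 - fps_const x * fps_X) * (\<Prod>x\<leftarrow>x # xs. gfps (a + 1) x) =
   ((1 - fps_const x * fps_X) * gfps (a + 1) x) * ((\<Prod>x\<leftarrow>xs. 1 - fps_const x * fps_X) * (\<Prod>x\<leftarrow>xs. gfps (a + 1) x))"
   by (simp only: list.map prod_list.Cons mult_ac)
  then show ?case unfolding gfps_step Cons by simp
 qed simp
 then have "fps_nth ((\<Prod>x\<leftarrow>xs. 1 - fps_const x * fps_X) * (\<Prod>x\<leftarrow>xs. gfps (a + 1) x)) k = fps_nth (\<Prod>x\<leftarrow>xs. gfps a x) k"
  by simp
 then show ?thesis by (simp add: fps_mult_nth gfps_hsum esym_fps atMost_atLeast0)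
qed

lemma hsum_0: "hsum 0 k xs = (if k = 0 then 1 else 0)"
proof -
 have "(\<Prod>x\<leftarrow>xs. gfps 0 x) = 1"
 proof (induction xs)
  case (Cons x xs)
  have "gfps 0 x = 1" by (rule fps_ext) (simp add: gfps_nth pochhammer_0_left)
  then show ?case using Cons by simp
 qed simp
 then show ?thesis using gfps_hsum[of 0 xs k] by simp
qed

section \<open>Convergence\<close>

text \<open>Factors from \<open>J\<close> on cost at most \<open>E\<close> each; the finitely many
  earlier ones, raised to at least 1, go into the constant.\<close>

lemma prod_growth:
 fixes q :: "nat => real"
 assumes q: "!!j. 0 <= q j" and E: "1 <= E" and ev: "!!j. J <= j ==> q j <= E"
 obtains K where "0 < K" "!!l. (\<Prod>j<l. q j) <= K * E ^ l"
proof
 define u where "u j = (if j < J then max 1 (q j) else 1)" for j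
 have u1: "1 <= u j" for j by (simp add: u_def)
 show "0 < (\<Prod>j<J. u j)" using u1 by (intro prod_pos) (auto intro: less_le_trans[OF zero_less_one])
 fix l
 have "(\<Prod>j<l. q j) <= (\<Prod>j<l. u j * E)"
 proof (intro prod_mono conjI q)
  fix j show "q j <= u j * E"
  proof (cases "j < J")
   case True
   have "q j * 1 <= max 1 (q j) * E" using q[of j] E by (intro mult_mono) auto
   then show ?thesis using True by (simp add: u_def)
  next
   case False
   then show ?thesis using ev[of j] by (simp add: u_def)
  qed
 qed
 also have "... = (\<Prod>j<l. u j) * E ^ l" by (simp add: prod.distrib)
 also have "... <= (\<Prod>j<J. u j) * E ^ l"
 proof (intro mult_right_mono)
  have "(\<Prod>j<l. u j) <= (\<Prod>j<max l J. u j)"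
   using u1 by (intro prod_mono2) (auto intro: order_trans[OF zero_le_one])
  also have "... = (\<Prod>j<J. u j)" by (intro prod.mono_neutral_right) (auto simp: u_def)
  finally show "(\<Prod>j<l. u j) <= (\<Prod>j<J. u j)" .
 qed (use E in simp)
 finally show "(\<Prod>j<l. q j) <= (\<Prod>j<J. u j) * E ^ l" .
qed

lemma norm_pochhammer: "norm (pochhammer c l) = (\<Prod>j<l. norm (c + of_nat j))" for c :: complex
 by (simp add: pochhammer_prod prod_norm atLeast0LessThan)

lemma pochhammer_ratio_bound:
 fixes c d :: complex
 assumes E: "1 < E"
 obtains K where "0 < K" "!!l. norm (pochhammer c l / pochhammer d l) <= K * E ^ l"
proof -
 \<comment> \<open>The inequality norm c + j \<le> E (j - norm d) solved for j; the extra norm d + 1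
   keeps the denominators nonzero from there on.\<close>
 define J where "J = nat \<lceil>(norm c + E * norm d) / (E - 1) + norm d + 1\<rceil>"
 have "norm (c + of_nat j) / norm (d + of_nat j) <= E" if "J <= j" for j
 proof -
  have j: "(norm c + E * norm d) / (E - 1) + norm d + 1 <= real j" using that unfolding J_def by linarith
  have nn: "0 <= (norm c + E * norm d) / (E - 1)" using E by simp
  have "(norm c + E * norm d) / (E - 1) <= real j" using j norm_ge_zero[of d] by linarith
  then have "norm c + E * norm d <= real j * (E - 1)" using E by (simp add: pos_divide_le_eq)
  then have 1: "norm c + real j <= E * (real j - norm d)" by (simp add: algebra_simps)
  have c: "norm (c + of_nat j) <= norm c + real j" using norm_triangle_ineq[of c "of_nat j"] by simp
  have d: "real j - norm d <= norm (d + of_nat j)"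
   using norm_triangle_ineq2[of "of_nat j" "- d"] by (simp add: add.commute)
  have "0 < norm (d + of_nat j)" using d j nn by linarith
  moreover have "norm (c + of_nat j) <= E * norm (d + of_nat j)"
   using c 1 mult_left_mono[OF d, of E] E by linarith
  ultimately show ?thesis by (simp add: pos_divide_le_eq)
 qed
 then obtain K where K: "0 < K" "!!l. (\<Prod>j<l. norm (c + of_nat j) / norm (d + of_nat j)) <= K * E ^ l"
  using prod_growth[of "%j. norm (c + of_nat j) / norm (d + of_nat j)" E J] E by auto
 then show thesis using that[of K] by (simp add: norm_divide norm_pochhammer prod_dividef)
qed

lemma pochhammer_inverse_bound:
 fixes d :: complex
 assumes E: "1 < E"
 obtains K where "0 < K" "!!l. norm (1 / pochhammer d l) <= K * E ^ l"
proof -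
 obtain K where K: "0 < K" "!!l. norm (pochhammer 1 l / pochhammer d l) <= K * E ^ l"
  using pochhammer_ratio_bound[OF E, of 1 d] by blast
 have "norm (1 / pochhammer d l) <= norm (pochhammer 1 l / pochhammer d l)" for l
  using fact_ge_1[of l, where 'a = real] by (simp add: norm_divide divide_right_mono flip: pochhammer_fact)
 then show thesis using that[of K] K order_trans by blast
qed

lemma gpoch_parts:
 assumes "la \<in> parts m k"
 shows "gpoch \<beta> a la = (\<Prod>i<m. pochhammer (a - of_nat i / 2 * of_nat \<beta>) (la i))" unfolding gpoch_def
 by (rule prod.mono_neutral_left) (use assms in \<open>auto simp: parts_def expos_def not_less[symmetric] intro: ccontr\<close>)

lemma gpoch_bound_aux:
 fixes f :: "nat => nat => complex"
 assumes "!!i. \<exists>K>0. \<forall>l. norm (f i l) <= K * E ^ l" and E: "0 <= E"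
 obtains K where "0 < K" "!!k la. la \<in> parts m k ==> norm (\<Prod>i<m. f i (la i)) <= K * E ^ k"
proof -
 obtain K where K: "!!i. 0 < K i" "!!i l. norm (f i l) <= K i * E ^ l" using assms(1) by metis
 show thesis
 proof
  show "0 < (\<Prod>i<m. K i)" using K(1) by (intro prod_pos) auto
  fix k la assume la: "la \<in> parts m k"
  have "norm (\<Prod>i<m. f i (la i)) <= (\<Prod>i<m. K i * E ^ la i)"
   unfolding prod_norm[symmetric] by (intro prod_mono conjI K norm_ge_zero)
  also have "... = (\<Prod>i<m. K i) * E ^ k"
   using la by (simp add: prod.distrib power_sum[symmetric] parts_def expos_def)
  finally show "norm (\<Prod>i<m. f i (la i)) <= (\<Prod>i<m. K i) * E ^ k" .
 qed
qed

lemma gpoch_ratio_bound: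
 assumes E: "1 < E"
 obtains K where "0 < K" "!!k la. la \<in> parts m k ==> norm (gpoch \<beta> a la / gpoch \<beta> b la) <= K * E ^ k"
proof -
 let ?f = "%i l. pochhammer (a - of_nat i / 2 * of_nat \<beta>) l / pochhammer (b - of_nat i / 2 * of_nat \<beta>) l"
 have "\<exists>K>0. \<forall>l. norm (?f i l) <= K * E ^ l" for i by (rule pochhammer_ratio_bound[OF E]) blast
 then obtain K where "0 < K" "!!k la. la \<in> parts m k ==> norm (\<Prod>i<m. ?f i (la i)) <= K * E ^ k"
  using gpoch_bound_aux[of ?f E m] E by auto
 then show thesis using that[of K] by (simp add: gpoch_parts prod_dividef)
qed

lemma gpoch_inverse_bound:
 assumes E: "1 < E"
 obtains K where "0 < K" "!!k la. la \<in> parts m k ==> norm (1 / gpoch \<beta> b la) <= K * E ^ k"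
proof -
 let ?f = "%i l. 1 / pochhammer (b - of_nat i / 2 * of_nat \<beta>) l"
 have "\<exists>K>0. \<forall>l. norm (?f i l) <= K * E ^ l" for i by (rule pochhammer_inverse_bound[OF E]) blast
 then obtain K where "0 < K" "!!k la. la \<in> parts m k ==> norm (\<Prod>i<m. ?f i (la i)) <= K * E ^ k"
  using gpoch_bound_aux[of ?f E m] E by auto
 then show thesis using that[of K] by (simp add: gpoch_parts prod_dividef)
qed

lemma pFq_coeff_simps:
 "pFq_coeff \<beta> (a # as) (b # bs) la = (gpoch \<beta> a la / gpoch \<beta> b la) * pFq_coeff \<beta> as bs la"
 "pFq_coeff \<beta> [] (b # bs) la = (1 / gpoch \<beta> b la) * pFq_coeff \<beta> [] bs la"
 "pFq_coeff \<beta> [] [] la = 1" "pFq_coeff \<beta> [a] [] la = gpoch \<beta> a la" by (simp_all add: pFq_coeff_def)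

text \<open>Numerator symbols are paired with denominator symbols and leftover denominators stand
  alone; each step costs a geometric factor, which the factorial k! will absorb. The base 2 is just
  some number above 1.\<close>

lemma coeff_bound_le:
 assumes "length as <= length bs"
 shows "\<exists>K D. 0 <= K \<and> 0 <= D \<and> (\<forall>k. \<forall>la\<in>parts m k. norm (pFq_coeff \<beta> as bs la) <= K * D ^ k)" using assms
proof (induction bs arbitrary: as)
 case Nil
 then show ?case by (intro exI[of _ 1]) (simp add: pFq_coeff_simps)
next
 case (Cons b bs)
 define as' where "as' = tl as"
 have "length as' <= length bs" using Cons.prems by (cases as) (auto simp: as'_def)
 from Cons.IH[OF this] obtain K D where K: "0 <= K" "0 <= D"
  "!!k la. la \<in> parts m k ==> norm (pFq_coeff \<beta> as' bs la) <= K * D ^ k" by blast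
 obtain L where L: "0 < L" "!!k la. la \<in> parts m k ==>
   norm ((if as = [] then 1 else gpoch \<beta> (hd as) la) / gpoch \<beta> b la) <= L * 2 ^ k"
 proof (cases as)
  case Nil
  show ?thesis by (rule gpoch_inverse_bound[of 2 m \<beta> b]) (use that Nil in auto)
 next
  case (Cons a as'')
  show ?thesis by (rule gpoch_ratio_bound[of 2 m \<beta> a b]) (use that Cons in auto)
 qed
 have "norm (pFq_coeff \<beta> as (b # bs) la) <= (L * K) * (2 * D) ^ k" if la: "la \<in> parts m k" for k la
 proof -
  have "pFq_coeff \<beta> as (b # bs) la = ((if as = [] then 1 else gpoch \<beta> (hd as) la) / gpoch \<beta> b la) * pFq_coeff \<beta> as' bs la"
   by (cases as) (simp_all add: pFq_coeff_simps as'_def)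
  then have "norm (pFq_coeff \<beta> as (b # bs) la) <= (L * 2 ^ k) * (K * D ^ k)"
   using L K la by (simp only: norm_mult) (intro mult_mono; simp)
  then show ?thesis by (simp add: power_mult_distrib mult_ac)
 qed
 then show ?case using L K by (intro exI[of _ "L * K"] exI[of _ "2 * D"]) auto
qed

context fld
begin

text \<open>The slack m\<beta> covers the shift i\<beta>/2 twice: once for the triangle inequality
  and once because \<open>rpoch\<close> subtracts it again.\<close>

lemma gpoch_rpoch_bound:
 assumes N: "norm a + real (m * \<beta>) <= N" and la: "la \<in> parts m k"
 shows "norm (gpoch \<beta> a la) <= rpoch m N la" unfolding gpoch_parts[OF la] prod_norm[symmetric] rpoch_def
proof (intro prod_mono conjI norm_ge_zero)
 fix i assume "i \<in> {..<m}"
 then have i: "real i * real \<beta> <= real m * real \<beta>" by (intro mult_right_mono) auto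
 have p: "pochhammer x l = (\<Prod>j<l. x + real j)" for x :: real and l by (simp add: pochhammer_prod atLeast0LessThan)
 show "norm (pochhammer (a - of_nat i / 2 * of_nat \<beta>) (la i)) <= pochhammer (N - real i / 2 * real \<beta>) (la i)"
  unfolding norm_pochhammer p
 proof (intro prod_mono conjI norm_ge_zero)
  fix j
  have "norm (a - of_nat i / 2 * of_nat \<beta> + of_nat j) <= norm a + norm (of_nat i / 2 * of_nat \<beta> :: complex) + norm (of_nat j :: complex)"
   using norm_triangle_ineq[of "a - of_nat i / 2 * of_nat \<beta>" "of_nat j"] norm_triangle_ineq4[of a "of_nat i / 2 * of_nat \<beta>"] by linarith
  also have "... = norm a + real i / 2 * real \<beta> + real j" by (simp add: norm_mult norm_divide)
  also have "... <= N - real i / 2 * real \<beta> + real j" using N i by simp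
  finally show "norm (a - of_nat i / 2 * of_nat \<beta> + of_nat j) <= N - real i / 2 * real \<beta> + real j" .
 qed
qed

text \<open>The pairs cost powers of an \<open>E\<close> that may be taken close to 1; the one
  unpaired numerator is dominated by a real symbol, whose series is the binomial one.\<close>

lemma coeff_bound_eq:
 assumes "length as = length bs + 1" "1 < E"
 shows "\<exists>K N. 0 <= K \<and> 0 <= N \<and> (\<forall>k. \<forall>la\<in>parts m k. norm (pFq_coeff \<beta> as bs la) <= K * (E ^ length bs) ^ k * rpoch m N la)"
 using assms(1)
proof (induction bs arbitrary: as)
 case Nil
 then obtain a where a: "as = [a]" by (cases as) auto
 show ?case
  by (intro exI[of _ 1] exI[of _ "norm a + real (m * \<beta>)"]) (auto simp: a pFq_coeff_simps intro: gpoch_rpoch_bound)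
next
 case (Cons b bs)
 then obtain a as' where as: "as = a # as'" "length as' = length bs + 1" by (cases as) auto
 from Cons.IH[OF as(2)] obtain K N where K: "0 <= K" "0 <= N"
  "!!k la. la \<in> parts m k ==> norm (pFq_coeff \<beta> as' bs la) <= K * (E ^ length bs) ^ k * rpoch m N la" by blast
 obtain L where L: "0 < L" "!!k la. la \<in> parts m k ==> norm (gpoch \<beta> a la / gpoch \<beta> b la) <= L * E ^ k"
  using gpoch_ratio_bound[OF assms(2)] by blast
 have "norm (pFq_coeff \<beta> as (b # bs) la) <= (L * K) * (E ^ length (b # bs)) ^ k * rpoch m N la" if la: "la \<in> parts m k" for k la
 proof -
  have "norm (pFq_coeff \<beta> as (b # bs) la) <= (L * E ^ k) * (K * (E ^ length bs) ^ k * rpoch m N la)"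
   unfolding as(1) pFq_coeff_simps norm_mult using L K(3) la assms(2) by (intro mult_mono) auto
  then show ?thesis by (simp add: power_mult_distrib mult_ac)
 qed
 then show ?case using L K by (intro exI[of _ "L * K"] exI[of _ N]) auto
qed

lemma acoef_sum: "(\<Sum>la\<in>parts CARD('m::finite) k. acoef TYPE('m) k la) = real CARD('m) ^ k"
proof -
 have "rtr (mat 1 :: quat^'m^'m) = real CARD('m)" by (simp add: rtr_def mat_def)
 then show ?thesis using rtr_power_acoef[OF herm_simps(5), where 'm='m and k=k] by (simp add: phi_one)
qed

lemma binomial_sum:
 "(\<Sum>la\<in>parts CARD('m::finite) k. rpoch CARD('m) a la / fact k * hpoly CARD('m) k (jcoef TYPE('m) k la) x) =
  hpoly CARD('m) k (hbin CARD('m) a) x"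
 unfolding hpoly_lin[symmetric] by (rule hpoly_cong[OF binomial_coefficients])

lemma rpoch_acoef_sum:
 "(\<Sum>la\<in>parts CARD('m::finite) k. rpoch CARD('m) a la * acoef TYPE('m) k la / fact k) = hpoly CARD('m) k (hbin CARD('m) a) (%_. 1)"
proof -
 have "(\<Sum>la\<in>parts CARD('m) k. rpoch CARD('m) a la * acoef TYPE('m) k la / fact k) =
  (\<Sum>la\<in>parts CARD('m) k. rpoch CARD('m) a la / fact k * hpoly CARD('m) k (jcoef TYPE('m) k la) (%_. 1))"
  by (intro sum.cong refl) (simp add: jcoef_phi dg_one phi_one)
 then show ?thesis by (simp only: binomial_sum)
qed

text \<open>At the point (1, ..., 1) the recurrence reduces to (k + 1) h_(k+1) = (k + am) h_k, so
  the ratios of consecutive terms tend to s.\<close>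

lemma hbin_one_summable:
 assumes a: "0 <= a" and s: "0 <= s" "s < 1"
 shows "summable (%k. hpoly m k (hbin m a) (%_. 1) * s ^ k)"
proof -
 define h where "h k = hpoly m k (hbin m a) (%_. 1)" for k
 have h0: "0 <= h k" for k
  unfolding h_def hpoly_def hbin_def using a by (intro sum_nonneg mult_nonneg_nonneg prod_nonneg) (auto simp: pochhammer_prod prod_nonneg)
 have rec: "real (Suc k) * h (Suc k) = (real k + a * real m) * h k" for k
 proof -
  have "eop m k (hbin m a) (%_. 1) = (\<Sum>e\<in>expos m k. (\<Sum>i<m. real (e i)) * (hbin m a e * xmon m e (%_. 1)))"
   unfolding eop_def sum_distrib_right by (intro sum.cong refl) simp
  also have "... = (\<Sum>e\<in>expos m k. real k * (hbin m a e * xmon m e (%_. 1)))"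
   by (intro sum.cong refl) (simp add: expos_def flip: of_nat_sum)
  finally have "eop m k (hbin m a) (%_. 1) = real k * h k" by (simp add: h_def hpoly_xmon sum_distrib_left)
  then show ?thesis using hbin_recurrence[of k m a "%_. 1"] by (simp add: h_def algebra_simps)
 qed
 define c where "c = (1 + s) / 2"
 have c: "s < c" "c < 1" using s by (simp_all add: c_def)
 define N where "N = nat \<lceil>a * real m * s / (c - s)\<rceil>"
 show ?thesis unfolding h_def[symmetric]
 proof (rule summable_ratio_test[OF c(2)])
  fix n assume "N <= n"
  then have "a * real m * s / (c - s) <= real n" unfolding N_def by linarith
  then have "a * real m * s <= real n * (c - s)" using c by (simp add: pos_divide_le_eq)
  then have "(real n + a * real m) * s <= c * real (Suc n)" using c s by (simp add: algebra_simps)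
  then have "(real n + a * real m) * s * (h n * s ^ n) <= c * real (Suc n) * (h n * s ^ n)"
   using h0 s by (intro mult_right_mono) auto
  moreover have "real (Suc n) * (h (Suc n) * s ^ Suc n) = (real n + a * real m) * s * (h n * s ^ n)"
  proof -
   have "real (Suc n) * (h (Suc n) * s ^ Suc n) = (real (Suc n) * h (Suc n)) * s ^ Suc n" by (simp only: mult.assoc)
   then show ?thesis unfolding rec power_Suc by (simp only: mult_ac)
  qed
  ultimately have "real (Suc n) * (h (Suc n) * s ^ Suc n) <= real (Suc n) * (c * (h n * s ^ n))"
   by (simp only: mult_ac)
  then have "h (Suc n) * s ^ Suc n <= c * (h n * s ^ n)" by (simp only: mult_le_cancel_left_pos[OF of_nat_0_less_iff[THEN iffD2, OF zero_less_Suc]])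
  then show "norm (h (Suc n) * s ^ Suc n) <= c * norm (h n * s ^ n)" using h0 s by simp
 qed
qed

definition majorant :: "'m::finite itself => complex list => complex list => real => nat => real"
 where "majorant T as bs r k = (\<Sum>la\<in>parts CARD('m) k. norm (pFq_coeff \<beta> as bs la) * (acoef T k la * r ^ k / fact k))"

lemma majorant_nonneg: "0 <= r ==> 0 <= majorant TYPE('m::finite) as bs r k"
 unfolding majorant_def using acoef_pos[where 'm='m] by (intro sum_nonneg mult_nonneg_nonneg divide_nonneg_nonneg) (auto intro: less_imp_le)

lemma majorant_summable:
 assumes r: "0 <= r" and c: "length as <= length bs \<or> length as = length bs + 1 \<and> r < 1"
 shows "summable (majorant TYPE('m::finite) as bs r)" using c
proof
 assume "length as <= length bs"
 then obtain K D where K: "0 <= K" "0 <= D"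
  "!!k la. la \<in> parts CARD('m) k ==> norm (pFq_coeff \<beta> as bs la) <= K * D ^ k"
  using coeff_bound_le[of as bs "CARD('m)" \<beta>] by blast
 show ?thesis
 proof (rule summable_comparison_test')
  show "summable (%k. K * (inverse (fact k) * (D * real CARD('m) * r) ^ k))"
   by (intro summable_mult summable_exp)
  fix k :: nat
  have "majorant TYPE('m) as bs r k <= (\<Sum>la\<in>parts CARD('m) k. K * D ^ k * (acoef TYPE('m) k la * r ^ k / fact k))"
   unfolding majorant_def using r acoef_pos[where 'm='m and k=k]
   by (intro sum_mono mult_right_mono K) (auto simp: less_imp_le)
  also have "... = K * D ^ k * (real CARD('m) ^ k * r ^ k / fact k)"
   unfolding acoef_sum[symmetric] by (simp add: sum_distrib_left sum_distrib_right sum_divide_distrib)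
  also have "... = K * (inverse (fact k) * (D * real CARD('m) * r) ^ k)"
   by (simp add: power_mult_distrib divide_inverse mult_ac)
  finally show "norm (majorant TYPE('m) as bs r k) <= K * (inverse (fact k) * (D * real CARD('m) * r) ^ k)"
   using majorant_nonneg[OF r, where 'm='m] by simp
 qed
next
 assume c: "length as = length bs + 1 \<and> r < 1"
 \<comment> \<open>The strict inequality r < 1 leaves room for some E > 1 with E^q r still below 1,
   where q is the number of denominators.\<close>
 have "((%E. E ^ length bs * r) \<longlongrightarrow> 1 ^ length bs * r) (at_right 1)" by (intro tendsto_intros)
 then have "\<forall>\<^sub>F E in at_right 1. E ^ length bs * r < 1" using c by (intro order_tendstoD(2)) auto
 then have "\<forall>\<^sub>F E in at_right 1. 1 < E \<and> E ^ length bs * r < 1"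
  using eventually_at_right_less[of 1] by eventually_elim simp
 then obtain E where E: "1 < E" "E ^ length bs * r < 1"
  using eventually_happens'[OF trivial_limit_at_right_real] by blast
 obtain K N where K: "0 <= K" "0 <= N"
  "!!k la. la \<in> parts CARD('m) k ==> norm (pFq_coeff \<beta> as bs la) <= K * (E ^ length bs) ^ k * rpoch CARD('m) N la"
  using coeff_bound_eq[OF conjunct1[OF c] E(1), of "CARD('m)"] by blast
 define s where "s = E ^ length bs * r"
 have s: "0 <= s" "s < 1" using E r by (simp_all add: s_def)
 show ?thesis
 proof (rule summable_comparison_test')
  show "summable (%k. K * (hpoly CARD('m) k (hbin CARD('m) N) (%_. 1) * s ^ k))"
   by (intro summable_mult hbin_one_summable K s)
  fix k :: nat
  have "majorant TYPE('m) as bs r k <= (\<Sum>la\<in>parts CARD('m) k. K * (E ^ length bs) ^ k * rpoch CARD('m) N la * (acoef TYPE('m) k la * r ^ k / fact k))"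
   unfolding majorant_def using r acoef_pos[where 'm='m and k=k]
   by (intro sum_mono mult_right_mono K) (auto simp: less_imp_le)
  also have "... = K * ((\<Sum>la\<in>parts CARD('m) k. rpoch CARD('m) N la * acoef TYPE('m) k la / fact k) * s ^ k)"
   by (simp add: sum_distrib_left sum_distrib_right s_def power_mult_distrib mult_ac)
  finally show "norm (majorant TYPE('m) as bs r k) <= K * (hpoly CARD('m) k (hbin CARD('m) N) (%_. 1) * s ^ k)"
   using majorant_nonneg[OF r, where 'm='m] by (simp add: rpoch_acoef_sum)
 qed
qed

end

section \<open>The integral formulas\<close>

context fld
begin

lemma stiefel_nonempty:
 assumes "stiefel_measure \<beta> (\<mu> :: (quat^'n^'m) measure)"
 obtains H0 where "H0 \<in> (Stf :: (quat^'n^'m) set)"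
 using prob_space.not_empty[OF sm_prob[OF assms]] sm_space[OF assms] by blast

lemma conj_herm_stiefel: "B \<in> Hrm ==> H \<in> Stf ==> H**B**adj H \<in> Hrm" for B :: "quat^'n^'n" and H :: "quat^'n^'m"
 by (simp add: stiefel_mats)

text \<open>Since C_\<kappa>(I_m) = a_\<kappa>, the integral a_\<kappa> \<phi>_\<kappa>(A)
  \<phi>_\<kappa>(H B \<open>adj\<close> H) is C_\<kappa>(A) C_\<kappa>(B) / C_\<kappa>(I_m); it
  vanishes when \<kappa> has more than n parts.\<close>

lemma pFq1_term_integral:
 fixes A :: "quat^'m^'m" and B :: "quat^'n^'n" and \<mu> :: "(quat^'n^'m) measure"
 assumes nm: "CARD('n) <= CARD('m)" and A: "A \<in> Hrm" and B: "B \<in> Hrm" and \<mu>: "stiefel_measure \<beta> \<mu>"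
  and la: "la \<in> parts CARD('m) k"
 shows "integrable \<mu> (%H. pFq1_term \<beta> as bs A (H**B**adj H) k la)"
  and "(LINT H|\<mu>. pFq1_term \<beta> as bs A (H**B**adj H) k la) =
   (if la \<in> parts CARD('n) k then pFq2_term \<beta> as bs A B k la else 0)"
proof -
 obtain H0 where H0: "H0 \<in> (Stf :: (quat^'n^'m) set)" using stiefel_nonempty[OF \<mu>] by blast
 note J = sym_prod_jack_integral[OF A B \<mu> la H0]
 show "integrable \<mu> (%H. pFq1_term \<beta> as bs A (H**B**adj H) k la)"
  unfolding pFq1_term_def using J(1) by (intro integrable_mult_right integrable_of_real) auto
 have "(LINT H|\<mu>. pFq1_term \<beta> as bs A (H**B**adj H) k la) = pFq_coeff \<beta> as bs la *
   of_real (acoef TYPE('m) k la * (phi la A * phi la (H0**B**adj H0)) / fact k)"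
  unfolding pFq1_term_def J(2)[symmetric] by (simp add: J(1))
 also have "... = (if la \<in> parts CARD('n) k then pFq2_term \<beta> as bs A B k la else 0)"
 proof (cases "la \<in> parts CARD('n) k")
  case True
  show ?thesis using True acoef_pos[OF la] unfolding pFq2_term_def jackC_def
   by (simp add: jack_phi_square[OF A la] jack_phi_square[OF herm_simps(5) la] jack_phi(1)[OF nm B H0 True] phi_one)
 next
  case False
  then show ?thesis by (simp add: jack_phi(2)[OF nm B H0 la])
 qed
 finally show "(LINT H|\<mu>. pFq1_term \<beta> as bs A (H**B**adj H) k la) =
   (if la \<in> parts CARD('n) k then pFq2_term \<beta> as bs A B k la else 0)" .
qed

lemma pFq1_term_bound:
 fixes A :: "quat^'m^'m" and B :: "quat^'n^'n" and H :: "quat^'n^'m"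
 assumes A: "A \<in> Hrm" and B: "B \<in> Hrm" and H: "H \<in> Stf" and la: "la \<in> parts CARD('m) k"
 shows "\<bar>sprod (jack \<beta> k la) A (H**B**adj H)\<bar> <= acoef TYPE('m) k la * (eignorm \<beta> A * eignorm \<beta> B) ^ k"
proof -
 note M = conj_herm_stiefel[OF B H]
 have "\<bar>sprod (jack \<beta> k la) A (H**B**adj H)\<bar> \<le>
  acoef TYPE('m) k la * (eignorm \<beta> A * eignorm \<beta> (H**B**adj H)) ^ k"
  by (intro sym_prod_jack_bound qbound_eignorm A M la)
 also have "... <= acoef TYPE('m) k la * (eignorm \<beta> A * eignorm \<beta> B) ^ k"
  using acoef_pos[OF la] qbound_eignorm(2)[OF A] qbound_eignorm(2)[OF M] eignorm_stiefel[OF B H]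
  by (intro mult_left_mono power_mono mult_nonneg_nonneg) auto
 finally show ?thesis .
qed

lemma pFq1_sum_bound:
 fixes A :: "quat^'m^'m" and B :: "quat^'n^'n" and H :: "quat^'n^'m"
 assumes A: "A \<in> Hrm" and B: "B \<in> Hrm" and H: "H \<in> Stf"
 shows "norm (\<Sum>la\<in>parts CARD('m) k. pFq1_term \<beta> as bs A (H**B**adj H) k la) \<le>
  majorant TYPE('m) as bs (eignorm \<beta> A * eignorm \<beta> B) k"
proof -
 have "norm (\<Sum>la\<in>parts CARD('m) k. pFq1_term \<beta> as bs A (H**B**adj H) k la) \<le>
  (\<Sum>la\<in>parts CARD('m) k. norm (pFq1_term \<beta> as bs A (H**B**adj H) k la))" by (rule norm_sum)
 also have "... <= majorant TYPE('m) as bs (eignorm \<beta> A * eignorm \<beta> B) k" unfolding majorant_def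
 proof (rule sum_mono)
  fix la assume la: "la \<in> parts CARD('m) k"
  show "norm (pFq1_term \<beta> as bs A (H**B**adj H) k la) \<le>
   norm (pFq_coeff \<beta> as bs la) * (acoef TYPE('m) k la * (eignorm \<beta> A * eignorm \<beta> B) ^ k / fact k)"
   unfolding pFq1_term_def norm_mult norm_of_real abs_divide
   using pFq1_term_bound[OF A B H la] by (intro mult_left_mono) (auto intro: divide_right_mono)
 qed
 finally show ?thesis .
qed

lemma pFq_integral:
 fixes A :: "quat^'m^'m" and B :: "quat^'n^'n" and \<mu> :: "(quat^'n^'m) measure"
 assumes nm: "CARD('n) <= CARD('m)" and A: "A \<in> Hrm" and B: "B \<in> Hrm" and \<mu>: "stiefel_measure \<beta> \<mu>"
  and conv: "pFq_convergent \<beta> as bs A B"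
 shows "pFq2 \<beta> as bs A B = (LINT H|\<mu>. pFq1_prod \<beta> as bs A (H**B**adj H))"
proof -
 let ?r = "eignorm \<beta> A * eignorm \<beta> B"
 define G where "G k H = (\<Sum>la\<in>parts CARD('m) k. pFq1_term \<beta> as bs A (H**B**adj H) k la)" for k and H :: "quat^'n^'m"
 have r: "0 <= ?r" using qbound_eignorm(2)[OF A] qbound_eignorm(2)[OF B] by simp
 obtain M where M: "summable M" "!!k H. H \<in> Stf ==> norm (G k H) <= M k"
 proof (cases "length as <= length bs \<or> length as = length bs + 1 \<and> ?r < 1")
  case True
  show ?thesis
   by (rule that[OF majorant_summable[OF r True, where 'm='m]]) (simp add: G_def pFq1_sum_bound[OF A B])
 next
  case False
  \<comment> \<open>Here the norms give no summable majorant, but the terms vanish beyond a degree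
    uniform in H, so the majorant can be cut off there.\<close>
  then have "pFq_terminates \<beta> as bs A B" using conv by (auto simp: pFq_convergent_def)
  then obtain K where K: "!!k la H. K <= k ==> H \<in> (Stf :: (quat^'n^'m) set) ==> la \<in> parts CARD('m) k ==>
   pFq1_term \<beta> as bs A (H**B**adj H) k la = 0" unfolding pFq_terminates_def by blast
  define M where "M k = (if k < K then majorant TYPE('m) as bs ?r k else 0)" for k
  show ?thesis
  proof (rule that[of M])
   show "summable M" by (rule summable_finite[of "{..<K}"]) (auto simp: M_def)
   show "norm (G k H) <= M k" if "H \<in> Stf" for k H
    using that pFq1_sum_bound[OF A B that] K[OF _ that, of k] by (cases "k < K") (simp_all add: M_def G_def)
  qed
 qed
 have intG: "integrable \<mu> (G k)" for k
  unfolding G_def by (intro Bochner_Integration.integrable_sum pFq1_term_integral(1)[OF nm A B \<mu>])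
 have G: "(LINT H|\<mu>. G k H) = (\<Sum>la\<in>parts CARD('n) k. pFq2_term \<beta> as bs A B k la)" for k
 proof -
  have "(LINT H|\<mu>. G k H) = (\<Sum>la\<in>parts CARD('m) k. if la \<in> parts CARD('n) k then pFq2_term \<beta> as bs A B k la else 0)"
   unfolding G_def by (simp add: LINT_sum pFq1_term_integral[OF nm A B \<mu>])
  also have "... = (\<Sum>la\<in>parts CARD('n) k. pFq2_term \<beta> as bs A B k la)"
   using parts_mono[OF nm, of k] by (intro sum.mono_neutral_cong_right) auto
  finally show ?thesis .
 qed
 have sp: "!!H. H \<in> space \<mu> ==> H \<in> Stf" by (simp add: sm_space[OF \<mu>])
 have "(LINT H|\<mu>. (\<Sum>k. G k H)) = (\<Sum>k. (LINT H|\<mu>. G k H))"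
 proof (rule integral_suminf[OF intG])
  show "AE H in \<mu>. summable (%k. norm (G k H))"
   using M by (intro AE_I2 summable_comparison_test'[OF M(1)]) (auto dest: sp)
  show "summable (%k. LINT H|\<mu>. norm (G k H))"
  proof (rule summable_comparison_test'[OF M(1)])
   fix k
   have "(LINT H|\<mu>. norm (G k H)) <= (LINT H|\<mu>. M k)"
    using M(2) sp by (intro integral_mono integrable_norm intG sm_integrable[OF \<mu>] continuous_on_const) auto
   then have "(LINT H|\<mu>. norm (G k H)) <= M k" by (simp only: sm_const[OF \<mu>])
   then show "norm (LINT H|\<mu>. norm (G k H)) <= M k" by simp
  qed
 qed
 then show ?thesis by (simp only: pFq2_def pFq1_prod_def G G_def[symmetric])
qed

lemma jack_sum:
 fixes X :: "quat^'m^'m"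
 assumes "X \<in> Hrm"
 shows "(\<Sum>la\<in>parts CARD('m) k. jack \<beta> k la (spec X)) = sum_list (spec X) ^ k"
 by (simp add: jack_phi_square[OF assms] sum_list_eigvals[OF assms] rtr_power_acoef[OF assms])

lemma sym_prod_jack_sum:
 fixes A M :: "quat^'m^'m"
 assumes A: "A \<in> Hrm" and M: "M \<in> Hrm"
 shows "(\<Sum>la\<in>parts CARD('m) k. sprod (jack \<beta> k la) A M) = sprod sum_list A M ^ k"
proof -
 have "(\<Sum>la\<in>parts CARD('m) k. sprod (jack \<beta> k la) A M) = sprod (%xs. \<Sum>la\<in>parts CARD('m) k. 1 * jack \<beta> k la xs) A M"
  by (subst sym_prod_sum[OF finite_parts eigpoly_jack A M]) auto
 also have "... = sprod (%xs. sum_list xs ^ k) A M" by (rule sym_prod_cong[OF _ M]) (simp add: jack_sum)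
 finally show ?thesis by (simp add: sym_prod_power[OF eigpoly_sum_list A M])
qed

lemma pFq1_prod_exp:
 fixes A M :: "quat^'m^'m"
 assumes "A \<in> Hrm" "M \<in> Hrm"
 shows "pFq1_prod \<beta> [] [] A M = of_real (etr_prod \<beta> A M)"
proof -
 have "(\<Sum>la\<in>parts CARD('m) k. pFq1_term \<beta> [] [] A M k la) = of_real (sprod sum_list A M ^ k /\<^sub>R fact k)" for k
  unfolding pFq1_term_def pFq_coeff_simps sym_prod_jack_sum[OF assms, symmetric]
  by (simp add: sum_divide_distrib divide_inverse mult.commute flip: sum_distrib_left)
 moreover have "(\<Sum>k. of_real (sprod sum_list A M ^ k /\<^sub>R fact k) :: complex) = of_real (etr_prod \<beta> A M)"
  unfolding etr_prod_def exp_def by (rule suminf_of_real[symmetric]) (rule summable_exp_generic)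
 ultimately show ?thesis unfolding pFq1_prod_def by simp
qed

lemma jack_jcoef:
 fixes X :: "quat^'m^'m"
 assumes X: "X \<in> Hrm" and la: "la \<in> parts CARD('m) k"
 shows "jack \<beta> k la (spec X) = hpoly CARD('m) k (jcoef TYPE('m) k la) (%i. spec X ! i)"
 using jack_hpoly[OF beta_pos, of "spec X" k "jcoef TYPE('m) k" la] la
 by (simp add: length_eigvals[OF X] jcoef_family)

lemma eigpoly_hsum: "eigpoly TYPE('m::finite) k (hsum a k)"
proof -
 have "eigpoly TYPE('m) k (%xs. \<Sum>la\<in>parts CARD('m) k. (rpoch CARD('m) a la / fact k) * jack \<beta> k la xs)"
  by (intro eigpoly_sum eigpoly_cmult eigpoly_jack)
 then obtain F where F: "hp k F" "!!X. X \<in> (Hrm :: (quat^'m^'m) set) ==>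
  (\<Sum>la\<in>parts CARD('m) k. (rpoch CARD('m) a la / fact k) * jack \<beta> k la (spec X)) = F X"
  unfolding eigpoly_def by blast
 show ?thesis
 proof (rule eigpolyI[OF F(1)])
  fix X :: "quat^'m^'m" assume X: "X \<in> Hrm"
  show "hsum a k (spec X) = F X"
   unfolding F(2)[OF X, symmetric] hsum_def length_eigvals[OF X] binomial_sum[symmetric]
   by (intro sum.cong refl) (simp add: jack_jcoef[OF X])
 qed
qed

lemma sym_prod_hsum:
 fixes A M :: "quat^'m^'m"
 assumes A: "A \<in> Hrm" and M: "M \<in> Hrm"
 shows "(\<Sum>la\<in>parts CARD('m) k. rpoch CARD('m) a la / fact k * sprod (jack \<beta> k la) A M) = sprod (hsum a k) A M"
proof -
 have "(\<Sum>la\<in>parts CARD('m) k. rpoch CARD('m) a la / fact k * sprod (jack \<beta> k la) A M) =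
  sprod (%xs. \<Sum>la\<in>parts CARD('m) k. rpoch CARD('m) a la / fact k * jack \<beta> k la xs) A M"
  by (rule sym_prod_sum[OF finite_parts eigpoly_jack A M, symmetric])
 also have "... = sprod (hsum a k) A M"
 proof (rule sym_prod_cong[OF _ M])
  fix X :: "quat^'m^'m" assume X: "X \<in> Hrm"
  show "(\<Sum>la\<in>parts CARD('m) k. rpoch CARD('m) a la / fact k * jack \<beta> k la (spec X)) = hsum a k (spec X)"
   unfolding hsum_def length_eigvals[OF X] binomial_sum[symmetric]
   by (intro sum.cong refl) (simp add: jack_jcoef[OF X])
 qed
 finally show ?thesis .
qed

lemma det_I_minus_prod_esym:
 fixes A M :: "quat^'m^'m"
 assumes A: "A \<in> Hrm" and M: "M \<in> Hrm"
 shows "det_I_minus_prod \<beta> A M = (\<Sum>j\<le>CARD('m). (-1) ^ j * sprod (esym j) A M)"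
proof -
 have "det_I_minus_prod \<beta> A M = sprod (%xs. \<Sum>j\<le>CARD('m). (-1) ^ j * esym j xs) A M"
  unfolding det_I_minus_prod_def
 proof (rule sym_prod_cong[OF _ M])
  fix X :: "quat^'m^'m" assume "X \<in> Hrm"
  then show "(\<Prod>x\<leftarrow>spec X. 1 - x) = (\<Sum>j\<le>CARD('m). (-1) ^ j * esym j (spec X))"
   using prod_list_esym[of "-1" "spec X"] by (simp add: length_eigvals)
 qed
 also have "... = (\<Sum>j\<le>CARD('m). (-1) ^ j * sprod (esym j) A M)"
  by (rule sym_prod_sum[OF finite_atMost eigpoly_esym A M])
 finally show ?thesis .
qed

lemma gpoch_of_nat: "la \<in> parts m k ==> gpoch \<beta> (of_nat a) la = of_real (rpoch m (real a) la)"
proof -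
 have "of_nat a - of_nat i / 2 * of_nat \<beta> = (of_real (real a - real i / 2 * real \<beta>) :: complex)" for i by simp
 then show "la \<in> parts m k ==> gpoch \<beta> (of_nat a) la = of_real (rpoch m (real a) la)"
  unfolding rpoch_def by (simp add: gpoch_parts pochhammer_of_real del: of_real_diff of_real_divide of_real_mult)
qed

lemma pFq1_term_binomial:
 fixes A M :: "quat^'m^'m"
 assumes A: "A \<in> Hrm" and M: "M \<in> Hrm"
 shows "(\<Sum>la\<in>parts CARD('m) k. pFq1_term \<beta> [of_nat a] [] A M k la) = of_real (sprod (hsum (real a) k) A M)"
 unfolding sym_prod_hsum[OF A M, symmetric] of_real_sum
 by (intro sum.cong refl) (simp add: pFq1_term_def pFq_coeff_simps gpoch_of_nat)

text \<open>The Cauchy product with the finite alternating sum of the e_j, which is |I - AM|, lowers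
  the parameter by one, and at parameter 0 the series is 1. Induction on the natural number a works
  directly with the continued polynomials in A, without reference to eigenvalues of AM.\<close>

lemma pFq1_prod_binomial:
 fixes A :: "quat^'m^'m" and B :: "quat^'n^'n" and H :: "quat^'n^'m"
 assumes A: "A \<in> Hrm" and B: "B \<in> Hrm" and H: "H \<in> Stf" and r: "eignorm \<beta> A * eignorm \<beta> B < 1"
 shows "pFq1_prod \<beta> [of_nat a] [] A (H**B**adj H) = of_real (inverse (det_I_minus_prod \<beta> A (H**B**adj H) ^ a))"
proof -
 define M where "M = H**B**adj H"
 have M: "M \<in> Hrm" unfolding M_def by (rule conj_herm_stiefel[OF B H])
 define s where "s a k = sprod (hsum (real a) k) A M" for a k
 let ?D = "det_I_minus_prod \<beta> A M"
 have r0: "0 <= eignorm \<beta> A * eignorm \<beta> B" using qbound_eignorm(2)[OF A] qbound_eignorm(2)[OF B] by simp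
 have sum: "summable (%k. norm (s a k))" for a
 proof (rule summable_comparison_test')
  show "summable (majorant TYPE('m) [of_nat a] [] (eignorm \<beta> A * eignorm \<beta> B))"
   using r by (intro majorant_summable r0) simp
  show "norm (norm (s a k)) <= majorant TYPE('m) [of_nat a] [] (eignorm \<beta> A * eignorm \<beta> B) k" for k
   using pFq1_sum_bound[OF A B H, of "[of_nat a]" "[]" k] unfolding M_def[symmetric] pFq1_term_binomial[OF A M]
   by (simp add: s_def)
 qed
 define E where "E j = (-1) ^ j * sprod (esym j) A M" for j
 have E0: "E j = 0" if "CARD('m) < j" for j
 proof -
  have "sprod (esym j) A M = sprod (%_. 0) A M"
   by (rule sym_prod_cong[OF _ M]) (simp add: esym_gt length_eigvals that)
  then show ?thesis by (simp add: E_def sym_prod_const A)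
 qed
 have Esum: "(\<Sum>j. E j) = ?D"
  unfolding det_I_minus_prod_esym[OF A M] E_def[symmetric] by (rule suminf_finite) (auto intro: E0)
 have En: "summable (%j. norm (E j))" by (rule summable_finite[of "{..CARD('m)}"]) (auto intro: E0)
 have step: "?D * (\<Sum>k. s (Suc a) k) = (\<Sum>k. s a k)" for a
 proof -
  have "(\<Sum>i\<le>k. E i * s (Suc a) (k - i)) = s a k" for k
  proof -
   have "(\<Sum>i\<le>k. E i * s (Suc a) (k - i)) = (\<Sum>i\<le>k. (-1) ^ i * sprod (%xs. esym i xs * hsum (real (Suc a)) (k - i) xs) A M)"
    unfolding E_def s_def by (simp only: sym_prod_mult[OF eigpoly_esym eigpoly_hsum A M] mult.assoc)
   also have "... = sprod (%xs. \<Sum>i\<le>k. (-1) ^ i * (esym i xs * hsum (real (Suc a)) (k - i) xs)) A M"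
    by (rule sym_prod_sum[OF finite_atMost eigpoly_mult[OF eigpoly_esym eigpoly_hsum] A M, symmetric])
   also have "(%xs. \<Sum>i\<le>k. (-1) ^ i * (esym i xs * hsum (real (Suc a)) (k - i) xs)) = hsum (real a) k"
    using hsum_recurrence[where k = k and a = "real a"] by (simp add: fun_eq_iff mult.assoc add.commute)
   finally show ?thesis by (simp add: s_def)
  qed
  then show ?thesis using Cauchy_product[OF En sum[of "Suc a"]] by (simp add: Esum)
 qed
 have "(\<Sum>k. s a k) * ?D ^ a = 1" for a
 proof (induction a)
  case 0
  have s0: "s 0 k = (if k = 0 then 1 else 0)" for k
  proof -
   have "hsum (real 0) k = (%_. if k = 0 then 1 else 0)" by (simp add: fun_eq_iff hsum_0)
   then show ?thesis unfolding s_def by (simp only: sym_prod_const[OF A])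
  qed
  then have "(\<Sum>k. s 0 k) = (\<Sum>k\<in>{0}. s 0 k)" by (intro suminf_finite) auto
  then show ?case by (simp add: s0)
 next
  case (Suc a)
  have "(\<Sum>k. s (Suc a) k) * ?D ^ Suc a =
   (?D * (\<Sum>k. s (Suc a) k)) * ?D ^ a" by (simp only: power_Suc mult_ac)
  then show ?case by (simp only: step Suc)
 qed
 then have "(\<Sum>k. s a k) = inverse (?D ^ a)" by (metis inverse_unique mult.commute)
 moreover have "pFq1_prod \<beta> [of_nat a] [] A M = of_real (\<Sum>k. s a k)"
  unfolding pFq1_prod_def pFq1_term_binomial[OF A M] s_def[symmetric]
  by (rule suminf_of_real[symmetric]) (rule summable_norm_cancel[OF sum])
 ultimately show ?thesis by (simp add: M_def)
qed

lemma sym_prod_sum_list: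
 fixes A M :: "quat^'m^'m"
 assumes "A \<in> Hrm" and M: "M \<in> Hrm"
 shows "sprod sum_list A M = rtr (A**M)"
proof (rule sym_prod_eqI[OF assms(1)])
 have "linear (%X. X**M)" using linear_conj[of "mat 1" M] by simp
 from linear_compose[OF this linear_rtr] show "real_polynomial_function (%X. rtr (X**M))"
  by (intro hp_rpf[OF hp_linear]) (simp add: o_def)
 fix X :: "quat^'m^'m" assume X: "pdef X"
 have "rtr (X**M) = rtr (sqr X**(sqr X**M))" by (simp add: matrix_mul_assoc psqrt_mult[OF X])
 also have "... = rtr ((sqr X**M)**sqr X)" by (rule rtr_commute)
 finally show "rtr (X**M) = sum_list (spec (sqr X**M**sqr X))"
  using sum_list_eigvals[OF psqrt_conj_herm[OF X M]] by simp
qed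

text \<open>The exponent is a real trace, additive in its left factor, and
  \<open>H**B**adj H\<close> has the same trace as B.\<close>

lemma etr_prod_shift:
 fixes A :: "quat^'m^'m" and B :: "quat^'n^'n" and H :: "quat^'n^'m"
 assumes A: "A \<in> Hrm" and B: "B \<in> Hrm" and H: "H \<in> Stf"
 shows "etr_prod \<beta> (mat 1 + A) (H**B**adj H) = etr \<beta> B * etr_prod \<beta> A (H**B**adj H)"
proof -
 note M = conj_herm_stiefel[OF B H]
 have "rtr (H**B**adj H) = rtr (adj H**(H**B))" by (rule rtr_commute)
 also have "... = rtr B" by (simp add: matrix_mul_assoc stiefelD[OF H])
 also have "... = sum_list (spec B)" by (rule sum_list_eigvals[OF B, symmetric])
 finally have "sprod sum_list (mat 1 + A) (H**B**adj H) = sum_list (spec B) + sprod sum_list A (H**B**adj H)"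
  using A M by (simp add: sym_prod_sum_list matrix_add_rdistrib linear_add[OF linear_rtr] del: herm_conj)
 then show ?thesis by (simp add: etr_prod_def etr_def exp_add)
qed

end

theorem theorem5:
  fixes \<beta> :: nat
    and A :: "quat^'m^'m" and B :: "quat^'n^'n"
    and as bs :: "complex list" and \<alpha>\<^sub>1 :: nat
    and \<mu> :: "(quat^'n^'m) measure"
  assumes "\<beta> \<in> {1, 2, 4}"
    and "CARD('n) \<le> CARD('m)"
    and "A \<in> herm \<beta>" and "B \<in> herm \<beta>"
    and "stiefel_measure \<beta> \<mu>"
  shows "(pFq_convergent \<beta> as bs A B \<longrightarrow>
           pFq2 \<beta> as bs A B = (LINT H|\<mu>. pFq1_prod \<beta> as bs A (H ** B ** adj H))) \<and>
         pFq2 \<beta> [] [] A B = of_real (LINT H|\<mu>. etr_prod \<beta> A (H ** B ** adj H)) \<and>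
         (eignorm \<beta> A * eignorm \<beta> B < 1 \<longrightarrow>
           pFq2 \<beta> [of_nat \<alpha>\<^sub>1] [] A B =
             of_real (LINT H|\<mu>. inverse (det_I_minus_prod \<beta> A (H ** B ** adj H) ^ \<alpha>\<^sub>1))) \<and>
         pFq2 \<beta> [] [] (mat 1 + A) B = of_real (etr \<beta> B) * pFq2 \<beta> [] [] A B"
proof -
 interpret fld \<beta> by (rule fld.intro) (rule assms(1))
 note nm = assms(2) and A = assms(3) and B = assms(4) and \<mu> = assms(5)
 \<comment> \<open>For arbitrary Hermitian \<open>X\<close>: the second identity is the case
   \<open>A\<close>, and the fourth compares \<open>A\<close> with \<open>mat 1 + A\<close>.\<close>
 have exp: "pFq2 \<beta> [] [] X B = of_real (LINT H|\<mu>. etr_prod \<beta> X (H**B**adj H))" if X: "X \<in> Hrm" for X :: "quat^'m^'m"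
 proof -
  have "pFq_convergent \<beta> [] [] X B" by (simp add: pFq_convergent_def)
  then have "pFq2 \<beta> [] [] X B = (LINT H|\<mu>. pFq1_prod \<beta> [] [] X (H**B**adj H))"
   by (rule pFq_integral[OF nm X B \<mu>])
  also have "... = (LINT H|\<mu>. complex_of_real (etr_prod \<beta> X (H**B**adj H)))"
   by (intro sm_cong[OF \<mu>] pFq1_prod_exp X conj_herm_stiefel B)
  finally show ?thesis by simp
 qed
 have bin: "pFq2 \<beta> [of_nat \<alpha>\<^sub>1] [] A B = of_real (LINT H|\<mu>. inverse (det_I_minus_prod \<beta> A (H**B**adj H) ^ \<alpha>\<^sub>1))"
  if r: "eignorm \<beta> A * eignorm \<beta> B < 1"
 proof -
  have "pFq_convergent \<beta> [of_nat \<alpha>\<^sub>1] [] A B" using r by (simp add: pFq_convergent_def)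
  then have "pFq2 \<beta> [of_nat \<alpha>\<^sub>1] [] A B = (LINT H|\<mu>. pFq1_prod \<beta> [of_nat \<alpha>\<^sub>1] [] A (H**B**adj H))"
   by (rule pFq_integral[OF nm A B \<mu>])
  also have "... = (LINT H|\<mu>. complex_of_real (inverse (det_I_minus_prod \<beta> A (H**B**adj H) ^ \<alpha>\<^sub>1)))"
   by (intro sm_cong[OF \<mu>] pFq1_prod_binomial A B r)
  finally show ?thesis by (simp only: integral_complex_of_real)
 qed
 have "(LINT H|\<mu>. etr_prod \<beta> (mat 1 + A) (H**B**adj H)) = (LINT H|\<mu>. etr \<beta> B * etr_prod \<beta> A (H**B**adj H))"
  by (intro sm_cong[OF \<mu>] etr_prod_shift A B)
 then have "pFq2 \<beta> [] [] (mat 1 + A) B = of_real (etr \<beta> B) * pFq2 \<beta> [] [] A B" using A by (simp add: exp)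
 then show ?thesis using pFq_integral[OF nm A B \<mu>] exp[OF A] bin by blast
qed

end
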